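(* Let $\Gamma$ be a unimodular Gaussian lattice of rank $2g$ over $\mathbb{Z}$, let $q\in\mathcal{Q}_e^{(i)}$, let $\Theta_q$ be the corresponding $i$-invariant theta divisor on $A_\Gamma$, and let $Q_q:A_i\to\mathbb{Z}/4$ be the associated quadratic form. Let $\alpha\in A_i$, and let $m_\alpha(\Theta_q)$ be the multiplicity of $\Theta_q$ at $\alpha$. Then $$2m_\alpha(\Theta_q)\equiv \sigma(Q_q)+g-2Q_q(\alpha)\pmod 8,$$ where $\sigma(Q_q)\in\mathbb{Z}/8$ is the Brown invariant of $Q_q$.
   Context: **Gaussian lattices.** A Gaussian lattice is a free finitely generated $\mathbb{Z}[i]$-module $\Gamma$ with a positive (definite) hermitian form $H:\Gamma\times\Gamma\to\mathbb{Z}[i]$, $\mathbb{C}$-linear in the second variable. Write $H=S+iE$ with $S,E$ $\mathbb{Z}$-valued; $S$ is symmetric, $E$ is skew-symmetric, $S$ and $E$ are invariant under multiplication by $i$, and $E(x,y)=S(ix,y)$. $\Gamma$ is unimodular if $\det S=\det E=(\det H)^2=1$. **The abelian variety.** Let $\Gamma$ be unimodular of $\mathbb{Z}$-rank $2g$. Put $\Gamma_{\mathbb{R}}=\Gamma\otimes_{\mathbb{Z}}\mathbb{R}$, a complex vector space via $i$, and $A_\Gamma=\Gamma_{\mathbb{R}}/\Gamma$; with the polarization given by $H$ it is a principally polarized abelian variety of dimension $g$. Multiplication by $i$ induces an automorphism of $A_\Gamma$, also denoted $i$. Let $A_2=\Gamma/2\Gamma$, identified with the 2-torsion subgroup of $A_\Gamma$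 by $\gamma\mapsto\gamma/2$. It is a free module of rank $g$ over $\mathbb{F}_2[i]=\mathbb{F}_2[\varepsilon]$, $\varepsilon=1+i$, $\varepsilon^2=0$. Let $A_i$ be the subgroup of $i$-invariant points; $A_i=\operatorname{Ker}\varepsilon=\varepsilon A_2$, an $\mathbb{F}_2$-vector space of dimension $g$. Let $e:A_2\times A_2\to\mathbb{F}_2$ be the symplectic form induced by $E$, and $Q:A_2\to\mathbb{Z}/4$ the map induced by $x\mapsto S(x,x)$. **Quadratic forms.** For a non-degenerate symmetric bilinear form $b$ on a finite-dimensional $\mathbb{F}_2$-vector space $V$, a quadratic form associated to $b$ is a function $q:V\to\mathbb{Z}/4$ with $q(x+y)=q(x)+q(y)+2b(x,y)$, where multiplication by 2 is the isomorphism $\mathbb{Z}/2\cong 2\mathbb{Z}/4\mathbb{Z}\subset\mathbb{Z}/4$. The set of these is denoted $\mathcal{Q}_b$. Let $\mathcal{Q}_e^{(i)}$ be the set of quadratic forms $q$ on $A_2$ associated to $e$ with $q(i\alpha)=q(\alpha)$ for all $\alpha$. On $A_i$ there is a non-degenerate symmetric bilinear form $b$ defined by $b(\varepsilon\alpha,\varepsilon\beta)=e(\alpha,\varepsilon\beta)$ for $\alpha,\beta\in A_2$, and for $q\in\mathcal{Q}_e^{(i)}$ a quadratic form $Q_q\in\mathcal{Q}_b$ on $A_i$ defined by $Q_q(\varepsilon\alpha)=q(\alpha)-Q(\alpha)$ for $\alpha\in A_2$. **Brown invariant.** For $q\in\mathcal{Q}_b$ on $V$, the Brown invariant $\sigma(q)\in\mathbb{Z}/8$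 is: if $b(x,x)=0$ for all $x$, then $q$ takes values in $2\mathbb{Z}/4\mathbb{Z}\cong\mathbb{Z}/2$, giving an ordinary quadratic form $q':V\to\mathbb{Z}/2$, and $\sigma(q)=4\,\mathrm{Arf}(q')$; otherwise $V$ has an orthonormal basis $(e_j)$ for $b$, $q(e_j)=\pm1$, and $\sigma(q)=g^+-g^-\pmod 8$, where $g^{\pm}$ is the number of $j$ with $q(e_j)=\pm1$. **Theta divisors.** For a quadratic form $q$ on $A_2$ associated to $e$, put $e_\gamma(z)=i^{q(\bar\gamma)}e^{\pi H(\gamma,z+\gamma/2)}$ for $\gamma\in\Gamma$ with class $\bar\gamma\in A_2$ and $z\in\Gamma_{\mathbb{R}}$. The quotient of $\Gamma_{\mathbb{R}}\times\mathbb{C}$ by the action $\gamma\cdot(z,t)=(z+\gamma,e_\gamma(z)t)$ of $\Gamma$ is a line bundle on $A_\Gamma$ with a one-dimensional space of global sections; $\Theta_q$ is the divisor of a nonzero section, so this bundle is $\mathcal{O}_{A_\Gamma}(\Theta_q)$. The map $q\mapsto\Theta_q$ is a bijection onto the set of symmetric theta divisors, compatible with the action of $i$; $i$-invariant theta divisors correspond to $q\in\mathcal{Q}_e^{(i)}$. The multiplicity of a divisor at a point is the order of vanishing of a local equation there ($0$ if the point is not on the divisor). *)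

theory Defs
  imports "HOL-Analysis.Analysis" "HOL-Algebra.Coset" "Jordan_Normal_Form.Determinant"
begin

section \<open>Complex vector spaces\<close>

text \<open>The norm only serves to make differentiability of functions on a (finite-dimensional)
  space available; the zero space is not excluded.\<close>

class complex_normed_vector = real_normed_vector +
  fixes scaleC :: "complex \<Rightarrow> 'a \<Rightarrow> 'a"  (infixr "*\<^sub>C" 75)
  assumes scaleC_add_right: "a *\<^sub>C (x + y) = a *\<^sub>C x + a *\<^sub>C y"
    and scaleC_add_left: "(a + b) *\<^sub>C x = a *\<^sub>C x + b *\<^sub>C x"
    and scaleC_scaleC: "a *\<^sub>C b *\<^sub>C x = (a * b) *\<^sub>C x"
    and scaleR_scaleC: "r *\<^sub>R x = complex_of_real r *\<^sub>C x"
    and norm_scaleC: "norm (a *\<^sub>C x) = norm a * norm x"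

lemma scaleC_one: "1 *\<^sub>C x = (x :: 'a::complex_normed_vector)"
  using scaleR_scaleC[of 1 x] by simp

global_interpretation complex_vector:
  vector_space "scaleC :: complex \<Rightarrow> 'a \<Rightarrow> 'a::complex_normed_vector"
  by unfold_locales (simp_all add: scaleC_add_right scaleC_add_left scaleC_scaleC scaleC_one)

definition entire :: "('v::complex_normed_vector \<Rightarrow> complex) \<Rightarrow> bool" where
  "entire f \<longleftrightarrow> (\<forall>z. \<exists>D. (f has_derivative D) (at z) \<and> (\<forall>c v. D (c *\<^sub>C v) = c * D v))"

text \<open>The homogeneous part of degree \<open>k\<close> of the Taylor expansion of \<open>f\<close> at \<open>p\<close> is
  \<open>v \<mapsto> (1 / k!) (d/dt)^k f(p + t v)\<close> at \<open>t = 0\<close>; the order of vanishing is the degree of the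
  first homogeneous part that is not identically zero.\<close>

definition vanishing_order :: "('v::complex_normed_vector \<Rightarrow> complex) \<Rightarrow> 'v \<Rightarrow> nat" where
  "vanishing_order f p = (LEAST k. \<exists>v. (deriv ^^ k) (\<lambda>t. f (p + t *\<^sub>C v)) 0 \<noteq> 0)"

section \<open>Gaussian lattices\<close>

definition gauss_ints :: "complex set" where
  "gauss_ints = {z. Re z \<in> \<int> \<and> Im z \<in> \<int>}"

text \<open>\<open>\<Gamma>\<close> is free over the Gaussian integers with basis \<open>bs\<close>, and \<open>bs\<close> is at the same time a
  complex basis of the ambient space, which is therefore \<open>\<Gamma> \<otimes> \<real>\<close>.\<close>

definition gaussian_basis :: "'v::complex_normed_vector set \<Rightarrow> 'v list \<Rightarrow> bool" where
  "gaussian_basis \<Gamma> bs \<longleftrightarrow>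
     distinct bs \<and> complex_vector.independent (set bs) \<and> complex_vector.span (set bs) = UNIV \<and>
     \<Gamma> = {\<Sum>b\<in>set bs. c b *\<^sub>C b | c. \<forall>b. c b \<in> gauss_ints}"

definition positive_hermitian :: "('v::complex_normed_vector \<Rightarrow> 'v \<Rightarrow> complex) \<Rightarrow> bool" where
  "positive_hermitian H \<longleftrightarrow>
     (\<forall>x y z. H x (y + z) = H x y + H x z) \<and>
     (\<forall>c x y. H x (c *\<^sub>C y) = c * H x y) \<and>
     (\<forall>x y. H y x = cnj (H x y)) \<and>
     (\<forall>x. x \<noteq> 0 \<longrightarrow> Re (H x x) > 0)"

text \<open>\<open>g\<close> is the rank over the Gaussian integers, so the rank over \<open>\<int>\<close> is \<open>2 * g\<close>. The form \<open>H\<close>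
  is given by its (unique) extension to \<open>\<Gamma> \<otimes> \<real>\<close>.\<close>

definition gaussian_lattice ::
    "nat \<Rightarrow> 'v::complex_normed_vector set \<Rightarrow> ('v \<Rightarrow> 'v \<Rightarrow> complex) \<Rightarrow> bool" where
  "gaussian_lattice g \<Gamma> H \<longleftrightarrow>
     (\<exists>bs. gaussian_basis \<Gamma> bs \<and> length bs = g) \<and>
     positive_hermitian H \<and> (\<forall>x\<in>\<Gamma>. \<forall>y\<in>\<Gamma>. H x y \<in> gauss_ints)"

text \<open>\<open>H = S + \<i> E\<close>; on \<open>\<Gamma>\<close> real and imaginary part of \<open>H\<close> are integers, and the floor is exact.\<close>

definition S_form :: "('v \<Rightarrow> 'v \<Rightarrow> complex) \<Rightarrow> 'v \<Rightarrow> 'v \<Rightarrow> int" where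
  "S_form H x y = \<lfloor>Re (H x y)\<rfloor>"

definition E_form :: "('v \<Rightarrow> 'v \<Rightarrow> complex) \<Rightarrow> 'v \<Rightarrow> 'v \<Rightarrow> int" where
  "E_form H x y = \<lfloor>Im (H x y)\<rfloor>"

definition gram_det :: "('v \<Rightarrow> 'v \<Rightarrow> 'c::comm_ring_1) \<Rightarrow> 'v list \<Rightarrow> 'c" where
  "gram_det F bs =
     Determinant.det (Matrix.mat (length bs) (length bs) (\<lambda>(j, k). F (bs ! j) (bs ! k)))"

text \<open>The determinants of \<open>S\<close> and \<open>E\<close> are taken with respect to the \<open>\<int>\<close>-basis
  \<open>bs @ \<i> bs\<close> of \<open>\<Gamma>\<close>. None of the three numbers depends on \<open>bs\<close>.\<close>

definition unimodular ::
    "'v::complex_normed_vector set \<Rightarrow> ('v \<Rightarrow> 'v \<Rightarrow> complex) \<Rightarrow> bool" where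
  "unimodular \<Gamma> H \<longleftrightarrow>
     (\<exists>bs. gaussian_basis \<Gamma> bs \<and>
        gram_det (S_form H) (bs @ map (scaleC \<i>) bs) = 1 \<and>
        gram_det (E_form H) (bs @ map (scaleC \<i>) bs) = 1 \<and>
        (gram_det H bs)\<^sup>2 = 1)"

section \<open>Quadratic forms over the field with two elements\<close>

text \<open>\<open>\<int>/2\<close>, \<open>\<int>/4\<close> and \<open>\<int>/8\<close> are the numeral types \<open>2\<close>, \<open>4\<close> and \<open>8\<close>.
  \<open>lift c\<close> is the smallest natural number in the residue class \<open>c\<close>. The maps
  \<open>\<int>/2 \<rightarrow> \<int>/4\<close> and \<open>\<int>/4 \<rightarrow> \<int>/8\<close> given by multiplication by 2 are both instances of \<open>double\<close>.\<close>

definition lift :: "'c::ring_1 \<Rightarrow> nat" where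
  "lift c = (LEAST n. of_nat n = c)"

definition double :: "'c::ring_1 \<Rightarrow> 'd::ring_1" where
  "double c = of_nat (2 * lift c)"

text \<open>An \<open>\<bbbF>\<^sub>2\<close>-vector space is an abelian group of exponent 2, here a monoid record \<open>V\<close> written
  multiplicatively. A linear combination over \<open>\<bbbF>\<^sub>2\<close> is a sum over a subset.\<close>

definition quadratic_forms :: "'a monoid \<Rightarrow> ('a \<Rightarrow> 'a \<Rightarrow> 2) \<Rightarrow> ('a \<Rightarrow> 4) set" where
  "quadratic_forms V b =
     {q. \<forall>x\<in>carrier V. \<forall>y\<in>carrier V. q (x \<otimes>\<^bsub>V\<^esub> y) = q x + q y + double (b x y)}"

definition f2_basis :: "'a monoid \<Rightarrow> 'a set \<Rightarrow> bool" where
  "f2_basis V B \<longleftrightarrow>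
     B \<subseteq> carrier V \<and> (\<forall>x\<in>carrier V. \<exists>!T. T \<subseteq> B \<and> x = finprod V (\<lambda>v. v) T)"

definition orthonormal_basis :: "'a monoid \<Rightarrow> ('a \<Rightarrow> 'a \<Rightarrow> 2) \<Rightarrow> 'a set \<Rightarrow> bool" where
  "orthonormal_basis V b B \<longleftrightarrow>
     f2_basis V B \<and> (\<forall>x\<in>B. \<forall>y\<in>B. b x y = (if x = y then 1 else 0))"

text \<open>A symplectic basis is given as the set of its hyperbolic pairs. The conditions force the
  components of distinct pairs to be distinct.\<close>

definition symplectic_basis :: "'a monoid \<Rightarrow> ('a \<Rightarrow> 'a \<Rightarrow> 2) \<Rightarrow> ('a \<times> 'a) set \<Rightarrow> bool" where
  "symplectic_basis V b P \<longleftrightarrow>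
     f2_basis V (fst ` P \<union> snd ` P) \<and>
     (\<forall>(x, x')\<in>P. \<forall>(y, y')\<in>P.
        b x y = 0 \<and> b x' y' = 0 \<and> b x y' = (if (x, x') = (y, y') then 1 else 0))"

text \<open>The Arf and Brown invariants do not depend on the choice of the basis.\<close>

definition arf :: "'a monoid \<Rightarrow> ('a \<Rightarrow> 'a \<Rightarrow> 2) \<Rightarrow> ('a \<Rightarrow> 2) \<Rightarrow> 2" where
  "arf V b q' = (\<Sum>(x, x')\<in>(SOME P. symplectic_basis V b P). q' x * q' x')"

definition brown :: "'a monoid \<Rightarrow> ('a \<Rightarrow> 'a \<Rightarrow> 2) \<Rightarrow> ('a \<Rightarrow> 4) \<Rightarrow> 8" where
  "brown V b q =
     (if \<forall>x\<in>carrier V. b x x = 0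
      then of_nat (4 * lift (arf V b (\<lambda>x. THE c. double c = q x)))
      else let B = SOME B. orthonormal_basis V b B
           in of_nat (card {x\<in>B. q x = 1}) - of_nat (card {x\<in>B. q x = -1}))"

section \<open>The 2-torsion points\<close>

definition lattice_group :: "'v::complex_normed_vector set \<Rightarrow> 'v monoid" where
  "lattice_group \<Gamma> = \<lparr>carrier = \<Gamma>, mult = (+), one = 0\<rparr>"

definition A2 :: "'v::complex_normed_vector set \<Rightarrow> 'v set monoid" where
  "A2 \<Gamma> = lattice_group \<Gamma> Mod ((\<lambda>x. 2 *\<^sub>R x) ` \<Gamma>)"

definition class2 :: "'v::complex_normed_vector set \<Rightarrow> 'v \<Rightarrow> 'v set" where
  "class2 \<Gamma> \<gamma> = ((\<lambda>x. 2 *\<^sub>R x) ` \<Gamma>) #>\<^bsub>lattice_group \<Gamma>\<^esub> \<gamma>"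

definition i_act :: "'v::complex_normed_vector set \<Rightarrow> 'v set" where
  "i_act \<alpha> = scaleC \<i> ` \<alpha>"

definition eps :: "'v::complex_normed_vector set \<Rightarrow> 'v set \<Rightarrow> 'v set" where
  "eps \<Gamma> \<alpha> = \<alpha> \<otimes>\<^bsub>A2 \<Gamma>\<^esub> i_act \<alpha>"

definition A_i :: "'v::complex_normed_vector set \<Rightarrow> 'v set monoid" where
  "A_i \<Gamma> = (A2 \<Gamma>)\<lparr>carrier := {\<alpha> \<in> carrier (A2 \<Gamma>). i_act \<alpha> = \<alpha>}\<rparr>"

text \<open>In the following four definitions the value does not depend on the representatives, so
  that \<open>THE\<close> refers to an existing unique value.\<close>

definition e_form :: "('v \<Rightarrow> 'v \<Rightarrow> complex) \<Rightarrow> 'v set \<Rightarrow> 'v set \<Rightarrow> 2" where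
  "e_form H \<alpha> \<beta> = (THE c. \<exists>x\<in>\<alpha>. \<exists>y\<in>\<beta>. c = of_int (E_form H x y))"

definition Q_form :: "('v \<Rightarrow> 'v \<Rightarrow> complex) \<Rightarrow> 'v set \<Rightarrow> 4" where
  "Q_form H \<alpha> = (THE c. \<exists>x\<in>\<alpha>. c = of_int (S_form H x x))"

definition b_form :: "'v::complex_normed_vector set \<Rightarrow> ('v \<Rightarrow> 'v \<Rightarrow> complex) \<Rightarrow>
    'v set \<Rightarrow> 'v set \<Rightarrow> 2" where
  "b_form \<Gamma> H x y = (THE c. \<exists>\<alpha>\<in>carrier (A2 \<Gamma>). \<exists>\<beta>\<in>carrier (A2 \<Gamma>).
     x = eps \<Gamma> \<alpha> \<and> y = eps \<Gamma> \<beta> \<and> c = e_form H \<alpha> (eps \<Gamma> \<beta>))"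

definition Qq_form :: "'v::complex_normed_vector set \<Rightarrow> ('v \<Rightarrow> 'v \<Rightarrow> complex) \<Rightarrow>
    ('v set \<Rightarrow> 4) \<Rightarrow> 'v set \<Rightarrow> 4" where
  "Qq_form \<Gamma> H q x =
     (THE c. \<exists>\<alpha>\<in>carrier (A2 \<Gamma>). x = eps \<Gamma> \<alpha> \<and> c = q \<alpha> - Q_form H \<alpha>)"

definition i_invariant_forms :: "'v::complex_normed_vector set \<Rightarrow> ('v \<Rightarrow> 'v \<Rightarrow> complex) \<Rightarrow>
    ('v set \<Rightarrow> 4) set" where
  "i_invariant_forms \<Gamma> H =
     {q \<in> quadratic_forms (A2 \<Gamma>) (e_form H). \<forall>\<alpha>\<in>carrier (A2 \<Gamma>). q (i_act \<alpha>) = q \<alpha>}"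

section \<open>Theta divisors\<close>

definition theta_factor :: "'v::complex_normed_vector set \<Rightarrow> ('v \<Rightarrow> 'v \<Rightarrow> complex) \<Rightarrow>
    ('v set \<Rightarrow> 4) \<Rightarrow> 'v \<Rightarrow> 'v \<Rightarrow> complex" where
  "theta_factor \<Gamma> H q \<gamma> z =
     \<i> ^ lift (q (class2 \<Gamma> \<gamma>)) * exp (complex_of_real pi * H \<gamma> (z + (1/2) *\<^sub>R \<gamma>))"

text \<open>Global sections of the quotient of \<open>\<Gamma>\<^sub>\<real> \<times> \<complex>\<close> by
  \<open>\<gamma> \<cdot> (z, t) = (z + \<gamma>, theta_factor \<Gamma> H q \<gamma> z * t)\<close>, pulled back to \<open>\<Gamma>\<^sub>\<real>\<close>.\<close>

definition theta_sections :: "'v::complex_normed_vector set \<Rightarrow> ('v \<Rightarrow> 'v \<Rightarrow> complex) \<Rightarrow>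
    ('v set \<Rightarrow> 4) \<Rightarrow> ('v \<Rightarrow> complex) set" where
  "theta_sections \<Gamma> H q =
     {\<theta>. entire \<theta> \<and> (\<forall>\<gamma>\<in>\<Gamma>. \<forall>z. \<theta> (z + \<gamma>) = theta_factor \<Gamma> H q \<gamma> z * \<theta> z)}"

text \<open>The point \<open>\<gamma>/2 + \<Gamma>\<close> of \<open>\<Gamma>\<^sub>\<real>/\<Gamma>\<close> that is identified with \<open>\<alpha> = \<gamma> + 2\<Gamma>\<close>.\<close>

definition torsion_point :: "'v::complex_normed_vector set \<Rightarrow> 'v set" where
  "torsion_point \<alpha> = (\<lambda>x. (1/2) *\<^sub>R x) ` \<alpha>"

text \<open>Multiplicity of the divisor of a nonzero section \<open>\<theta>\<close> at a point of \<open>\<Gamma>\<^sub>\<real>/\<Gamma>\<close>,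
  that is, at a coset \<open>P\<close> of \<open>\<Gamma>\<close>. Near any \<open>z \<in> P\<close>, \<open>\<theta>\<close> is a local equation of the divisor.\<close>

definition divisor_mult :: "('v::complex_normed_vector \<Rightarrow> complex) \<Rightarrow> 'v set \<Rightarrow> nat" where
  "divisor_mult \<theta> P = (THE m. \<forall>z\<in>P. vanishing_order \<theta> z = m)"

end

theory Submission
  imports Defs "HOL-Complex_Analysis.Complex_Analysis" "HOL-Real_Asymp.Real_Asymp"
    "HOL-Probability.Distributions" "HOL-Number_Theory.Cong"
begin

text \<open>
  Write \<open>\<epsilon> = 1 + \<i>\<close>, \<open>\<chi>(\<gamma>) = \<i>\<close> to the power \<open>q(\<gamma>)\<close>, and let \<open>\<zeta>\<close> be the primitive eighth root of unity
  \<open>exp (\<pi>\<i>/4)\<close>. The proof has two halves: \<open>\<theta>\<close> is an eigenfunction of \<open>z \<mapsto> \<i> z\<close> whose eigenvalue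
  \<open>\<lambda>\<close> is an eighth root of unity given by a Gauss sum, and \<open>\<lambda>\<close> determines the multiplicities modulo 4.

  From the eigenvalue to the multiplicity. An \<open>\<i>\<close>-invariant 2-torsion point \<open>\<alpha>\<close> is represented by
  some \<open>p\<close> with \<open>\<i> p = p + \<delta>\<close> and \<open>\<delta> \<in> \<Gamma>\<close>. If \<open>\<theta>(\<i> z) = \<lambda> \<theta>(z)\<close>, then quasi-periodicity under
  \<open>\<delta>\<close> gives \<open>\<theta>(p + \<i> v) = \<lambda> \<mu> exp(\<ell>(v)) \<theta>(p + v)\<close>, where \<open>\<ell>\<close> is linear and \<open>\<mu>\<close> is \<open>\<i>\<close> to the power
  \<open>- Q\<^sub>q(\<alpha>)\<close>. The first nonzero homogeneous part of \<open>\<theta>\<close> at \<open>p\<close>, of degree \<open>m\<close>, is multiplied by the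
  \<open>m\<close>-th power of \<open>\<i>\<close> when \<open>v\<close> is replaced by \<open>\<i> v\<close>, so this power equals \<open>\<lambda> \<mu>\<close>
  (\<open>power_i_vanishing_order\<close>). With \<open>\<lambda>\<close> the power of \<open>\<zeta>\<close> with exponent \<open>\<sigma>(Q\<^sub>q) + g\<close>, comparing
  exponents of \<open>\<zeta>\<close> is the asserted congruence modulo 8.

  The eigenvalue. A unimodular lattice is its own dual, so that Poisson summation over \<open>\<Gamma>\<close> relates
  the values on \<open>\<Gamma>\<close> of a function and of its Fourier transform. It is applied to
  \<open>w \<mapsto> \<theta>(z + w) exp(- \<pi> H(w, z) - \<pi> s H(w, w))\<close>. On \<open>\<Gamma>\<close> this function equals
  \<open>\<theta>(z) \<chi>(w) exp(- \<pi> (s - 1/2) H(w, w))\<close>; its Fourier transform is a Gaussian times a value of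
  \<open>\<theta>\<close>, because an entire function equals its Gaussian means (\<open>mean_value_Gaussian\<close>). The parameter
  \<open>s\<close> is moved to \<open>\<epsilon>/2\<close>, where the decay on both sides is lost, and both sides are divided by the
  total weight of a widening Gaussian. On the left, the remaining factor is
  \<open>\<chi>(x) exp(- \<pi>\<i> H(x, x)/2)\<close>, that is, \<open>\<i>\<close> to the power \<open>Q\<^sub>q(\<epsilon> x)\<close>; it depends on \<open>x\<close> modulo
  \<open>\<epsilon> \<Gamma>\<close> only, and the classes of \<open>\<Gamma>/\<epsilon>\<Gamma>\<close> carry asymptotically equal weights
  (\<open>equidistribution\<close>), so that the limit is the Gauss sum of \<open>Q\<^sub>q\<close> over \<open>A_i\<close> divided by its number
  of terms. On the right, the points at which \<open>\<theta>\<close> is evaluated all tend to \<open>\<i> z\<close>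
  (\<open>limit_E_side\<close>). Thus (\<open>theta_i_times\<close>) there is a real \<open>c \<ge> 0\<close> such that, for all \<open>z\<close>, the
  Gauss sum times \<open>\<theta>(z)\<close> is \<open>c\<close> times the \<open>g\<close>-th power of \<open>1 - \<i>\<close> times \<open>\<theta>(\<i> z)\<close>.

  The Gauss sum is a positive multiple of the power of \<open>\<zeta>\<close> with exponent \<open>\<sigma>(Q\<^sub>q)\<close>
  (\<open>gauss_sum_brown\<close>), computed factor by factor in an orthonormal or symplectic basis. Positive
  factors are irrelevant: multiplication by \<open>\<i>\<close> has order 4, so \<open>|\<lambda>| = 1\<close>
  (\<open>theta_i_eigenvalue\<close>).
\<close>

section \<open>Lebesgue measure on complex coordinate spaces\<close>

lemma measurable_Complex_pair [measurable]:
  "(\<lambda>(x, y). Complex x y) \<in> borel \<Otimes>\<^sub>M borel \<rightarrow>\<^sub>M borel"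
  unfolding borel_prod
  by (intro borel_measurable_continuous_onI)
    (auto simp: case_prod_unfold Complex_eq intro!: continuous_intros)

text \<open>Through the real coordinates, integrals over the complex plane become double integrals.\<close>

lemma lborel_complex_split:
  "(lborel :: complex measure) = distr (lborel \<Otimes>\<^sub>M lborel) borel (\<lambda>(x, y). Complex x y)"
proof (rule lborel_eqI)
  have [measurable]: "(\<lambda>(x, y). Complex x y) \<in> lborel \<Otimes>\<^sub>M lborel \<rightarrow>\<^sub>M borel"
    by (simp add: measurable_lborel1) measurable
  fix l u :: complex
  assume le: "\<And>b. b \<in> Basis \<Longrightarrow> l \<bullet> b \<le> u \<bullet> b"
  then have le': "Re l \<le> Re u" "Im l \<le> Im u"
    using le[of 1] le[of \<i>] by (auto simp: Basis_complex_def)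
  have "(\<lambda>(x, y). Complex x y) -` box l u = {Re l<..<Re u} \<times> {Im l<..<Im u}"
    by (auto simp: in_box_complex_iff)
  then have "emeasure (distr (lborel \<Otimes>\<^sub>M lborel) borel (\<lambda>(x, y). Complex x y)) (box l u)
      = emeasure (lborel \<Otimes>\<^sub>M lborel) ({Re l<..<Re u} \<times> {Im l<..<Im u})"
    by (subst emeasure_distr) (auto simp: space_pair_measure)
  also have "\<dots> = ennreal ((Re u - Re l) * (Im u - Im l))"
    using le' by (subst lborel.emeasure_pair_measure_Times) (auto simp: ennreal_mult')
  also have "\<dots> = (\<Prod>b\<in>Basis. (u - l) \<bullet> b)"
    by (simp add: Basis_complex_def)
  finally show "emeasure (distr (lborel \<Otimes>\<^sub>M lborel) borel (\<lambda>(x, y). Complex x y)) (box l u)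
      = (\<Prod>b\<in>Basis. (u - l) \<bullet> b)" .
qed simp

lemma measurable_Complex [measurable (raw)]:
  assumes "f \<in> borel_measurable M" "g \<in> borel_measurable M"
  shows "(\<lambda>x. Complex (f x) (g x)) \<in> borel_measurable M"
  using assms unfolding Complex_eq by measurable

lemma nn_integral_lborel_complex:
  assumes [measurable]: "f \<in> borel_measurable borel"
  shows "(\<integral>\<^sup>+c. f c \<partial>(lborel :: complex measure)) = (\<integral>\<^sup>+x. \<integral>\<^sup>+y. f (Complex x y) \<partial>lborel \<partial>lborel)"
proof -
  have [measurable]: "(\<lambda>(x, y). Complex x y) \<in> lborel \<Otimes>\<^sub>M lborel \<rightarrow>\<^sub>M borel"
    by measurable
  show ?thesis
    unfolding lborel_complex_split
    by (subst nn_integral_distr; simp add: lborel.nn_integral_fst[symmetric])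
qed

text \<open>Multiplication by \<open>u\<close> has real determinant \<open>|u|\<^sup>2\<close>. If \<open>Re u \<noteq> 0\<close>, it is a product of two shears and scalings,
  so that two real substitutions suffice; any other \<open>u \<noteq> 0\<close> is a product of two numbers of this kind.\<close>

lemma nn_integral_lborel_complex_mult:
  fixes u :: complex
  assumes [measurable]: "f \<in> borel_measurable borel" and u: "u \<noteq> 0"
  shows "(\<integral>\<^sup>+c. f c \<partial>lborel) = ennreal ((cmod u)\<^sup>2) * (\<integral>\<^sup>+c. f (u * c) \<partial>lborel)"
proof -
  have *: "(\<integral>\<^sup>+c. f c \<partial>lborel) = ennreal ((cmod u)\<^sup>2) * (\<integral>\<^sup>+c. f (u * c) \<partial>lborel)"
    if a: "Re u \<noteq> 0" and [measurable]: "f \<in> borel_measurable borel" for u :: complex and f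
  proof -
    define a b where "a = Re u" and "b = Im u"
    have ab: "a \<noteq> 0" "a\<^sup>2 + b\<^sup>2 > 0" "(cmod u)\<^sup>2 = a\<^sup>2 + b\<^sup>2"
      using a by (auto simp: a_def b_def cmod_power2 sum_power2_gt_zero_iff)
    have "(\<integral>\<^sup>+c. f (u * c) \<partial>lborel) = (\<integral>\<^sup>+x. \<integral>\<^sup>+y. f (Complex (a * x - b * y) (b * x + a * y)) \<partial>lborel \<partial>lborel)"
      by (subst nn_integral_lborel_complex)
        (auto simp: a_def b_def algebra_simps complex_eq_iff
              intro!: nn_integral_cong arg_cong[where f=f])
    also have "\<dots> = (\<integral>\<^sup>+y. \<integral>\<^sup>+x. f (Complex (a * x - b * y) (b * x + a * y)) \<partial>lborel \<partial>lborel)"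
      by (rule lborel_pair.Fubini'[symmetric]) measurable
    also have "\<dots> = (\<integral>\<^sup>+y. \<bar>1/a\<bar> * (\<integral>\<^sup>+x. f (Complex x ((b * x + (a\<^sup>2 + b\<^sup>2) * y) / a)) \<partial>lborel) \<partial>lborel)"
      using ab by (intro nn_integral_cong, subst nn_integral_real_affine[where c = "1/a" and t = "b * _ / a"])
        (auto simp: field_simps power2_eq_square intro!: arg_cong[where f=ennreal] nn_integral_cong arg_cong[where f=f] arg_cong2[where f="(*)"])
    also have "\<dots> = \<bar>1/a\<bar> * (\<integral>\<^sup>+y. (\<integral>\<^sup>+x. f (Complex x ((b * x + (a\<^sup>2 + b\<^sup>2) * y) / a)) \<partial>lborel) \<partial>lborel)"
      by (rule nn_integral_cmult) measurable
    also have "(\<integral>\<^sup>+y. (\<integral>\<^sup>+x. f (Complex x ((b * x + (a\<^sup>2 + b\<^sup>2) * y) / a)) \<partial>lborel) \<partial>lborel)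
       = (\<integral>\<^sup>+x. (\<integral>\<^sup>+y. f (Complex x ((b * x + (a\<^sup>2 + b\<^sup>2) * y) / a)) \<partial>lborel) \<partial>lborel)"
      by (rule lborel_pair.Fubini') measurable
    also have "\<dots> = (\<integral>\<^sup>+x. \<bar>a / (a\<^sup>2 + b\<^sup>2)\<bar> * (\<integral>\<^sup>+y. f (Complex x y) \<partial>lborel) \<partial>lborel)"
    proof (rule nn_integral_cong)
      fix x
      have "(\<integral>\<^sup>+y. f (Complex x y) \<partial>lborel) = ennreal \<bar>(a\<^sup>2 + b\<^sup>2) / a\<bar> *
          (\<integral>\<^sup>+y. f (Complex x (b * x / a + (a\<^sup>2 + b\<^sup>2) / a * y)) \<partial>lborel)"
        using ab by (intro nn_integral_real_affine) auto
      also have "(\<lambda>y. Complex x (b * x / a + (a\<^sup>2 + b\<^sup>2) / a * y)) = (\<lambda>y. Complex x ((b * x + (a\<^sup>2 + b\<^sup>2) * y) / a))"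
        by (simp add: fun_eq_iff add_divide_distrib distrib_right)
      finally have "ennreal \<bar>a / (a\<^sup>2 + b\<^sup>2)\<bar> * (\<integral>\<^sup>+y. f (Complex x y) \<partial>lborel) = 
          ennreal \<bar>a / (a\<^sup>2 + b\<^sup>2)\<bar> * ennreal \<bar>(a\<^sup>2 + b\<^sup>2) / a\<bar> *
          (\<integral>\<^sup>+y. f (Complex x ((b * x + (a\<^sup>2 + b\<^sup>2) * y) / a)) \<partial>lborel)"
        by (metis mult.assoc)
      also have "ennreal \<bar>a / (a\<^sup>2 + b\<^sup>2)\<bar> * ennreal \<bar>(a\<^sup>2 + b\<^sup>2) / a\<bar> = 1"
        using ab by (simp add: ennreal_mult'[symmetric] abs_mult[symmetric])
      finally show "(\<integral>\<^sup>+y. f (Complex x ((b * x + (a\<^sup>2 + b\<^sup>2) * y) / a)) \<partial>lborel) = ennreal \<bar>a / (a\<^sup>2 + b\<^sup>2)\<bar> * (\<integral>\<^sup>+y. f (Complex x y) \<partial>lborel)"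
        by simp
    qed
    also have "\<dots> = \<bar>a / (a\<^sup>2 + b\<^sup>2)\<bar> * (\<integral>\<^sup>+c. f c \<partial>lborel)"
      by (subst nn_integral_cmult) (auto simp: nn_integral_lborel_complex)
    finally have "ennreal ((cmod u)\<^sup>2) * (\<integral>\<^sup>+c. f (u * c) \<partial>lborel)
      = ennreal (a\<^sup>2 + b\<^sup>2) * ennreal \<bar>1/a\<bar> * ennreal \<bar>a / (a\<^sup>2 + b\<^sup>2)\<bar> * (\<integral>\<^sup>+c. f c \<partial>lborel)"
      using ab by (simp add: mult.assoc)
    also have "ennreal (a\<^sup>2 + b\<^sup>2) * ennreal \<bar>1/a\<bar> * ennreal \<bar>a / (a\<^sup>2 + b\<^sup>2)\<bar> = 1"
    proof -
      have "(a\<^sup>2 + b\<^sup>2) * \<bar>1/a\<bar> * \<bar>a / (a\<^sup>2 + b\<^sup>2)\<bar> = 1"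
        using ab by (simp add: abs_mult[symmetric])
      moreover have "ennreal p * ennreal \<bar>x\<bar> * ennreal \<bar>y\<bar> = ennreal (p * \<bar>x\<bar> * \<bar>y\<bar>)" for p x y :: real
        by (simp add: ennreal_mult'')
      ultimately show ?thesis by (metis ennreal_1)
    qed
    finally show ?thesis by simp
  qed
  show ?thesis
  proof (cases "Re u = 0")
    case False
    then show ?thesis by (rule *) measurable
  next
    case True
    with u have [simp]: "Im u \<noteq> 0" by (auto simp: complex_eq_iff)
    define v :: complex where "v = 1 + \<i>"
    define w where "w = u / v"
    have uvw: "u = w * v" by (simp add: w_def v_def complex_eq_iff)
    have w: "Re w \<noteq> 0"
      using True by (simp add: w_def v_def Re_divide)
    have v: "Re v \<noteq> 0" by (simp add: v_def)
    have "(\<integral>\<^sup>+c. f c \<partial>lborel) = ennreal ((cmod w)\<^sup>2) * (\<integral>\<^sup>+c. f (w * c) \<partial>lborel)"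
      using w by (rule *) measurable
    also have "(\<integral>\<^sup>+c. f (w * c) \<partial>lborel) = ennreal ((cmod v)\<^sup>2) * (\<integral>\<^sup>+c. f (w * (v * c)) \<partial>lborel)"
      using v by (rule *) measurable
    finally show ?thesis
      by (simp add: uvw norm_mult power_mult_distrib ennreal_mult mult_ac)
  qed
qed

lemma nn_integral_lborel_complex_affine:
  fixes u v :: complex
  assumes [measurable]: "f \<in> borel_measurable borel" and u: "u \<noteq> 0"
  shows "(\<integral>\<^sup>+c. f c \<partial>lborel) = ennreal ((cmod u)\<^sup>2) * (\<integral>\<^sup>+c. f (u * c + v) \<partial>lborel)"
proof -
  have "(\<integral>\<^sup>+c. f c \<partial>lborel) = (\<integral>\<^sup>+c. f (v + c) \<partial>lborel)"
    by (subst lborel_distr_plus[of v, symmetric]) (simp add: nn_integral_distr)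
  also have "\<dots> = ennreal ((cmod u)\<^sup>2) * (\<integral>\<^sup>+c. f (v + u * c) \<partial>lborel)"
    by (rule nn_integral_lborel_complex_mult) (use u in measurable)
  finally show ?thesis by (simp add: add.commute)
qed

interpretation lborel_prod: product_sigma_finite "\<lambda>_. lborel :: complex measure"
  by standard

abbreviation cmeas :: "nat \<Rightarrow> (nat \<Rightarrow> complex) measure" where
  "cmeas g \<equiv> PiM {..<g} (\<lambda>_. lborel)"

lemma nn_integral_PiM_complex_affine:
  fixes u :: complex and v :: "nat \<Rightarrow> complex"
  assumes I: "finite I" and f: "f \<in> borel_measurable (PiM I (\<lambda>_. lborel))" and u: "u \<noteq> 0"
  shows "(\<integral>\<^sup>+c. f c \<partial>(PiM I (\<lambda>_. lborel))) =
    ennreal ((cmod u)\<^sup>2) ^ card I * (\<integral>\<^sup>+c. f (\<lambda>k\<in>I. u * c k + v k) \<partial>(PiM I (\<lambda>_. lborel)))"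
  using I f
proof (induction I arbitrary: f)
  case empty
  then show ?case 
    by (subst (1 2) PiM_empty) (simp add: nn_integral_count_space_finite restrict_def)
next
  case (insert i I)
  note [measurable] = insert.prems
  let ?P = "\<lambda>I. PiM I (\<lambda>_. lborel :: complex measure)"
  have T[measurable]: "(\<lambda>c. \<lambda>k\<in>J. u * c k + v k) \<in> ?P J \<rightarrow>\<^sub>M ?P J" for J
    by (intro measurable_restrict) measurable
  have sw: "(\<lambda>k\<in>insert i I. u * (x(i := y)) k + v k) = (\<lambda>k\<in>I. u * x k + v k)(i := u * y + v i)" if "x \<in> space (?P I)" for x y
    using insert.hyps by (auto simp: fun_eq_iff)
  have [measurable]: "(\<lambda>x. \<integral>\<^sup>+ y. f (x(i := y)) \<partial>lborel) \<in> borel_measurable (?P I)"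
    by measurable
  have "(\<integral>\<^sup>+c. f c \<partial>?P (insert i I)) = (\<integral>\<^sup>+x. \<integral>\<^sup>+y. f (x(i := y)) \<partial>lborel \<partial>?P I)"
    using insert by (intro lborel_prod.product_nn_integral_insert) auto
  also have "\<dots> = ennreal ((cmod u)\<^sup>2) ^ card I * (\<integral>\<^sup>+x. \<integral>\<^sup>+y. f ((\<lambda>k\<in>I. u * x k + v k)(i := y)) \<partial>lborel \<partial>?P I)"
    by (rule insert.IH) measurable
  also have "(\<integral>\<^sup>+x. \<integral>\<^sup>+y. f ((\<lambda>k\<in>I. u * x k + v k)(i := y)) \<partial>lborel \<partial>?P I) = 
     (\<integral>\<^sup>+x. ennreal ((cmod u)\<^sup>2) * (\<integral>\<^sup>+y. f ((\<lambda>k\<in>I. u * x k + v k)(i := u * y + v i)) \<partial>lborel) \<partial>?P I)"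
  proof (intro nn_integral_cong nn_integral_lborel_complex_affine[OF _ u])
    fix x assume x: "x \<in> space (?P I)"
    then have "(\<lambda>k\<in>I. u * x k + v k) \<in> space (?P I)"
      by (auto simp: space_PiM)
    then show "(\<lambda>y. f ((\<lambda>k\<in>I. u * x k + v k)(i := y))) \<in> borel_measurable borel"
      using measurable_comp[OF measurable_component_update[of "\<lambda>k\<in>I. u * x k + v k" I "\<lambda>_. lborel" i] insert.prems] insert.hyps
      unfolding comp_def by simp
  qed
  also have "\<dots> = (\<integral>\<^sup>+x. ennreal ((cmod u)\<^sup>2) * (\<integral>\<^sup>+y. f (\<lambda>k\<in>insert i I. u * (x(i := y)) k + v k) \<partial>lborel) \<partial>?P I)"
    by (intro nn_integral_cong) (simp only: sw)
  also have "\<dots> = ennreal ((cmod u)\<^sup>2) * (\<integral>\<^sup>+x. (\<integral>\<^sup>+y. f (\<lambda>k\<in>insert i I. u * (x(i := y)) k + v k) \<partial>lborel) \<partial>?P I)"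
    by (rule nn_integral_cmult) measurable
  also have "(\<integral>\<^sup>+x. (\<integral>\<^sup>+y. f (\<lambda>k\<in>insert i I. u * (x(i := y)) k + v k) \<partial>lborel) \<partial>?P I)
    = (\<integral>\<^sup>+c. f (\<lambda>k\<in>insert i I. u * c k + v k) \<partial>?P (insert i I))"
    using insert.hyps by (subst lborel_prod.product_nn_integral_insert) auto
  finally show ?case
    unfolding card_insert_disjoint[OF insert.hyps] power_Suc by (simp only: mult_ac)
qed

lemma PiM_complex_affine:
  fixes u :: complex and v :: "nat \<Rightarrow> complex"
  assumes I: "finite I" and u: "u \<noteq> 0"
  shows "PiM I (\<lambda>_. lborel) = density (distr (PiM I (\<lambda>_. lborel)) (PiM I (\<lambda>_. lborel)) (\<lambda>c. \<lambda>k\<in>I. u * c k + v k))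
     (\<lambda>_. ennreal ((cmod u)\<^sup>2 ^ card I))"
proof (rule measure_eqI)
  let ?P = "PiM I (\<lambda>_. lborel :: complex measure)"
  have T[measurable]: "(\<lambda>c. \<lambda>k\<in>J. u * c k + v k) \<in> PiM J (\<lambda>_. lborel) \<rightarrow>\<^sub>M PiM J (\<lambda>_. lborel)" for J
    by (intro measurable_restrict) measurable
  fix A assume A[measurable]: "A \<in> sets ?P"
  show "emeasure ?P A = emeasure (density (distr ?P ?P (\<lambda>c. \<lambda>k\<in>I. u * c k + v k)) (\<lambda>_. ennreal ((cmod u)\<^sup>2 ^ card I))) A"
    using nn_integral_PiM_complex_affine[OF I _ u, of "indicator A" v] 
    by (simp add: nn_integral_density nn_integral_cmult ennreal_power nn_integral_distr flip: nn_integral_indicator)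
qed simp

lemma integral_PiM_complex_affine:
  fixes u :: complex and v :: "nat \<Rightarrow> complex" and f :: "(nat \<Rightarrow> complex) \<Rightarrow> complex"
  assumes I: "finite I" and u: "u \<noteq> 0" and f[measurable]: "f \<in> borel_measurable (PiM I (\<lambda>_. lborel))"
  shows "integral\<^sup>L (PiM I (\<lambda>_. lborel)) f =
    complex_of_real ((cmod u)\<^sup>2 ^ card I) * (\<integral>c. f (\<lambda>k\<in>I. u * c k + v k) \<partial>PiM I (\<lambda>_. lborel))"
proof -
  let ?P = "PiM I (\<lambda>_. lborel :: complex measure)"
  let ?T = "\<lambda>c. \<lambda>k\<in>I. u * c k + v k"
  have T[measurable]: "?T \<in> ?P \<rightarrow>\<^sub>M ?P"
    by (intro measurable_restrict) measurable
  let ?D = "density (distr ?P ?P ?T) (\<lambda>_. ennreal ((cmod u)\<^sup>2 ^ card I))"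
  have "integral\<^sup>L ?D f = complex_of_real ((cmod u)\<^sup>2 ^ card I) * (\<integral>c. f (?T c) \<partial>?P)"
    by (subst integral_density) (auto simp: integral_distr scaleR_conv_of_real)
  moreover have eq: "?P = ?D" by (rule PiM_complex_affine[OF I u])
  ultimately show ?thesis by metis
qed

section \<open>Sums over the Gaussian integers\<close>

text \<open>Dominated convergence for the counting measure.\<close>

lemma tendsto_infsum_dominated:
  fixes f :: "nat \<Rightarrow> 'a \<Rightarrow> 'b :: {banach, second_countable_topology}"
  assumes lim: "\<And>x. x \<in> A \<Longrightarrow> (\<lambda>n. f n x) \<longlonglongrightarrow> F x"
    and bound: "\<And>n x. x \<in> A \<Longrightarrow> norm (f n x) \<le> h x"
    and h: "h summable_on A"
  shows "(\<lambda>n. infsum (f n) A) \<longlonglongrightarrow> infsum F A"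
proof -
  have "Infinite_Sum.abs_summable_on h A"
    using h summable_on_iff_abs_summable_on_real by blast
  then have h': "integrable (count_space A) h"
    unfolding abs_summable_equivalent abs_summable_on_def .
  have F: "norm (F x) \<le> h x" if "x \<in> A" for x
    using that lim bound by (intro Lim_bounded[OF tendsto_norm[OF lim]]) auto
  have "(\<lambda>x. norm (f n x)) summable_on A" for n
    using bound by (intro summable_on_comparison_test[OF h]) auto
  then have f': "infsum (f n) A = integral\<^sup>L (count_space A) (f n)" for n
    by (metis abs_summable_equivalent infsetsum_def infsetsum_infsum)
  have "(\<lambda>x. norm (F x)) summable_on A"
    using F by (intro summable_on_comparison_test[OF h]) auto
  then have F': "infsum F A = integral\<^sup>L (count_space A) F"
    by (metis abs_summable_equivalent infsetsum_def infsetsum_infsum)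
  show ?thesis
    unfolding f' F'
    by (rule integral_dominated_convergence[where w = h]) (auto simp: h' lim bound AE_count_space)
qed

text \<open>Squares of integers dominate absolute values, and the geometric series converges.\<close>

lemma summable_on_exp_int:
  fixes b :: real
  assumes "b > 0"
  shows "(\<lambda>j::int. exp (- b * (real_of_int j)\<^sup>2)) summable_on UNIV"
proof -
  have *: "(\<lambda>n. exp (- b * real n)) summable_on (UNIV :: nat set)"
  proof -
    have "summable (\<lambda>n. exp (- b) ^ n)"
      using assms by (intro summable_geometric) auto
    then show ?thesis
      by (subst summable_on_UNIV_nonneg_real_iff) (auto simp: exp_of_nat_mult[symmetric] mult.commute)
  qed
  have "(\<lambda>j::int. exp (- b * \<bar>real_of_int j\<bar>)) summable_on (range int)"
    using * by (subst summable_on_reindex) (auto simp: o_def)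
  moreover have "(\<lambda>j::int. exp (- b * \<bar>real_of_int j\<bar>)) summable_on (range (\<lambda>n. - int n))"
    using * by (subst summable_on_reindex) (auto simp: o_def inj_on_def)
  ultimately have "(\<lambda>j::int. exp (- b * \<bar>real_of_int j\<bar>)) summable_on (range int \<union> range (\<lambda>n. - int n))"
    by (intro summable_on_union) auto
  moreover have "j \<in> range int \<union> range (\<lambda>n. - int n)" for j
    by (cases j rule: int_cases2) auto
  then have "range int \<union> range (\<lambda>n. - int n) = UNIV"
    by auto
  ultimately have "(\<lambda>j::int. exp (- b * \<bar>real_of_int j\<bar>)) summable_on UNIV"
    by simp
  then show ?thesis
  proof (rule summable_on_comparison_test)
    fix j :: int
    have "\<bar>real_of_int j\<bar> \<le> (real_of_int j)\<^sup>2"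
    proof (cases "j = 0")
      case False
      then have "1 \<le> \<bar>real_of_int j\<bar>" by linarith
      then have "\<bar>real_of_int j\<bar> * 1 \<le> \<bar>real_of_int j\<bar> * \<bar>real_of_int j\<bar>"
        by (intro mult_left_mono) auto
      then show ?thesis by (simp add: power2_eq_square)
    qed auto
    then show "exp (- b * (real_of_int j)\<^sup>2) \<le> exp (- b * \<bar>real_of_int j\<bar>)"
      using assms by simp
  qed auto
qed

lemma gint_eq_image: "gauss_ints = (\<lambda>(a, b). Complex (of_int a) (of_int b)) ` UNIV"
  by (force simp: gauss_ints_def image_iff complex_eq_iff elim!: Ints_cases)

lemma summable_on_exp_gint:
  fixes b :: real
  assumes "b > 0"
  shows "(\<lambda>c. exp (- b * (cmod c)\<^sup>2)) summable_on gauss_ints"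
proof -
  let ?e = "\<lambda>j::int. exp (- b * (real_of_int j)\<^sup>2)"
  have "Infinite_Set_Sum.abs_summable_on ?e UNIV"
    using summable_on_exp_int[OF assms] by (simp add: abs_summable_equivalent[symmetric])
  then have "Infinite_Set_Sum.abs_summable_on (\<lambda>(x, y). ?e x * ?e y) (UNIV \<times> UNIV)"
    by (intro abs_summable_on_product) auto
  then have "(\<lambda>(x, y). ?e x * ?e y) summable_on UNIV"
    using abs_summable_equivalent summable_on_iff_abs_summable_on_real by (metis UNIV_Times_UNIV)
  then have "(\<lambda>c. exp (- b * (cmod c)\<^sup>2)) summable_on (\<lambda>(a, b). Complex (of_int a) (of_int b)) ` UNIV"
    by (subst summable_on_reindex)
      (auto simp: inj_on_def o_def case_prod_unfold cmod_power2 exp_add[symmetric] distrib_left)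
  then show ?thesis by (simp add: gint_eq_image)
qed

lemma summable_on_exp_gint_PiE:
  fixes b :: real
  assumes "b > 0" "finite I"
  shows "(\<lambda>n. \<Prod>k\<in>I. exp (- b * (cmod (n k))\<^sup>2)) summable_on (PiE I (\<lambda>_. gauss_ints))"
proof -
  have "countable gauss_ints" by (simp add: gint_eq_image)
  moreover have "Infinite_Set_Sum.abs_summable_on (\<lambda>c. exp (- b * (cmod c)\<^sup>2)) gauss_ints"
    using summable_on_exp_gint[OF assms(1)] by (simp add: abs_summable_equivalent[symmetric])
  ultimately have "Infinite_Set_Sum.abs_summable_on (\<lambda>n. \<Prod>k\<in>I. exp (- b * (cmod (n k))\<^sup>2)) (PiE I (\<lambda>_. gauss_ints))"
    by (intro abs_summable_on_prod_PiE assms)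
  then show ?thesis
    unfolding abs_summable_equivalent[symmetric] by (rule abs_summable_summable)
qed

section \<open>A periodic approximate identity on the line\<close>

text \<open>The de la Vallee-Poussin kernel, normalised to have integral 1 over a period. It is a nonnegative
  trigonometric polynomial whose coefficients lie in \<open>[0, 1]\<close>, which makes both sides of Poisson
  summation accessible to dominated convergence.\<close>

definition cker :: "nat \<Rightarrow> real \<Rightarrow> real" where
  "cker M x = (4 ^ M / real ((2 * M) choose M)) * cos (pi * x) ^ (2 * M)"

definition cell :: "real set" where "cell = {-1/2..<1/2}"

lemma cell_closed_AE: "AE x in lborel. indicator cell x = (indicator {-1/2..1/2} x :: real)"
  by (rule AE_mp[OF AE_lborel_singleton[of "1/2"]]) (auto simp: cell_def indicator_def intro!: AE_I2)

lemma
  fixes f :: "real \<Rightarrow> real"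
  assumes "continuous_on UNIV f"
  shows integrable_cell: "integrable lborel (\<lambda>x. f x * indicator cell x)"
    and integral_cell: "(\<integral>x. f x * indicator cell x \<partial>lborel) = (\<integral>x. f x * indicator {-1/2..1/2} x \<partial>lborel)"
proof -
  have [measurable]: "f \<in> borel_measurable borel" "cell \<in> sets borel"
    using assms by (auto intro: borel_measurable_continuous_onI simp: cell_def)
  have ae: "AE x in lborel. f x * indicator cell x = f x * indicator {-1/2..1/2} x"
    using cell_closed_AE by eventually_elim simp
  show "(\<integral>x. f x * indicator cell x \<partial>lborel) = (\<integral>x. f x * indicator {-1/2..1/2} x \<partial>lborel)"
    by (rule integral_cong_AE) (use ae in measurable)
  have "integrable lborel (\<lambda>x. f x * indicator {-1/2..1/2} x)"
    using borel_integrable_atLeastAtMost'[of "-1/2" "1/2" f] continuous_on_subset[OF assms]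
    by (simp add: set_integrable_def mult.commute)
  then show "integrable lborel (\<lambda>x. f x * indicator cell x)"
    by (subst integrable_cong_AE[OF _ _ ae]) auto
qed

lemma central_binomial_Suc:
  "real ((2 * Suc M) choose (Suc M)) / 4 ^ Suc M = real (2 * M + 1) / real (2 * M + 2) * (real ((2 * M) choose M) / 4 ^ M)"
proof -
  define A B C where "A = real ((2 * Suc M) choose (Suc M))" and "B = real ((2 * M + 1) choose M)" and "C = real ((2 * M) choose M)"
  have "Suc (2 * M + 1) * ((2 * M + 1) choose M) = ((2 * Suc M) choose (Suc M)) * Suc M"
    using Suc_times_binomial_eq[of "2 * M + 1" M] by simp
  then have "real (Suc (2 * M + 1) * ((2 * M + 1) choose M)) = real (((2 * Suc M) choose (Suc M)) * Suc M)"
    by (rule arg_cong)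
  then have 1: "(2 * real M + 2) * B = A * (real M + 1)"
    unfolding of_nat_mult A_def B_def by (simp add: algebra_simps del: binomial_Suc_Suc)
  have "(2 * M + 1 - M) * ((2 * M + 1) choose M) = (2 * M + 1) * ((2 * M) choose M)"
    using binomial_absorb_comp[of "2 * M + 1" M] by simp
  then have "real ((2 * M + 1 - M) * ((2 * M + 1) choose M)) = real ((2 * M + 1) * ((2 * M) choose M))"
    by (rule arg_cong)
  then have 2: "(real M + 1) * B = (2 * real M + 1) * C"
    unfolding of_nat_mult B_def C_def by (simp add: algebra_simps del: binomial_Suc_Suc)
  have "A * (real M + 1) = 2 * ((2 * real M + 1) * C)"
    using 1 2 by (simp add: algebra_simps)
  then have "A = 4 * ((2 * real M + 1) / (2 * real M + 2) * C)"
    by (simp add: field_simps)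
  then have "A / 4 ^ Suc M = (2 * real M + 1) / (2 * real M + 2) * (C / 4 ^ M)"
    by simp
  then show ?thesis unfolding A_def C_def by (simp add: add.commute del: binomial_Suc_Suc mult_Suc_right)
qed

text \<open>Integration by parts reduces the exponent by two; the recursion is that of the central binomial
  coefficients.\<close>

lemma cos_power_integral:
  "(\<integral>x. cos (pi * x) ^ (2 * M) * indicator cell x \<partial>lborel) = real ((2 * M) choose M) / 4 ^ M"
proof (induction M)
  case 0
  have "integral\<^sup>L lborel (indicator cell) = (1 :: real)"
    by (simp add: cell_def)
  then show ?case by simp
next
  case (Suc M)
  let ?J = "\<lambda>M. \<integral>x. cos (pi * x) ^ (2 * M) * indicator cell x \<partial>lborel"
  have int: "integrable lborel (\<lambda>x. cos (pi * x) ^ m * indicator cell x)" for m :: nat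
    by (intro integrable_cell continuous_intros)
  let ?f = "\<lambda>x. pi * (2 * M + 2) * cos (pi * x) ^ (2 * Suc M) - pi * (2 * M + 1) * cos (pi * x) ^ (2 * M)"
  let ?F = "\<lambda>x. sin (pi * x) * cos (pi * x) ^ (2 * M + 1)"
  have "(\<integral>x. ?f x * indicator cell x \<partial>lborel) = (\<integral>x. ?f x * indicator {-1/2..1/2} x \<partial>lborel)"
    by (intro integral_cell continuous_intros)
  also have "(\<integral>x. ?f x * indicator {-1/2..1/2} x \<partial>lborel) = ?F (1/2) - ?F (-1/2)"
  proof (rule integral_FTC_Icc_real)
    fix x :: real
    have c: "((\<lambda>x. cos (pi * x)) has_real_derivative (- sin (pi * x) * pi)) (at x)"
      and s: "((\<lambda>x. sin (pi * x)) has_real_derivative (cos (pi * x) * pi)) (at x)"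
      by (auto intro!: derivative_eq_intros)
    have "(?F has_real_derivative (pi * cos (pi * x)) * cos (pi * x) ^ (2 * M + 1) + sin (pi * x) * (real (2 * M + 1) * cos (pi * x) ^ (2 * M) * (- sin (pi * x) * pi))) (at x)"
      using DERIV_mult[OF s DERIV_power[OF c, of "2 * M + 1"]] by (simp add: mult_ac)
    also have "(pi * cos (pi * x)) * cos (pi * x) ^ (2 * M + 1) + sin (pi * x) * (real (2 * M + 1) * cos (pi * x) ^ (2 * M) * (- sin (pi * x) * pi))
       = pi * cos (pi * x) ^ (2 * M) * ((cos (pi * x))\<^sup>2 - real (2 * M + 1) * (sin (pi * x))\<^sup>2)"
      by (simp add: power2_eq_square algebra_simps)
    also have "\<dots> = ?f x"
      unfolding sin_squared_eq by (simp add: power2_eq_square algebra_simps)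
    finally show "DERIV ?F x :> ?f x" .
    show "isCont ?f x" by (intro continuous_intros)
  qed auto
  also have "?F (1/2) - ?F (-1/2) = 0"
    by simp
  finally have "0 = (\<integral>x. ?f x * indicator cell x \<partial>lborel)" ..
  also have "(\<lambda>x. ?f x * indicator cell x) = 
      (\<lambda>x. pi * (2 * M + 2) * (cos (pi * x) ^ (2 * Suc M) * indicator cell x) - pi * (2 * M + 1) * (cos (pi * x) ^ (2 * M) * indicator cell x))"
    by (simp add: algebra_simps fun_eq_iff)
  also have "integral\<^sup>L lborel \<dots> = pi * (2 * M + 2) * ?J (Suc M) - pi * (2 * M + 1) * ?J M"
    using int by (subst Bochner_Integration.integral_diff) (auto simp del: mult_Suc_right)
  finally have "(2 * M + 2) * ?J (Suc M) = (2 * M + 1) * ?J M"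
    by (simp add: mult.assoc del: mult_Suc_right)
  moreover have "J = (2 * M + 1) / (2 * M + 2) * c" if "real (2 * M + 2) * J = real (2 * M + 1) * c" for J c :: real
    using that by (simp add: field_simps)
  ultimately have "?J (Suc M) = (2 * M + 1) / (2 * M + 2) * (real ((2 * M) choose M) / 4 ^ M)"
    unfolding Suc by blast
  also have "\<dots> = real ((2 * Suc M) choose (Suc M)) / 4 ^ Suc M"
    by (rule central_binomial_Suc[symmetric])
  finally show ?case .
qed

lemma cker_nonneg: "cker M x \<ge> 0"
  by (simp add: cker_def power_mult)

lemma continuous_cker [continuous_intros]:
  fixes f :: "'a::t2_space \<Rightarrow> real"
  shows "continuous_on A f \<Longrightarrow> continuous_on A (\<lambda>x. cker M (f x))"
  unfolding cker_def by (auto intro!: continuous_intros)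

lemma measurable_cker [measurable]: "cker M \<in> borel_measurable borel"
  by (intro borel_measurable_continuous_onI continuous_intros)

lemma integral_cker: "(\<integral>x. cker M x * indicator cell x \<partial>lborel) = 1"
proof -
  have "(\<integral>x. cker M x * indicator cell x \<partial>lborel) = 4 ^ M / real ((2 * M) choose M) * (\<integral>x. cos (pi * x) ^ (2 * M) * indicator cell x \<partial>lborel)"
    by (subst integral_mult_right_zero[symmetric]) (simp add: cker_def mult.assoc)
  then show ?thesis
    by (simp add: cos_power_integral)
qed

text \<open>The second moment, measured by \<open>sin\<^sup>2\<close>, tends to 0: the kernel concentrates at the integers.\<close>

lemma integral_cker_sin:
  "(\<integral>x. (cker M x * (sin (pi * x))\<^sup>2) * indicator cell x \<partial>lborel) = 1 / (2 * real M + 2)"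
proof -
  define w where "w = 4 ^ M / real ((2 * M) choose M)"
  have eq: "(\<lambda>x. (cker M x * (sin (pi * x))\<^sup>2) * indicator cell x) =
     (\<lambda>x. w * (cos (pi * x) ^ (2 * M) * indicator cell x) - w * (cos (pi * x) ^ (2 * Suc M) * indicator cell x))"
    unfolding sin_squared_eq cker_def w_def[symmetric] by (auto simp: fun_eq_iff algebra_simps power2_eq_square)
  have "(\<integral>x. (cker M x * (sin (pi * x))\<^sup>2) * indicator cell x \<partial>lborel) = w * (real ((2 * M) choose M) / 4 ^ M) - w * (real ((2 * Suc M) choose (Suc M)) / 4 ^ Suc M)"
    unfolding eq by (subst Bochner_Integration.integral_diff)
      (auto simp: cos_power_integral simp del: mult_Suc_right power_Suc binomial_Suc_Suc intro!: integrable_mult_right integrable_cell continuous_intros)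
  also have "w * (real ((2 * M) choose M) / 4 ^ M) = 1"
    by (simp add: w_def)
  also have "w * (real ((2 * Suc M) choose (Suc M)) / 4 ^ Suc M) = (2 * real M + 1) / (2 * real M + 2)"
    unfolding central_binomial_Suc w_def by (simp add: add.commute)
  also have "1 - (2 * real M + 1) / (2 * real M + 2) = 1 / (2 * real M + 2)"
    by (simp add: field_simps)
  finally show ?thesis .
qed

lemma cker_periodic: "cker M (x + of_int n) = cker M x"
proof -
  have "(cos (pi * (x + of_int n)))\<^sup>2 = (cos (pi * x))\<^sup>2"
    by (simp add: distrib_left cos_add power_mult_distrib)
  then show ?thesis
    unfolding cker_def power_mult by (simp only:)
qed

definition kcoeff :: "nat \<Rightarrow> int \<Rightarrow> real" where
  "kcoeff M m = real ((2 * M) choose nat (int M + m)) / real ((2 * M) choose M)"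

lemma kcoeff_bounds: "0 \<le> kcoeff M m" "kcoeff M m \<le> 1"
  by (simp_all add: kcoeff_def binomial_maximum')

lemma cker_expansion:
  "complex_of_real (cker M x) = (\<Sum>m\<in>{- int M..int M}. of_real (kcoeff M m) * exp (- (2 * of_real pi * \<i> * of_int m * of_real x)))"
proof -
  define u where "u = \<i> * of_real (pi * x)"
  have pw: "(2 :: complex) ^ (2 * M) = 4 ^ M"
    by (simp add: power_mult)
  have eq: "complex_of_real (cos (pi * x)) = (exp u + exp (- u)) / 2"
    unfolding u_def cos_exp_eq cos_of_real[symmetric] by (simp add: algebra_simps)
  have "complex_of_real (cos (pi * x) ^ (2 * M)) = (exp u + exp (- u)) ^ (2 * M) / 4 ^ M"
    by (simp only: of_real_power eq power_divide pw)
  also have "(exp u + exp (- u)) ^ (2 * M) = (\<Sum>k\<le>2 * M. of_nat ((2 * M) choose k) * exp u ^ k * exp (- u) ^ (2 * M - k))"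
    by (rule binomial_ring)
  also have "\<dots> = (\<Sum>k\<le>2 * M. of_nat ((2 * M) choose k) * exp (of_int (2 * int k - 2 * int M) * u))"
  proof (rule sum.cong)
    fix k assume k: "k \<in> {..2 * M}"
    have "exp u ^ k * exp (- u) ^ (2 * M - k) = exp (of_nat k * u + of_nat (2 * M - k) * (- u))"
      by (simp only: exp_of_nat_mult exp_add)
    also have "of_nat k * u + of_nat (2 * M - k) * (- u) = of_int (2 * int k - 2 * int M) * u"
      using k by (simp add: of_nat_diff algebra_simps)
    finally show "of_nat ((2 * M) choose k) * exp u ^ k * exp (- u) ^ (2 * M - k) = of_nat ((2 * M) choose k) * exp (of_int (2 * int k - 2 * int M) * u)"
      by (simp add: mult.assoc)
  qed auto
  also have "\<dots> = (\<Sum>m\<in>{- int M..int M}. of_nat ((2 * M) choose nat (int M + m)) * exp (- (2 * of_real pi * \<i> * of_int m * of_real x)))"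
  proof (rule sum.reindex_bij_witness[of _ "\<lambda>m. nat (int M - m)" "\<lambda>k. int M - int k"])
    fix k assume k: "k \<in> {..2 * M}"
    have "(2 * M) choose k = (2 * M) choose (2 * M - k)"
      using k by (intro binomial_symmetric) auto
    moreover have "nat (int M + (int M - int k)) = 2 * M - k"
      using k by auto
    ultimately show "of_nat ((2 * M) choose nat (int M + (int M - int k))) * exp (- (2 * of_real pi * \<i> * of_int (int M - int k) * of_real x)) =
       of_nat ((2 * M) choose k) * exp (of_int (2 * int k - 2 * int M) * u)"
      by (simp add: u_def algebra_simps)
  qed auto
  finally have *: "complex_of_real (cos (pi * x) ^ (2 * M)) =
     (\<Sum>m\<in>{- int M..int M}. of_nat ((2 * M) choose nat (int M + m)) * exp (- (2 * of_real pi * \<i> * of_int m * of_real x))) / 4 ^ M"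
    by simp
  have "complex_of_real (cker M x) = 4 ^ M / of_nat ((2 * M) choose M) * complex_of_real (cos (pi * x) ^ (2 * M))"
    unfolding cker_def by simp
  also have "\<dots> = (\<Sum>m\<in>{- int M..int M}. of_nat ((2 * M) choose nat (int M + m)) * exp (- (2 * of_real pi * \<i> * of_int m * of_real x))) / of_nat ((2 * M) choose M)"
    unfolding * by simp
  also have "\<dots> = (\<Sum>m\<in>{- int M..int M}. of_real (kcoeff M m) * exp (- (2 * of_real pi * \<i> * of_int m * of_real x)))"
    unfolding sum_divide_distrib kcoeff_def by (intro sum.cong) auto
  finally show ?thesis .
qed

lemma kcoeff_uminus: "\<bar>m\<bar> \<le> int M \<Longrightarrow> kcoeff M (- m) = kcoeff M m"
proof -
  assume m: "\<bar>m\<bar> \<le> int M"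
  have "nat (int M + m) = 2 * M - nat (int M + - m)" using m by auto
  moreover have "(2 * M) choose nat (int M + - m) = (2 * M) choose (2 * M - nat (int M + - m))"
    using m by (intro binomial_symmetric) auto
  ultimately show ?thesis
    by (simp add: kcoeff_def)
qed

lemma kcoeff_tendsto: "(\<lambda>M. kcoeff M m) \<longlonglongrightarrow> 1"
proof -
  have nat: "(\<lambda>M. kcoeff M (int k)) \<longlonglongrightarrow> 1" for k
  proof (induction k)
    case 0
    then show ?case by (simp add: kcoeff_def)
  next
    case (Suc k)
    have "(\<lambda>M. (real M - real k) / (real M + real k + 1)) \<longlonglongrightarrow> 1"
      by real_asymp
    from tendsto_mult[OF this Suc] have "(\<lambda>M. (real M - real k) / (real M + real k + 1) * kcoeff M (int k)) \<longlonglongrightarrow> 1"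
      by simp
    moreover have "eventually (\<lambda>M. (real M - real k) / (real M + real k + 1) * kcoeff M (int k) = kcoeff M (int (Suc k))) sequentially"
      using eventually_ge_at_top[of k]
    proof eventually_elim
      case (elim M)
      have "Suc (M + k) * ((2 * M) choose Suc (M + k)) = (2 * M - (M + k)) * ((2 * M) choose (M + k))"
        using binomial_absorption[of "M + k" "2 * M"] binomial_absorb_comp[of "2 * M" "M + k"] by simp
      then have "real (Suc (M + k) * ((2 * M) choose Suc (M + k))) = real ((2 * M - (M + k)) * ((2 * M) choose (M + k)))"
        by (rule arg_cong)
      then have *: "(real M + real k + 1) * real ((2 * M) choose Suc (M + k)) = (real M - real k) * real ((2 * M) choose (M + k))"
        using elim unfolding of_nat_mult by (simp add: of_nat_diff add_ac)
      have n: "nat (int M + int (Suc k)) = Suc (M + k)" "nat (int M + int k) = M + k" by auto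
      have "real ((2 * M) choose Suc (M + k)) = (real M - real k) / (real M + real k + 1) * real ((2 * M) choose (M + k))"
        using * by (simp add: field_simps)
      then show ?case
        unfolding kcoeff_def n by simp
    qed
    ultimately show ?case
      by (rule Lim_transform_eventually)
  qed
  show ?thesis
  proof (cases "m \<ge> 0")
    case True
    then show ?thesis using nat[of "nat m"] by simp
  next
    case False
    then have "(\<lambda>M. kcoeff M (- m)) \<longlonglongrightarrow> 1" using nat[of "nat (- m)"] by simp
    moreover have "eventually (\<lambda>M. kcoeff M (- m) = kcoeff M m) sequentially"
      using eventually_ge_at_top[of "nat \<bar>m\<bar>"] by eventually_elim (rule kcoeff_uminus, auto)
    ultimately show ?thesis by (rule Lim_transform_eventually)
  qed
qed

section \<open>A periodic approximate identity on the complex plane\<close>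

lemma
  fixes f g :: "real \<Rightarrow> real"
  assumes f: "integrable lborel f" and g: "integrable lborel g"
  shows integrable_complex_Re_Im: "integrable lborel (\<lambda>c. f (Re c) * g (Im c))"
    and integral_complex_Re_Im: "(\<integral>c. f (Re c) * g (Im c) \<partial>lborel) = integral\<^sup>L lborel f * integral\<^sup>L lborel g"
proof -
  have [measurable]: "f \<in> borel_measurable borel" "g \<in> borel_measurable borel"
    using f g by auto
  have [measurable]: "(\<lambda>(x, y). Complex x y) \<in> lborel \<Otimes>\<^sub>M lborel \<rightarrow>\<^sub>M borel"
    by measurable
  have int: "integrable (lborel \<Otimes>\<^sub>M lborel) (\<lambda>(x, y). f x * g y)"
    using f g by (intro lborel_pair.Fubini_integrable) (auto simp: norm_mult abs_mult)
  then show "integrable lborel (\<lambda>c. f (Re c) * g (Im c))"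
    unfolding lborel_complex_split by (subst integrable_distr_eq) (auto simp: case_prod_unfold)
  have "(\<integral>c. f (Re c) * g (Im c) \<partial>lborel) = (\<integral>p. (case p of (x, y) \<Rightarrow> f x * g y) \<partial>(lborel \<Otimes>\<^sub>M lborel))"
    unfolding lborel_complex_split by (subst integral_distr) (auto simp: case_prod_unfold)
  also have "\<dots> = (\<integral>x. (\<integral>y. f x * g y \<partial>lborel) \<partial>lborel)"
    using lborel_pair.integral_fst'[OF int] by simp
  also have "\<dots> = integral\<^sup>L lborel f * integral\<^sup>L lborel g"
    by simp
  finally show "(\<integral>c. f (Re c) * g (Im c) \<partial>lborel) = integral\<^sup>L lborel f * integral\<^sup>L lborel g" .
qed

definition pker :: "nat \<Rightarrow> complex \<Rightarrow> real" where
  "pker M c = cker M (Re c) * cker M (Im c)"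

definition ccell :: "complex set" where
  "ccell = {c. Re c \<in> cell \<and> Im c \<in> cell}"

text \<open>A smooth periodic substitute for the squared distance to the nearest Gaussian integer, chosen so
  that its integral against the kernel has a closed form.\<close>

definition gdist :: "complex \<Rightarrow> real" where
  "gdist c = (sin (pi * Re c))\<^sup>2 + (sin (pi * Im c))\<^sup>2"

lemma indicator_ccell: "indicator ccell c = (indicator cell (Re c) * indicator cell (Im c) :: real)"
  by (auto simp: ccell_def indicator_def)

lemma pker_nonneg: "pker M c \<ge> 0"
  by (simp add: pker_def cker_nonneg)

lemma measurable_pker [measurable]: "pker M \<in> borel_measurable borel"
  unfolding pker_def by measurable

lemma sets_cell [measurable]: "cell \<in> sets borel"
  by (simp add: cell_def)

lemma sets_ccell [measurable]: "ccell \<in> sets borel"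
  unfolding ccell_def by measurable

lemma integrable_pker: "integrable lborel (\<lambda>c. pker M c * indicator ccell c)"
  and integral_pker: "(\<integral>c. pker M c * indicator ccell c \<partial>lborel) = 1"
proof -
  have i: "integrable lborel (\<lambda>x. cker M x * indicator cell x)"
    by (intro integrable_cell continuous_intros)
  have eq: "(\<lambda>c. pker M c * indicator ccell c) = (\<lambda>c. (cker M (Re c) * indicator cell (Re c)) * (cker M (Im c) * indicator cell (Im c)))"
    by (simp add: pker_def indicator_ccell mult_ac)
  show "integrable lborel (\<lambda>c. pker M c * indicator ccell c)"
    unfolding eq by (rule integrable_complex_Re_Im[OF i i])
  show "(\<integral>c. pker M c * indicator ccell c \<partial>lborel) = 1"
    unfolding eq integral_complex_Re_Im[OF i i] by (simp add: integral_cker)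
qed

lemma integrable_pker_gdist: "integrable lborel (\<lambda>c. pker M c * indicator ccell c * gdist c)"
  and integral_pker_gdist: "(\<integral>c. pker M c * indicator ccell c * gdist c \<partial>lborel) = 1 / (real M + 1)"
proof -
  have i: "integrable lborel (\<lambda>x. cker M x * indicator cell x)"
    by (intro integrable_cell continuous_intros)
  have j: "integrable lborel (\<lambda>x. (cker M x * (sin (pi * x))\<^sup>2) * indicator cell x)"
    by (intro integrable_cell continuous_intros)
  have eq: "(\<lambda>c. pker M c * indicator ccell c * gdist c) = 
     (\<lambda>c. ((cker M (Re c) * (sin (pi * Re c))\<^sup>2) * indicator cell (Re c)) * (cker M (Im c) * indicator cell (Im c))
        + (cker M (Re c) * indicator cell (Re c)) * ((cker M (Im c) * (sin (pi * Im c))\<^sup>2) * indicator cell (Im c)))"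
    by (simp add: pker_def indicator_ccell gdist_def algebra_simps)
  show "integrable lborel (\<lambda>c. pker M c * indicator ccell c * gdist c)"
    unfolding eq by (intro Bochner_Integration.integrable_add integrable_complex_Re_Im[OF i j] integrable_complex_Re_Im[OF j i])
  show "(\<integral>c. pker M c * indicator ccell c * gdist c \<partial>lborel) = 1 / (real M + 1)"
    unfolding eq
    by (subst Bochner_Integration.integral_add[OF integrable_complex_Re_Im[OF j i] integrable_complex_Re_Im[OF i j]])
      (simp only: integral_complex_Re_Im[OF i j] integral_complex_Re_Im[OF j i] integral_cker integral_cker_sin, simp add: field_simps)
qed

lemma pker_periodic: "n \<in> gauss_ints \<Longrightarrow> pker M (c + n) = pker M c"
  by (auto simp: pker_def gauss_ints_def cker_periodic elim!: Ints_cases)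

definition gbox :: "nat \<Rightarrow> complex set" where
  "gbox M = {n \<in> gauss_ints. \<bar>Re n\<bar> \<le> real M \<and> \<bar>Im n\<bar> \<le> real M}"

lemma gbox_eq: "gbox M = (\<lambda>(a, b). Complex (of_int a) (of_int b)) ` ({- int M..int M} \<times> {- int M..int M})"
proof -
  have "\<bar>real_of_int a\<bar> \<le> real M \<longleftrightarrow> a \<in> {- int M..int M}" for a
    by (auto simp: abs_le_iff)
  then show ?thesis
    unfolding gbox_def gint_eq_image by (auto simp: image_iff)
qed

lemma finite_gbox: "finite (gbox M)"
  by (simp add: gbox_eq)

lemma gbox_subset: "gbox M \<subseteq> gauss_ints"
  by (auto simp: gbox_def)

definition gcoeff :: "nat \<Rightarrow> complex \<Rightarrow> real" where
  "gcoeff M n = kcoeff M \<lfloor>Re n\<rfloor> * kcoeff M \<lfloor>Im n\<rfloor>"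

lemma gcoeff_bounds: "0 \<le> gcoeff M n" "gcoeff M n \<le> 1"
  unfolding gcoeff_def using kcoeff_bounds[of M] by (auto intro!: mult_nonneg_nonneg mult_le_one)

lemma gcoeff_tendsto: "(\<lambda>M. gcoeff M n) \<longlonglongrightarrow> 1"
  unfolding gcoeff_def using tendsto_mult[OF kcoeff_tendsto kcoeff_tendsto] by simp

text \<open>The characters of the complex plane; those with Gaussian integer parameter are trivial on the
  Gaussian integers, because the Gaussian integers are self-dual under \<open>Re (cnj c * n)\<close>.\<close>

definition echar :: "complex \<Rightarrow> complex \<Rightarrow> complex" where
  "echar n c = exp (- (2 * of_real pi * \<i> * of_real (Re (cnj c * n))))"

lemma pker_expansion: "complex_of_real (pker M c) = (\<Sum>n\<in>gbox M. of_real (gcoeff M n) * echar n c)"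
proof -
  let ?I = "{- int M..int M}"
  let ?E = "\<lambda>m x. of_real (kcoeff M m) * exp (- (2 * of_real pi * \<i> * of_int m * of_real x))"
  have "complex_of_real (pker M c) = (\<Sum>a\<in>?I. ?E a (Re c)) * (\<Sum>b\<in>?I. ?E b (Im c))"
    by (simp add: pker_def cker_expansion)
  also have "\<dots> = (\<Sum>(a, b)\<in>?I \<times> ?I. ?E a (Re c) * ?E b (Im c))"
    by (simp add: sum_product sum.cartesian_product)
  also have "\<dots> = (\<Sum>(a, b)\<in>?I \<times> ?I. of_real (gcoeff M (Complex (of_int a) (of_int b))) * echar (Complex (of_int a) (of_int b)) c)"
    by (intro sum.cong) (auto simp: gcoeff_def echar_def exp_add[symmetric] algebra_simps)
  also have "\<dots> = (\<Sum>n\<in>gbox M. of_real (gcoeff M n) * echar n c)"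
    unfolding gbox_eq by (subst sum.reindex) (auto simp: inj_on_def case_prod_unfold)
  finally show ?thesis .
qed

lemma norm_echar [simp]: "norm (echar n c) = 1"
  by (simp add: echar_def)

lemma measurable_echar [measurable]: "echar n \<in> borel_measurable borel"
  unfolding echar_def by (intro borel_measurable_continuous_onI) (auto intro!: continuous_intros)

lemma gint_add: "a \<in> gauss_ints \<Longrightarrow> b \<in> gauss_ints \<Longrightarrow> a + b \<in> gauss_ints"
  by (auto simp: gauss_ints_def)

lemma ccell_cover: "\<exists>!n. n \<in> gauss_ints \<and> c - n \<in> ccell"
proof -
  have r: "\<exists>!m::int. x - of_int m \<in> cell" for x :: real
  proof (rule ex1I[of _ "\<lfloor>x + 1/2\<rfloor>"])
    show "x - of_int \<lfloor>x + 1/2\<rfloor> \<in> cell"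
      unfolding cell_def by (simp, linarith)
    fix m :: int assume "x - of_int m \<in> cell"
    then show "m = \<lfloor>x + 1/2\<rfloor>"
      unfolding cell_def by (simp, linarith)
  qed
  obtain a where a: "Re c - of_int a \<in> cell" "\<And>m. Re c - of_int m \<in> cell \<Longrightarrow> m = a" using r[of "Re c"] by auto
  obtain b where b: "Im c - of_int b \<in> cell" "\<And>m. Im c - of_int m \<in> cell \<Longrightarrow> m = b" using r[of "Im c"] by auto
  show ?thesis
  proof (rule ex1I[of _ "Complex (of_int a) (of_int b)"])
    show "Complex (of_int a) (of_int b) \<in> gauss_ints \<and> c - Complex (of_int a) (of_int b) \<in> ccell"
      using a(1) b(1) by (auto simp: gauss_ints_def ccell_def)
    fix n assume "n \<in> gauss_ints \<and> c - n \<in> ccell"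
    then show "n = Complex (of_int a) (of_int b)"
      using a(2) b(2) by (auto simp: gauss_ints_def ccell_def complex_eq_iff elim!: Ints_cases)
  qed
qed

lemma norm_ccell_le: "c \<in> ccell \<Longrightarrow> (cmod c)\<^sup>2 \<le> 1/2"
proof -
  assume "c \<in> ccell"
  then have "\<bar>Re c\<bar> \<le> 1/2" "\<bar>Im c\<bar> \<le> 1/2" by (auto simp: ccell_def cell_def)
  then have "(Re c)\<^sup>2 \<le> (1/2)\<^sup>2" "(Im c)\<^sup>2 \<le> (1/2)\<^sup>2"
    by (auto intro!: power2_le_iff_abs_le[THEN iffD2])
  then show ?thesis unfolding cmod_power2 by (simp add: power_divide)
qed

text \<open>Compactness of the unit cell: \<open>gdist\<close> is positive away from 0 there.\<close>

lemma gdist_small: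
  assumes "d > 0"
  shows "\<exists>e>0. \<forall>c\<in>ccell. gdist c < e \<longrightarrow> cmod c < d"
proof -
  define K where "K = cbox (Complex (-1/2) (-1/2)) (Complex (1/2) (1/2)) \<inter> {c. d \<le> cmod c}"
  have K: "compact K"
    unfolding K_def by (intro compact_Int_closed compact_cbox closed_Collect_le continuous_intros)
  have cont: "continuous_on K gdist"
    unfolding gdist_def by (auto intro!: continuous_intros)
  have pos: "gdist c > 0" if "c \<in> K" for c
  proof (rule ccontr)
    assume "\<not> gdist c > 0"
    then have "sin (pi * Re c) = 0" "sin (pi * Im c) = 0"
      unfolding gdist_def by (auto simp: sum_power2_gt_zero_iff)
    moreover have "\<bar>Re c\<bar> \<le> 1/2" "\<bar>Im c\<bar> \<le> 1/2"
      using that by (auto simp: K_def in_cbox_complex_iff)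
    then have "pi * \<bar>Re c\<bar> < pi * 1" "pi * \<bar>Im c\<bar> < pi * 1"
      by (intro mult_strict_left_mono; simp)+
    then have "\<bar>pi * Re c\<bar> < pi" "\<bar>pi * Im c\<bar> < pi"
      by (simp_all add: abs_mult)
    then have "- pi < pi * Re c" "pi * Re c < pi" "- pi < pi * Im c" "pi * Im c < pi"
      by linarith+
    ultimately have "pi * Re c = 0" "pi * Im c = 0"
      using sin_eq_0_pi by blast+
    then have "c = 0" by (simp add: complex_eq_iff)
    then show False using that assms by (simp add: K_def)
  qed
  obtain e where e: "e > 0" "\<And>c. c \<in> K \<Longrightarrow> e \<le> gdist c"
  proof (cases "K = {}")
    case True then show ?thesis by (intro that[of 1]) auto
  next
    case False
    from continuous_attains_inf[OF K this cont] obtain x where "x \<in> K" "\<forall>y\<in>K. gdist x \<le> gdist y" by auto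
    then show ?thesis using pos by (intro that[of "gdist x"]) auto
  qed
  have "cmod c < d" if "c \<in> ccell" "gdist c < e" for c
  proof (rule ccontr)
    assume "\<not> cmod c < d"
    then have "c \<in> K" using that by (auto simp: K_def ccell_def cell_def in_cbox_complex_iff)
    then show False using e that by fastforce
  qed
  then show ?thesis using e(1) by blast
qed

lemma gdist_nonneg: "gdist c \<ge> 0" by (simp add: gdist_def)

lemma measurable_gdist [measurable]: "gdist \<in> borel_measurable borel"
  unfolding gdist_def by measurable

section \<open>Poisson summation for the Gaussian integers\<close>

lemma measurable_PiM_continuous:
  fixes F :: "(nat \<Rightarrow> complex) \<Rightarrow> complex"
  assumes loc: "\<And>c. F (restrict c I) = F c" and cont: "continuous_on UNIV F"
  shows "F \<in> borel_measurable (PiM I (\<lambda>_. lborel))"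
proof -
  have "(\<lambda>c k. if k \<in> I then c k else undefined) \<in> borel_measurable (PiM I (\<lambda>_. lborel :: complex measure))"
  proof (rule measurable_coordinatewise_then_product)
    fix k :: nat
    show "(\<lambda>c. if k \<in> I then c k else undefined) \<in> borel_measurable (PiM I (\<lambda>_. lborel :: complex measure))"
      by (cases "k \<in> I") (auto intro: measurable_component_singleton[of k I "\<lambda>_. lborel", simplified])
  qed
  moreover have "F \<in> borel_measurable borel"
    using cont by (rule borel_measurable_continuous_onI)
  ultimately have "(\<lambda>c. F (\<lambda>k. if k \<in> I then c k else undefined)) \<in> borel_measurable (PiM I (\<lambda>_. lborel :: complex measure))"
    by (rule measurable_compose)
  then show ?thesis
    using loc by (simp add: restrict_def)
qed

lemma integrable_exp_cmod:
  assumes "\<beta> > 0"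
  shows "integrable lborel (\<lambda>c::complex. exp (- \<beta> * (cmod c)\<^sup>2))"
proof -
  define \<sigma> where "\<sigma> = sqrt (1 / (2 * \<beta>))"
  have \<sigma>: "\<sigma> > 0" "2 * \<sigma>\<^sup>2 = 1 / \<beta>" using assms by (simp_all add: \<sigma>_def)
  have *: "integrable lborel (\<lambda>x::real. exp (- \<beta> * x\<^sup>2))"
  proof -
    have "integrable lborel (\<lambda>x. sqrt (2 * pi * \<sigma>\<^sup>2) * normal_density 0 \<sigma> x)"
      by (intro integrable_mult_right integrable_normal_density \<sigma>)
    moreover have "sqrt (2 * pi * \<sigma>\<^sup>2) * normal_density 0 \<sigma> x = exp (- \<beta> * x\<^sup>2)" for x
      using \<sigma> assms by (simp add: normal_density_def)
    ultimately show ?thesis by simp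
  qed
  have "integrable lborel (\<lambda>c. exp (- \<beta> * (Re c)\<^sup>2) * exp (- \<beta> * (Im c)\<^sup>2))"
    by (rule integrable_complex_Re_Im[OF * *])
  then show ?thesis
    by (simp add: cmod_power2 exp_add[symmetric] distrib_left)
qed

text \<open>Continuity for the product topology gives uniform smallness in finitely many coordinates, here all
  those on which \<open>F\<close> depends.\<close>

lemma continuous_coordinates_eps:
  fixes F :: "(nat \<Rightarrow> complex) \<Rightarrow> complex"
  assumes loc: "\<And>c. F (restrict c I) = F c" and cont: "continuous_on UNIV F" and "e > 0"
  shows "\<exists>d>0. \<forall>c. (\<forall>k\<in>I. cmod (c k) < d) \<longrightarrow> norm (F (\<lambda>k\<in>I. c k + n k) - F n) < e"
proof (rule ccontr)
  assume "\<not> ?thesis"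
  then have neg: "\<exists>c. (\<forall>k\<in>I. cmod (c k) < d) \<and> \<not> norm (F (\<lambda>k\<in>I. c k + n k) - F n) < e" if "d > 0" for d
    using that by blast
  have "\<forall>j::nat. \<exists>c. (\<forall>k\<in>I. cmod (c k) < 1 / (real j + 1)) \<and> \<not> norm (F (\<lambda>k\<in>I. c k + n k) - F n) < e"
    by (intro allI neg) simp
  then obtain c where c: "\<And>j k. k \<in> I \<Longrightarrow> cmod (c j k) < 1 / (real j + 1)"
     and ge: "\<And>j. \<not> norm (F (\<lambda>k\<in>I. c j k + n k) - F n) < e"
    by metis
  define x where "x j = (\<lambda>k. if k \<in> I then c j k + n k else n k)" for j
  have "(\<lambda>j. x j k) \<longlonglongrightarrow> n k" for k
  proof (cases "k \<in> I")
    case True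
    have "(\<lambda>j. 1 / (real j + 1)) \<longlonglongrightarrow> 0" by real_asymp
    then have "(\<lambda>j. c j k) \<longlonglongrightarrow> 0"
      by (rule tendsto_0_le[where K=1]) (use c[OF True] in \<open>auto intro!: always_eventually less_imp_le simp: abs_if\<close>)
    from tendsto_add[OF this tendsto_const[of "n k"]] show ?thesis
      using True by (simp add: x_def)
  qed (simp add: x_def)
  then have "x \<longlonglongrightarrow> n"
    using limitin_componentwise[of "\<lambda>_::nat. euclidean :: complex topology" UNIV x n sequentially]
    by (simp add: euclidean_product_topology)
  then have "(\<lambda>j. F (x j)) \<longlonglongrightarrow> F n"
    by (rule continuous_on_tendsto_compose[OF cont]) auto
  moreover have "F (x j) = F (\<lambda>k\<in>I. c j k + n k)" for j
  proof -
    have "restrict (x j) I = (\<lambda>k\<in>I. c j k + n k)" by (auto simp: x_def)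
    then show ?thesis using loc[of "x j"] by simp
  qed
  ultimately have "(\<lambda>j. F (\<lambda>k\<in>I. c j k + n k)) \<longlonglongrightarrow> F n" by simp
  then have "eventually (\<lambda>j. dist (F (\<lambda>k\<in>I. c j k + n k)) (F n) < e) sequentially"
    using \<open>e > 0\<close> by (rule tendstoD)
  then show False
    using ge by (auto simp: dist_norm eventually_sequentially)
qed

text \<open>A continuous function with Gaussian decay of the coordinates in \<open>I\<close>. It is defined on all sequences
  but depends on these coordinates only, so that the same type serves every dimension.\<close>

locale poisson_setting =
  fixes I :: "nat set" and F :: "(nat \<Rightarrow> complex) \<Rightarrow> complex" and K \<beta> :: real
  assumes fin: "finite I"
    and loc: "\<And>c. F (restrict c I) = F c"
    and cont: "continuous_on UNIV F"
    and beta: "\<beta> > 0"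
    and bound: "\<And>c. norm (F c) \<le> K * (\<Prod>k\<in>I. exp (- \<beta> * (cmod (c k))\<^sup>2))"
begin

abbreviation "P \<equiv> PiM I (\<lambda>_. lborel :: complex measure)"
abbreviation "L \<equiv> PiE I (\<lambda>_. gauss_ints)"

definition Fh :: "(nat \<Rightarrow> complex) \<Rightarrow> complex" where
  "Fh n = (\<integral>c. F c * (\<Prod>k\<in>I. echar (n k) (c k)) \<partial>P)"

lemma measurable_F [measurable]: "F \<in> borel_measurable P"
  using loc cont by (rule measurable_PiM_continuous)

lemma K_nonneg: "K \<ge> 0"
proof -
  have "0 \<le> K * (\<Prod>k\<in>I. exp (- \<beta> * (cmod ((\<lambda>_. 0) k))\<^sup>2))"
    by (rule order_trans[OF norm_ge_zero bound])
  then show ?thesis by simp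
qed

lemma F_le: "norm (F c) \<le> K"
proof -
  have "(\<Prod>k\<in>I. exp (- \<beta> * (cmod (c k))\<^sup>2)) \<le> 1"
    using beta by (intro prod_le_1) auto
  then have "K * (\<Prod>k\<in>I. exp (- \<beta> * (cmod (c k))\<^sup>2)) \<le> K * 1"
    by (intro mult_left_mono K_nonneg)
  with bound[of c] show ?thesis by simp
qed

lemma integrable_F: "integrable P F"
proof (rule Bochner_Integration.integrable_bound)
  show "integrable P (\<lambda>c. K * (\<Prod>k\<in>I. exp (- \<beta> * (cmod (c k))\<^sup>2)))"
    by (intro integrable_mult_right lborel_prod.product_integrable_prod fin integrable_exp_cmod beta)
  show "AE c in P. norm (F c) \<le> norm (K * (\<Prod>k\<in>I. exp (- \<beta> * (cmod (c k))\<^sup>2)))"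
    using bound by (intro AE_I2) (metis abs_ge_self order_trans real_norm_def)
qed measurable

lemma integrable_F_echar: "integrable P (\<lambda>c. F c * (\<Prod>k\<in>I. echar (n k) (c k)))"
  by (rule Bochner_Integration.integrable_bound[OF integrable_F]) (auto simp: norm_mult prod_norm[symmetric])

definition Ker :: "nat \<Rightarrow> (nat \<Rightarrow> complex) \<Rightarrow> real" where
  "Ker M c = (\<Prod>k\<in>I. pker M (c k))"

definition gc :: "nat \<Rightarrow> (nat \<Rightarrow> complex) \<Rightarrow> real" where
  "gc M n = (\<Prod>k\<in>I. gcoeff M (n k))"

lemma Ker_nonneg: "Ker M c \<ge> 0"
  unfolding Ker_def by (intro prod_nonneg) (auto simp: pker_nonneg)

lemma measurable_Ker [measurable]: "Ker M \<in> borel_measurable P"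
  unfolding Ker_def by measurable

lemma Ker_expansion: "of_real (Ker M c) = (\<Sum>n\<in>PiE I (\<lambda>_. gbox M). of_real (gc M n) * (\<Prod>k\<in>I. echar (n k) (c k)))"
  by (simp add: Ker_def gc_def pker_expansion prod_sum_PiE fin finite_gbox prod.distrib)

lemma F_Ker_expansion: "F c * of_real (Ker M c) = (\<Sum>n\<in>PiE I (\<lambda>_. gbox M). of_real (gc M n) * (F c * (\<Prod>k\<in>I. echar (n k) (c k))))"
  unfolding Ker_expansion sum_distrib_left by (simp add: mult_ac)

lemma integrable_F_Ker: "integrable P (\<lambda>c. F c * of_real (Ker M c))"
  unfolding F_Ker_expansion
  by (intro Bochner_Integration.integrable_sum integrable_mult_right integrable_F_echar)

lemma integral_F_Ker: "(\<integral>c. F c * of_real (Ker M c) \<partial>P) = (\<Sum>n\<in>PiE I (\<lambda>_. gbox M). of_real (gc M n) * Fh n)"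
  unfolding F_Ker_expansion Fh_def
  by (subst Bochner_Integration.integral_sum) (auto intro!: integrable_mult_right integrable_F_echar)

lemma finite_box: "finite (PiE I (\<lambda>_. gbox M))"
  by (intro finite_PiE fin finite_gbox)

lemma box_subset: "PiE I (\<lambda>_. gbox M) \<subseteq> L"
  by (intro PiE_mono gbox_subset)

lemma eventually_box: "n \<in> L \<Longrightarrow> eventually (\<lambda>M. n \<in> PiE I (\<lambda>_. gbox M)) sequentially"
proof -
  assume n: "n \<in> L"
  have "eventually (\<lambda>M. n k \<in> gbox M) sequentially" if "k \<in> I" for k
  proof -
    have "eventually (\<lambda>M. real M \<ge> \<bar>Re (n k)\<bar>) sequentially" "eventually (\<lambda>M. real M \<ge> \<bar>Im (n k)\<bar>) sequentially"
      by real_asymp+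
    then show ?thesis
      by eventually_elim (use n that in \<open>auto simp: gbox_def\<close>)
  qed
  then have "eventually (\<lambda>M. \<forall>k\<in>I. n k \<in> gbox M) sequentially"
    using fin by (intro eventually_ball_finite) auto
  then show ?thesis
    by eventually_elim (use n in auto)
qed

text \<open>Boxes exhaust the lattice; a common summable bound allows the terms to vary with the box.\<close>

lemma sum_box_tendsto:
  fixes f :: "nat \<Rightarrow> (nat \<Rightarrow> complex) \<Rightarrow> complex"
  assumes lim: "\<And>n. n \<in> L \<Longrightarrow> (\<lambda>M. f M n) \<longlonglongrightarrow> G n"
    and bd: "\<And>M n. n \<in> L \<Longrightarrow> norm (f M n) \<le> h n" and h: "h summable_on L"
  shows "(\<lambda>M. \<Sum>n\<in>PiE I (\<lambda>_. gbox M). f M n) \<longlonglongrightarrow> infsum G L"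
proof -
  let ?f = "\<lambda>M n. if n \<in> PiE I (\<lambda>_. gbox M) then f M n else 0"
  have "(\<lambda>M. infsum (?f M) L) \<longlonglongrightarrow> infsum G L"
  proof (rule tendsto_infsum_dominated[OF _ _ h])
    fix n assume n: "n \<in> L"
    show "(\<lambda>M. ?f M n) \<longlonglongrightarrow> G n"
      by (rule Lim_transform_eventually[OF lim[OF n]], rule eventually_mono[OF eventually_box[OF n]]) auto
    show "norm (?f M n) \<le> h n" for M
      using bd[OF n, of M] order_trans[OF norm_ge_zero bd[OF n, of M]] by auto
  qed
  moreover have "infsum (?f M) L = (\<Sum>n\<in>PiE I (\<lambda>_. gbox M). f M n)" for M
  proof -
    have "infsum (?f M) L = infsum (f M) (PiE I (\<lambda>_. gbox M))"
      using box_subset[of M] by (intro infsum_cong_neutral) auto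
    then show ?thesis using finite_box by simp
  qed
  ultimately show ?thesis by simp
qed

text \<open>Integrating \<open>F\<close> against the kernel and expanding the kernel into characters gives a finite sum of
  Fourier coefficients with weights tending to 1.\<close>

lemma spectral_side:
  assumes "(\<lambda>n. norm (Fh n)) summable_on L"
  shows "(\<lambda>M. \<integral>c. F c * of_real (Ker M c) \<partial>P) \<longlonglongrightarrow> infsum Fh L"
  unfolding integral_F_Ker
proof (rule sum_box_tendsto[OF _ _ assms])
  fix n
  have "(\<lambda>M. gc M n) \<longlonglongrightarrow> (\<Prod>k\<in>I. 1)"
    unfolding gc_def by (intro tendsto_prod gcoeff_tendsto)
  then have "(\<lambda>M. complex_of_real (gc M n) * Fh n) \<longlonglongrightarrow> of_real 1 * Fh n"
    by (intro tendsto_intros) simp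
  then show "(\<lambda>M. complex_of_real (gc M n) * Fh n) \<longlonglongrightarrow> Fh n" by simp
  fix M
  have "\<bar>gc M n\<bar> \<le> 1"
    unfolding gc_def using gcoeff_bounds by (auto simp: abs_prod intro!: prod_le_1)
  then have "\<bar>gc M n\<bar> * norm (Fh n) \<le> 1 * norm (Fh n)"
    by (intro mult_right_mono) auto
  then show "norm (complex_of_real (gc M n) * Fh n) \<le> norm (Fh n)"
    by (simp add: norm_mult)
qed

definition cellK :: "nat \<Rightarrow> (nat \<Rightarrow> complex) \<Rightarrow> (nat \<Rightarrow> complex) \<Rightarrow> real" where
  "cellK M n c = (\<Prod>k\<in>I. pker M (c k) * indicator ccell (c k - n k))"

definition T :: "nat \<Rightarrow> (nat \<Rightarrow> complex) \<Rightarrow> complex" where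
  "T M n = (\<integral>c. F c * of_real (cellK M n c) \<partial>P)"

lemma measurable_cellK [measurable]: "cellK M n \<in> borel_measurable P"
  unfolding cellK_def by measurable

lemma cellK_nonneg: "cellK M n c \<ge> 0"
  unfolding cellK_def by (intro prod_nonneg) (auto simp: pker_nonneg)

lemma cellK_le: "cellK M n c \<le> Ker M c"
  unfolding cellK_def Ker_def by (intro prod_mono) (auto simp: pker_nonneg indicator_def)

lemma integrable_F_cellK: "integrable P (\<lambda>c. F c * of_real (cellK M n c))"
  by (rule Bochner_Integration.integrable_bound[OF integrable_F_Ker[of M]])
    (auto simp: norm_mult intro!: mult_left_mono AE_I2 order_trans[OF _ abs_ge_self] cellK_le simp: abs_of_nonneg cellK_nonneg Ker_nonneg)

lemma fold_sum: "(\<Sum>n\<in>PiE I (\<lambda>_. gbox N). cellK M n c) = Ker M c * (\<Prod>k\<in>I. \<Sum>m\<in>gbox N. indicator ccell (c k - m))"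
  by (simp add: cellK_def Ker_def prod_sum_PiE fin finite_gbox prod.distrib sum_distrib_left)

lemma cell_sum: "(\<Sum>m\<in>gbox N. indicator ccell (z - m)) = (if \<exists>m\<in>gbox N. z - m \<in> ccell then 1 else 0 :: real)"
proof (cases "\<exists>m\<in>gbox N. z - m \<in> ccell")
  case True
  then obtain m where m: "m \<in> gbox N" "z - m \<in> ccell" by auto
  then have "indicator ccell (z - m') = (if m' = m then 1 else 0 :: real)" if "m' \<in> gbox N" for m'
    using ccell_cover[of z] that gbox_subset[of N] by (auto simp: indicator_def)
  then show ?thesis using m True finite_gbox by simp
qed auto

text \<open>The unit cells around the lattice points tile the space, so the integral against the kernel is the sum
  of its parts over the cells.\<close>

lemma fold_side: "(\<lambda>N. \<Sum>n\<in>PiE I (\<lambda>_. gbox N). T M n) \<longlonglongrightarrow> (\<integral>c. F c * of_real (Ker M c) \<partial>P)"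
proof -
  let ?w = "\<lambda>N (c :: nat \<Rightarrow> complex). \<Prod>k\<in>I. \<Sum>m\<in>gbox N. indicator ccell (c k - m) :: real"
  have "(\<Sum>n\<in>PiE I (\<lambda>_. gbox N). T M n) = (\<integral>c. F c * of_real (Ker M c) * of_real (?w N c) \<partial>P)" for N
  proof -
    have "(\<Sum>n\<in>PiE I (\<lambda>_. gbox N). T M n) = (\<integral>c. (\<Sum>n\<in>PiE I (\<lambda>_. gbox N). F c * of_real (cellK M n c)) \<partial>P)"
      unfolding T_def by (subst Bochner_Integration.integral_sum) (auto intro: integrable_F_cellK)
    also have "\<dots> = (\<integral>c. F c * of_real (Ker M c) * of_real (?w N c) \<partial>P)"
      by (simp only: sum_distrib_left[symmetric] of_real_sum[symmetric] fold_sum of_real_mult mult.assoc)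
    finally show ?thesis .
  qed
  moreover have "(\<lambda>N. \<integral>c. F c * of_real (Ker M c) * of_real (?w N c) \<partial>P) \<longlonglongrightarrow> (\<integral>c. F c * of_real (Ker M c) \<partial>P)"
  proof (rule integral_dominated_convergence[where w = "\<lambda>c. norm (F c * of_real (Ker M c))"])
    show "integrable P (\<lambda>c. norm (F c * complex_of_real (Ker M c)))"
      using integrable_F_Ker by (rule integrable_norm)
    show "AE c in P. (\<lambda>N. F c * of_real (Ker M c) * of_real (?w N c)) \<longlonglongrightarrow> F c * of_real (Ker M c)"
    proof (rule AE_I2)
      fix c :: "nat \<Rightarrow> complex"
      have w1: "(\<lambda>N. \<Sum>m\<in>gbox N. indicator ccell (c k - m) :: real) \<longlonglongrightarrow> 1" for k
      proof -
        obtain n where n: "n \<in> gauss_ints" "c k - n \<in> ccell" using ccell_cover by blast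
        have "eventually (\<lambda>M. real M \<ge> \<bar>Re n\<bar>) sequentially" "eventually (\<lambda>M. real M \<ge> \<bar>Im n\<bar>) sequentially"
          by real_asymp+
        then have "eventually (\<lambda>N. (\<Sum>m\<in>gbox N. indicator ccell (c k - m) :: real) = 1) sequentially"
        proof eventually_elim
          case (elim N)
          then have "n \<in> gbox N" using n by (auto simp: gbox_def)
          then show ?case using n(2) unfolding cell_sum by auto
        qed
        then show ?thesis by (rule tendsto_eventually)
      qed
      have wl: "(\<lambda>N. ?w N c) \<longlonglongrightarrow> (\<Prod>k\<in>I. 1)"
        by (intro tendsto_prod w1)
      have "(\<lambda>N. F c * of_real (Ker M c) * of_real (?w N c)) \<longlonglongrightarrow> F c * of_real (Ker M c) * of_real (\<Prod>k\<in>I. 1)"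
        by (intro tendsto_intros wl)
      then show "(\<lambda>N. F c * of_real (Ker M c) * of_real (?w N c)) \<longlonglongrightarrow> F c * of_real (Ker M c)" by simp
    qed
    fix N
    show "AE c in P. norm (F c * of_real (Ker M c) * of_real (?w N c)) \<le> norm (F c * of_real (Ker M c))"
    proof (rule AE_I2)
      fix c :: "nat \<Rightarrow> complex"
      have "\<bar>?w N c\<bar> \<le> 1"
        unfolding cell_sum by (auto simp: abs_prod intro!: prod_le_1)
      then have "norm (F c * of_real (Ker M c)) * \<bar>?w N c\<bar> \<le> norm (F c * of_real (Ker M c)) * 1"
        by (intro mult_left_mono) auto
      then show "norm (F c * of_real (Ker M c) * of_real (?w N c)) \<le> norm (F c * of_real (Ker M c))"
        by (simp only: norm_mult norm_of_real mult_1_right)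
    qed
  qed (auto intro!: borel_measurable_sum borel_measurable_prod)
  ultimately show ?thesis by simp
qed

text \<open>By periodicity of the kernel, the part over each cell can be moved to the cell at the origin.\<close>

lemma T_translate:
  assumes "n \<in> L"
  shows "T M n = (\<integral>c. F (\<lambda>k\<in>I. c k + n k) * of_real (cellK M (\<lambda>_. 0) c) \<partial>P)"
proof -
  have "T M n = (\<integral>c. F (\<lambda>k\<in>I. 1 * c k + n k) * of_real (cellK M n (\<lambda>k\<in>I. 1 * c k + n k)) \<partial>P)"
    unfolding T_def by (subst integral_PiM_complex_affine[where u = 1 and v = n]) (auto simp: fin)
  moreover have "cellK M n (\<lambda>k\<in>I. 1 * c k + n k) = cellK M (\<lambda>_. 0) c" for c
    unfolding cellK_def using assms by (intro prod.cong) (auto simp: pker_periodic PiE_iff)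
  ultimately show ?thesis by simp
qed

lemma integrable_cellK0: "integrable P (cellK M (\<lambda>_. 0))"
  and integral_cellK0: "integral\<^sup>L P (cellK M (\<lambda>_. 0)) = 1"
proof -
  have eq: "cellK M (\<lambda>_. 0) = (\<lambda>c. \<Prod>k\<in>I. pker M (c k) * indicator ccell (c k))"
    by (simp add: cellK_def fun_eq_iff)
  show "integrable P (cellK M (\<lambda>_. 0))"
    unfolding eq by (intro lborel_prod.product_integrable_prod fin integrable_pker)
  have "integral\<^sup>L P (cellK M (\<lambda>_. 0)) = (\<Prod>k\<in>I. \<integral>c. pker M c * indicator ccell c \<partial>lborel)"
    unfolding eq by (intro lborel_prod.product_integral_prod fin integrable_pker)
  then show "integral\<^sup>L P (cellK M (\<lambda>_. 0)) = 1"
    by (simp add: integral_pker)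
qed

lemma
  assumes "j \<in> I"
  shows integrable_cellK_gdist: "integrable P (\<lambda>c. cellK M (\<lambda>_. 0) c * gdist (c j))"
    and integral_cellK_gdist: "(\<integral>c. cellK M (\<lambda>_. 0) c * gdist (c j) \<partial>P) = 1 / (real M + 1)"
proof -
  let ?f = "\<lambda>k c. if k = j then pker M c * indicator ccell c * gdist c else pker M c * indicator ccell c"
  have eq: "(\<lambda>c. cellK M (\<lambda>_. 0) c * gdist (c j)) = (\<lambda>c. \<Prod>k\<in>I. ?f k (c k))"
    unfolding cellK_def
    by (subst (1 2) prod.remove[OF fin assms]) (auto simp: fun_eq_iff intro!: prod.cong)
  have int: "integrable lborel (?f k)" for k
    by (cases "k = j") (simp_all add: integrable_pker integrable_pker_gdist)
  show "integrable P (\<lambda>c. cellK M (\<lambda>_. 0) c * gdist (c j))"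
    unfolding eq by (intro lborel_prod.product_integrable_prod fin int)
  have "(\<integral>c. cellK M (\<lambda>_. 0) c * gdist (c j) \<partial>P) = (\<Prod>k\<in>I. integral\<^sup>L lborel (?f k))"
    unfolding eq by (intro lborel_prod.product_integral_prod fin int)
  also have "\<dots> = (\<Prod>k\<in>I. if k = j then 1 / (real M + 1) else 1)"
    by (intro prod.cong) (auto simp: integral_pker integral_pker_gdist)
  also have "\<dots> = 1 / (real M + 1)"
    using assms fin by simp
  finally show "(\<integral>c. cellK M (\<lambda>_. 0) c * gdist (c j) \<partial>P) = 1 / (real M + 1)" .
qed

text \<open>The kernel has mass 1 on the cell and concentrates at its centre, so the part over the cell at \<open>n\<close>
  tends to \<open>F n\<close>. The deviation is at most \<open>e / 2\<close> near the centre and is bounded by a multiple of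
  \<open>gdist\<close> elsewhere.\<close>

lemma T_tendsto:
  assumes n: "n \<in> L"
  shows "(\<lambda>M. T M n) \<longlonglongrightarrow> F n"
proof (rule LIMSEQ_I)
  fix e :: real assume e: "e > 0"
  let ?F = "\<lambda>c. F (\<lambda>k\<in>I. c k + n k)"
  obtain d where d: "d > 0" "\<And>c. (\<forall>k\<in>I. cmod (c k) < d) \<Longrightarrow> norm (?F c - F n) < e / 2"
    using continuous_coordinates_eps[OF loc cont, of "e / 2" n] e by auto
  obtain r where r: "r > 0" "\<And>c. c \<in> ccell \<Longrightarrow> gdist c < r \<Longrightarrow> cmod c < d"
    using gdist_small[OF d(1)] by auto
  define C where "C = 2 * K / r"
  have C: "C \<ge> 0" using K_nonneg r by (simp add: C_def)
  have key: "norm ((?F c - F n) * of_real (cellK M (\<lambda>_. 0) c)) \<le> (e / 2) * cellK M (\<lambda>_. 0) c + (\<Sum>j\<in>I. C * (cellK M (\<lambda>_. 0) c * gdist (c j)))" for c M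
  proof (cases "\<forall>k\<in>I. c k \<in> ccell")
    case False
    then have "cellK M (\<lambda>_. 0) c = 0"
      unfolding cellK_def using fin by (auto simp: indicator_def)
    then show ?thesis by simp
  next
    case True
    have "norm (?F c - F n) \<le> e / 2 + C * (\<Sum>j\<in>I. gdist (c j))"
    proof (cases "\<forall>j\<in>I. gdist (c j) < r")
      case True
      then have "norm (?F c - F n) < e / 2"
        using \<open>\<forall>k\<in>I. c k \<in> ccell\<close> r(2) by (intro d(2)) auto
      moreover have "C * (\<Sum>j\<in>I. gdist (c j)) \<ge> 0"
        using C by (intro mult_nonneg_nonneg sum_nonneg) (auto simp: gdist_nonneg)
      ultimately show ?thesis by simp
    next
      case False
      then obtain j where j: "j \<in> I" "gdist (c j) \<ge> r" by auto
      then have "r \<le> (\<Sum>j\<in>I. gdist (c j))"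
        using member_le_sum[of j I "\<lambda>j. gdist (c j)"] fin j by (auto simp: gdist_nonneg)
      then have "C * r \<le> C * (\<Sum>j\<in>I. gdist (c j))"
        using C by (rule mult_left_mono)
      moreover have "C * r = 2 * K" using r by (simp add: C_def)
      moreover have "norm (?F c - F n) \<le> K + K"
        by (rule order_trans[OF norm_triangle_ineq4 add_mono[OF F_le F_le]])
      ultimately show ?thesis using e by simp
    qed
    then have "norm (?F c - F n) * cellK M (\<lambda>_. 0) c \<le> (e / 2 + C * (\<Sum>j\<in>I. gdist (c j))) * cellK M (\<lambda>_. 0) c"
      by (intro mult_right_mono cellK_nonneg)
    moreover have "(e / 2 + C * (\<Sum>j\<in>I. gdist (c j))) * cellK M (\<lambda>_. 0) c = (e / 2) * cellK M (\<lambda>_. 0) c + (\<Sum>j\<in>I. C * (cellK M (\<lambda>_. 0) c * gdist (c j)))"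
      by (simp add: algebra_simps sum_distrib_left)
    ultimately show ?thesis
      by (simp add: norm_mult cellK_nonneg)
  qed
  have meas [measurable]: "?F \<in> borel_measurable P"
    by (rule measurable_compose[OF _ measurable_F], rule measurable_restrict) measurable
  have int1: "integrable P (\<lambda>c. ?F c * of_real (cellK M (\<lambda>_. 0) c))" for M
  proof (rule Bochner_Integration.integrable_bound)
    show "integrable P (\<lambda>c. K * cellK M (\<lambda>_. 0) c)"
      by (intro integrable_mult_right integrable_cellK0)
    show "AE c in P. norm (?F c * of_real (cellK M (\<lambda>_. 0) c)) \<le> norm (K * cellK M (\<lambda>_. 0) c)"
      using F_le K_nonneg by (intro AE_I2) (simp add: norm_mult cellK_nonneg abs_mult mult_right_mono)
  qed measurable
  have int2: "integrable P (\<lambda>c. F n * of_real (cellK M (\<lambda>_. 0) c))" for M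
    by (intro integrable_mult_right integrable_of_real integrable_cellK0)
  have "norm (T M n - F n) \<le> e / 2 + C * (card I / (real M + 1))" for M
  proof -
    have "T M n - F n = (\<integral>c. ?F c * of_real (cellK M (\<lambda>_. 0) c) \<partial>P) - (\<integral>c. F n * of_real (cellK M (\<lambda>_. 0) c) \<partial>P)"
      unfolding T_translate[OF n] by (simp add: integral_cellK0)
    also have "\<dots> = (\<integral>c. (?F c - F n) * of_real (cellK M (\<lambda>_. 0) c) \<partial>P)"
      by (subst Bochner_Integration.integral_diff[OF int1 int2, symmetric]) (simp add: left_diff_distrib)
    also have "norm \<dots> \<le> (\<integral>c. norm ((?F c - F n) * of_real (cellK M (\<lambda>_. 0) c)) \<partial>P)"
      by (rule integral_norm_bound)
    also have "\<dots> \<le> (\<integral>c. (e / 2) * cellK M (\<lambda>_. 0) c + (\<Sum>j\<in>I. C * (cellK M (\<lambda>_. 0) c * gdist (c j))) \<partial>P)"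
    proof (rule integral_mono)
      have "integrable P (\<lambda>c. (?F c - F n) * of_real (cellK M (\<lambda>_. 0) c))"
        using Bochner_Integration.integrable_diff[OF int1 int2] by (simp add: left_diff_distrib)
      then show "integrable P (\<lambda>c. norm ((?F c - F n) * of_real (cellK M (\<lambda>_. 0) c)))"
        by (rule integrable_norm)
      show "integrable P (\<lambda>c. (e / 2) * cellK M (\<lambda>_. 0) c + (\<Sum>j\<in>I. C * (cellK M (\<lambda>_. 0) c * gdist (c j))))"
        by (intro Bochner_Integration.integrable_add integrable_mult_right Bochner_Integration.integrable_sum integrable_cellK0 integrable_cellK_gdist)
      show "norm ((?F c - F n) * of_real (cellK M (\<lambda>_. 0) c)) \<le> (e / 2) * cellK M (\<lambda>_. 0) c + (\<Sum>j\<in>I. C * (cellK M (\<lambda>_. 0) c * gdist (c j)))" for c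
        by (rule key)
    qed
    also have "\<dots> = (e / 2) * 1 + (\<Sum>j\<in>I. C * (1 / (real M + 1)))"
      by (subst Bochner_Integration.integral_add)
        (auto simp: integral_cellK0 integral_cellK_gdist Bochner_Integration.integral_sum integrable_cellK_gdist
          intro!: integrable_mult_right Bochner_Integration.integrable_sum integrable_cellK0 integrable_cellK_gdist sum.cong)
    finally show ?thesis by (simp add: mult.commute)
  qed
  moreover have "eventually (\<lambda>M. e / 2 + C * (card I / (real M + 1)) < e) sequentially"
  proof -
    have "(\<lambda>M. e / 2 + C * (card I / (real M + 1))) \<longlonglongrightarrow> e / 2 + C * 0"
      by (intro tendsto_intros) real_asymp
    then show ?thesis by (rule order_tendstoD(2)) (use e in simp)
  qed
  ultimately have "eventually (\<lambda>M. norm (T M n - F n) < e) sequentially"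
    by (auto elim!: eventually_mono intro: le_less_trans)
  then show "\<exists>no. \<forall>M\<ge>no. norm (T M n - F n) < e"
    by (simp add: eventually_sequentially)
qed

definition Tbound :: "(nat \<Rightarrow> complex) \<Rightarrow> real" where
  "Tbound n = K * exp (\<beta> / 2) ^ card I * (\<Prod>k\<in>I. exp (- (\<beta> / 2) * (cmod (n k))\<^sup>2))"

lemma summable_Tbound: "Tbound summable_on L"
  unfolding Tbound_def using beta fin by (intro summable_on_cmult_right summable_on_exp_gint_PiE) auto

text \<open>Within a cell the Gaussian bound loses only a constant factor and half of the exponent.\<close>

lemma T_le: 
  assumes n: "n \<in> L"
  shows "norm (T M n) \<le> Tbound n"
proof -
  have key: "norm (F (\<lambda>k\<in>I. c k + n k) * of_real (cellK M (\<lambda>_. 0) c)) \<le> Tbound n * cellK M (\<lambda>_. 0) c" for c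
  proof (cases "\<forall>k\<in>I. c k \<in> ccell")
    case False
    then have "cellK M (\<lambda>_. 0) c = 0"
      unfolding cellK_def using fin by (auto simp: indicator_def)
    then show ?thesis by simp
  next
    case True
    have "(\<Prod>k\<in>I. exp (- \<beta> * (cmod ((\<lambda>k\<in>I. c k + n k) k))\<^sup>2)) \<le> (\<Prod>k\<in>I. exp (\<beta> / 2) * exp (- (\<beta> / 2) * (cmod (n k))\<^sup>2))"
    proof (intro prod_mono conjI)
      fix k assume k: "k \<in> I"
      have "cmod (n k) \<le> cmod (c k + n k) + cmod (c k)"
        using norm_triangle_ineq4[of "c k + n k" "c k"] by simp
      then have "(cmod (n k))\<^sup>2 \<le> (cmod (c k + n k) + cmod (c k))\<^sup>2"
        by (intro power_mono) auto
      also have "\<dots> \<le> 2 * (cmod (c k + n k))\<^sup>2 + 2 * (cmod (c k))\<^sup>2"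
        using sum_squares_bound[of "cmod (c k + n k)" "cmod (c k)"] by (simp add: power2_sum)
      also have "\<dots> \<le> 2 * (cmod (c k + n k))\<^sup>2 + 1"
        using norm_ccell_le[of "c k"] True k by auto
      finally have "(\<beta> / 2) * (cmod (n k))\<^sup>2 \<le> (\<beta> / 2) * (2 * (cmod (c k + n k))\<^sup>2 + 1)"
        using beta by (intro mult_left_mono) auto
      then show "exp (- \<beta> * (cmod ((\<lambda>k\<in>I. c k + n k) k))\<^sup>2) \<le> exp (\<beta> / 2) * exp (- (\<beta> / 2) * (cmod (n k))\<^sup>2)"
        using k by (simp add: exp_add[symmetric] algebra_simps)
    qed auto
    also have "\<dots> = exp (\<beta> / 2) ^ card I * (\<Prod>k\<in>I. exp (- (\<beta> / 2) * (cmod (n k))\<^sup>2))"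
      by (simp add: prod.distrib)
    finally have "K * (\<Prod>k\<in>I. exp (- \<beta> * (cmod ((\<lambda>k\<in>I. c k + n k) k))\<^sup>2)) \<le> Tbound n"
      unfolding Tbound_def mult.assoc using K_nonneg by (rule mult_left_mono)
    then have "norm (F (\<lambda>k\<in>I. c k + n k)) \<le> Tbound n"
      by (rule order_trans[OF bound])
    then show ?thesis
      by (simp add: norm_mult cellK_nonneg mult_right_mono)
  qed
  have "norm (T M n) \<le> (\<integral>c. norm (F (\<lambda>k\<in>I. c k + n k) * of_real (cellK M (\<lambda>_. 0) c)) \<partial>P)"
    unfolding T_translate[OF n] by (rule integral_norm_bound)
  also have "\<dots> \<le> (\<integral>c. Tbound n * cellK M (\<lambda>_. 0) c \<partial>P)"
    using key K_nonneg
    by (intro integral_mono' integrable_mult_right integrable_cellK0)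
      (auto simp: Tbound_def intro!: mult_nonneg_nonneg prod_nonneg cellK_nonneg)
  also have "\<dots> = Tbound n" by (simp add: integral_cellK0)
  finally show ?thesis .
qed

text \<open>Both sides are the limit of the integrals of \<open>F\<close> against the periodic kernel: summed over cells these
  tend to the sum of the values of \<open>F\<close>, expanded into characters to the sum of its Fourier transform.\<close>

theorem poisson_summation:
  assumes "(\<lambda>n. norm (Fh n)) summable_on L"
  shows "infsum F L = infsum Fh L"
proof -
  have "(\<lambda>N. \<Sum>n\<in>PiE I (\<lambda>_. gbox N). T M n) \<longlonglongrightarrow> infsum (T M) L" for M
    by (rule sum_box_tendsto[OF _ T_le summable_Tbound]) auto
  then have eq: "infsum (T M) L = (\<integral>c. F c * of_real (Ker M c) \<partial>P)" for M
    using fold_side LIMSEQ_unique by blast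
  have "(\<lambda>M. infsum (T M) L) \<longlonglongrightarrow> infsum F L"
    by (rule tendsto_infsum_dominated[OF T_tendsto T_le summable_Tbound])
  then show ?thesis
    using spectral_side[OF assms] LIMSEQ_unique unfolding eq by blast
qed

end

section \<open>Residues modulo 2, 4 and 8 as exponents of roots of unity\<close>

lemma lift_of_nat: "lift (of_nat n :: 'n::finite bit0) = n mod CARD('n bit0)"
  unfolding lift_def
proof (rule Least_equality)
  show "(of_nat (n mod CARD('n bit0)) :: 'n bit0) = of_nat n"
    by (subst of_nat_eq_iff_cong_CHAR) (simp add: cong_def)
  fix m assume "(of_nat m :: 'n bit0) = of_nat n"
  then have "[m = n] (mod CARD('n bit0))"
    by (subst (asm) of_nat_eq_iff_cong_CHAR) simp
  then show "n mod CARD('n bit0) \<le> m"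
    by (metis cong_def mod_less_eq_dividend)
qed

lemma bit0_eq_of_nat: "\<exists>n. (c :: 'n::finite bit0) = of_nat n"
proof (cases c)
  case (of_int z)
  then show ?thesis by (intro exI[of _ "nat z"]) simp
qed

lemma double_of_nat:
  assumes "CARD('m::finite bit0) = 2 * CARD('n::finite bit0)"
  shows "double (of_nat n :: 'n bit0) = (of_nat (2 * n) :: 'm bit0)"
  unfolding double_def lift_of_nat
  unfolding of_nat_eq_iff_cong_CHAR cong_def bit0.CHAR_eq assms by (simp only: mult_mod_right mod_mod_trivial)

lemma double2_of_nat: "double (of_nat n :: 2) = (of_nat (2 * n) :: 4)"
  by (rule double_of_nat) simp

lemma double4_of_nat: "double (of_nat n :: 4) = (of_nat (2 * n) :: 8)"
  by (rule double_of_nat) simp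

lemma double2_add: "double (a + b :: 2) = (double a + double b :: 4)"
proof -
  obtain m n where "a = of_nat m" "b = of_nat n" using bit0_eq_of_nat by blast
  then have "a + b = of_nat (m + n)" "a = of_nat m" "b = of_nat n" by simp_all
  then show ?thesis by (simp only: double2_of_nat) (simp add: algebra_simps)
qed

lemma two_cases: "(x :: 2) = 0 \<or> x = 1"
proof -
  obtain n where "x = of_nat n" using bit0_eq_of_nat by blast
  moreover have "(of_nat n :: 2) = of_nat (n mod 2)"
    by (subst of_nat_eq_iff_cong_CHAR) (simp add: cong_def)
  moreover have "n mod 2 = 0 \<or> n mod 2 = 1" by auto
  ultimately show ?thesis by auto
qed

lemma two_add_self: "(x :: 2) + x = 0"
  using two_cases[of x] by auto

text \<open>The character of \<open>\<int>/4\<close> that takes the value \<open>\<i>\<close> at 1.\<close>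

definition i4 :: "4 \<Rightarrow> complex" where "i4 c = \<i> ^ lift c"

text \<open>The character of \<open>\<int>/8\<close> that takes the value \<open>exp (\<pi>\<i>/4)\<close> at 1. It is faithful, so identities in \<open>\<int>/8\<close>
  can be proved as identities between complex numbers.\<close>

definition z8 :: "8 \<Rightarrow> complex" where "z8 c = cis (pi / 4) ^ lift c"

lemma i4_of_nat: "i4 (of_nat n) = \<i> ^ n"
proof -
  have "\<i> ^ n = \<i> ^ (4 * (n div 4) + n mod 4)" by simp
  also have "\<dots> = (\<i> ^ 4) ^ (n div 4) * \<i> ^ (n mod 4)" by (simp only: power_add power_mult)
  also have "\<i> ^ 4 = 1" by simp
  finally show ?thesis by (simp add: i4_def lift_of_nat)
qed

lemma cis_pi4_8: "cis (pi / 4) ^ 8 = 1"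
  using Complex.DeMoivre[of "pi / 4" 8] by simp

lemma z8_of_nat: "z8 (of_nat n) = cis (pi / 4) ^ n"
proof -
  have "cis (pi / 4) ^ n = cis (pi / 4) ^ (8 * (n div 8) + n mod 8)" by simp
  also have "\<dots> = (cis (pi / 4) ^ 8) ^ (n div 8) * cis (pi / 4) ^ (n mod 8)" by (simp only: power_add power_mult)
  finally show ?thesis by (simp add: z8_def lift_of_nat cis_pi4_8)
qed

lemma i4_add: "i4 (a + b) = i4 a * i4 b"
proof -
  obtain m n where "a = of_nat m" "b = of_nat n" using bit0_eq_of_nat by blast
  then have "a + b = of_nat (m + n)" "a = of_nat m" "b = of_nat n" by simp_all
  then show ?thesis by (simp only: i4_of_nat power_add)
qed

lemma z8_add: "z8 (a + b) = z8 a * z8 b"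
proof -
  obtain m n where "a = of_nat m" "b = of_nat n" using bit0_eq_of_nat by blast
  then have "a + b = of_nat (m + n)" "a = of_nat m" "b = of_nat n" by simp_all
  then show ?thesis by (simp only: z8_of_nat power_add)
qed

lemma i4_0 [simp]: "i4 0 = 1" using i4_of_nat[of 0] by simp
lemma z8_0 [simp]: "z8 0 = 1" using z8_of_nat[of 0] by simp

lemma i4_nonzero [simp]: "i4 a \<noteq> 0" by (simp add: i4_def)
lemma z8_nonzero [simp]: "z8 a \<noteq> 0" by (simp add: z8_def)

lemma i4_uminus: "i4 (- a) = inverse (i4 a)"
  using i4_add[of "- a" a] by (simp add: field_simps)

lemma z8_uminus: "z8 (- a) = inverse (z8 a)"
  using z8_add[of "- a" a] by (simp add: field_simps)

lemma z8_diff: "z8 (a - b) = z8 a / z8 b"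
  using z8_add[of a "- b"] by (simp add: z8_uminus field_simps)

lemma i4_diff: "i4 (a - b) = i4 a / i4 b"
  using i4_add[of a "- b"] by (simp add: i4_uminus field_simps)

lemma i4_1: "i4 1 = \<i>" using i4_of_nat[of 1] by simp

lemma norm_i4 [simp]: "norm (i4 a) = 1" by (simp add: i4_def norm_power)
lemma norm_z8 [simp]: "norm (z8 a) = 1" by (simp add: z8_def norm_power)

lemma z8_double: "z8 (double c) = i4 c"
proof -
  obtain n where c: "c = of_nat n" using bit0_eq_of_nat by blast
  have "cis (pi / 4) ^ (2 * n) = \<i> ^ n"
    by (simp add: power_mult power2_eq_square cis_mult)
  then show ?thesis unfolding c double4_of_nat z8_of_nat i4_of_nat .
qed

lemma i4_double: "i4 (double c) = (- 1) ^ lift (c :: 2)"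
  unfolding double_def i4_of_nat by (simp add: power_mult)

lemma neg_one_lift_of_nat: "(- 1 :: complex) ^ lift (of_nat n :: 2) = (- 1) ^ n"
proof -
  have "(- 1 :: complex) ^ n = (- 1) ^ (2 * (n div 2) + n mod 2)" by simp
  also have "\<dots> = ((- 1) ^ 2) ^ (n div 2) * (- 1) ^ (n mod 2)" by (simp only: power_add power_mult)
  finally show ?thesis by (simp add: lift_of_nat)
qed

lemma lift_2_simps: "lift (0 :: 2) = 0" "lift (1 :: 2) = 1"
  using lift_of_nat[of 0, where 'n = num1 ] lift_of_nat[of 1, where 'n = num1] by simp_all

lemma z8_eq_iff: "z8 a = z8 b \<longleftrightarrow> a = b"
proof
  assume eq: "z8 a = z8 b"
  obtain n where n: "a - b = of_nat n" using bit0_eq_of_nat by blast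
  have "cis (pi / 4) ^ n = 1" using eq z8_diff[of a b] unfolding n z8_of_nat by simp
  then have "cis (of_nat n * (pi / 4)) = 1" by (simp add: Complex.DeMoivre)
  then have "cos (real n * (pi / 4)) = 1" by (simp add: complex_eq_iff)
  then obtain k :: int where "real n * (pi / 4) = of_int k * 2 * pi"
    by (auto simp: cos_one_2pi_int)
  then have "real n = 8 * of_int k" by (simp add: field_simps)
  then have "int n = 8 * k" by linarith
  then have "8 dvd n" by presburger
  then have "(of_nat n :: 8) = of_nat 0"
    by (subst of_nat_eq_iff_cong_CHAR) (simp add: cong_def mod_eq_0_iff_dvd)
  then show "a = b" using n by simp
qed auto

lemma double2_eq_0_iff: "double (c :: 2) = (0 :: 4) \<longleftrightarrow> c = 0"
proof -
  have "i4 (double (1 :: 2)) \<noteq> 1" unfolding i4_double lift_2_simps by simp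
  then have "double (1 :: 2) \<noteq> (0 :: 4)" by (metis i4_0)
  moreover have "double (0 :: 2) = (0 :: 4)" using double2_of_nat[of 0] by simp
  ultimately show ?thesis using two_cases[of c] by auto
qed

lemma double2_inject: "double (c :: 2) = (double d :: 4) \<longleftrightarrow> c = d"
proof
  assume "double c = (double d :: 4)"
  then have "double (c + d) = (0 :: 4)"
    using double2_add[of c d] double2_add[of d d] two_add_self[of d] double2_eq_0_iff[of 0] by simp
  then have "c + d = 0" by (simp add: double2_eq_0_iff)
  then show "c = d" using two_cases[of c] two_cases[of d] by auto
qed auto

lemma four_double_cases: "(x :: 4) + x = 0 \<Longrightarrow> \<exists>c :: 2. double c = x"
proof -
  assume "x + x = 0"
  obtain n where n: "x = of_nat n" using bit0_eq_of_nat by blast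
  have "(of_nat (n + n) :: 4) = of_nat 0" using \<open>x + x = 0\<close> n by simp
  then have "[n + n = 0] (mod CHAR(4))" by (subst (asm) of_nat_eq_iff_cong_CHAR)
  then have "[n + n = 0] (mod 4)" by simp
  then have "even n" by (simp add: cong_def) presburger
  then obtain m where "n = 2 * m" by auto
  then show ?thesis using n double2_of_nat[of m] by blast
qed

lemma four_unit_cases: "(x :: 4) + x = 2 \<Longrightarrow> x = 1 \<or> x = - 1"
proof -
  assume "x + x = 2"
  obtain n where n: "x = of_nat n" using bit0_eq_of_nat by blast
  have "(of_nat (n + n) :: 4) = of_nat 2" using \<open>x + x = 2\<close> n by simp
  then have "[n + n = 2] (mod CHAR(4))" by (subst (asm) of_nat_eq_iff_cong_CHAR)
  then have "[n + n = 2] (mod 4)" by simp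
  then have "n mod 4 = 1 \<or> n mod 4 = 3" by (simp add: cong_def) presburger
  then have "[n = 1] (mod CHAR(4)) \<or> [n = 3] (mod CHAR(4))" by (simp add: cong_def)
  then have "(of_nat n :: 4) = of_nat 1 \<or> (of_nat n :: 4) = of_nat 3"
    by (simp only: of_nat_eq_iff_cong_CHAR)
  moreover have "(of_nat 3 :: 4) = - 1" by simp
  ultimately show ?thesis unfolding n by (metis of_nat_1)
qed

section \<open>Bases of forms over the field with two elements\<close>

lemma ex_max_card:
  assumes "finite A" "A \<noteq> {}"
  shows "\<exists>B\<in>A. \<forall>B'\<in>A. card B' \<le> card B"
proof -
  have "Max (card ` A) \<in> card ` A" using assms by (intro Max_in) auto
  then obtain B where "B \<in> A" "card B = Max (card ` A)" by auto
  then show ?thesis using assms by (metis Max_ge finite_imageI image_eqI)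
qed

text \<open>A finite vector space over the field with two elements with a nondegenerate symmetric bilinear form.\<close>

locale f2_form = comm_group V for V :: "'a monoid" (structure) +
  fixes b :: "'a \<Rightarrow> 'a \<Rightarrow> 2"
  assumes finite_V: "finite (carrier V)"
    and exp2: "x \<in> carrier V \<Longrightarrow> x \<otimes> x = \<one>"
    and b_add: "x \<in> carrier V \<Longrightarrow> y \<in> carrier V \<Longrightarrow> z \<in> carrier V \<Longrightarrow> b (x \<otimes> y) z = b x z + b y z"
    and b_sym: "x \<in> carrier V \<Longrightarrow> y \<in> carrier V \<Longrightarrow> b x y = b y x"
    and nondeg: "x \<in> carrier V \<Longrightarrow> (\<And>y. y \<in> carrier V \<Longrightarrow> b x y = 0) \<Longrightarrow> x = \<one>"
begin

abbreviation "S T \<equiv> finprod V (\<lambda>v. v) T"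

lemma S_closed [simp]: "T \<subseteq> carrier V \<Longrightarrow> S T \<in> carrier V"
  by (intro finprod_closed) auto

lemma b_one [simp]: "y \<in> carrier V \<Longrightarrow> b \<one> y = 0"
  using b_add[of \<one> \<one> y] by simp

lemma b_add_right: "x \<in> carrier V \<Longrightarrow> y \<in> carrier V \<Longrightarrow> z \<in> carrier V \<Longrightarrow> b z (x \<otimes> y) = b z x + b z y"
  using b_add[of x y z] b_sym[of z] by simp

lemma b_S: "finite T \<Longrightarrow> T \<subseteq> carrier V \<Longrightarrow> y \<in> carrier V \<Longrightarrow> b (S T) y = (\<Sum>t\<in>T. b t y)"
proof (induction T rule: finite_induct)
  case (insert t T)
  then have "S (insert t T) = t \<otimes> S T" by (intro finprod_insert) auto
  then show ?case using insert by (simp add: b_add)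
qed simp

lemma finite_subset_carrier: "T \<subseteq> carrier V \<Longrightarrow> finite T"
  using finite_V finite_subset by blast

lemma eq_if_prod_one: "x \<in> carrier V \<Longrightarrow> y \<in> carrier V \<Longrightarrow> x \<otimes> y = \<one> \<Longrightarrow> x = y"
  by (metis exp2 l_one m_assoc r_one)

text \<open>A family with a dual family is independent, and it spans because subtracting the expected linear
  combination leaves a vector orthogonal to the dual family.\<close>

lemma f2_basisI:
  assumes B: "B \<subseteq> carrier V"
    and dual: "\<And>e. e \<in> B \<Longrightarrow> e' e \<in> carrier V" "\<And>e t. e \<in> B \<Longrightarrow> t \<in> B \<Longrightarrow> b t (e' e) = (if t = e then 1 else 0)"
    and perp: "\<And>x. x \<in> carrier V \<Longrightarrow> (\<And>e. e \<in> B \<Longrightarrow> b x (e' e) = 0) \<Longrightarrow> x = \<one>"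
  shows "f2_basis V B"
  unfolding f2_basis_def
proof (intro conjI B ballI)
  fix x assume x: "x \<in> carrier V"
  have coeff: "b (S T) (e' e) = (if e \<in> T then 1 else 0)" if T: "T \<subseteq> B" and e: "e \<in> B" for T e
  proof -
    have fT: "finite T" using T B finite_subset_carrier by blast
    have "b (S T) (e' e) = (\<Sum>t\<in>T. b t (e' e))"
      using T B e dual fT by (intro b_S) auto
    also have "\<dots> = (\<Sum>t\<in>T. if t = e then 1 else 0)"
      using T e dual by (intro sum.cong) auto
    finally show ?thesis using fT by simp
  qed
  define T where "T = {e \<in> B. b x (e' e) = 1}"
  have T: "T \<subseteq> B" by (auto simp: T_def)
  then have TC: "T \<subseteq> carrier V" using B by auto
  have "x \<otimes> S T = \<one>"
  proof (rule perp)
    fix e assume e: "e \<in> B"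
    show "b (x \<otimes> S T) (e' e) = 0"
      using x TC e dual coeff[OF T e] two_cases[of "b x (e' e)"]
      by (auto simp: b_add T_def two_add_self)
  qed (use x TC in auto)
  then have xT: "x = S T" by (rule eq_if_prod_one[OF x S_closed[OF TC]])
  show "\<exists>!T. T \<subseteq> B \<and> x = S T"
  proof (rule ex1I[of _ T])
    fix T' assume T': "T' \<subseteq> B \<and> x = S T'"
    have "e \<in> T' \<longleftrightarrow> e \<in> T" if "e \<in> B" for e
      using coeff[of T' e] coeff[OF T that] T' that xT by (auto split: if_splits)
    then show "T' = T" using T T' by blast
  qed (use T xT in auto)
qed

definition ON :: "'a set \<Rightarrow> bool" where
  "ON B \<longleftrightarrow> B \<subseteq> carrier V \<and> (\<forall>x\<in>B. \<forall>y\<in>B. b x y = (if x = y then 1 else 0))"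

text \<open>Orthogonal projection onto the complement of an orthonormal system.\<close>

lemma project:
  assumes B: "ON B" and y: "y \<in> carrier V"
  obtains y' where "y' \<in> carrier V" "\<And>e. e \<in> B \<Longrightarrow> b y' e = 0"
    "\<And>x. x \<in> carrier V \<Longrightarrow> (\<And>e. e \<in> B \<Longrightarrow> b x e = 0) \<Longrightarrow> b x y' = b x y"
proof -
  define T where "T = {e \<in> B. b y e = 1}"
  have T: "T \<subseteq> B" and TC: "T \<subseteq> carrier V" "B \<subseteq> carrier V" using B by (auto simp: T_def ON_def)
  have fT: "finite T" using TC finite_subset_carrier by blast
  show ?thesis
  proof (rule that[of "y \<otimes> S T"])
    show "y \<otimes> S T \<in> carrier V" using y TC by auto
    fix e assume e: "e \<in> B"
    have "b (S T) e = (\<Sum>t\<in>T. b t e)" using TC e fT by (intro b_S) auto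
    also have "\<dots> = (\<Sum>t\<in>T. if t = e then 1 else 0)"
      using T e B by (intro sum.cong) (auto simp: ON_def)
    also have "\<dots> = b y e" using fT e two_cases[of "b y e"] by (auto simp: T_def)
    finally show "b (y \<otimes> S T) e = 0" using y TC e by (simp add: b_add two_add_self subset_iff)
  next
    fix x assume x: "x \<in> carrier V" "\<And>e. e \<in> B \<Longrightarrow> b x e = 0"
    have "b (S T) x = (\<Sum>t\<in>T. b t x)" using TC x fT by (intro b_S) auto
    also have "\<dots> = (\<Sum>t\<in>T. 0)"
    proof (rule sum.cong)
      fix t assume "t \<in> T"
      then have "t \<in> B" "t \<in> carrier V" using T TC by auto
      then show "b t x = 0" using x(1) x(2)[of t] b_sym[of t x] by simp
    qed auto
    finally have "b x (S T) = 0" using x TC b_sym[of x "S T"] by simp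
    then show "b x (y \<otimes> S T) = b x y" using x y TC by (simp add: b_add_right)
  qed
qed

text \<open>A maximal orthonormal system \<open>B\<close> works. On its orthogonal complement the form is alternating by
  maximality; a hyperbolic pair there could be combined with an element of \<open>B\<close> to enlarge the system.\<close>

lemma ex_orthonormal_basis:
  assumes nonalt: "\<not> (\<forall>x\<in>carrier V. b x x = 0)"
  shows "\<exists>B. orthonormal_basis V b B"
proof -
  have "finite {B. ON B}"
    by (rule finite_subset[of _ "Pow (carrier V)"]) (auto simp: ON_def finite_V)
  moreover have "{} \<in> {B. ON B}" by (simp add: ON_def)
  ultimately obtain B where B: "ON B" and max: "\<And>B'. ON B' \<Longrightarrow> card B' \<le> card B"
    using ex_max_card[of "{B. ON B}"] by auto
  have BC: "B \<subseteq> carrier V" and fB: "finite B" using B finite_subset_carrier by (auto simp: ON_def)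
  have Bb: "b x y = (if x = y then 1 else 0)" if "x \<in> B" "y \<in> B" for x y
    using B that by (auto simp: ON_def)
  have alt: "b x x = 0" if x: "x \<in> carrier V" "\<And>e. e \<in> B \<Longrightarrow> b x e = 0" for x
  proof (rule ccontr)
    assume "b x x \<noteq> 0"
    then have xx: "b x x = 1" using two_cases by auto
    then have "x \<notin> B" using x(2)[of x] by auto
    moreover have "b e x = 0" if "e \<in> B" for e
      using x that BC b_sym[of e x] by auto
    then have "ON (insert x B)"
      unfolding ON_def using x xx BC Bb \<open>x \<notin> B\<close> by auto
    ultimately show False using max[of "insert x B"] fB by simp
  qed
  have perp: "x = \<one>" if x: "x \<in> carrier V" "\<And>e. e \<in> B \<Longrightarrow> b x e = 0" for x
  proof (rule ccontr)
    assume "x \<noteq> \<one>"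
    then obtain y0 where y0: "y0 \<in> carrier V" "b x y0 \<noteq> 0" using nondeg x by blast
    then have "b x y0 = 1" using two_cases by auto
    with project[OF B y0(1)] x obtain y where y: "y \<in> carrier V" "\<And>e. e \<in> B \<Longrightarrow> b y e = 0" "b x y = 1"
      by metis
    have "B \<noteq> {}" using nonalt alt by blast
    then obtain e where e: "e \<in> B" by auto
    then have eC: "e \<in> carrier V" using BC by auto
    have sy: "b e x = 0" "b e y = 0" "b x e = 0" "b y e = 0" "b y x = 1" "b x x = 0" "b y y = 0" "b e e = 1"
      using x y e eC alt Bb b_sym[of e x] b_sym[of e y] b_sym[of x y] by simp_all
    (* The sum of a unit vector e and a hyperbolic plane x, y has an orthonormal basis of three vectors. *)
    let ?u = "e \<otimes> x" and ?v = "e \<otimes> y" and ?w = "(e \<otimes> x) \<otimes> y"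
    have C: "?u \<in> carrier V" "?v \<in> carrier V" "?w \<in> carrier V" using eC x y by auto
    note bs = b_add b_add_right sy y(3) eC x(1) y(1) two_add_self
    have uvw: "b ?u ?u = 1" "b ?v ?v = 1" "b ?w ?w = 1" "b ?u ?v = 0" "b ?v ?u = 0" "b ?u ?w = 0" "b ?w ?u = 0" "b ?v ?w = 0" "b ?w ?v = 0"
      by (simp_all add: bs)
    have f0: "b ?u f = 0" "b ?v f = 0" "b ?w f = 0" "b f ?u = 0" "b f ?v = 0" "b f ?w = 0" if f: "f \<in> B - {e}" for f
    proof -
      have "f \<in> carrier V" "b f x = 0" "b f y = 0" "b x f = 0" "b y f = 0" "b e f = 0" "b f e = 0"
        using f BC x y Bb e b_sym[of f x] b_sym[of f y] by auto
      then show "b ?u f = 0" "b ?v f = 0" "b ?w f = 0" "b f ?u = 0" "b f ?v = 0" "b f ?w = 0"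
        by (simp_all add: bs)
    qed
    have dist: "?u \<noteq> ?v" "?u \<noteq> ?w" "?v \<noteq> ?w" using uvw by (metis zero_neq_one)+
    have notin: "?u \<notin> B - {e}" "?v \<notin> B - {e}" "?w \<notin> B - {e}" using f0 uvw by (metis zero_neq_one)+
    have "ON ({?u, ?v, ?w} \<union> (B - {e}))"
      unfolding ON_def
    proof (intro conjI ballI)
      show "{?u, ?v, ?w} \<union> (B - {e}) \<subseteq> carrier V" using C BC by auto
      fix s t assume "s \<in> {?u, ?v, ?w} \<union> (B - {e})" "t \<in> {?u, ?v, ?w} \<union> (B - {e})"
      then consider "s \<in> {?u, ?v, ?w}" "t \<in> {?u, ?v, ?w}" | "s \<in> {?u, ?v, ?w}" "t \<in> B - {e}"
        | "s \<in> B - {e}" "t \<in> {?u, ?v, ?w}" | "s \<in> B - {e}" "t \<in> B - {e}" by blast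
      then show "b s t = (if s = t then 1 else 0)"
      proof cases
        case 1 then show ?thesis using uvw dist by auto
      next
        case 2 then show ?thesis using f0(1-3)[OF 2(2)] notin by auto
      next
        case 3 then show ?thesis using f0(4-6)[OF 3(1)] notin by auto
      next
        case 4 then show ?thesis using Bb by auto
      qed
    qed
    moreover have "card ({?u, ?v, ?w} \<union> (B - {e})) = card B + 2"
    proof -
      have "card ({?u, ?v, ?w} \<union> (B - {e})) = card {?u, ?v, ?w} + card (B - {e})"
        using notin fB by (intro card_Un_disjoint) auto
      moreover have "card {?u, ?v, ?w} = 3" using dist by simp
      moreover have "card (B - {e}) = card B - 1" "card B > 0" using e fB by (auto simp: card_gt_0_iff)
      ultimately show ?thesis by simp
    qed
    ultimately show False using max by fastforce
  qed
  have "f2_basis V B"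
    using BC Bb perp by (intro f2_basisI[where e' = "\<lambda>e. e"]) auto
  then show ?thesis
    using Bb by (auto simp: orthonormal_basis_def)
qed

definition SP :: "('a \<times> 'a) set \<Rightarrow> bool" where
  "SP P \<longleftrightarrow> P \<subseteq> carrier V \<times> carrier V \<and> (\<forall>(x, x')\<in>P. \<forall>(y, y')\<in>P.
        b x y = 0 \<and> b x' y' = 0 \<and> b x y' = (if (x, x') = (y, y') then 1 else 0))"

lemma SPI:
  assumes "P \<subseteq> carrier V \<times> carrier V"
    and "\<And>p p'. p \<in> P \<Longrightarrow> p' \<in> P \<Longrightarrow>
      b (fst p) (fst p') = 0 \<and> b (snd p) (snd p') = 0 \<and> b (fst p) (snd p') = (if p = p' then 1 else 0)"
  shows "SP P"
  unfolding SP_def case_prod_unfold prod.collapse using assms by blast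

lemma SPD:
  assumes "SP P" "p \<in> P" "p' \<in> P"
  shows "b (fst p) (fst p') = 0" "b (snd p) (snd p') = 0" "b (fst p) (snd p') = (if p = p' then 1 else 0)"
    "b (snd p') (fst p) = (if p = p' then 1 else 0)" "fst p \<in> carrier V" "snd p \<in> carrier V"
proof -
  have *: "\<forall>p\<in>P. \<forall>p'\<in>P. b (fst p) (fst p') = 0 \<and> b (snd p) (snd p') = 0 \<and> b (fst p) (snd p') = (if p = p' then 1 else 0)"
    using assms(1) by (simp add: SP_def case_prod_unfold prod_eq_iff)
  show C: "fst p \<in> carrier V" "snd p \<in> carrier V" using assms by (auto simp: SP_def)
  have C': "fst p' \<in> carrier V" "snd p' \<in> carrier V" using assms by (auto simp: SP_def)
  show "b (fst p) (fst p') = 0" "b (snd p) (snd p') = 0" "b (fst p) (snd p') = (if p = p' then 1 else 0)"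
    using * assms by blast+
  then show "b (snd p') (fst p) = (if p = p' then 1 else 0)" using C C' b_sym[of "fst p" "snd p'"] by simp
qed

lemma SP_disjoint:
  assumes "SP P" "p \<in> P" "p' \<in> P"
  shows "fst p \<noteq> snd p'" "fst p = fst p' \<Longrightarrow> p = p'" "snd p = snd p' \<Longrightarrow> p = p'"
proof -
  show "fst p \<noteq> snd p'"
    using SPD(3)[OF assms(1,2,2)] SPD(2)[OF assms(1,3,2)] by auto
  have *: "b (fst p) (snd p) = 1" "b (fst p') (snd p) = (if p' = p then 1 else 0)"
     "b (fst p) (snd p') = (if p = p' then 1 else 0)"
    using SPD(3)[OF assms(1,2,2)] SPD(3)[OF assms(1,3,2)] SPD(3)[OF assms] by auto
  show "p = p'" if "fst p = fst p'"
    using *(1,2) that by (metis zero_neq_one)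
  show "p = p'" if "snd p = snd p'"
    using *(1,3) that by (metis zero_neq_one)
qed

text \<open>The dual family exchanges the two members of each hyperbolic pair.\<close>

lemma SP_f2_basis:
  assumes P: "SP P" and perp: "\<And>x. x \<in> carrier V \<Longrightarrow> (\<And>p. p \<in> P \<Longrightarrow> b x (fst p) = 0 \<and> b x (snd p) = 0) \<Longrightarrow> x = \<one>"
  shows "f2_basis V (fst ` P \<union> snd ` P)"
proof -
  define e' where "e' e = (if \<exists>p\<in>P. e = fst p then snd (SOME p. p \<in> P \<and> e = fst p) else fst (SOME p. p \<in> P \<and> e = snd p))" for e
  have e1: "e' (fst p) = snd p" if p: "p \<in> P" for p
  proof -
    have "(SOME p'. p' \<in> P \<and> fst p = fst p') = p"
      using p SP_disjoint(2)[OF P] by (intro some_equality) auto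
    then show ?thesis using p by (auto simp: e'_def)
  qed
  have e2: "e' (snd p) = fst p" if p: "p \<in> P" for p
  proof -
    have "(SOME p'. p' \<in> P \<and> snd p = snd p') = p"
      using p SP_disjoint(3)[OF P] by (intro some_equality) auto
    moreover have "\<not> (\<exists>p'\<in>P. snd p = fst p')" using SP_disjoint(1)[OF P] p by metis
    ultimately show ?thesis by (auto simp: e'_def)
  qed
  show ?thesis
  proof (rule f2_basisI[where e' = e'])
    show "fst ` P \<union> snd ` P \<subseteq> carrier V" using P by (auto simp: SP_def)
    show "e' e \<in> carrier V" if "e \<in> fst ` P \<union> snd ` P" for e
      using that SPD(5,6)[OF P] e1 e2 by auto
    show "b t (e' e) = (if t = e then 1 else 0)" if "e \<in> fst ` P \<union> snd ` P" "t \<in> fst ` P \<union> snd ` P" for e t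
    proof -
      from that(1) obtain p where p: "p \<in> P" "e = fst p \<or> e = snd p" by auto
      from that(2) obtain p' where p': "p' \<in> P" "t = fst p' \<or> t = snd p'" by auto
      have d: "fst p \<noteq> snd p'" "fst p' \<noteq> snd p" using SP_disjoint(1)[OF P] p p' by auto
      show ?thesis
        using p(2) p'(2)
      proof (elim disjE)
        assume "e = fst p" "t = fst p'" then show ?thesis
          using e1[OF p(1)] SPD(3)[OF P p'(1) p(1)] SP_disjoint(2)[OF P p'(1) p(1)] by auto
      next
        assume "e = fst p" "t = snd p'" then show ?thesis
          using e1[OF p(1)] SPD(2)[OF P p'(1) p(1)] d by auto
      next
        assume "e = snd p" "t = fst p'" then show ?thesis
          using e2[OF p(1)] SPD(1)[OF P p'(1) p(1)] d by auto
      next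
        assume "e = snd p" "t = snd p'" then show ?thesis
          using e2[OF p(1)] SPD(4)[OF P p(1) p'(1)] SP_disjoint(3)[OF P p'(1) p(1)] by auto
      qed
    qed
    fix x assume x: "x \<in> carrier V" "\<And>e. e \<in> fst ` P \<union> snd ` P \<Longrightarrow> b x (e' e) = 0"
    show "x = \<one>"
    proof (rule perp[OF x(1)])
      fix p assume "p \<in> P"
      then show "b x (fst p) = 0 \<and> b x (snd p) = 0"
        using x(2)[of "fst p"] x(2)[of "snd p"] e1 e2 by auto
    qed
  qed
qed

text \<open>A maximal system of hyperbolic pairs works: a vector orthogonal to it pairs to 1 with some vector, and
  the projection of the latter to the orthogonal complement yields a further pair.\<close>

lemma ex_symplectic_basis:
  assumes alt: "\<And>x. x \<in> carrier V \<Longrightarrow> b x x = 0"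
  shows "\<exists>P. symplectic_basis V b P"
proof -
  have "finite {P. SP P}"
    by (rule finite_subset[of _ "Pow (carrier V \<times> carrier V)"]) (auto simp: SP_def finite_V)
  moreover have "{} \<in> {P. SP P}" by (simp add: SP_def)
  ultimately obtain P where P: "SP P" and max: "\<And>P'. SP P' \<Longrightarrow> card P' \<le> card P"
    using ex_max_card[of "{P. SP P}"] by auto
  have PC: "P \<subseteq> carrier V \<times> carrier V" using P by (simp add: SP_def)
  then have fP: "finite P" using finite_V by (meson finite_SigmaI finite_subset)
  have perp: "x = \<one>" if x: "x \<in> carrier V" "\<And>p. p \<in> P \<Longrightarrow> b x (fst p) = 0 \<and> b x (snd p) = 0" for x
  proof (rule ccontr)
    assume "x \<noteq> \<one>"
    then obtain y0 where y0: "y0 \<in> carrier V" "b x y0 \<noteq> 0" using nondeg x by blast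
    then have xy0: "b x y0 = 1" using two_cases by auto
    define T where "T = fst ` {p \<in> P. b y0 (snd p) = 1}"
    define T' where "T' = snd ` {p \<in> P. b y0 (fst p) = 1}"
    have TC: "T \<subseteq> carrier V" "T' \<subseteq> carrier V" using PC by (auto simp: T_def T'_def)
    have f: "finite T" "finite T'" using fP by (auto simp: T_def T'_def)
    define y where "y = y0 \<otimes> (S T \<otimes> S T')"
    have yC: "y \<in> carrier V" using y0 TC by (simp add: y_def)
    have bTf: "b (S T) (fst p) = 0" "b (S T') (snd p) = 0" if p: "p \<in> P" for p
    proof -
      have "b (S T) (fst p) = (\<Sum>t\<in>T. b t (fst p))" using SPD(5)[OF P p p] TC f by (intro b_S) auto
      also have "\<dots> = 0"
      proof (rule sum.neutral, rule ballI)
        fix t assume "t \<in> T"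
        then obtain p' where "p' \<in> P" "t = fst p'" by (auto simp: T_def)
        then show "b t (fst p) = 0" using SPD(1)[OF P _ p] by simp
      qed
      finally show "b (S T) (fst p) = 0" .
      have "b (S T') (snd p) = (\<Sum>t\<in>T'. b t (snd p))" using SPD(6)[OF P p p] TC f by (intro b_S) auto
      also have "\<dots> = 0"
      proof (rule sum.neutral, rule ballI)
        fix t assume "t \<in> T'"
        then obtain p' where "p' \<in> P" "t = snd p'" by (auto simp: T'_def)
        then show "b t (snd p) = 0" using SPD(2)[OF P _ p] by simp
      qed
      finally show "b (S T') (snd p) = 0" .
    qed
    have bTs: "b (S T) (snd p) = b y0 (snd p)" if p: "p \<in> P" for p
    proof -
      have "b (S T) (snd p) = (\<Sum>t\<in>T. b t (snd p))" using SPD(6)[OF P p p] TC f by (intro b_S) auto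
      also have "\<dots> = (\<Sum>t\<in>T. if t = fst p then 1 else 0)"
      proof (rule sum.cong)
        fix t assume "t \<in> T"
        then obtain p' where p': "p' \<in> P" "t = fst p'" by (auto simp: T_def)
        then show "b t (snd p) = (if t = fst p then 1 else 0)"
          using SPD(3)[OF P p'(1) p] SP_disjoint(2)[OF P p'(1) p] by auto
      qed auto
      also have "\<dots> = (if fst p \<in> T then 1 else 0)" using f by simp
      also have "fst p \<in> T \<longleftrightarrow> b y0 (snd p) = 1"
        using p SP_disjoint(2)[OF P _ p] by (auto simp: T_def)
      also have "(if b y0 (snd p) = 1 then 1 else 0) = b y0 (snd p)"
        using two_cases[of "b y0 (snd p)"] by auto
      finally show ?thesis .
    qed
    have bTs': "b (S T') (fst p) = b y0 (fst p)" if p: "p \<in> P" for p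
    proof -
      have "b (S T') (fst p) = (\<Sum>t\<in>T'. b t (fst p))" using SPD(5)[OF P p p] TC f by (intro b_S) auto
      also have "\<dots> = (\<Sum>t\<in>T'. if t = snd p then 1 else 0)"
      proof (rule sum.cong)
        fix t assume "t \<in> T'"
        then obtain p' where p': "p' \<in> P" "t = snd p'" by (auto simp: T'_def)
        then show "b t (fst p) = (if t = snd p then 1 else 0)"
          using SPD(4)[OF P p p'(1)] SP_disjoint(3)[OF P p'(1) p] by auto
      qed auto
      also have "\<dots> = (if snd p \<in> T' then 1 else 0)" using f by simp
      also have "snd p \<in> T' \<longleftrightarrow> b y0 (fst p) = 1"
        using p SP_disjoint(3)[OF P _ p] by (auto simp: T'_def)
      also have "(if b y0 (fst p) = 1 then 1 else 0) = b y0 (fst p)"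
        using two_cases[of "b y0 (fst p)"] by auto
      finally show ?thesis .
    qed
    have yp: "b y (fst p) = 0" "b y (snd p) = 0" if p: "p \<in> P" for p
      using SPD(5,6)[OF P p p] TC y0 bTf[OF p] bTs[OF p] bTs'[OF p] by (simp_all add: y_def b_add two_add_self)
    have 0: "b (S T) x = 0"
      unfolding b_S[OF f(1) TC(1) x(1)]
    proof (rule sum.neutral, rule ballI)
      fix t assume t: "t \<in> T"
      then have "b x t = 0" using x(2) by (auto simp: T_def)
      then show "b t x = 0" using x(1) TC t b_sym[of t x] by auto
    qed
    have 1: "b (S T') x = 0"
      unfolding b_S[OF f(2) TC(2) x(1)]
    proof (rule sum.neutral, rule ballI)
      fix t assume t: "t \<in> T'"
      then have "b x t = 0" using x(2) by (auto simp: T'_def)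
      then show "b t x = 0" using x(1) TC t b_sym[of t x] by auto
    qed
    have xy: "b x y = 1"
      using x y0 xy0 TC 0 1 b_sym[of x "S T"] b_sym[of x "S T'"] by (simp add: y_def b_add_right)
    have "(x, y) \<notin> P" using x(2)[of "(x, y)"] xy by auto
    moreover have "SP (insert (x, y) P)"
    proof -
      have "b x (fst p) = 0" "b x (snd p) = 0" "b y (fst p) = 0" "b y (snd p) = 0"
         "b (fst p) x = 0" "b (snd p) x = 0" "b (fst p) y = 0" "b (snd p) y = 0" if "p \<in> P" for p
        using that x yp SPD(5,6)[OF P that that] yC
          b_sym[of "fst p" x] b_sym[of "snd p" x] b_sym[of "fst p" y] b_sym[of "snd p" y] by auto
      then have *: "\<forall>p\<in>P. b x (fst p) = 0 \<and> b x (snd p) = 0 \<and> b y (fst p) = 0 \<and> b y (snd p) = 0 \<and>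
         b (fst p) x = 0 \<and> b (snd p) x = 0 \<and> b (fst p) y = 0 \<and> b (snd p) y = 0" by blast
      have xx: "b x x = 0" "b y y = 0" using alt x yC by auto
      have "b (fst p) (fst p') = 0 \<and> b (snd p) (snd p') = 0 \<and> b (fst p) (snd p') = (if p = p' then 1 else 0)"
        if "p \<in> insert (x, y) P" "p' \<in> insert (x, y) P" for p p'
      proof (cases "p = (x, y)"; cases "p' = (x, y)")
        assume "p = (x, y)" "p' = (x, y)" then show ?thesis using xx xy by simp
      next
        assume "p = (x, y)" "p' \<noteq> (x, y)" then show ?thesis using * that by auto
      next
        assume "p \<noteq> (x, y)" "p' = (x, y)" then show ?thesis using * that by auto
      next
        assume "p \<noteq> (x, y)" "p' \<noteq> (x, y)" then show ?thesis using SPD[OF P, of p p'] that by auto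
      qed
      then show ?thesis
        using PC x(1) yC by (intro SPI) auto
    qed
    ultimately show False using max[of "insert (x, y) P"] fP by simp
  qed
  have "f2_basis V (fst ` P \<union> snd ` P)" by (rule SP_f2_basis[OF P perp])
  then show ?thesis
    using P unfolding symplectic_basis_def SP_def by blast
qed

end

section \<open>Gauss sums and the Brown invariant\<close>

lemma one_plus_i: "1 + \<i> = of_real (sqrt 2) * cis (pi / 4)" "1 + inverse \<i> = of_real (sqrt 2) * inverse (cis (pi / 4))"
  by (simp_all add: complex_eq_iff cos_45 sin_45 real_sqrt_mult_self)

context f2_form
begin

lemma qf_add:
  assumes "q \<in> quadratic_forms V b" "x \<in> carrier V" "y \<in> carrier V"
  shows "q (x \<otimes> y) = q x + q y + double (b x y)"
  using assms by (auto simp: quadratic_forms_def)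

lemma qf_one:
  assumes "q \<in> quadratic_forms V b"
  shows "q \<one> = 0"
proof -
  have "q (\<one> \<otimes> \<one>) = q \<one> + q \<one> + double (b \<one> \<one>)"
    using assms by (intro qf_add) auto
  then show ?thesis using double2_eq_0_iff[of 0] by simp
qed

lemma qf_self:
  assumes "q \<in> quadratic_forms V b" "x \<in> carrier V"
  shows "q x + q x + double (b x x) = 0"
  using qf_add[OF assms assms(2)] qf_one[OF assms(1)] exp2[OF assms(2)] by simp

text \<open>On orthogonal vectors a quadratic form is additive, so that Gauss sums over orthogonal bases factor.\<close>

lemma i4_qf_S:
  assumes q: "q \<in> quadratic_forms V b"
    and orth: "\<And>s t. s \<in> T \<Longrightarrow> t \<in> T \<Longrightarrow> s \<noteq> t \<Longrightarrow> b s t = 0"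
    and T: "T \<subseteq> carrier V"
  shows "i4 (q (S T)) = (\<Prod>t\<in>T. i4 (q t))"
proof -
  have "finite T" using T by (rule finite_subset_carrier)
  then show ?thesis
    using T orth
  proof (induction T rule: finite_induct)
    case empty
    then show ?case using qf_one[OF q] by simp
  next
    case (insert t T)
    have "b (S T) t = (\<Sum>s\<in>T. b s t)" using insert by (intro b_S) auto
    also have "\<dots> = 0" using insert by (intro sum.neutral ballI) (metis insertCI)
    finally have "b t (S T) = 0" using insert b_sym[of t "S T"] by simp
    moreover have "S (insert t T) = t \<otimes> S T" using insert by (intro finprod_insert) auto
    moreover have "i4 (q (S T)) = (\<Prod>t\<in>T. i4 (q t))" using insert by (intro insert.IH) auto
    ultimately show ?case
      using insert qf_add[OF q, of t "S T"] double2_eq_0_iff[of 0] by (simp add: i4_add)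
  qed
qed

lemma bij_S: "f2_basis V B \<Longrightarrow> bij_betw S (Pow B) (carrier V)"
  unfolding bij_betw_def
proof
  assume B: "f2_basis V B"
  then have BC: "B \<subseteq> carrier V" by (simp add: f2_basis_def)
  show "inj_on S (Pow B)"
  proof (rule inj_onI)
    fix T T' assume T: "T \<in> Pow B" "T' \<in> Pow B" "S T = S T'"
    have "S T \<in> carrier V" using T BC by auto
    then show "T = T'" using B T unfolding f2_basis_def by blast
  qed
  show "S ` Pow B = carrier V"
    using B BC unfolding f2_basis_def by (auto intro!: S_closed)
qed

definition gauss_sum :: "('a \<Rightarrow> 4) \<Rightarrow> complex" where
  "gauss_sum q = (\<Sum>x\<in>carrier V. i4 (q x))"

text \<open>Each basis vector \<open>t\<close> contributes the factor \<open>1 + i4 (q t) = 1 \<plusminus> \<i>\<close>, a positive multiple of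
  \<open>exp (\<plusminus> \<pi>\<i>/4)\<close>.\<close>

lemma gauss_sum_orthonormal:
  assumes q: "q \<in> quadratic_forms V b" and B: "orthonormal_basis V b B"
  shows "gauss_sum q = of_real (sqrt 2 ^ card B) * z8 (of_nat (card {x\<in>B. q x = 1}) - of_nat (card {x\<in>B. q x = - 1}))"
proof -
  have basis: "f2_basis V B" and ob: "\<And>x y. x \<in> B \<Longrightarrow> y \<in> B \<Longrightarrow> b x y = (if x = y then 1 else 0)"
    using B by (auto simp: orthonormal_basis_def)
  then have BC: "B \<subseteq> carrier V" by (simp add: f2_basis_def)
  have fB: "finite B" using BC by (rule finite_subset_carrier)
  have q1: "q x = 1 \<or> q x = - 1" if x: "x \<in> B" for x
  proof (rule four_unit_cases)
    have "double (b x x) = (of_nat (2 * 1) :: 4)" using double2_of_nat[of 1] ob[OF x x] by simp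
    then have "q x + q x + 2 = 0" using qf_self[OF q, of x] x BC by auto
    then have "q x + q x = - 2" by (simp add: eq_neg_iff_add_eq_0)
    moreover have "(- 2 :: 4) = 2" by simp
    ultimately show "q x + q x = 2" by metis
  qed
  have ne: "(1 :: 4) \<noteq> - 1" by simp
  have "gauss_sum q = (\<Sum>T\<in>Pow B. i4 (q (S T)))"
    unfolding gauss_sum_def using bij_S[OF basis] by (rule sum.reindex_bij_betw[symmetric])
  also have "\<dots> = (\<Sum>T\<in>Pow B. (\<Prod>t\<in>T. i4 (q t)) * (\<Prod>t\<in>B - T. 1))"
  proof (rule sum.cong)
    fix T assume "T \<in> Pow B"
    then have "i4 (q (S T)) = (\<Prod>t\<in>T. i4 (q t))"
      using BC ob by (intro i4_qf_S[OF q]) (auto simp: subset_iff)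
    then show "i4 (q (S T)) = (\<Prod>t\<in>T. i4 (q t)) * (\<Prod>t\<in>B - T. 1)" by simp
  qed auto
  also have "\<dots> = (\<Prod>t\<in>B. i4 (q t) + 1)"
    using fB by (rule prod_add[symmetric])
  also have "\<dots> = (\<Prod>t\<in>B. of_real (sqrt 2) * (if q t = 1 then cis (pi / 4) else inverse (cis (pi / 4))))"
  proof (rule prod.cong)
    fix t assume "t \<in> B"
    then show "i4 (q t) + 1 = of_real (sqrt 2) * (if q t = 1 then cis (pi / 4) else inverse (cis (pi / 4)))"
      using q1[of t] one_plus_i ne by (auto simp: i4_1 i4_uminus add.commute)
  qed auto
  also have "\<dots> = of_real (sqrt 2 ^ card B) * (\<Prod>t\<in>B. (if q t = 1 then cis (pi / 4) else inverse (cis (pi / 4))))"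
    by (simp add: prod.distrib)
  also have "(\<Prod>t\<in>B. (if q t = 1 then cis (pi / 4) else inverse (cis (pi / 4)))) = 
     cis (pi / 4) ^ card {x\<in>B. q x = 1} * inverse (cis (pi / 4)) ^ card {x\<in>B. q x \<noteq> 1}"
    using fB by (simp add: prod.If_cases Int_def)
  also have "{x\<in>B. q x \<noteq> 1} = {x\<in>B. q x = - 1}" using q1 ne by auto
  also have "cis (pi / 4) ^ card {x\<in>B. q x = 1} * inverse (cis (pi / 4)) ^ card {x\<in>B. q x = - 1} =
     z8 (of_nat (card {x\<in>B. q x = 1}) - of_nat (card {x\<in>B. q x = - 1}))"
    unfolding z8_diff z8_of_nat by (simp only: divide_inverse power_inverse)
  finally show ?thesis .
qed

text \<open>Each hyperbolic plane contributes a sum of four terms \<open>1 + \<alpha> + \<beta> - \<alpha>\<beta>\<close> with signs \<open>\<alpha>, \<beta>\<close>; it is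
  \<open>2\<close>, or \<open>-2\<close> if both signs are negative.\<close>

lemma gauss_sum_symplectic:
  fixes q' :: "'a \<Rightarrow> 2"
  assumes q: "q \<in> quadratic_forms V b" and P: "symplectic_basis V b P"
    and q': "\<And>x. x \<in> carrier V \<Longrightarrow> double (q' x) = q x"
  shows "gauss_sum q = of_real (2 ^ card P) * z8 (of_nat (4 * lift (\<Sum>(x, x')\<in>P. q' x * q' x')))"
proof -
  have basis: "f2_basis V (fst ` P \<union> snd ` P)"
    using P unfolding symplectic_basis_def by blast
  then have "fst ` P \<union> snd ` P \<subseteq> carrier V" unfolding f2_basis_def by blast
  then have PC: "P \<subseteq> carrier V \<times> carrier V" by force
  have SP: "SP P"
    using P PC unfolding symplectic_basis_def SP_def by blast
  from PC have fP: "finite P" using finite_V by (meson finite_SigmaI finite_subset)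
  have injf: "inj_on fst P" and injs: "inj_on snd P"
    using SP_disjoint[OF SP] by (auto intro!: inj_onI)
  have disj: "fst ` P \<inter> snd ` P = {}" using SP_disjoint(1)[OF SP] by fastforce
  have C: "fst p \<in> carrier V" "snd p \<in> carrier V" if "p \<in> P" for p using that PC by auto
  let ?\<alpha> = "\<lambda>p. i4 (q (fst p))" and ?\<beta> = "\<lambda>p. i4 (q (snd p))"
  have bij: "bij_betw (\<lambda>(T, T'). fst ` T \<union> snd ` T') (Pow P \<times> Pow P) (Pow (fst ` P \<union> snd ` P))"
  proof (rule bij_betw_byWitness[where f' = "\<lambda>U. ({p \<in> P. fst p \<in> U}, {p \<in> P. snd p \<in> U})"])
    show "\<forall>a\<in>Pow P \<times> Pow P. ({p \<in> P. fst p \<in> (case a of (T, T') \<Rightarrow> fst ` T \<union> snd ` T')}, {p \<in> P. snd p \<in> (case a of (T, T') \<Rightarrow> fst ` T \<union> snd ` T')}) = a"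
    proof
      fix a assume "a \<in> Pow P \<times> Pow P"
      then obtain T T' where a: "a = (T, T')" "T \<subseteq> P" "T' \<subseteq> P" by auto
      have "fst p \<in> fst ` T \<union> snd ` T' \<longleftrightarrow> p \<in> T" if p: "p \<in> P" for p
      proof
        assume "fst p \<in> fst ` T \<union> snd ` T'"
        then consider p' where "p' \<in> T" "fst p = fst p'" | p' where "p' \<in> T'" "fst p = snd p'" by auto
        then show "p \<in> T"
        proof cases
          case 1 then show ?thesis using SP_disjoint(2)[OF SP p, of p'] a by auto
        next
          case 2 then show ?thesis using SP_disjoint(1)[OF SP p, of p'] a by auto
        qed
      qed auto
      moreover have "snd p \<in> fst ` T \<union> snd ` T' \<longleftrightarrow> p \<in> T'" if p: "p \<in> P" for p
      proof
        assume "snd p \<in> fst ` T \<union> snd ` T'"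
        then consider p' where "p' \<in> T" "snd p = fst p'" | p' where "p' \<in> T'" "snd p = snd p'" by auto
        then show "p \<in> T'"
        proof cases
          case 1 then show ?thesis using SP_disjoint(1)[OF SP, of p' p] a p by auto
        next
          case 2 then show ?thesis using SP_disjoint(3)[OF SP p, of p'] a by auto
        qed
      qed auto
      ultimately have "{p \<in> P. fst p \<in> fst ` T \<union> snd ` T'} = T" "{p \<in> P. snd p \<in> fst ` T \<union> snd ` T'} = T'"
        using a(2,3) by blast+
      then show "({p \<in> P. fst p \<in> (case a of (T, T') \<Rightarrow> fst ` T \<union> snd ` T')}, {p \<in> P. snd p \<in> (case a of (T, T') \<Rightarrow> fst ` T \<union> snd ` T')}) = a"
        unfolding a(1) by (simp only: prod.case)
    qed
    show "\<forall>U\<in>Pow (fst ` P \<union> snd ` P). (case ({p \<in> P. fst p \<in> U}, {p \<in> P. snd p \<in> U}) of (T, T') \<Rightarrow> fst ` T \<union> snd ` T') = U"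
      by (auto 0 3)
  qed auto
  have term_eq: "i4 (q (S (fst ` T \<union> snd ` T'))) = (\<Prod>p\<in>T. ?\<alpha> p) * (\<Prod>p\<in>T'. ?\<beta> p * (if p \<in> T then - 1 else 1))"
    if T: "T \<subseteq> P" "T' \<subseteq> P" for T T'
  proof -
    have f: "finite T" "finite T'" using T fP finite_subset by blast+
    have TC: "fst ` T \<subseteq> carrier V" "snd ` T' \<subseteq> carrier V" using T C by auto
    have "S (fst ` T \<union> snd ` T') = S (fst ` T) \<otimes> S (snd ` T')"
    proof (rule finprod_Un_disjoint)
      show "fst ` T \<inter> snd ` T' = {}" using T disj by blast
    qed (use f TC in auto)
    moreover have "i4 (q (S (fst ` T))) = (\<Prod>t\<in>fst ` T. i4 (q t))"
    proof (rule i4_qf_S[OF q _ TC(1)])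
      fix s t assume "s \<in> fst ` T" "t \<in> fst ` T"
      then obtain p p' where "p \<in> P" "p' \<in> P" "s = fst p" "t = fst p'" using T by blast
      then show "b s t = 0" using SPD(1)[OF SP] by simp
    qed
    then have "i4 (q (S (fst ` T))) = (\<Prod>p\<in>T. ?\<alpha> p)"
      using inj_on_subset[OF injf T(1)] by (simp add: prod.reindex)
    moreover have "i4 (q (S (snd ` T'))) = (\<Prod>t\<in>snd ` T'. i4 (q t))"
    proof (rule i4_qf_S[OF q _ TC(2)])
      fix s t assume "s \<in> snd ` T'" "t \<in> snd ` T'"
      then obtain p p' where "p \<in> P" "p' \<in> P" "s = snd p" "t = snd p'" using T by blast
      then show "b s t = 0" using SPD(2)[OF SP] by simp
    qed
    then have "i4 (q (S (snd ` T'))) = (\<Prod>p\<in>T'. ?\<beta> p)"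
      using inj_on_subset[OF injs T(2)] by (simp add: prod.reindex)
    moreover have "b (S (fst ` T)) (S (snd ` T')) = of_nat (card (T' \<inter> T))"
    proof -
      have "b (S (snd ` T')) (S (fst ` T)) = (\<Sum>t\<in>snd ` T'. b t (S (fst ` T)))"
        using f TC by (intro b_S) auto
      also have "\<dots> = (\<Sum>p\<in>T'. b (snd p) (S (fst ` T)))"
        using inj_on_subset[OF injs T(2)] by (simp add: sum.reindex)
      also have "\<dots> = (\<Sum>p\<in>T'. if p \<in> T then 1 else 0)"
      proof (rule sum.cong)
        fix p assume p: "p \<in> T'"
        then have pP: "p \<in> P" using T by auto
        have "b (S (fst ` T)) (snd p) = (\<Sum>t\<in>fst ` T. b t (snd p))"
          using f TC C pP by (intro b_S) auto
        also have "\<dots> = (\<Sum>p'\<in>T. b (fst p') (snd p))"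
          using inj_on_subset[OF injf T(1)] by (simp add: sum.reindex)
        also have "\<dots> = (\<Sum>p'\<in>T. if p' = p then 1 else 0)"
          using SPD(3)[OF SP _ pP] T by (intro sum.cong) auto
        also have "\<dots> = (if p \<in> T then 1 else 0)" using f by simp
        finally show "b (snd p) (S (fst ` T)) = (if p \<in> T then 1 else 0)"
          using b_sym[of "snd p" "S (fst ` T)"] C pP TC by simp
      qed auto
      also have "\<dots> = of_nat (card (T' \<inter> T))"
        using f by (simp add: sum.If_cases Int_def)
      finally show ?thesis using b_sym[of "S (fst ` T)" "S (snd ` T')"] TC by simp
    qed
    ultimately have "i4 (q (S (fst ` T \<union> snd ` T'))) = (\<Prod>p\<in>T. ?\<alpha> p) * (\<Prod>p\<in>T'. ?\<beta> p) * (- 1) ^ card (T' \<inter> T)"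
      using qf_add[OF q, of "S (fst ` T)" "S (snd ` T')"] TC by (simp add: i4_add i4_double neg_one_lift_of_nat)
    also have "(- 1) ^ card (T' \<inter> T) = (\<Prod>p\<in>T'. if p \<in> T then - 1 else 1 :: complex)"
      using f by (simp add: prod.If_cases Int_def)
    finally show ?thesis by (simp add: prod.distrib)
  qed
  have "gauss_sum q = (\<Sum>U\<in>Pow (fst ` P \<union> snd ` P). i4 (q (S U)))"
    unfolding gauss_sum_def using bij_S[OF basis] by (rule sum.reindex_bij_betw[symmetric])
  also have "\<dots> = (\<Sum>(T, T')\<in>Pow P \<times> Pow P. i4 (q (S (fst ` T \<union> snd ` T'))))"
    using sum.reindex_bij_betw[OF bij, of "\<lambda>U. i4 (q (S U))"] by (simp add: case_prod_unfold)
  also have "\<dots> = (\<Sum>T\<in>Pow P. \<Sum>T'\<in>Pow P. i4 (q (S (fst ` T \<union> snd ` T'))))"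
    by (simp add: sum.cartesian_product)
  also have "\<dots> = (\<Sum>T\<in>Pow P. (\<Prod>p\<in>T. ?\<alpha> p * (1 - ?\<beta> p)) * (\<Prod>p\<in>P - T. 1 + ?\<beta> p))"
  proof (rule sum.cong)
    fix T assume T: "T \<in> Pow P"
    have "(\<Sum>T'\<in>Pow P. i4 (q (S (fst ` T \<union> snd ` T')))) = (\<Sum>T'\<in>Pow P. (\<Prod>p\<in>T. ?\<alpha> p) * ((\<Prod>p\<in>T'. ?\<beta> p * (if p \<in> T then - 1 else 1)) * (\<Prod>p\<in>P - T'. 1)))"
      using T term_eq by (intro sum.cong) auto
    also have "\<dots> = (\<Prod>p\<in>T. ?\<alpha> p) * (\<Prod>p\<in>P. ?\<beta> p * (if p \<in> T then - 1 else 1) + 1)"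
      by (simp only: sum_distrib_left[symmetric] prod_add[OF fP])
    also have "(\<Prod>p\<in>P. ?\<beta> p * (if p \<in> T then - 1 else 1) + 1) = (\<Prod>p\<in>P. if p \<in> T then 1 - ?\<beta> p else 1 + ?\<beta> p)"
      by (intro prod.cong) auto
    also have "\<dots> = (\<Prod>p\<in>T. 1 - ?\<beta> p) * (\<Prod>p\<in>P - T. 1 + ?\<beta> p)"
      using T fP by (simp add: prod.If_cases Int_absorb1 Diff_eq)
    finally show "(\<Sum>T'\<in>Pow P. i4 (q (S (fst ` T \<union> snd ` T')))) = (\<Prod>p\<in>T. ?\<alpha> p * (1 - ?\<beta> p)) * (\<Prod>p\<in>P - T. 1 + ?\<beta> p)"
      by (simp add: prod.distrib mult.assoc)
  qed auto
  also have "\<dots> = (\<Prod>p\<in>P. ?\<alpha> p * (1 - ?\<beta> p) + (1 + ?\<beta> p))"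
    using fP by (rule prod_add[symmetric])
  also have "\<dots> = (\<Prod>p\<in>P. 2 * (- 1) ^ lift (q' (fst p) * q' (snd p)))"
  proof (rule prod.cong)
    fix p assume p: "p \<in> P"
    have "q (fst p) = double (q' (fst p))" "q (snd p) = double (q' (snd p))" using q' C p by auto
    then show "?\<alpha> p * (1 - ?\<beta> p) + (1 + ?\<beta> p) = 2 * (- 1) ^ lift (q' (fst p) * q' (snd p))"
      using two_cases[of "q' (fst p)"] two_cases[of "q' (snd p)"] by (auto simp: i4_double lift_2_simps)
  qed auto
  also have "\<dots> = of_real (2 ^ card P) * (- 1) ^ lift (\<Sum>p\<in>P. q' (fst p) * q' (snd p))"
  proof -
    have neg: "(- 1 :: complex) ^ lift (\<Sum>p\<in>R. f p) = (\<Prod>p\<in>R. (- 1) ^ lift (f p))" if "finite R" for R and f :: "'a \<times> 'a \<Rightarrow> 2"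
      using that by (induction R rule: finite_induct) (simp_all add: lift_2_simps i4_double[symmetric] double2_add i4_add del: i4_double)
    show ?thesis unfolding neg[OF fP] by (simp add: prod.distrib)
  qed
  also have "(- 1) ^ lift (\<Sum>p\<in>P. q' (fst p) * q' (snd p)) = z8 (of_nat (4 * lift (\<Sum>(x, x')\<in>P. q' x * q' x')))"
  proof -
    have "cis (pi / 4) ^ 4 = - 1" using Complex.DeMoivre[of "pi / 4" 4] by simp
    then show ?thesis unfolding z8_of_nat power_mult by (simp add: case_prod_unfold)
  qed
  finally show ?thesis .
qed

text \<open>The Brown invariant is the phase of the Gauss sum.\<close>

theorem gauss_sum_brown:
  assumes q: "q \<in> quadratic_forms V b"
  shows "\<exists>r>0. gauss_sum q = of_real r * z8 (brown V b q)"
proof (cases "\<forall>x\<in>carrier V. b x x = 0")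
  case True
  define q' where "q' x = (THE c :: 2. double c = q x)" for x
  have q': "double (q' x) = q x" if x: "x \<in> carrier V" for x
  proof -
    have "q x + q x = 0" using qf_self[OF q x] True x double2_eq_0_iff[of 0] by simp
    then obtain c :: 2 where c: "double c = q x" using four_double_cases by blast
    then have "(THE c :: 2. double c = q x) = c"
      by (intro the_equality) (auto simp: double2_inject[symmetric])
    then show ?thesis using c by (simp add: q'_def)
  qed
  obtain P where "symplectic_basis V b P" using ex_symplectic_basis True by blast
  then have P: "symplectic_basis V b (SOME P. symplectic_basis V b P)" by (rule someI)
  have "brown V b q = of_nat (4 * lift (arf V b q'))"
    using True by (simp add: brown_def q'_def[abs_def])
  then show ?thesis
    using gauss_sum_symplectic[OF q P q'] unfolding arf_def
    by (intro exI[of _ "2 ^ card (SOME P. symplectic_basis V b P)"]) simp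
next
  case False
  obtain B where "orthonormal_basis V b B" using ex_orthonormal_basis False by blast
  then have B: "orthonormal_basis V b (SOME B. orthonormal_basis V b B)" by (rule someI)
  show ?thesis
    using gauss_sum_orthonormal[OF q B] False
    by (intro exI[of _ "sqrt 2 ^ card (SOME B. orthonormal_basis V b B)"]) (auto simp: brown_def Let_def)
qed

end

section \<open>Unimodular Gaussian lattices\<close>

lemma gint_0 [simp]: "0 \<in> gauss_ints" and gint_1 [simp]: "1 \<in> gauss_ints" and gint_i [simp]: "\<i> \<in> gauss_ints"
  by (auto simp: gauss_ints_def)

lemma gint_uminus: "a \<in> gauss_ints \<Longrightarrow> - a \<in> gauss_ints"
  by (auto simp: gauss_ints_def)

lemma gint_diff: "a \<in> gauss_ints \<Longrightarrow> b \<in> gauss_ints \<Longrightarrow> a - b \<in> gauss_ints"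
  by (auto simp: gauss_ints_def)

lemma gint_mult: "a \<in> gauss_ints \<Longrightarrow> b \<in> gauss_ints \<Longrightarrow> a * b \<in> gauss_ints"
  by (auto simp: gauss_ints_def)

lemma gint_sum: "(\<And>x. x \<in> A \<Longrightarrow> f x \<in> gauss_ints) \<Longrightarrow> sum f A \<in> gauss_ints"
  by (induction A rule: infinite_finite_induct) (auto intro: gint_add)

lemma gint_prod: "(\<And>x. x \<in> A \<Longrightarrow> f x \<in> gauss_ints) \<Longrightarrow> prod f A \<in> gauss_ints"
  by (induction A rule: infinite_finite_induct) (auto intro: gint_mult)

lemma gint_power: "a \<in> gauss_ints \<Longrightarrow> a ^ n \<in> gauss_ints"
  by (induction n) (auto intro: gint_mult)

lemma gint_signof: "(signof p :: complex) \<in> gauss_ints"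
  by (auto simp: sign_def intro: gint_uminus)

lemma gint_det:
  assumes A: "A \<in> carrier_mat n n" and el: "\<And>i j. i < n \<Longrightarrow> j < n \<Longrightarrow> A $$ (i, j) \<in> gauss_ints"
  shows "Determinant.det A \<in> gauss_ints"
  unfolding det_def'[OF A]
proof (intro gint_sum gint_mult gint_signof gint_prod)
  fix p i assume "p \<in> {p. p permutes {0..<n}}" "i \<in> {0..<n}"
  then have "p i \<in> {0..<n}" using permutes_in_image[of p "{0..<n}" i] by simp
  then show "A $$ (i, p i) \<in> gauss_ints" using \<open>i \<in> {0..<n}\<close> by (intro el) auto
qed

lemma gint_adj_mat:
  assumes A: "A \<in> carrier_mat n n" and el: "\<And>i j. i < n \<Longrightarrow> j < n \<Longrightarrow> A $$ (i, j) \<in> gauss_ints"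
    and ij: "i < n" "j < n"
  shows "adj_mat A $$ (i, j) \<in> gauss_ints"
proof -
  have d: "dim_row A = n" "dim_col A = n" using A by auto
  have "adj_mat A $$ (i, j) = cofactor A j i" using ij d by (simp add: adj_mat_def)
  also have "\<dots> \<in> gauss_ints"
    unfolding cofactor_def
  proof (intro gint_mult gint_power gint_uminus gint_1)
    show "Determinant.det (mat_delete A j i) \<in> gauss_ints"
    proof (rule gint_det[OF mat_delete_carrier[OF A]])
      fix k l assume "k < n - 1" "l < n - 1"
      then show "mat_delete A j i $$ (k, l) \<in> gauss_ints"
        unfolding mat_delete_def using d by (auto intro!: el)
    qed
  qed
  finally show ?thesis .
qed

text \<open>\<open>g\<close> is the rank, and \<open>bs\<close> a basis for which the Gram determinant is a unit.\<close>

locale gauss_lat =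
  fixes \<Gamma> :: "'v::complex_normed_vector set" and H :: "'v \<Rightarrow> 'v \<Rightarrow> complex" and bs :: "'v list" and g :: nat
  assumes basis: "gaussian_basis \<Gamma> bs" and len: "length bs = g"
    and pos: "positive_hermitian H" and int_H: "x \<in> \<Gamma> \<Longrightarrow> y \<in> \<Gamma> \<Longrightarrow> H x y \<in> gauss_ints"
    and gram: "(gram_det H bs)\<^sup>2 = 1"
begin

abbreviation bk :: "nat \<Rightarrow> 'v" where "bk k \<equiv> bs ! k"

definition lin :: "(nat \<Rightarrow> complex) \<Rightarrow> 'v" where
  "lin c = (\<Sum>k<g. c k *\<^sub>C bk k)"

definition Sq :: "'v \<Rightarrow> real" where "Sq w = Re (H w w)"

lemma H_add_right: "H x (y + z) = H x y + H x z"
  and H_scale_right: "H x (c *\<^sub>C y) = c * H x y"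
  and H_cnj: "H y x = cnj (H x y)"
  and Sq_pos: "x \<noteq> 0 \<Longrightarrow> Sq x > 0"
  using pos unfolding positive_hermitian_def Sq_def by blast+

lemma H_add_left: "H (x + y) z = H x z + H y z"
  unfolding H_cnj[of "x + y" z] H_cnj[of x z] H_cnj[of y z] by (simp add: H_add_right)

lemma H_scale_left: "H (c *\<^sub>C x) y = cnj c * H x y"
  unfolding H_cnj[of "c *\<^sub>C x" y] H_cnj[of x y] by (simp add: H_scale_right)

lemma H_zero_right [simp]: "H x 0 = 0" using H_add_right[of x 0 0] by simp
lemma H_zero_left [simp]: "H 0 x = 0" using H_add_left[of 0 0 x] by simp
lemma H_minus_right: "H x (- y) = - H x y" using H_add_right[of x y "- y"] by (simp add: eq_neg_iff_add_eq_0 add.commute)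
lemma H_minus_left: "H (- x) y = - H x y" using H_add_left[of x "- x" y] by (simp add: eq_neg_iff_add_eq_0 add.commute)
lemma H_diff_right: "H x (y - z) = H x y - H x z" using H_add_right[of x y "- z"] by (simp add: H_minus_right)
lemma H_diff_left: "H (x - y) z = H x z - H y z" using H_add_left[of x "- y" z] by (simp add: H_minus_left)

lemma H_sum_right: "H x (\<Sum>k\<in>A. f k) = (\<Sum>k\<in>A. H x (f k))"
  by (induction A rule: infinite_finite_induct) (auto simp: H_add_right)

lemma H_self: "H x x = of_real (Sq x)"
  using H_cnj[of x x] by (simp add: Sq_def complex_eq_iff)

lemma Sq_nonneg [simp]: "Sq x \<ge> 0"
  by (cases "x = 0") (auto simp: less_imp_le Sq_pos, simp add: Sq_def)

lemma Sq_zero [simp]: "Sq 0 = 0" by (simp add: Sq_def)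

lemma Sq_add: "Sq (x + y) = Sq x + 2 * Re (H x y) + Sq y"
  using arg_cong[OF H_cnj[of y x], of Re] by (simp add: Sq_def H_add_right H_add_left)

lemma Sq_scale: "Sq (c *\<^sub>C x) = (cmod c)\<^sup>2 * Sq x"
proof -
  have "H (c *\<^sub>C x) (c *\<^sub>C x) = (c * cnj c) * H x x"
    by (simp add: H_scale_left H_scale_right)
  also have "\<dots> = of_real ((cmod c)\<^sup>2 * Sq x)"
    unfolding complex_norm_square[symmetric] H_self by simp
  finally show ?thesis unfolding Sq_def[of "c *\<^sub>C x"] by (simp only: Re_complex_of_real)
qed

lemma Sq_minus [simp]: "Sq (- x) = Sq x"
  by (simp add: Sq_def H_minus_left H_minus_right)

lemma Sq_diff: "Sq (x - y) = Sq x - 2 * Re (H x y) + Sq y"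
  using Sq_add[of x "- y"] by (simp add: H_minus_right)

lemma Cauchy_Schwarz: "(cmod (H x y))\<^sup>2 \<le> Sq x * Sq y"
proof (cases "x = 0")
  case False
  then have Sx: "Sq x > 0" by (rule Sq_pos)
  define t where "t = H x y / of_real (Sq x)"
  have "0 \<le> Sq (y - t *\<^sub>C x)" by simp
  also have "\<dots> = Sq y - 2 * Re (t * H y x) + (cmod t)\<^sup>2 * Sq x"
    unfolding Sq_diff by (simp add: H_scale_right Sq_scale)
  also have "t * H y x = of_real ((cmod (H x y))\<^sup>2 / Sq x)"
    unfolding t_def H_cnj[of y x] using complex_norm_square[of "H x y"] by simp
  also have "(cmod t)\<^sup>2 * Sq x = (cmod (H x y))\<^sup>2 / Sq x"
    using Sx by (simp add: t_def norm_divide power_divide power2_eq_square)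
  finally have "(cmod (H x y))\<^sup>2 / Sq x \<le> Sq y" by simp
  then show ?thesis using Sx by (simp add: field_simps)
qed simp

lemma Sq_add_le: "Sq (x + y) \<le> 2 * Sq x + 2 * Sq y"
  using Sq_add[of x y] Sq_diff[of x y] Sq_nonneg[of "x - y"] by linarith

lemma H_bound: "d > 0 \<Longrightarrow> cmod (H x y) \<le> d * Sq x + Sq y / d"
proof -
  assume d: "d > 0"
  have "(cmod (H x y))\<^sup>2 \<le> (d * Sq x) * (Sq y / d)" using Cauchy_Schwarz[of x y] d by simp
  also have "\<dots> \<le> (d * Sq x + Sq y / d)\<^sup>2"
    using d by (simp add: power2_sum)
  finally have sq: "(cmod (H x y))\<^sup>2 \<le> (d * Sq x + Sq y / d)\<^sup>2" .
  have "0 \<le> d * Sq x + Sq y / d"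
    by (intro add_nonneg_nonneg mult_nonneg_nonneg divide_nonneg_pos) (use d in simp_all)
  then show ?thesis by (rule power2_le_imp_le[OF sq])
qed

lemma lin_cong: "(\<And>k. k < g \<Longrightarrow> c k = d k) \<Longrightarrow> lin c = lin d"
  unfolding lin_def by (intro sum.cong) auto

lemma lin_restrict [simp]: "lin (restrict c {..<g}) = lin c"
  by (intro lin_cong) auto

lemma lin_add: "lin (\<lambda>k. c k + d k) = lin c + lin d"
  by (simp add: lin_def scaleC_add_left sum.distrib)

lemma lin_scale: "lin (\<lambda>k. u * c k) = u *\<^sub>C lin c"
  by (simp add: lin_def complex_vector.scale_sum_right)

lemma H_lin: "H x (lin c) = (\<Sum>k<g. c k * H x (bk k))"
  by (simp add: lin_def H_sum_right H_scale_right)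

lemma sum_bs: "(\<Sum>b\<in>set bs. f b *\<^sub>C b) = lin (\<lambda>k. f (bk k))"
proof -
  have "distinct bs" using basis by (simp add: gaussian_basis_def)
  then have "bij_betw (nth bs) {..<g} (set bs)"
    using len by (auto simp: bij_betw_nth)
  then show ?thesis
    unfolding lin_def by (rule sum.reindex_bij_betw[symmetric, where g = "\<lambda>b. f b *\<^sub>C b"])
qed

lemma ex_fun_bs: "\<exists>f. \<forall>k<g. f (bk k) = (c k :: complex)" "(\<forall>k<g. c k \<in> gauss_ints) \<Longrightarrow> \<exists>f. (\<forall>b. f b \<in> gauss_ints) \<and> (\<forall>k<g. f (bk k) = c k)"
proof -
  have d: "distinct bs" using basis by (simp add: gaussian_basis_def)
  define f where "f b = (if b \<in> set bs then c (THE k. k < g \<and> bk k = b) else 0)" for b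
  have f: "f (bk k) = c k" if "k < g" for k
  proof -
    have "(THE j. j < g \<and> bk j = bk k) = k"
      using that d len by (intro the_equality) (auto simp: nth_eq_iff_index_eq)
    then show ?thesis using that len by (simp add: f_def)
  qed
  then show "\<exists>f. \<forall>k<g. f (bk k) = c k" by blast
  assume c: "\<forall>k<g. c k \<in> gauss_ints"
  have "f b \<in> gauss_ints" for b
  proof (cases "b \<in> set bs")
    case True
    then obtain k where "k < g" "b = bk k" using len by (auto simp: in_set_conv_nth)
    then show ?thesis using f c by auto
  qed (simp add: f_def)
  then show "\<exists>f. (\<forall>b. f b \<in> gauss_ints) \<and> (\<forall>k<g. f (bk k) = c k)" using f by blast
qed

lemma Gamma_eq: "\<Gamma> = lin ` (PiE {..<g} (\<lambda>_. gauss_ints))"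
proof -
  have 1: "\<Gamma> = {lin (\<lambda>k. f (bk k)) | f. \<forall>b. f b \<in> gauss_ints}"
    using basis by (simp add: gaussian_basis_def sum_bs)
  show ?thesis
  proof
    show "\<Gamma> \<subseteq> lin ` (PiE {..<g} (\<lambda>_. gauss_ints))"
    proof
      fix x assume "x \<in> \<Gamma>"
      then obtain f where f: "x = lin (\<lambda>k. f (bk k))" "\<forall>b. f b \<in> gauss_ints" unfolding 1 by blast
      have "restrict (\<lambda>k. f (bk k)) {..<g} \<in> PiE {..<g} (\<lambda>_. gauss_ints)" using f(2) by simp
      moreover have "x = lin (restrict (\<lambda>k. f (bk k)) {..<g})" using f(1) by simp
      ultimately show "x \<in> lin ` (PiE {..<g} (\<lambda>_. gauss_ints))" by blast
    qed
    show "lin ` (PiE {..<g} (\<lambda>_. gauss_ints)) \<subseteq> \<Gamma>"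
    proof
      fix x assume "x \<in> lin ` (PiE {..<g} (\<lambda>_. gauss_ints))"
      then obtain c where c: "x = lin c" "\<forall>k<g. c k \<in> gauss_ints" by auto
      then obtain f where "\<forall>b. f b \<in> gauss_ints" "\<forall>k<g. f (bk k) = c k" using ex_fun_bs(2) by blast
      then have "x = lin (\<lambda>k. f (bk k))" using c by (auto intro!: lin_cong)
      then show "x \<in> \<Gamma>" unfolding 1 using \<open>\<forall>b. f b \<in> gauss_ints\<close> by blast
    qed
  qed
qed

lemma lin_in_Gamma: "(\<And>k. k < g \<Longrightarrow> c k \<in> gauss_ints) \<Longrightarrow> lin c \<in> \<Gamma>"
  unfolding Gamma_eq by (rule image_eqI[where x = "restrict c {..<g}"]) auto

lemma Gamma_linE:
  assumes "x \<in> \<Gamma>" obtains c where "x = lin c" "\<And>k. k < g \<Longrightarrow> c k \<in> gauss_ints"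
  using assms unfolding Gamma_eq by auto

lemma Gamma_zero [simp]: "0 \<in> \<Gamma>"
  using lin_in_Gamma[of "\<lambda>_. 0"] by (simp add: lin_def)

lemma Gamma_add: "x \<in> \<Gamma> \<Longrightarrow> y \<in> \<Gamma> \<Longrightarrow> x + y \<in> \<Gamma>"
  by (elim Gamma_linE) (auto simp: lin_add[symmetric] intro!: lin_in_Gamma gint_add)

lemma Gamma_scale: "u \<in> gauss_ints \<Longrightarrow> x \<in> \<Gamma> \<Longrightarrow> u *\<^sub>C x \<in> \<Gamma>"
  by (elim Gamma_linE) (auto simp: lin_scale[symmetric] intro!: lin_in_Gamma gint_mult)

lemma Gamma_minus: "x \<in> \<Gamma> \<Longrightarrow> - x \<in> \<Gamma>"
  using Gamma_scale[of "- 1" x] by (simp add: gint_uminus)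

lemma Gamma_diff: "x \<in> \<Gamma> \<Longrightarrow> y \<in> \<Gamma> \<Longrightarrow> x - y \<in> \<Gamma>"
  using Gamma_add[of x "- y"] by (simp add: Gamma_minus)

lemma lin_unit: "k < g \<Longrightarrow> lin (\<lambda>j. if j = k then 1 else 0) = bk k"
  unfolding lin_def by (simp add: if_distrib[of "\<lambda>u. u *\<^sub>C _"] scaleC_one cong: if_cong)

lemma bk_in_Gamma: "k < g \<Longrightarrow> bk k \<in> \<Gamma>"
  using lin_in_Gamma[of "\<lambda>j. if j = k then 1 else 0"] lin_unit[of k] by auto

lemma lin_surj: "\<exists>c. w = lin c"
proof -
  have "w \<in> complex_vector.span (set bs)" using basis by (simp add: gaussian_basis_def)
  then obtain f where "w = (\<Sum>b\<in>set bs. f b *\<^sub>C b)"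
    by (auto simp: complex_vector.span_finite)
  then show ?thesis by (auto simp: sum_bs)
qed

text \<open>Cramer's rule: the adjugate of the Gram matrix has Gaussian integer entries, and the determinant is a
  unit.\<close>

lemma ex_dual:
  assumes \<mu>: "\<And>k. k < g \<Longrightarrow> \<mu> k \<in> gauss_ints"
  shows "\<exists>x\<in>\<Gamma>. \<forall>k<g. H (bk k) x = \<mu> k"
proof -
  define G where "G = Matrix.mat g g (\<lambda>(j, k). H (bk j) (bk k))"
  have G: "G \<in> carrier_mat g g" by (simp add: G_def)
  define d where "d = Determinant.det G"
  have d2: "d * d = 1" using gram len by (simp add: d_def G_def gram_det_def power2_eq_square)
  have Gel: "G $$ (i, j) = H (bk i) (bk j)" if "i < g" "j < g" for i j using that by (simp add: G_def)
  have Gint: "G $$ (i, j) \<in> gauss_ints" if "i < g" "j < g" for i j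
    using that by (simp add: Gel int_H bk_in_Gamma)
  have dint: "d \<in> gauss_ints" unfolding d_def by (rule gint_det[OF G Gint])
  define B where "B = adj_mat G"
  have B: "B \<in> carrier_mat g g" using adj_mat(1)[OF G] by (simp add: B_def)
  have Bint: "B $$ (i, j) \<in> gauss_ints" if "i < g" "j < g" for i j
    unfolding B_def by (rule gint_adj_mat[OF G Gint that])
  have GB: "(\<Sum>k<g. H (bk i) (bk k) * B $$ (k, j)) = (if i = j then d else 0)" if "i < g" "j < g" for i j
  proof -
    have "(G * B) $$ (i, j) = (\<Sum>k<g. G $$ (i, k) * B $$ (k, j))"
      using that G B by (simp add: scalar_prod_def atLeast0LessThan)
    also have "\<dots> = (\<Sum>k<g. H (bk i) (bk k) * B $$ (k, j))"
      using that by (intro sum.cong) (auto simp: Gel)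
    also have "(G * B) $$ (i, j) = (if i = j then d else 0)"
      unfolding B_def adj_mat(2)[OF G] using that by (simp add: d_def)
    finally show ?thesis ..
  qed
  define c where "c k = d * (\<Sum>j<g. B $$ (k, j) * \<mu> j)" for k
  have "H (bk i) (lin c) = \<mu> i" if i: "i < g" for i
  proof -
    have "H (bk i) (lin c) = (\<Sum>k<g. \<Sum>j<g. d * \<mu> j * (H (bk i) (bk k) * B $$ (k, j)))"
      unfolding H_lin c_def sum_distrib_left sum_distrib_right by (simp add: mult_ac)
    also have "\<dots> = (\<Sum>j<g. d * \<mu> j * (\<Sum>k<g. H (bk i) (bk k) * B $$ (k, j)))"
      by (subst sum.swap) (simp add: sum_distrib_left)
    also have "\<dots> = (\<Sum>j<g. d * \<mu> j * (if i = j then d else 0))"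
      using i by (intro sum.cong) (auto simp: GB)
    also have "\<dots> = d * \<mu> i * d" using i by (simp add: if_distrib[of "\<lambda>x. _ * x"] cong: if_cong)
    finally show ?thesis using d2 by (metis mult.assoc mult.commute mult_1)
  qed
  moreover have "lin c \<in> \<Gamma>"
    unfolding c_def by (intro lin_in_Gamma gint_mult dint gint_sum Bint \<mu>) auto
  ultimately show ?thesis by blast
qed

definition Dv :: "nat \<Rightarrow> 'v" where
  "Dv k = (SOME x. x \<in> \<Gamma> \<and> (\<forall>j<g. H (bk j) x = (if j = k then 1 else 0)))"

lemma Dv: "Dv k \<in> \<Gamma>" "j < g \<Longrightarrow> H (bk j) (Dv k) = (if j = k then 1 else 0)"
proof -
  have "\<exists>x. x \<in> \<Gamma> \<and> (\<forall>j<g. H (bk j) x = (if j = k then 1 else 0))"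
  proof -
    have "\<exists>x\<in>\<Gamma>. \<forall>j<g. H (bk j) x = (if j = k then 1 else 0)"
      by (rule ex_dual) auto
    then show ?thesis by blast
  qed
  then have "Dv k \<in> \<Gamma> \<and> (\<forall>j<g. H (bk j) (Dv k) = (if j = k then 1 else 0))"
    unfolding Dv_def by (rule someI_ex)
  then show "Dv k \<in> \<Gamma>" "j < g \<Longrightarrow> H (bk j) (Dv k) = (if j = k then 1 else 0)" by auto
qed

lemma H_Dv_lin: "k < g \<Longrightarrow> H (Dv k) (lin c) = c k"
proof -
  assume k: "k < g"
  have "H (Dv k) (lin c) = (\<Sum>j<g. c j * (if j = k then 1 else 0))"
    unfolding H_lin
  proof (rule sum.cong)
    fix j assume "j \<in> {..<g}"
    then show "c j * H (Dv k) (bk j) = c j * (if j = k then 1 else 0)"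
      using Dv(2)[of j k] H_cnj[of "Dv k" "bk j"] by simp
  qed simp
  then show ?thesis using k by (simp add: if_distrib[of "\<lambda>x. _ * x"] cong: if_cong)
qed

lemma lin_H_Dv: "lin (\<lambda>k. H (Dv k) w) = w"
proof -
  obtain c where "w = lin c" using lin_surj by blast
  then show ?thesis by (auto intro!: lin_cong simp: H_Dv_lin)
qed

lemma inj_lin: "inj_on lin (PiE {..<g} A)"
proof (rule inj_onI)
  fix c d assume cd: "c \<in> PiE {..<g} A" "d \<in> PiE {..<g} A" "lin c = lin d"
  have "c k = d k" if "k < g" for k using H_Dv_lin[OF that, of c] H_Dv_lin[OF that, of d] cd by simp
  then show "c = d" using cd by (intro PiE_ext[of c "{..<g}" A d]) auto
qed

lemma bij_lin: "bij_betw lin (PiE {..<g} (\<lambda>_. gauss_ints)) \<Gamma>"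
  using inj_lin Gamma_eq by (auto simp: bij_betw_def)

text \<open>Self-duality of the lattice. Injectivity is positivity of the form, surjectivity is unimodularity.\<close>

lemma bij_dual: "bij_betw (\<lambda>x. \<lambda>k\<in>{..<g}. H (bk k) x) \<Gamma> (PiE {..<g} (\<lambda>_. gauss_ints))"
  unfolding bij_betw_def
proof
  show "inj_on (\<lambda>x. \<lambda>k\<in>{..<g}. H (bk k) x) \<Gamma>"
  proof (rule inj_onI)
    fix x y assume "x \<in> \<Gamma>" "y \<in> \<Gamma>" "(\<lambda>k\<in>{..<g}. H (bk k) x) = (\<lambda>k\<in>{..<g}. H (bk k) y)"
    then have "H (bk k) x = H (bk k) y" if "k < g" for k
      using that by (metis lessThan_iff restrict_apply')
    then have *: "H (bk k) (x - y) = 0" if "k < g" for k using that by (simp add: H_diff_right)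
    obtain c where c: "x - y = lin c" using lin_surj by blast
    have "H (x - y) (x - y) = (\<Sum>k<g. c k * H (x - y) (bk k))"
      by (subst (2) c) (rule H_lin)
    also have "\<dots> = 0"
    proof (rule sum.neutral, rule ballI)
      fix k assume "k \<in> {..<g}"
      then show "c k * H (x - y) (bk k) = 0" using *[of k] H_cnj[of "x - y" "bk k"] by simp
    qed
    finally have "Sq (x - y) = 0" by (simp add: Sq_def)
    then show "x = y" using Sq_pos[of "x - y"] by force
  qed
  show "(\<lambda>x. \<lambda>k\<in>{..<g}. H (bk k) x) ` \<Gamma> = PiE {..<g} (\<lambda>_. gauss_ints)"
  proof
    show "(\<lambda>x. \<lambda>k\<in>{..<g}. H (bk k) x) ` \<Gamma> \<subseteq> PiE {..<g} (\<lambda>_. gauss_ints)"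
      by (rule image_subsetI) (simp add: int_H bk_in_Gamma)
    show "PiE {..<g} (\<lambda>_. gauss_ints) \<subseteq> (\<lambda>x. \<lambda>k\<in>{..<g}. H (bk k) x) ` \<Gamma>"
    proof
      fix \<mu> assume \<mu>: "\<mu> \<in> PiE {..<g} (\<lambda>_. gauss_ints)"
      then obtain x where "x \<in> \<Gamma>" "\<forall>k<g. H (bk k) x = \<mu> k" using ex_dual[of \<mu>] by auto
      then show "\<mu> \<in> (\<lambda>x. \<lambda>k\<in>{..<g}. H (bk k) x) ` \<Gamma>"
        using \<mu> by (intro image_eqI[where x = x]) (auto simp: fun_eq_iff PiE_iff extensional_def)
    qed
  qed
qed

text \<open>A lower bound for \<open>Sq\<close> in terms of the coordinates, from the Cauchy-Schwarz inequality with the dual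
  vectors; adding 1 keeps the denominator positive in dimension 0.\<close>

definition beta0 :: real where "beta0 = 1 / ((\<Sum>k<g. Sq (Dv k)) + 1)"

lemma beta0_pos: "beta0 > 0"
  unfolding beta0_def by (intro divide_pos_pos add_nonneg_pos sum_nonneg) auto

lemma Sq_lin_lower: "beta0 * (\<Sum>k<g. (cmod (c k))\<^sup>2) \<le> Sq (lin c)"
proof -
  let ?M = "\<Sum>k<g. Sq (Dv k)"
  have M: "?M \<ge> 0" by (intro sum_nonneg) auto
  have "(\<Sum>k<g. (cmod (c k))\<^sup>2) \<le> (\<Sum>k<g. Sq (Dv k) * Sq (lin c))"
    using Cauchy_Schwarz[of "Dv _" "lin c"] by (intro sum_mono) (metis H_Dv_lin lessThan_iff)
  also have "\<dots> = ?M * Sq (lin c)" by (simp add: sum_distrib_right)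
  also have "\<dots> \<le> (?M + 1) * Sq (lin c)" by (intro mult_right_mono) auto
  finally show ?thesis using M by (simp add: beta0_def field_simps)
qed

lemma exp_Sq_le_prod: "a \<ge> 0 \<Longrightarrow> exp (- a * Sq (lin c)) \<le> (\<Prod>k<g. exp (- (a * beta0) * (cmod (c k))\<^sup>2))"
  using mult_left_mono[OF Sq_lin_lower[of c], of a]
  by (simp add: exp_sum[symmetric] sum_distrib_left sum_negf mult.assoc)

lemma summable_exp_Sq: "a > 0 \<Longrightarrow> (\<lambda>x. exp (- a * Sq x)) summable_on \<Gamma>"
proof -
  assume a: "a > 0"
  have "(\<lambda>c. exp (- a * Sq (lin c))) summable_on (PiE {..<g} (\<lambda>_. gauss_ints))"
    using a beta0_pos
    by (intro summable_on_comparison_test[OF summable_on_exp_gint_PiE[of "a * beta0" "{..<g}"]] exp_Sq_le_prod) auto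
  then show ?thesis
    using summable_on_reindex_bij_betw[OF bij_lin, of "\<lambda>x. exp (- a * Sq x)"] by simp
qed

end

section \<open>Gaussian means of holomorphic functions\<close>

lemma norm_exp_minus_one_le:
  fixes z :: complex
  shows "norm (exp z - 1) \<le> norm z * exp (norm z)"
proof -
  have "norm (exp z - exp 0) \<le> exp (norm z) * norm (z - 0)"
  proof (rule field_differentiable_bound[where S = "cball 0 (norm z)" and f' = exp])
    show "convex (cball (0 :: complex) (norm z))" by simp
    show "(exp has_field_derivative exp w) (at w within cball 0 (norm z))" if "w \<in> cball 0 (norm z)" for w :: complex
      by (rule DERIV_subset[OF DERIV_exp]) simp
    show "norm (exp w) \<le> exp (norm z)" if "w \<in> cball 0 (norm z)" for w :: complex
    proof -
      have "norm (exp w) \<le> exp (norm w)" by (rule norm_exp)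
      also have "\<dots> \<le> exp (norm z)" using that by simp
      finally show ?thesis .
    qed
  qed auto
  then show ?thesis by (simp add: mult.commute)
qed

lemma sum_roots_of_unity:
  assumes "n > 0" "n < N"
  shows "(\<Sum>j<N. cis (2 * pi * real j / real N) ^ n) = 0"
proof -
  define w where "w = cis (2 * pi * real n / real N)"
  have "(\<Sum>j<N. cis (2 * pi * real j / real N) ^ n) = (\<Sum>j<N. w ^ j)"
    by (intro sum.cong) (simp_all add: w_def Complex.DeMoivre mult_ac)
  also have "w \<noteq> 1"
  proof
    assume "w = 1"
    then have "cos (2 * pi * real n / real N) = 1" by (simp add: w_def complex_eq_iff)
    then obtain k :: int where "2 * pi * real n / real N = of_int k * 2 * pi"
      by (auto simp: cos_one_2pi_int)
    then have "real n = of_int k * real N" using assms by (simp add: field_simps)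
    then have "int n = k * int N" by (metis of_int_eq_iff of_int_mult of_int_of_nat_eq)
    then have "int N dvd int n" by simp
    then have "N dvd n" by simp
    then show False using assms by (auto dest: dvd_imp_le)
  qed
  then have "(\<Sum>j<N. w ^ j) = (w ^ N - 1) / (w - 1)"
    by (rule geometric_sum)
  also have "w ^ N = 1"
    using assms by (simp add: w_def Complex.DeMoivre cis_multiple_2pi)
  finally show ?thesis by simp
qed

text \<open>Averaging over the \<open>N\<close>-th roots of unity removes from the power series all terms of degree not
  divisible by \<open>N\<close>. This replaces a contour integral by averages of finitely many rotations, each of which
  preserves Gaussian integrals.\<close>

lemma mean_roots_of_unity:
  assumes hol: "f holomorphic_on UNIV"
  shows "(\<lambda>N. (\<Sum>j<N. f (cis (2 * pi * real j / real N))) / of_nat N) \<longlonglongrightarrow> f 0"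
proof -
  define a where "a n = (deriv ^^ n) f 0 / fact n" for n
  have sums: "(\<lambda>n. a n * w ^ n) sums f w" for w
    using holomorphic_power_series[of f 0 "cmod w + 1" w] holomorphic_on_subset[OF hol]
    by (auto simp: a_def)
  have a0: "a 0 = f 0" by (simp add: a_def)
  have "summable (\<lambda>n. a n * of_real 2 ^ n)" using sums[of "of_real 2"] by (rule sums_summable)
  then have "summable (\<lambda>n. norm (a n))"
  proof -
    have "summable (\<lambda>n. norm (a n * 1 ^ n))"
      using sums_summable[OF sums[of 2]] by (rule powser_insidea) simp
    then show ?thesis by simp
  qed
  note abs_summable = this
  have avg: "(\<Sum>j<N. f (cis (2 * pi * real j / real N))) / of_nat N = (\<Sum>n. a n * ((\<Sum>j<N. cis (2 * pi * real j / real N) ^ n) / of_nat N))" for N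
  proof -
    have "(\<lambda>n. \<Sum>j<N. a n * cis (2 * pi * real j / real N) ^ n) sums (\<Sum>j<N. f (cis (2 * pi * real j / real N)))"
      by (rule sums_sum) (rule sums)
    then have "(\<lambda>n. (\<Sum>j<N. a n * cis (2 * pi * real j / real N) ^ n) / of_nat N) sums ((\<Sum>j<N. f (cis (2 * pi * real j / real N))) / of_nat N)"
      by (rule sums_divide)
    then show ?thesis by (simp add: sums_iff sum_distrib_left)
  qed
  define b :: "nat \<Rightarrow> complex" where "b n = (if n = 0 then a 0 else 0)" for n
  have "((\<lambda>N. \<Sum>n. a n * ((\<Sum>j<N. cis (2 * pi * real j / real N) ^ n) / of_nat N)) \<longlonglongrightarrow> suminf b)"
  proof -
    have lim: "((\<lambda>N. a n * ((\<Sum>j<N. cis (2 * pi * real j / real N) ^ n) / of_nat N)) \<longlongrightarrow> b n) sequentially" for n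
    proof (rule tendsto_eventually)
      show "eventually (\<lambda>N. a n * ((\<Sum>j<N. cis (2 * pi * real j / real N) ^ n) / of_nat N) = b n) sequentially"
        using eventually_gt_at_top[of n]
        by eventually_elim (auto simp: b_def sum_roots_of_unity)
    qed
    have bound: "norm (a n * ((\<Sum>j<N. cis (2 * pi * real j / real N) ^ n) / of_nat N)) \<le> norm (a n)" for n N
    proof -
      have "norm (\<Sum>j<N. cis (2 * pi * real j / real N) ^ n) \<le> (\<Sum>j<N. 1)"
        by (rule sum_norm_le) (simp add: norm_power)
      then have "norm ((\<Sum>j<N. cis (2 * pi * real j / real N) ^ n) / of_nat N) \<le> 1"
        by (cases "N = 0") (simp_all add: norm_divide field_simps)
      then have "norm (a n) * norm ((\<Sum>j<N. cis (2 * pi * real j / real N) ^ n) / of_nat N) \<le> norm (a n) * 1"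
        by (intro mult_left_mono) auto
      then show ?thesis by (simp only: norm_mult mult_1_right)
    qed
    have ev: "eventually (\<lambda>(n, N). norm (a n * ((\<Sum>j<N. cis (2 * pi * real j / real N) ^ n) / of_nat N)) \<le> norm (a n)) (at_top \<times>\<^sub>F sequentially)"
      by (rule always_eventually) (use bound in auto)
    show ?thesis
      using tannerys_theorem[OF lim ev abs_summable] by simp
  qed
  moreover have "suminf b = f 0"
  proof -
    have "suminf b = (\<Sum>n\<in>{0}. b n)" by (rule suminf_finite) (auto simp: b_def)
    then show ?thesis by (simp add: b_def a0)
  qed
  ultimately show ?thesis unfolding avg by simp
qed

context gauss_lat
begin

abbreviation "P \<equiv> cmeas g"

lemma bounded_linear_scaleC: "bounded_linear (\<lambda>c. c *\<^sub>C (x :: 'v))"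
proof (rule bounded_linear_intro[of _ "norm x"])
  fix r :: real and c :: complex
  show "(r *\<^sub>R c) *\<^sub>C x = r *\<^sub>R c *\<^sub>C x" by (simp add: scaleR_scaleC scaleC_scaleC scaleR_conv_of_real)
qed (simp_all add: scaleC_add_left norm_scaleC)

lemma continuous_lin: "continuous_on UNIV lin"
proof -
  have "continuous_on UNIV (\<lambda>c. c k *\<^sub>C bk k)" for k
    by (rule bounded_linear.continuous_on[OF bounded_linear_scaleC]) simp
  then show ?thesis unfolding lin_def by (intro continuous_on_sum)
qed

lemma continuous_H_lin: "continuous_on UNIV (\<lambda>c. H x (lin c))"
  unfolding H_lin by (intro continuous_on_sum continuous_on_mult continuous_on_const) simp

lemma Sq_lin: "Sq (lin c) = Re (\<Sum>k<g. cnj (c k) * H (bk k) (lin c))"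
proof -
  have "H (lin c) (lin c) = (\<Sum>k<g. c k * H (lin c) (bk k))" by (rule H_lin)
  then have "cnj (H (lin c) (lin c)) = (\<Sum>k<g. cnj (c k) * cnj (H (lin c) (bk k)))" by simp
  also have "\<dots> = (\<Sum>k<g. cnj (c k) * H (bk k) (lin c))"
    by (intro sum.cong) (simp_all add: H_cnj[of "bk _" "lin c"])
  finally show ?thesis by (simp add: Sq_def complex_eq_iff)
qed

lemma continuous_Sq_lin: "continuous_on UNIV (\<lambda>c. Sq (lin c))"
  unfolding Sq_lin
  by (intro continuous_on_Re continuous_on_sum continuous_on_mult continuous_on_cnj continuous_H_lin) simp

lemma measurable_lin_continuous:
  fixes f :: "(nat \<Rightarrow> complex) \<Rightarrow> complex"
  assumes "continuous_on UNIV f" "\<And>c. f (restrict c {..<g}) = f c"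
  shows "f \<in> borel_measurable P"
  by (rule measurable_PiM_continuous[OF assms(2,1)])

lemma measurable_Sq_lin [measurable]: "(\<lambda>c. Sq (lin c)) \<in> borel_measurable P"
proof -
  have "(\<lambda>c. complex_of_real (Sq (lin c))) \<in> borel_measurable P"
    by (rule measurable_lin_continuous) (auto intro!: continuous_on_of_real continuous_Sq_lin)
  then have "(\<lambda>c. Re (complex_of_real (Sq (lin c)))) \<in> borel_measurable P" by measurable
  then show ?thesis by simp
qed

lemma integrable_exp_Sq: "a > 0 \<Longrightarrow> integrable P (\<lambda>c. exp (- a * Sq (lin c)))"
proof (rule Bochner_Integration.integrable_bound)
  assume a: "a > 0"
  show "integrable P (\<lambda>c. \<Prod>k<g. exp (- (a * beta0) * (cmod (c k))\<^sup>2))"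
    using a beta0_pos by (intro lborel_prod.product_integrable_prod integrable_exp_cmod) auto
  show "AE c in P. norm (exp (- a * Sq (lin c))) \<le> norm (\<Prod>k<g. exp (- (a * beta0) * (cmod (c k))\<^sup>2))"
    using exp_Sq_le_prod a by (intro AE_I2) (simp add: prod_nonneg)
qed measurable

definition J :: "complex \<Rightarrow> complex" where
  "J s = (\<integral>c. exp (- (of_real pi * s * of_real (Sq (lin c)))) \<partial>P)"

lemma norm_exp_Sq: "norm (exp (- (of_real pi * s * of_real (Sq w)))) = exp (- (pi * Re s) * Sq w)"
  by simp

lemma measurable_exp_Sq [measurable]: "(\<lambda>c. exp (- (of_real pi * s * of_real (Sq (lin c)))) :: complex) \<in> borel_measurable P"
  by measurable

lemma integrable_J: "Re s > 0 \<Longrightarrow> integrable P (\<lambda>c. exp (- (of_real pi * s * of_real (Sq (lin c)))))"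
  by (rule Bochner_Integration.integrable_bound[OF integrable_exp_Sq[of "pi * Re s"]]) (auto simp: norm_exp_Sq)

lemma J_real_nonneg: "s > 0 \<Longrightarrow> \<exists>r\<ge>0. J (of_real s) = of_real r"
proof -
  assume s: "s > 0"
  have "J (of_real s) = (\<integral>c. complex_of_real (exp (- (pi * s) * Sq (lin c))) \<partial>P)"
    unfolding J_def by (intro Bochner_Integration.integral_cong) (simp_all add: exp_of_real[symmetric])
  also have "\<dots> = of_real (\<integral>c. exp (- (pi * s) * Sq (lin c)) \<partial>P)" by (rule integral_complex_of_real)
  finally show ?thesis
    by (intro exI[of _ "\<integral>c. exp (- (pi * s) * Sq (lin c)) \<partial>P"]) (auto intro!: integral_nonneg_AE)
qed

lemma integral_lin_affine:
  fixes f :: "'v \<Rightarrow> complex"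
  assumes f: "(\<lambda>c. f (lin c)) \<in> borel_measurable P" and u: "u \<noteq> 0"
  shows "(\<integral>c. f (lin c) \<partial>P) = of_real ((cmod u)\<^sup>2 ^ g) * (\<integral>c. f (u *\<^sub>C lin c + w) \<partial>P)"
proof -
  have eq: "lin (\<lambda>k. u * c k + H (Dv k) w) = u *\<^sub>C lin c + w" for c
    using lin_add[of "\<lambda>k. u * c k" "\<lambda>k. H (Dv k) w"] by (simp add: lin_scale lin_H_Dv)
  show ?thesis
    using integral_PiM_complex_affine[OF _ u f, of "\<lambda>k. H (Dv k) w"] by (simp add: eq)
qed

lemma J_scale: "t > 0 \<Longrightarrow> J s = of_real (t ^ g) * J (of_real t * s)"
proof -
  assume t: "t > 0"
  have m: "(cmod (of_real (sqrt t)))\<^sup>2 = t" using t by simp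
  have "J s = of_real ((cmod (of_real (sqrt t)))\<^sup>2 ^ g) * (\<integral>c. exp (- (of_real pi * s * of_real (Sq (of_real (sqrt t) *\<^sub>C lin c + 0)))) \<partial>P)"
    unfolding J_def using t by (intro integral_lin_affine) auto
  then show ?thesis
    unfolding m J_def using t by (simp add: Sq_scale mult_ac)
qed

text \<open>Differentiation under the integral sign: the difference quotients of the exponential are dominated by a
  Gaussian of slower decay.\<close>

lemma J_deriv:
  assumes s: "Re s > 0"
  shows "(J has_field_derivative (\<integral>c. - of_real (pi * Sq (lin c)) * exp (- (of_real pi * s * of_real (Sq (lin c)))) \<partial>P)) (at s)"
  unfolding has_field_derivative_iff
proof (subst tendsto_at_iff_sequentially, intro allI impI)
  fix X :: "nat \<Rightarrow> complex"
  assume X: "\<forall>i. X i \<in> UNIV - {s}" and lim: "X \<longlonglongrightarrow> s"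
  define r where "r = Re s / 2"
  have r: "r > 0" using s by (simp add: r_def)
  let ?e = "\<lambda>s c. exp (- (of_real pi * s * of_real (Sq (lin c)))) :: complex"
  let ?q = "\<lambda>i c. (if cmod (X i - s) < r then (?e (X i) c - ?e s c) / (X i - s) else 0)"
  define D where "D = (\<integral>c. - of_real (pi * Sq (lin c)) * ?e s c \<partial>P)"
  have near: "eventually (\<lambda>i. cmod (X i - s) < r) sequentially"
    using tendstoD[OF lim r] by (simp add: dist_norm)
  have "(\<lambda>i. \<integral>c. ?q i c \<partial>P) \<longlonglongrightarrow> D"
    unfolding D_def
  proof (rule integral_dominated_convergence[where w = "\<lambda>c. (2 / r) * exp (- (pi * r / 2) * Sq (lin c))"])
    show "integrable P (\<lambda>c. (2 / r) * exp (- (pi * r / 2) * Sq (lin c)))"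
      using r by (intro integrable_mult_right integrable_exp_Sq) auto
    show "AE c in P. (\<lambda>i. ?q i c) \<longlonglongrightarrow> - of_real (pi * Sq (lin c)) * ?e s c"
    proof (rule AE_I2)
      fix c
      have "((\<lambda>z. ?e z c) has_field_derivative (- of_real (pi * Sq (lin c)) * ?e s c)) (at s)"
        by (auto intro!: derivative_eq_intros)
      then have "((\<lambda>z. (?e z c - ?e s c) / (z - s)) \<longlongrightarrow> - of_real (pi * Sq (lin c)) * ?e s c) (at s)"
        by (simp add: has_field_derivative_iff)
      then have "(\<lambda>i. (?e (X i) c - ?e s c) / (X i - s)) \<longlonglongrightarrow> - of_real (pi * Sq (lin c)) * ?e s c"
        using X lim unfolding tendsto_at_iff_sequentially comp_def by blast
      then show "(\<lambda>i. ?q i c) \<longlonglongrightarrow> - of_real (pi * Sq (lin c)) * ?e s c"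
        by (rule Lim_transform_eventually) (use near in \<open>eventually_elim, simp\<close>)
    qed
    fix i
    show "AE c in P. norm (?q i c) \<le> (2 / r) * exp (- (pi * r / 2) * Sq (lin c))"
    proof (rule AE_I2)
      fix c
      define S where "S = Sq (lin c)"
      have S: "S \<ge> 0" by (simp add: S_def)
      show "norm (?q i c) \<le> (2 / r) * exp (- (pi * r / 2) * Sq (lin c))"
      proof (cases "cmod (X i - s) < r")
        case True
        define h where "h = X i - s"
        have h: "cmod h < r" "h \<noteq> 0" using True X by (auto simp: h_def)
        have "?e (X i) c - ?e s c = ?e s c * (exp (- (of_real pi * h * of_real S)) - 1)"
          by (simp add: h_def S_def right_diff_distrib exp_add[symmetric] algebra_simps)
        then have "norm (?e (X i) c - ?e s c) = exp (- (pi * Re s) * S) * norm (exp (- (of_real pi * h * of_real S)) - 1)"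
          by (simp add: norm_mult S_def)
        also have "\<dots> \<le> exp (- (pi * Re s) * S) * (norm (- (of_real pi * h * of_real S)) * exp (norm (- (of_real pi * h * of_real S))))"
          by (intro mult_left_mono norm_exp_minus_one_le) simp
        also have "norm (- (of_real pi * h * of_real S)) = pi * cmod h * S"
          using S by (simp add: norm_mult)
        also have "exp (- (pi * Re s) * S) * (pi * cmod h * S * exp (pi * cmod h * S)) \<le> exp (- (pi * Re s) * S) * (pi * cmod h * S * exp (pi * r * S))"
          using S h by (intro mult_left_mono) (auto intro!: mult_right_mono)
        also have "\<dots> = cmod h * (pi * S * exp (- (pi * r) * S))"
          by (simp add: r_def exp_add[symmetric] algebra_simps)
        finally have "norm ((?e (X i) c - ?e s c) / h) \<le> pi * S * exp (- (pi * r) * S)"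
          using h by (simp add: norm_divide field_simps)
        also have "\<dots> = (2 / r) * ((pi * r / 2 * S) * exp (- (pi * r / 2) * S)) * exp (- (pi * r / 2) * S)"
          using r by (simp add: mult_exp_exp)
        also have "\<dots> \<le> (2 / r) * 1 * exp (- (pi * r / 2) * S)"
        proof -
          have "x * exp (- x) \<le> 1" for x :: real
          proof -
            have "x \<le> exp x" using exp_ge_add_one_self[of x] by linarith
            then show ?thesis by (simp add: exp_minus field_simps)
          qed
          from this[of "pi * r / 2 * S"] show ?thesis using r by (intro mult_right_mono mult_left_mono) auto
        qed
        finally show ?thesis using True by (simp add: h_def S_def)
      qed (use r in simp)
    qed
  qed measurable
  moreover have "eventually (\<lambda>i. (\<integral>c. ?q i c \<partial>P) = (J (X i) - J s) / (X i - s)) sequentially"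
    using near
  proof eventually_elim
    case (elim i)
    have "\<bar>Re (X i - s)\<bar> < r" using elim abs_Re_le_cmod[of "X i - s"] by linarith
    then have "\<bar>Re (X i) - Re s\<bar> < Re s / 2" by (simp add: r_def)
    then have "Re (X i) > 0" using s by linarith
    then have "(\<integral>c. ?e (X i) c - ?e s c \<partial>P) = J (X i) - J s"
      unfolding J_def using s by (intro Bochner_Integration.integral_diff integrable_J)
    then show ?case using elim by simp
  qed
  ultimately have "(\<lambda>i. (J (X i) - J s) / (X i - s)) \<longlonglongrightarrow> D"
    by (rule Lim_transform_eventually)
  then show "((\<lambda>y. (J y - J s) / (y - s)) \<circ> X) \<longlonglongrightarrow> (\<integral>c. - of_real (pi * Sq (lin c)) * ?e s c \<partial>P)"
    by (simp add: D_def comp_def)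
qed

text \<open>By \<open>J_scale\<close>, \<open>s ^ g * J s\<close> is constant along rays from 0, so its complex derivative vanishes on the half
  plane.\<close>

lemma J_eq:
  assumes s: "Re s > 0"
  shows "J s = J 1 / s ^ g"
proof -
  define W where "W z = z ^ g * J z" for z
  have "\<exists>c. \<forall>z\<in>{z. Re z > 0}. W z = c"
  proof (rule has_field_derivative_zero_constant)
    show "convex {z. Re z > 0}" by (rule convex_halfspace_Re_gt)
    fix z assume "z \<in> {z. Re z > 0}"
    then have z: "Re z > 0" by simp
    from J_deriv[OF z] obtain D where D: "(J has_field_derivative D) (at z)" by blast
    then have "(W has_field_derivative (of_nat g * z ^ (g - 1) * J z + z ^ g * D)) (at z)"
      unfolding W_def by (auto intro!: derivative_eq_intros)
    then obtain D' where D': "(W has_field_derivative D') (at z)" by blast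
    have "((\<lambda>t. W (of_real t * z)) has_vector_derivative z * D') (at 1)"
    proof -
      have "((\<lambda>t. of_real t * z) has_vector_derivative z) (at 1)"
        by (auto intro!: derivative_eq_intros simp: has_vector_derivative_def scaleR_conv_of_real)
      from field_vector_diff_chain_at[OF this, of W D'] D' show ?thesis by (simp add: comp_def)
    qed
    moreover have "((\<lambda>t. W (of_real t * z)) has_vector_derivative 0) (at 1)"
    proof (rule has_vector_derivative_transform_within_open[where f = "\<lambda>_. W z" and S = "{0<..}"])
      fix t :: real assume "t \<in> {0<..}"
      then show "W z = W (of_real t * z)"
        using J_scale[of t z] by (simp add: W_def power_mult_distrib)
    qed auto
    ultimately have "z * D' = 0" by (rule vector_derivative_unique_at)
    moreover have "z \<noteq> 0" using z by auto
    ultimately have "D' = 0" by simp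
    then show "(W has_field_derivative 0) (at z within {z. Re z > 0})"
      using D' has_field_derivative_at_within by blast
  qed
  then have "W s = W 1" using s by force
  moreover have "s \<noteq> 0" using s by auto
  ultimately show ?thesis by (simp add: W_def field_simps)
qed

text \<open>Gaussian measures are invariant under multiplication by roots of unity, so \<open>f\<close> may be replaced by its
  averages over such rotations; by \<open>mean_roots_of_unity\<close> these tend to \<open>f 0\<close>.\<close>

lemma mean_value_Gaussian:
  fixes f :: "'v \<Rightarrow> complex"
  assumes hol: "\<And>v. (\<lambda>t. f (t *\<^sub>C v)) holomorphic_on UNIV"
    and cont: "continuous_on UNIV (\<lambda>c. f (lin c))"
    and growth: "\<And>w. norm (f w) \<le> K * exp (b * Sq w)" and b: "b < pi * Re s"
  shows "(\<integral>c. f (lin c) * exp (- (of_real pi * s * of_real (Sq (lin c)))) \<partial>P) = f 0 * J s"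
proof -
  let ?e = "\<lambda>c. exp (- (of_real pi * s * of_real (Sq (lin c)))) :: complex"
  define I where "I = (\<integral>c. f (lin c) * ?e c \<partial>P)"
  have K: "K \<ge> 0"
  proof -
    have "0 \<le> K * exp (b * Sq 0)" by (rule order_trans[OF norm_ge_zero growth])
    then show ?thesis by simp
  qed
  have meas: "(\<lambda>c. f (u *\<^sub>C lin c)) \<in> borel_measurable P" for u
  proof (rule measurable_lin_continuous)
    have "continuous_on UNIV (\<lambda>c. f (lin (\<lambda>k. u * c k)))"
      by (rule continuous_on_compose2[OF cont]) (auto intro!: continuous_on_coordinatewise_then_product continuous_on_mult)
    then show "continuous_on UNIV (\<lambda>c. f (u *\<^sub>C lin c))" by (simp add: lin_scale)
  qed simp
  note [measurable] = meas meas[of 1, unfolded scaleC_one]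
  have dom: "norm (f (u *\<^sub>C lin c) * ?e c) \<le> K * exp (- (pi * Re s - b) * Sq (lin c))" if "cmod u = 1" for u c
  proof -
    have "norm (f (u *\<^sub>C lin c) * ?e c) = norm (f (u *\<^sub>C lin c)) * exp (- (pi * Re s) * Sq (lin c))"
      by (simp add: norm_mult)
    also have "\<dots> \<le> K * exp (b * Sq (u *\<^sub>C lin c)) * exp (- (pi * Re s) * Sq (lin c))"
      by (intro mult_right_mono growth) simp
    also have "\<dots> = K * exp (- (pi * Re s - b) * Sq (lin c))"
      using that by (simp add: Sq_scale exp_add[symmetric] algebra_simps)
    finally show ?thesis .
  qed
  have int: "integrable P (\<lambda>c. f (u *\<^sub>C lin c) * ?e c)" if "cmod u = 1" for u
  proof (rule Bochner_Integration.integrable_bound)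
    show "integrable P (\<lambda>c. K * exp (- (pi * Re s - b) * Sq (lin c)))"
      using b by (intro integrable_mult_right integrable_exp_Sq) simp
    show "AE c in P. norm (f (u *\<^sub>C lin c) * ?e c) \<le> norm (K * exp (- (pi * Re s - b) * Sq (lin c)))"
      using dom[OF that] K by (intro AE_I2) simp
  qed measurable
  have rot: "(\<integral>c. f (u *\<^sub>C lin c) * ?e c \<partial>P) = I" if "cmod u = 1" for u
  proof -
    have "u \<noteq> 0" using that by auto
    then have "(\<integral>c. f (lin c) * ?e c \<partial>P) = of_real ((cmod u)\<^sup>2 ^ g) * (\<integral>c. f (u *\<^sub>C lin c + 0) * exp (- (of_real pi * s * of_real (Sq (u *\<^sub>C lin c + 0)))) \<partial>P)"
      by (intro integral_lin_affine[where f = "\<lambda>w. f w * exp (- (of_real pi * s * of_real (Sq w)))"]) measurable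
    then show ?thesis using that by (simp add: I_def Sq_scale)
  qed
  let ?u = "\<lambda>N j. cis (2 * pi * real j / real N)"
  define A where "A N c = (\<Sum>j<N. f (?u N j *\<^sub>C lin c)) / of_nat N" for N c
  have avg: "(\<integral>c. A (Suc N) c * ?e c \<partial>P) = I" for N
  proof -
    have "(\<integral>c. A (Suc N) c * ?e c \<partial>P) = (\<integral>c. (\<Sum>j<Suc N. f (?u (Suc N) j *\<^sub>C lin c) * ?e c) / of_nat (Suc N) \<partial>P)"
      by (simp add: A_def sum_distrib_right del: sum.lessThan_Suc)
    also have "\<dots> = (\<Sum>j<Suc N. I) / of_nat (Suc N)"
      by (simp only: integral_divide_zero, subst Bochner_Integration.integral_sum) (simp_all add: int rot del: sum.lessThan_Suc)
    also have "\<dots> = I" by (simp del: sum.lessThan_Suc of_nat_Suc)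
    finally show ?thesis .
  qed
  have "(\<lambda>N. \<integral>c. A (Suc N) c * ?e c \<partial>P) \<longlonglongrightarrow> (\<integral>c. f 0 * ?e c \<partial>P)"
  proof (rule integral_dominated_convergence[where w = "\<lambda>c. K * exp (- (pi * Re s - b) * Sq (lin c))"])
    show "integrable P (\<lambda>c. K * exp (- (pi * Re s - b) * Sq (lin c)))"
      using b by (intro integrable_mult_right integrable_exp_Sq) simp
    show "AE c in P. (\<lambda>N. A (Suc N) c * ?e c) \<longlonglongrightarrow> f 0 * ?e c"
    proof (rule AE_I2)
      fix c
      have "(\<lambda>N. A N c) \<longlonglongrightarrow> f (0 *\<^sub>C lin c)"
        unfolding A_def by (rule mean_roots_of_unity[OF hol])
      then have "(\<lambda>N. A N c) \<longlonglongrightarrow> f 0" by simp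
      then have "(\<lambda>N. A (Suc N) c) \<longlonglongrightarrow> f 0" by (rule LIMSEQ_Suc)
      then show "(\<lambda>N. A (Suc N) c * ?e c) \<longlonglongrightarrow> f 0 * ?e c" by (intro tendsto_intros)
    qed
    show "AE c in P. norm (A (Suc N) c * ?e c) \<le> K * exp (- (pi * Re s - b) * Sq (lin c))" for N
    proof (rule AE_I2)
      fix c
      have "A (Suc N) c * ?e c = (\<Sum>j<Suc N. f (?u (Suc N) j *\<^sub>C lin c) * ?e c) / of_nat (Suc N)"
        by (simp add: A_def sum_distrib_right del: sum.lessThan_Suc)
      also have "norm \<dots> = norm (\<Sum>j<Suc N. f (?u (Suc N) j *\<^sub>C lin c) * ?e c) / real (Suc N)"
        by (simp only: norm_divide norm_of_nat)
      also have "\<dots> \<le> (\<Sum>j<Suc N. K * exp (- (pi * Re s - b) * Sq (lin c))) / real (Suc N)"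
        by (intro divide_right_mono sum_norm_le dom) auto
      also have "\<dots> = K * exp (- (pi * Re s - b) * Sq (lin c))"
        by (simp del: sum.lessThan_Suc of_nat_Suc)
      finally show "norm (A (Suc N) c * ?e c) \<le> K * exp (- (pi * Re s - b) * Sq (lin c))" .
    qed
  qed (auto simp: A_def)
  then have "(\<lambda>N. I) \<longlonglongrightarrow> (\<integral>c. f 0 * ?e c \<partial>P)" unfolding avg .
  then have "I = (\<integral>c. f 0 * ?e c \<partial>P)" by (simp add: LIMSEQ_const_iff)
  then show ?thesis by (simp add: I_def J_def)
qed

end

section \<open>Poisson summation for a theta function\<close>

text \<open>A theta function with unitary multipliers \<open>ch\<close>. The assumption \<open>chi_eps\<close> holds for
  the multipliers given by an \<open>\<i>\<close>-invariant quadratic form; it makes the Fourier transform in \<open>Fourier_F\<close>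
  involve values of \<open>\<theta>\<close> near \<open>\<i> z\<close>.\<close>

locale theta_lat = gauss_lat \<Gamma> H bs g for \<Gamma> :: "'v::complex_normed_vector set" and H bs g +
  fixes \<theta> :: "'v \<Rightarrow> complex" and ch :: "'v \<Rightarrow> complex"
  assumes entire_theta: "entire \<theta>"
    and quasi: "x \<in> \<Gamma> \<Longrightarrow> \<theta> (z + x) = ch x * exp (of_real pi * H x (z + (1/2) *\<^sub>R x)) * \<theta> z"
    and norm_chi: "x \<in> \<Gamma> \<Longrightarrow> cmod (ch x) = 1"
    and chi_eps: "x \<in> \<Gamma> \<Longrightarrow> ch (- ((1 + \<i>) *\<^sub>C x)) = exp (- (\<i> * of_real pi * of_real (Sq x)))"
begin

lemma quasi': "x \<in> \<Gamma> \<Longrightarrow> \<theta> (z + x) = ch x * exp (of_real pi * (H x z + of_real (Sq x) / 2)) * \<theta> z"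
  using quasi[of x z] by (simp add: H_add_right scaleR_scaleC H_scale_right H_self)

lemma theta_line: "(\<lambda>t. \<theta> (p + t *\<^sub>C v)) holomorphic_on UNIV"
  unfolding holomorphic_on_def
proof
  fix t :: complex
  from entire_theta obtain D where D: "(\<theta> has_derivative D) (at (p + t *\<^sub>C v))" "\<And>c v. D (c *\<^sub>C v) = c * D v"
    unfolding entire_def by blast
  have "((\<lambda>t. p + t *\<^sub>C v) has_derivative (\<lambda>h. h *\<^sub>C v)) (at t)"
    using has_derivative_add[OF has_derivative_const bounded_linear_imp_has_derivative[OF bounded_linear_scaleC]] by simp
  from has_derivative_compose[OF this D(1)]
  have "((\<lambda>t. \<theta> (p + t *\<^sub>C v)) has_derivative (\<lambda>h. h * D v)) (at t)"
    by (simp add: D(2))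
  then have "((\<lambda>t. \<theta> (p + t *\<^sub>C v)) has_field_derivative D v) (at t)"
    by (simp add: has_field_derivative_def mult.commute[of _ "D v"])
  then show "(\<lambda>t. \<theta> (p + t *\<^sub>C v)) field_differentiable at t within UNIV"
    using field_differentiable_def by auto
qed

lemma continuous_theta: "continuous_on UNIV \<theta>"
proof (rule continuous_at_imp_continuous_on, rule ballI)
  fix z show "isCont \<theta> z"
    using entire_theta has_derivative_continuous unfolding entire_def by blast
qed

lemma continuous_theta_lin: "continuous_on UNIV (\<lambda>c. \<theta> (p + lin c))"
  by (rule continuous_on_compose2[OF continuous_theta]) (auto intro!: continuous_on_add continuous_lin)

text \<open>By quasi-periodicity, \<open>|\<theta> x| exp (- \<pi>/2 Sq x)\<close> is invariant under the lattice, hence bounded by its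
  maximum on a compact fundamental domain.\<close>

lemma theta_growth: "\<exists>K>0. \<forall>x. cmod (\<theta> x) \<le> K * exp (pi / 2 * Sq x)"
proof -
  define B where "B = cbox (Complex (-1/2) (-1/2)) (Complex (1/2) (1/2))"
  define C :: "(nat \<Rightarrow> complex) set" where "C = {c. \<forall>k. c k \<in> B}"
  have "compactin (product_topology (\<lambda>_::nat. euclidean :: complex topology) UNIV) (PiE UNIV (\<lambda>_. B))"
    by (simp add: compactin_PiE B_def compact_cbox)
  moreover have "PiE UNIV (\<lambda>_. B) = C" by (auto simp: C_def PiE_UNIV_domain)
  ultimately have "compact C" by (simp add: euclidean_product_topology)
  then have "compact ((\<lambda>c. \<theta> (0 + lin c)) ` C)"
    using continuous_theta_lin continuous_on_subset by (intro compact_continuous_image) blast+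
  then obtain K where K: "K > 0" "\<And>c. c \<in> C \<Longrightarrow> cmod (\<theta> (lin c)) \<le> K"
    unfolding bounded_pos by (metis (no_types, lifting) add_0 compact_imp_bounded bounded_pos image_eqI)
  have "cmod (\<theta> x) \<le> K * exp (pi / 2 * Sq x)" for x
  proof -
    obtain c where x: "x = lin c" using lin_surj by blast
    have "\<forall>k. \<exists>n. n \<in> gauss_ints \<and> c k - n \<in> ccell" using ccell_cover by blast
    then obtain n where n: "\<And>k. n k \<in> gauss_ints" "\<And>k. c k - n k \<in> ccell" by metis
    define d where "d = lin (\<lambda>k. c k - n k)"
    have y: "lin n \<in> \<Gamma>" using n by (intro lin_in_Gamma)
    have xd: "x = d + lin n" unfolding x d_def lin_add[symmetric] by simp
    have "w \<in> B" if "w \<in> ccell" for w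
      using that by (auto simp: B_def ccell_def cell_def in_cbox_complex_iff)
    then have "(\<lambda>k. c k - n k) \<in> C"
      using n(2) by (simp add: C_def)
    then have d: "cmod (\<theta> d) \<le> K" unfolding d_def by (rule K(2))
    have "cmod (\<theta> x) = exp (pi * (Re (H (lin n) d) + Sq (lin n) / 2)) * cmod (\<theta> d)"
      unfolding xd quasi'[OF y] by (simp add: norm_mult norm_chi[OF y])
    also have "\<dots> = exp (pi / 2 * (Sq x - Sq d)) * cmod (\<theta> d)"
      unfolding xd Sq_add using arg_cong[OF H_cnj[of "lin n" d], of Re] by (simp add: field_simps)
    also have "\<dots> \<le> exp (pi / 2 * Sq x) * K"
      using d by (intro mult_mono) auto
    finally show ?thesis by (simp add: mult.commute)
  qed
  then show ?thesis using K(1) by blast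
qed

text \<open>The Fourier transform of \<open>F\<close> on the lattice, up to the constant computed in \<open>Fourier_F\<close>. As \<open>\<tau>\<close> tends
  to 0 the Gaussian widens and the argument of \<open>\<theta>\<close> tends to \<open>\<i> z\<close>.\<close>

definition E :: "real \<Rightarrow> 'v \<Rightarrow> 'v \<Rightarrow> complex" where
  "E \<tau> z x = exp (- (of_real (pi * \<tau>) * (of_real (Sq x) - \<i> * H x z))) * \<theta> ((\<i> * of_real (1 - \<tau>)) *\<^sub>C z + of_real \<tau> *\<^sub>C x)"

text \<open>The inverse of the Gaussian parameter \<open>s\<close>: at \<open>\<tau> = 0\<close> it is \<open>1 - \<i>\<close>, and \<open>Re (s \<tau>) > 1/2\<close> for small positive
  \<open>\<tau>\<close>, which is what integrability against the growth of \<open>\<theta>\<close> requires.\<close>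

definition r :: "real \<Rightarrow> complex" where "r \<tau> = 1 - \<i> * of_real (1 - \<tau>)"

definition s :: "real \<Rightarrow> complex" where "s \<tau> = 1 / r \<tau>"

lemma r_nonzero [simp]: "r \<tau> \<noteq> 0" by (simp add: r_def complex_eq_iff)

lemma Re_s: "Re (s \<tau>) = 1 / (1 + (1 - \<tau>)\<^sup>2)"
  by (simp add: s_def r_def Re_divide power2_eq_square algebra_simps)

lemma Re_s_gt: "0 < \<tau> \<Longrightarrow> \<tau> < 2 \<Longrightarrow> 1 / 2 < Re (s \<tau>)"
proof -
  assume "0 < \<tau>" "\<tau> < 2"
  then have "\<bar>1 - \<tau>\<bar> < 1" by auto
  then have "(1 - \<tau>)\<^sup>2 < 1" by (simp add: abs_square_less_1)
  moreover have "1 + (1 - \<tau>)\<^sup>2 > 0" by (intro add_pos_nonneg) auto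
  ultimately show ?thesis unfolding Re_s by (simp add: field_simps)
qed

text \<open>In the argument of \<open>\<theta>\<close> the vector \<open>x\<close> has the factor \<open>\<tau>\<close>, so that the growth of \<open>\<theta>\<close> contributes
  a multiple of \<open>\<tau>\<^sup>2 Sq x\<close> to the exponent, which is small against \<open>\<tau> Sq x\<close>.\<close>

lemma E_bound_aux:
  assumes K: "\<And>x. cmod (\<theta> x) \<le> K * exp (pi / 2 * Sq x)" "K > 0" and t: "0 < \<tau>" "\<tau> \<le> 1 / 8"
  shows "cmod (exp (\<i> * of_real (pi * \<tau>) * H x z)) * cmod (\<theta> ((\<i> * of_real (1 - \<tau>)) *\<^sub>C z + of_real \<tau> *\<^sub>C x)) \<le> (K * exp (2 * pi * Sq z)) * exp (pi * \<tau> / 4 * Sq x)"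
proof -
  have "cmod (exp (\<i> * of_real (pi * \<tau>) * H x z)) = exp (pi * \<tau> * - Im (H x z))"
    by simp
  also have "\<dots> \<le> exp (pi * \<tau> * (1 / 8 * Sq x + 8 * Sq z))"
  proof -
    have "- Im (H x z) \<le> 1 / 8 * Sq x + 8 * Sq z"
      using H_bound[of "1/8" x z] abs_Im_le_cmod[of "H x z"] by simp
    then have "(pi * \<tau>) * - Im (H x z) \<le> (pi * \<tau>) * (1 / 8 * Sq x + 8 * Sq z)"
      using t by (intro mult_left_mono) auto
    then show ?thesis by simp
  qed
  also have "\<dots> \<le> exp (pi * (\<tau> / 8) * Sq x + pi * Sq z)"
  proof -
    have "\<tau> * 8 * Sq z \<le> 1 * Sq z" using t by (intro mult_right_mono) auto
    then have "pi * (\<tau> * 8 * Sq z) \<le> pi * (1 * Sq z)" by (intro mult_left_mono) auto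
    then show ?thesis by (simp add: algebra_simps)
  qed
  finally have 1: "cmod (exp (\<i> * of_real (pi * \<tau>) * H x z)) \<le> exp (pi * (\<tau> / 8) * Sq x + pi * Sq z)" .
  have "Sq ((\<i> * of_real (1 - \<tau>)) *\<^sub>C z + of_real \<tau> *\<^sub>C x) \<le> 2 * Sq ((\<i> * of_real (1 - \<tau>)) *\<^sub>C z) + 2 * Sq (of_real \<tau> *\<^sub>C x)"
    by (rule Sq_add_le)
  also have "\<dots> = 2 * ((1 - \<tau>)\<^sup>2 * Sq z) + 2 * (\<tau>\<^sup>2 * Sq x)"
    by (simp only: Sq_scale norm_mult norm_ii norm_of_real mult_1 power2_abs)
  also have "\<dots> \<le> 2 * (1 * Sq z) + 2 * (\<tau> / 8 * Sq x)"
  proof (intro add_mono mult_left_mono mult_right_mono)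
    show "(1 - \<tau>)\<^sup>2 \<le> 1" using t by (simp add: power_le_one)
    show "\<tau>\<^sup>2 \<le> \<tau> / 8" using t mult_left_mono[of \<tau> "1/8" \<tau>] by (simp add: power2_eq_square)
  qed auto
  finally have "pi / 2 * Sq ((\<i> * of_real (1 - \<tau>)) *\<^sub>C z + of_real \<tau> *\<^sub>C x) \<le> pi / 2 * (2 * (1 * Sq z) + 2 * (\<tau> / 8 * Sq x))"
    by (intro mult_left_mono) auto
  then have "exp (pi / 2 * Sq ((\<i> * of_real (1 - \<tau>)) *\<^sub>C z + of_real \<tau> *\<^sub>C x)) \<le> exp (pi * Sq z + pi * (\<tau> / 8) * Sq x)"
    by (simp add: algebra_simps)
  then have 2: "cmod (\<theta> ((\<i> * of_real (1 - \<tau>)) *\<^sub>C z + of_real \<tau> *\<^sub>C x)) \<le> K * exp (pi * Sq z + pi * (\<tau> / 8) * Sq x)"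
    using K(2) by (intro order_trans[OF K(1)]) auto
  have "cmod (exp (\<i> * of_real (pi * \<tau>) * H x z)) * cmod (\<theta> ((\<i> * of_real (1 - \<tau>)) *\<^sub>C z + of_real \<tau> *\<^sub>C x))
     \<le> exp (pi * (\<tau> / 8) * Sq x + pi * Sq z) * (K * exp (pi * Sq z + pi * (\<tau> / 8) * Sq x))"
    by (intro mult_mono 1 2) auto
  also have "\<dots> = (K * exp (2 * pi * Sq z)) * exp (pi * \<tau> / 4 * Sq x)"
  proof -
    have "(pi * (\<tau> / 8) * Sq x + pi * Sq z) + (pi * Sq z + pi * (\<tau> / 8) * Sq x) = 2 * pi * Sq z + pi * \<tau> / 4 * Sq x"
      by simp
    then show ?thesis by (metis exp_add mult.assoc mult.left_commute)
  qed
  finally show ?thesis .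
qed

lemma E_split: "E \<tau> z x = of_real (exp (- (pi * \<tau>) * Sq x)) * (exp (\<i> * of_real (pi * \<tau>) * H x z) * \<theta> ((\<i> * of_real (1 - \<tau>)) *\<^sub>C z + of_real \<tau> *\<^sub>C x))"
  unfolding E_def exp_of_real[symmetric] mult.assoc[symmetric] exp_add[symmetric]
  by (simp add: algebra_simps)

lemma E_bound:
  assumes K: "\<And>x. cmod (\<theta> x) \<le> K * exp (pi / 2 * Sq x)" "K > 0" and t: "0 < \<tau>" "\<tau> \<le> 1 / 8"
  shows "cmod (E \<tau> z x) \<le> (K * exp (2 * pi * Sq z)) * exp (- (3 * pi * \<tau> / 4) * Sq x)"
proof -
  have "cmod (E \<tau> z x) = exp (- (pi * \<tau>) * Sq x) * (cmod (exp (\<i> * of_real (pi * \<tau>) * H x z)) * cmod (\<theta> ((\<i> * of_real (1 - \<tau>)) *\<^sub>C z + of_real \<tau> *\<^sub>C x)))"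
    unfolding E_split norm_mult norm_of_real by simp
  also have "\<dots> \<le> exp (- (pi * \<tau>) * Sq x) * ((K * exp (2 * pi * Sq z)) * exp (pi * \<tau> / 4 * Sq x))"
    by (intro mult_left_mono E_bound_aux assms) auto
  also have "\<dots> = (K * exp (2 * pi * Sq z)) * exp (- (3 * pi * \<tau> / 4) * Sq x)"
    by (simp add: exp_add[symmetric] algebra_simps)
  finally show ?thesis .
qed

text \<open>The factor \<open>exp (- \<pi> H(w, z))\<close> cancels the dependence on \<open>z\<close> of the automorphy factor, so that on the
  lattice only \<open>\<theta> z\<close> times a Gaussian with multipliers remains.\<close>

definition F :: "real \<Rightarrow> 'v \<Rightarrow> 'v \<Rightarrow> complex" where
  "F \<tau> z w = \<theta> (z + w) * exp (- (of_real pi * H w z) - of_real pi * s \<tau> * of_real (Sq w))"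

lemma H_left_lin: "H (lin c) x = (\<Sum>k<g. cnj (c k) * H (bk k) x)"
proof -
  have "cnj (c k) * cnj (H x (bk k)) = cnj (c k) * H (bk k) x" for k
    using H_cnj[of "bk k" x] by simp
  then show ?thesis
    unfolding H_cnj[of "lin c" x] H_lin cnj_sum complex_cnj_mult by (intro sum.cong) auto
qed

lemma continuous_F: "continuous_on UNIV (\<lambda>c. F \<tau> z (lin c))"
  unfolding F_def H_left_lin
  by (intro continuous_on_mult continuous_theta_lin continuous_on_exp continuous_on_diff continuous_on_minus
      continuous_on_sum continuous_on_cnj continuous_on_const continuous_on_of_real continuous_Sq_lin) simp_all

lemma norm_F: 
  assumes K: "\<And>x. cmod (\<theta> x) \<le> K * exp (pi / 2 * Sq x)" "K > 0"
  shows "cmod (F \<tau> z w) \<le> (K * exp (pi / 2 * Sq z)) * exp (- (pi * (Re (s \<tau>) - 1 / 2)) * Sq w)"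
proof -
  have "cmod (F \<tau> z w) = cmod (\<theta> (z + w)) * exp (- (pi * Re (H w z)) - pi * Re (s \<tau>) * Sq w)"
    by (simp add: F_def norm_mult)
  also have "\<dots> \<le> (K * exp (pi / 2 * Sq (z + w))) * exp (- (pi * Re (H w z)) - pi * Re (s \<tau>) * Sq w)"
    by (intro mult_right_mono K) auto
  also have "\<dots> = (K * exp (pi / 2 * Sq z)) * exp (- (pi * (Re (s \<tau>) - 1 / 2)) * Sq w)"
    using arg_cong[OF H_cnj[of w z], of Re] by (simp add: Sq_add exp_add[symmetric] field_simps)
  finally show ?thesis .
qed

lemma F_on_Gamma: "x \<in> \<Gamma> \<Longrightarrow> F \<tau> z x = \<theta> z * (ch x * exp (- (of_real pi * (s \<tau> - 1 / 2) * of_real (Sq x))))"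
  unfolding F_def quasi' by (simp add: exp_add[symmetric] exp_diff field_simps)

text \<open>After completing the square the integrand is an entire function times a centred Gaussian, so that the
  integral is the value of that function at 0. The value of \<open>\<theta>\<close> found there is then translated by the
  lattice vector \<open>- (1 + \<i>) x\<close>; this is where \<open>chi_eps\<close> is used.\<close>

lemma Fourier_F:
  assumes t: "0 < \<tau>" "\<tau> \<le> 1 / 8" and x: "x \<in> \<Gamma>"
  shows "(\<integral>c. F \<tau> z (lin c) * exp (- (2 * of_real pi * \<i> * of_real (Re (H (lin c) x)))) \<partial>P) = J 1 / s \<tau> ^ g * E \<tau> z x"
proof -
  obtain K where K: "K > 0" "\<And>x. cmod (\<theta> x) \<le> K * exp (pi / 2 * Sq x)" using theta_growth by blast
  have sr: "s \<tau> * r \<tau> = 1" by (simp add: s_def)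
  have s_pos: "Re (s \<tau>) > 1 / 2" using t by (intro Re_s_gt) auto
  (* Chosen such that the terms linear in the conjugate of w cancel after translation by w0; the factor
     beside the Gaussian then depends holomorphically on w. *)
  define w0 where "w0 = - (r \<tau> *\<^sub>C (z + \<i> *\<^sub>C x))"
  have sw0: "s \<tau> *\<^sub>C w0 = - (z + \<i> *\<^sub>C x)"
  proof -
    have "s \<tau> *\<^sub>C w0 = - ((s \<tau> * r \<tau>) *\<^sub>C (z + \<i> *\<^sub>C x))"
      by (simp add: w0_def scaleC_scaleC complex_vector.scale_minus_right)
    then show ?thesis by (simp add: sr scaleC_one)
  qed
  define u where "u = cnj (s \<tau>) *\<^sub>C w0 - \<i> *\<^sub>C x"
  define c0 where "c0 = exp (- (of_real pi * \<i> * H x w0))"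
  define f where "f w = c0 * (\<theta> ((z + w0) + w) * exp (- (of_real pi * H u w)))" for w
  let ?G = "\<lambda>w. F \<tau> z w * exp (- (2 * of_real pi * \<i> * of_real (Re (H w x))))"
  have two_Re: "of_real (2 * Re (H a b)) = H a b + H b a" for a b
    using H_cnj[of b a] complex_add_cnj[of "H a b"] by simp
  have shift: "?G (w + w0) = f w * exp (- (of_real pi * s \<tau> * of_real (Sq w)))" for w
  proof -
    have 1: "of_real (Sq (w + w0)) = of_real (Sq w) + (H w w0 + H w0 w) + of_real (Sq w0)"
      unfolding Sq_add by (simp only: of_real_add two_Re)
    have 2: "2 * of_real pi * \<i> * of_real (Re (H (w + w0) x)) = of_real pi * \<i> * (H w x + H w0 x + (H x w + H x w0))"
    proof -
      have "2 * of_real pi * \<i> * of_real (Re (H (w + w0) x)) = of_real pi * \<i> * of_real (2 * Re (H (w + w0) x))" by simp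
      then show ?thesis unfolding two_Re by (simp only: H_add_left H_add_right)
    qed
    have "H y (s \<tau> *\<^sub>C w0) = - (H y z + \<i> * H y x)" for y
      unfolding sw0 H_minus_right H_add_right H_scale_right ..
    then have sH: "s \<tau> * H y w0 = - H y z - \<i> * H y x" for y
      by (simp add: H_scale_right)
    have Hu: "H u w = s \<tau> * H w0 w + \<i> * H x w"
      by (simp add: u_def H_diff_left H_scale_left)
    have "- (of_real pi * H (w + w0) z) - of_real pi * s \<tau> * of_real (Sq (w + w0)) - 2 * of_real pi * \<i> * of_real (Re (H (w + w0) x))
       = - (of_real pi * \<i> * H x w0) - of_real pi * H u w - of_real pi * s \<tau> * of_real (Sq w)"
    proof -
      have "s \<tau> * of_real (Sq (w + w0)) = s \<tau> * of_real (Sq w) + s \<tau> * H w w0 + s \<tau> * H w0 w + s \<tau> * H w0 w0"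
        unfolding 1 H_self by (simp add: algebra_simps)
      then have 3: "s \<tau> * of_real (Sq (w + w0)) = s \<tau> * of_real (Sq w) + (- H w z - \<i> * H w x) + s \<tau> * H w0 w + (- H w0 z - \<i> * H w0 x)"
        unfolding sH .
      have "- (of_real pi * H (w + w0) z) - of_real pi * s \<tau> * of_real (Sq (w + w0)) - 2 * of_real pi * \<i> * of_real (Re (H (w + w0) x))
        = of_real pi * (- H w z - H w0 z - s \<tau> * of_real (Sq (w + w0)) - \<i> * (H w x + H w0 x + (H x w + H x w0)))"
        unfolding 2 by (simp add: H_add_left algebra_simps)
      then show ?thesis unfolding 3 Hu by (simp add: algebra_simps)
    qed
    note eq = this
    have "?G (w + w0) = \<theta> (z + (w + w0)) * exp (- (of_real pi * H (w + w0) z) - of_real pi * s \<tau> * of_real (Sq (w + w0)) - 2 * of_real pi * \<i> * of_real (Re (H (w + w0) x)))"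
      unfolding F_def exp_diff[of _ "2 * of_real pi * \<i> * of_real (Re (H (w + w0) x))"] exp_minus by (simp add: divide_inverse)
    also have "\<dots> = \<theta> (z + w0 + w) * (c0 * exp (- (of_real pi * H u w)) * exp (- (of_real pi * s \<tau> * of_real (Sq w))))"
      unfolding eq by (simp add: c0_def exp_diff exp_minus divide_inverse add_ac)
    finally show ?thesis by (simp only: f_def mult_ac)
  qed
  have contG: "continuous_on UNIV (\<lambda>c. ?G (lin c))"
    unfolding H_left_lin
    by (intro continuous_on_mult continuous_F continuous_on_exp continuous_on_minus continuous_on_const
      continuous_on_of_real continuous_on_Re continuous_on_sum continuous_on_cnj) simp_all
  have "(\<integral>c. ?G (lin c) \<partial>P) = (\<integral>c. ?G (1 *\<^sub>C lin c + w0) \<partial>P)"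
    using integral_lin_affine[of ?G 1 w0] measurable_lin_continuous[OF contG] by simp
  also have "\<dots> = (\<integral>c. f (lin c) * exp (- (of_real pi * s \<tau> * of_real (Sq (lin c)))) \<partial>P)"
    by (simp only: scaleC_one shift)
  also have "\<dots> = f 0 * J (s \<tau>)"
  proof -
    define a where "a = z + w0"
    define d where "d = (Re (s \<tau>) - 1 / 2) / 2"
    have d: "d > 0" using s_pos by (simp add: d_def)
    define K' where "K' = cmod c0 * K * exp (pi / 2 * Sq a + pi * (Sq (a - u) / d))"
    show ?thesis
    proof (rule mean_value_Gaussian[where b = "pi / 2 + pi * d" and K = K'])
      show "(\<lambda>t. f (t *\<^sub>C v)) holomorphic_on UNIV" for v
        unfolding f_def H_scale_right by (intro holomorphic_intros theta_line)
      show "continuous_on UNIV (\<lambda>c. f (lin c))"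
        unfolding f_def
        by (intro continuous_on_mult continuous_theta_lin continuous_on_exp continuous_on_minus continuous_on_const continuous_H_lin)
      show "cmod (f w) \<le> K' * exp ((pi / 2 + pi * d) * Sq w)" for w
      proof -
        have "cmod (f w) = cmod c0 * (cmod (\<theta> (a + w)) * exp (- (pi * Re (H u w))))"
          by (simp add: f_def norm_mult a_def)
        also have "\<dots> \<le> cmod c0 * ((K * exp (pi / 2 * Sq (a + w))) * exp (- (pi * Re (H u w))))"
          by (intro mult_left_mono mult_right_mono K) auto
        also have "\<dots> = cmod c0 * K * exp (pi / 2 * Sq a + pi / 2 * Sq w + pi * Re (H (a - u) w))"
          by (simp add: Sq_add H_diff_left exp_add[symmetric] algebra_simps)
        also have "\<dots> \<le> cmod c0 * K * exp (pi / 2 * Sq a + pi / 2 * Sq w + pi * (d * Sq w + Sq (a - u) / d))"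
        proof -
          have "Re (H (a - u) w) \<le> d * Sq w + Sq (a - u) / d"
            using H_bound[OF d, of w "a - u"] complex_Re_le_cmod[of "H (a - u) w"] H_cnj[of w "a - u"] by simp
          then have "pi * Re (H (a - u) w) \<le> pi * (d * Sq w + Sq (a - u) / d)" by (intro mult_left_mono) auto
          then show ?thesis using K(1) by (intro mult_left_mono) auto
        qed
        also have "\<dots> = K' * exp ((pi / 2 + pi * d) * Sq w)"
          by (simp add: K'_def exp_add[symmetric] algebra_simps)
        finally show ?thesis .
      qed
      have "1 / 2 + d < Re (s \<tau>)" using s_pos by (simp add: d_def field_simps)
      then have "pi * (1 / 2 + d) < pi * Re (s \<tau>)" by (intro mult_strict_left_mono) auto
      then show "pi / 2 + pi * d < pi * Re (s \<tau>)" by (simp add: distrib_left)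
    qed
  qed
  also have "J (s \<tau>) = J 1 / s \<tau> ^ g" using s_pos by (intro J_eq) simp
  also have "f 0 = E \<tau> z x"
  proof -
    define y where "y = (\<i> * of_real (1 - \<tau>)) *\<^sub>C z + of_real \<tau> *\<^sub>C x"
    define e where "e = - ((1 + \<i>) *\<^sub>C x)"
    have e: "e \<in> \<Gamma>" unfolding e_def using x by (intro Gamma_minus Gamma_scale gint_add) auto
    have "z + w0 = y + e"
    proof -
      have "z + w0 = (1 - r \<tau>) *\<^sub>C z + (- (r \<tau> * \<i>)) *\<^sub>C x"
        by (simp add: w0_def scaleC_add_right scaleC_scaleC complex_vector.scale_left_diff_distrib scaleC_one)
      also have "1 - r \<tau> = \<i> * of_real (1 - \<tau>)" by (simp add: r_def)
      also have "- (r \<tau> * \<i>) = of_real \<tau> - (1 + \<i>)" by (simp add: r_def algebra_simps)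
      finally show ?thesis
        by (simp add: y_def e_def complex_vector.scale_left_diff_distrib)
    qed
    then have "f 0 = c0 * \<theta> (y + e)" by (simp add: f_def)
    also have "\<dots> = c0 * (exp (- (\<i> * of_real pi * of_real (Sq x))) * exp (of_real pi * (H e y + of_real (Sq e) / 2)) * \<theta> y)"
      unfolding quasi'[OF e] using chi_eps[OF x] by (simp add: e_def)
    also have "\<dots> = exp (- (of_real pi * \<i> * H x w0) - \<i> * of_real pi * of_real (Sq x) + of_real pi * (H e y + of_real (Sq e) / 2)) * \<theta> y"
    proof -
      have "exp (- a - b + c) = exp (- a) * (exp (- b) * exp c)" for a b c :: complex
        by (simp add: exp_add exp_diff exp_minus divide_inverse)
      then show ?thesis by (simp only: c0_def mult.assoc)
    qed
    also have "- (of_real pi * \<i> * H x w0) - \<i> * of_real pi * of_real (Sq x) + of_real pi * (H e y + of_real (Sq e) / 2)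
       = - (of_real (pi * \<tau>) * (of_real (Sq x) - \<i> * H x z))"
    proof -
      have h1: "H x w0 = - (r \<tau> * (H x z + \<i> * of_real (Sq x)))"
        by (simp add: w0_def H_minus_right H_scale_right H_add_right H_self)
      have h2: "H e y = - ((1 - \<i>) * (\<i> * of_real (1 - \<tau>) * H x z + of_real \<tau> * of_real (Sq x)))"
        by (simp add: e_def y_def H_minus_left H_scale_left H_add_right H_scale_right H_self, simp add: algebra_simps)
      have h3: "Sq e = 2 * Sq x"
        by (simp add: e_def Sq_scale cmod_power2)
      show ?thesis
        unfolding h1 h2 h3 r_def by (simp add: algebra_simps)
    qed
    finally show ?thesis by (simp add: E_def y_def)
  qed
  finally show ?thesis by (simp add: mult.commute)
qed

text \<open>Poisson summation for \<open>F\<close>, with the dual lattice identified with \<open>\<Gamma>\<close> by unimodularity.\<close>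

theorem theta_poisson:
  assumes t: "0 < \<tau>" "\<tau> \<le> 1 / 8"
  shows "\<theta> z * (\<Sum>\<^sub>\<infinity>x\<in>\<Gamma>. ch x * exp (- (of_real pi * (s \<tau> - 1 / 2) * of_real (Sq x)))) = J 1 / s \<tau> ^ g * (\<Sum>\<^sub>\<infinity>x\<in>\<Gamma>. E \<tau> z x)"
proof -
  obtain K where K: "K > 0" "\<And>x. cmod (\<theta> x) \<le> K * exp (pi / 2 * Sq x)" using theta_growth by blast
  have s_pos: "Re (s \<tau>) > 1 / 2" using t by (intro Re_s_gt) auto
  define a where "a = pi * (Re (s \<tau>) - 1 / 2)"
  have a: "a > 0" using s_pos by (simp add: a_def)
  interpret ps: poisson_setting "{..<g}" "\<lambda>c. F \<tau> z (lin c)" "K * exp (pi / 2 * Sq z)" "a * beta0"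
  proof
    show "continuous_on UNIV (\<lambda>c. F \<tau> z (lin c))" by (rule continuous_F)
    show "a * beta0 > 0" using a beta0_pos by simp
    fix c
    have "cmod (F \<tau> z (lin c)) \<le> (K * exp (pi / 2 * Sq z)) * exp (- a * Sq (lin c))"
      unfolding a_def by (rule norm_F[OF K(2,1)])
    also have "\<dots> \<le> (K * exp (pi / 2 * Sq z)) * (\<Prod>k\<in>{..<g}. exp (- (a * beta0) * (cmod (c k))\<^sup>2))"
      using a K(1) by (intro mult_left_mono exp_Sq_le_prod) auto
    finally show "cmod (F \<tau> z (lin c)) \<le> (K * exp (pi / 2 * Sq z)) * (\<Prod>k\<in>{..<g}. exp (- (a * beta0) * (cmod (c k))\<^sup>2))" .
  qed auto
  let ?d = "\<lambda>x. \<lambda>k\<in>{..<g}. H (bk k) x"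
  have Fh: "ps.Fh (?d x) = J 1 / s \<tau> ^ g * E \<tau> z x" if x: "x \<in> \<Gamma>" for x
  proof -
    have "(\<Prod>k\<in>{..<g}. echar (?d x k) (c k)) = exp (- (2 * of_real pi * \<i> * of_real (Re (H (lin c) x))))" for c
    proof -
      have "(\<Prod>k\<in>{..<g}. echar (?d x k) (c k)) = exp (\<Sum>k<g. - (2 * of_real pi * \<i> * of_real (Re (cnj (c k) * H (bk k) x))))"
        unfolding exp_sum[OF finite_lessThan] echar_def by (intro prod.cong) simp_all
      also have "(\<Sum>k<g. - (2 * of_real pi * \<i> * of_real (Re (cnj (c k) * H (bk k) x)))) = - (2 * of_real pi * \<i> * of_real (Re (H (lin c) x)))"
        unfolding H_left_lin Re_sum of_real_sum sum_distrib_left sum_negf ..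
      finally show ?thesis .
    qed
    then show ?thesis unfolding ps.Fh_def using Fourier_F[OF t x] by simp
  qed
  have Esum: "(\<lambda>x. cmod (J 1 / s \<tau> ^ g * E \<tau> z x)) summable_on \<Gamma>"
  proof (rule summable_on_comparison_test)
    show "(\<lambda>x. (cmod (J 1 / s \<tau> ^ g) * (K * exp (2 * pi * Sq z))) * exp (- (3 * pi * \<tau> / 4) * Sq x)) summable_on \<Gamma>"
      using t by (intro summable_on_cmult_right summable_exp_Sq) auto
    fix x
    have "cmod (J 1 / s \<tau> ^ g) * cmod (E \<tau> z x) \<le> cmod (J 1 / s \<tau> ^ g) * ((K * exp (2 * pi * Sq z)) * exp (- (3 * pi * \<tau> / 4) * Sq x))"
      by (intro mult_left_mono E_bound K t) auto
    then show "cmod (J 1 / s \<tau> ^ g * E \<tau> z x) \<le> (cmod (J 1 / s \<tau> ^ g) * (K * exp (2 * pi * Sq z))) * exp (- (3 * pi * \<tau> / 4) * Sq x)"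
      by (simp only: norm_mult mult.assoc)
  qed auto
  have "(\<lambda>n. cmod (ps.Fh n)) summable_on (PiE {..<g} (\<lambda>_. gauss_ints))"
  proof (subst summable_on_reindex_bij_betw[OF bij_dual, symmetric])
    show "(\<lambda>x. cmod (ps.Fh (?d x))) summable_on \<Gamma>"
      using Esum by (rule summable_on_cong[THEN iffD1, rotated]) (simp add: Fh)
  qed
  then have "infsum (\<lambda>c. F \<tau> z (lin c)) (PiE {..<g} (\<lambda>_. gauss_ints)) = infsum ps.Fh (PiE {..<g} (\<lambda>_. gauss_ints))"
    by (rule ps.poisson_summation)
  also have "infsum ps.Fh (PiE {..<g} (\<lambda>_. gauss_ints)) = (\<Sum>\<^sub>\<infinity>x\<in>\<Gamma>. ps.Fh (?d x))"
    by (rule infsum_reindex_bij_betw[OF bij_dual, symmetric])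
  also have "\<dots> = (\<Sum>\<^sub>\<infinity>x\<in>\<Gamma>. J 1 / s \<tau> ^ g * E \<tau> z x)"
    by (intro infsum_cong Fh)
  also have "\<dots> = J 1 / s \<tau> ^ g * (\<Sum>\<^sub>\<infinity>x\<in>\<Gamma>. E \<tau> z x)"
    by (rule infsum_cmult_right')
  also have "infsum (\<lambda>c. F \<tau> z (lin c)) (PiE {..<g} (\<lambda>_. gauss_ints)) = (\<Sum>\<^sub>\<infinity>x\<in>\<Gamma>. F \<tau> z x)"
    by (rule infsum_reindex_bij_betw[OF bij_lin])
  also have "\<dots> = (\<Sum>\<^sub>\<infinity>x\<in>\<Gamma>. \<theta> z * (ch x * exp (- (of_real pi * (s \<tau> - 1 / 2) * of_real (Sq x)))))"
    by (intro infsum_cong F_on_Gamma)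
  also have "\<dots> = \<theta> z * (\<Sum>\<^sub>\<infinity>x\<in>\<Gamma>. ch x * exp (- (of_real pi * (s \<tau> - 1 / 2) * of_real (Sq x))))"
    by (rule infsum_cmult_right')
  finally show ?thesis .
qed

end

section \<open>Gaussian averages over the lattice\<close>

context gauss_lat
begin

definition Z :: "real \<Rightarrow> real" where "Z a = (\<Sum>\<^sub>\<infinity>x\<in>\<Gamma>. exp (- a * Sq x))"

lemma summable_exp_Sq_shift:
  assumes "a > 0" "X \<subseteq> \<Gamma>"
  shows "(\<lambda>x. exp (- a * Sq (u + x))) summable_on X"
proof -
  have "(\<lambda>x. exp (a * Sq u) * exp (- (a / 2) * Sq x)) summable_on \<Gamma>"
    using assms by (intro summable_on_cmult_right summable_exp_Sq) auto
  then have "(\<lambda>x. exp (a * Sq u) * exp (- (a / 2) * Sq x)) summable_on X"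
    using assms(2) by (rule summable_on_subset_banach)
  then show ?thesis
  proof (rule summable_on_comparison_test)
    fix x
    have "Sq x \<le> 2 * Sq (u + x) + 2 * Sq u"
      using Sq_add_le[of "u + x" "- u"] by simp
    then have "(a / 2) * Sq x \<le> (a / 2) * (2 * Sq (u + x) + 2 * Sq u)"
      using assms by (intro mult_left_mono) auto
    then show "exp (- a * Sq (u + x)) \<le> exp (a * Sq u) * exp (- (a / 2) * Sq x)"
      by (simp add: exp_add[symmetric] algebra_simps)
  qed auto
qed

lemma summable_Z: "a > 0 \<Longrightarrow> X \<subseteq> \<Gamma> \<Longrightarrow> (\<lambda>x. exp (- a * Sq x)) summable_on X"
  using summable_exp_Sq_shift[of a X 0] by simp

lemma Z_pos: "a > 0 \<Longrightarrow> Z a > 0"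
proof -
  assume a: "a > 0"
  have "(\<Sum>\<^sub>\<infinity>x\<in>{0}. exp (- a * Sq x)) \<le> Z a"
    unfolding Z_def using a by (intro infsum_mono_neutral summable_Z) auto
  then show ?thesis by simp
qed

text \<open>By the parallelogram law and \<open>2 \<le> exp h + exp (- h)\<close>, twice the weight at \<open>y\<close> is at most a constant times
  the sum of the weights at \<open>y + v\<close> and \<open>y - v\<close>; the two shifts run through the same coset.\<close>

lemma coset_shift_le:
  assumes a: "a > 0" and X: "X \<subseteq> \<Gamma>" and add: "\<And>x y. x \<in> X \<Longrightarrow> y \<in> X \<Longrightarrow> x + y \<in> X" "\<And>x. x \<in> X \<Longrightarrow> - x \<in> X"
    and v: "2 *\<^sub>R v \<in> X"
  shows "(\<Sum>\<^sub>\<infinity>x\<in>X. exp (- a * Sq (u + x))) \<le> exp (a * Sq v) * (\<Sum>\<^sub>\<infinity>x\<in>X. exp (- a * Sq (u + v + x)))"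
proof -
  note su = summable_exp_Sq_shift[OF a X]
  have bij: "bij_betw (\<lambda>x. x - 2 *\<^sub>R v) X X"
    by (rule bij_betw_byWitness[where f' = "\<lambda>x. x + 2 *\<^sub>R v"]) (use add(1)[OF _ v] add(1)[OF _ add(2)[OF v]] in \<open>auto simp: diff_conv_add_uminus simp del: add_uminus_conv_diff\<close>)
  have "(\<Sum>\<^sub>\<infinity>x\<in>X. exp (- a * Sq (u + v + x))) = (\<Sum>\<^sub>\<infinity>x\<in>X. exp (- a * Sq (u + v + (x - 2 *\<^sub>R v))))"
    using infsum_reindex_bij_betw[OF bij, of "\<lambda>x. exp (- a * Sq (u + v + x))"] by simp
  moreover have "u + v + (x - 2 *\<^sub>R v) = (u - v) + x" for x
    by (simp add: scaleR_2)
  ultimately have eq: "(\<Sum>\<^sub>\<infinity>x\<in>X. exp (- a * Sq (u + v + x))) = (\<Sum>\<^sub>\<infinity>x\<in>X. exp (- a * Sq (u - v + x)))"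
    by simp
  have "2 * (\<Sum>\<^sub>\<infinity>x\<in>X. exp (- a * Sq (u + x))) = (\<Sum>\<^sub>\<infinity>x\<in>X. 2 * exp (- a * Sq (u + x)))"
    by (rule infsum_cmult_right'[symmetric])
  also have "\<dots> \<le> (\<Sum>\<^sub>\<infinity>x\<in>X. exp (a * Sq v) * (exp (- a * Sq (u + v + x)) + exp (- a * Sq (u - v + x))))"
  proof (rule infsum_mono)
    show "(\<lambda>x. 2 * exp (- a * Sq (u + x))) summable_on X" by (intro summable_on_cmult_right su)
    show "(\<lambda>x. exp (a * Sq v) * (exp (- a * Sq (u + v + x)) + exp (- a * Sq (u - v + x)))) summable_on X"
      by (intro summable_on_cmult_right summable_on_add su)
    fix x
    define y where "y = u + x"
    define h where "h = 2 * a * Re (H y v)"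
    have "2 \<le> exp h + exp (- h)"
      using cosh_real_ge_1[of h] by (simp add: cosh_def)
    then have "exp (- a * Sq y) * 2 \<le> exp (- a * Sq y) * (exp h + exp (- h))"
      by (intro mult_left_mono) auto
    also have "\<dots> = exp (a * Sq v) * (exp (- a * Sq (y - v)) + exp (- a * Sq (y + v)))"
      unfolding Sq_add Sq_diff h_def by (simp add: distrib_left exp_add[symmetric] algebra_simps)
    finally show "2 * exp (- a * Sq (u + x)) \<le> exp (a * Sq v) * (exp (- a * Sq (u + v + x)) + exp (- a * Sq (u - v + x)))"
      by (simp add: y_def algebra_simps)
  qed
  also have "\<dots> = exp (a * Sq v) * ((\<Sum>\<^sub>\<infinity>x\<in>X. exp (- a * Sq (u + v + x))) + (\<Sum>\<^sub>\<infinity>x\<in>X. exp (- a * Sq (u - v + x))))"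
    by (simp only: infsum_cmult_right' infsum_add[OF su su])
  also have "\<dots> = 2 * (exp (a * Sq v) * (\<Sum>\<^sub>\<infinity>x\<in>X. exp (- a * Sq (u + v + x))))"
    unfolding eq[symmetric] by simp
  finally show ?thesis by simp
qed

abbreviation "\<Lambda> \<equiv> scaleC (1 + \<i>) ` \<Gamma>"

lemma gint_1_i [simp]: "1 + \<i> \<in> gauss_ints" "1 - \<i> \<in> gauss_ints"
  by (auto intro: gint_add gint_diff)

lemma Lambda_subset: "\<Lambda> \<subseteq> \<Gamma>" by (auto intro!: Gamma_scale)

lemma Lambda_add: "x \<in> \<Lambda> \<Longrightarrow> y \<in> \<Lambda> \<Longrightarrow> x + y \<in> \<Lambda>"
  by (auto simp: scaleC_add_right[symmetric] intro!: imageI Gamma_add)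

lemma Lambda_minus: "x \<in> \<Lambda> \<Longrightarrow> - x \<in> \<Lambda>"
proof -
  assume "x \<in> \<Lambda>"
  then obtain y where y: "y \<in> \<Gamma>" "x = (1 + \<i>) *\<^sub>C y" by blast
  have "- x = (1 + \<i>) *\<^sub>C (- y)" unfolding y(2) complex_vector.scale_minus_right ..
  then show ?thesis using Gamma_minus[OF y(1)] by blast
qed

lemma two_in_Lambda: "x \<in> \<Gamma> \<Longrightarrow> 2 *\<^sub>R x \<in> \<Lambda>"
proof -
  assume x: "x \<in> \<Gamma>"
  have "2 *\<^sub>R x = (1 + \<i>) *\<^sub>C ((1 - \<i>) *\<^sub>C x)"
  proof -
    have "(1 + \<i>) * (1 - \<i>) = complex_of_real 2" by (simp add: complex_eq_iff)
    then show ?thesis unfolding scaleR_scaleC scaleC_scaleC by simp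
  qed
  then show ?thesis using x by (metis Gamma_scale gint_1_i(2) imageI)
qed

end

text \<open>\<open>R\<close> presents the quotient of \<open>\<Gamma>\<close> by \<open>(1 + \<i>) \<Gamma>\<close> on the finite set \<open>C\<close>.\<close>

locale gauss_classes = gauss_lat \<Gamma> H bs g for \<Gamma> :: "'v::complex_normed_vector set" and H bs g +
  fixes R :: "'v \<Rightarrow> 'c" and C :: "'c set"
  assumes finite_C: "finite C" and R_image: "R ` \<Gamma> = C"
    and R_eq_iff: "x \<in> \<Gamma> \<Longrightarrow> y \<in> \<Gamma> \<Longrightarrow> R x = R y \<longleftrightarrow> x - y \<in> \<Lambda>"
begin

definition rep :: "'c \<Rightarrow> 'v" where "rep c = (SOME x. x \<in> \<Gamma> \<and> R x = c)"

lemma rep: "c \<in> C \<Longrightarrow> rep c \<in> \<Gamma> \<and> R (rep c) = c"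
proof -
  assume "c \<in> C"
  then have "\<exists>x. x \<in> \<Gamma> \<and> R x = c" unfolding R_image[symmetric] by blast
  then show ?thesis unfolding rep_def by (rule someI_ex)
qed

definition fib :: "'c \<Rightarrow> 'v set" where "fib c = {x \<in> \<Gamma>. R x = c}"

lemma fib_eq: "c \<in> C \<Longrightarrow> fib c = (\<lambda>x. rep c + x) ` \<Lambda>"
proof -
  assume c: "c \<in> C"
  have *: "x \<in> fib c \<longleftrightarrow> x - rep c \<in> \<Lambda>" for x
  proof
    assume "x \<in> fib c" then show "x - rep c \<in> \<Lambda>" using R_eq_iff[of x "rep c"] rep[OF c] by (auto simp: fib_def)
  next
    assume l: "x - rep c \<in> \<Lambda>"
    then have "rep c + (x - rep c) \<in> \<Gamma>" using Lambda_subset rep[OF c] by (intro Gamma_add) auto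
    then show "x \<in> fib c" using l R_eq_iff[of x "rep c"] rep[OF c] by (auto simp: fib_def)
  qed
  show ?thesis
  proof
    show "fib c \<subseteq> (\<lambda>x. rep c + x) ` \<Lambda>"
    proof
      fix x assume "x \<in> fib c"
      then have "x - rep c \<in> \<Lambda>" using * by blast
      moreover have "x = rep c + (x - rep c)" by simp
      ultimately show "x \<in> (\<lambda>x. rep c + x) ` \<Lambda>" by (rule image_eqI[rotated])
    qed
    show "(\<lambda>x. rep c + x) ` \<Lambda> \<subseteq> fib c"
    proof
      fix x assume "x \<in> (\<lambda>x. rep c + x) ` \<Lambda>"
      then have "x - rep c \<in> \<Lambda>" by auto
      then show "x \<in> fib c" using * by blast
    qed
  qed
qed

definition Zc :: "'c \<Rightarrow> real \<Rightarrow> real" where "Zc c a = (\<Sum>\<^sub>\<infinity>x\<in>fib c. exp (- a * Sq x))"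

definition ZL :: "real \<Rightarrow> real" where "ZL a = (\<Sum>\<^sub>\<infinity>x\<in>\<Lambda>. exp (- a * Sq x))"

lemma Zc_eq: "c \<in> C \<Longrightarrow> Zc c a = (\<Sum>\<^sub>\<infinity>x\<in>\<Lambda>. exp (- a * Sq (rep c + x)))"
  unfolding Zc_def fib_eq by (subst infsum_reindex) (auto simp: comp_def)

lemma ZL_pos: "a > 0 \<Longrightarrow> ZL a > 0"
proof -
  assume a: "a > 0"
  have "0 \<in> \<Lambda>" by (rule image_eqI[of _ _ 0]) auto
  then have "(\<Sum>\<^sub>\<infinity>x\<in>{0}. exp (- a * Sq x)) \<le> ZL a"
    unfolding ZL_def using a Lambda_subset by (intro infsum_mono_neutral summable_Z) auto
  then show ?thesis by simp
qed

lemma Zc_bounds: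
  assumes c: "c \<in> C" and a: "a > 0"
  shows "Zc c a \<le> exp (a * Sq (rep c)) * ZL a" "ZL a \<le> exp (a * Sq (rep c)) * Zc c a"
proof -
  have v: "2 *\<^sub>R rep c \<in> \<Lambda>" using rep[OF c] two_in_Lambda by blast
  then have v': "2 *\<^sub>R (- rep c) \<in> \<Lambda>" using Lambda_minus[OF v] by simp
  show "Zc c a \<le> exp (a * Sq (rep c)) * ZL a"
    using coset_shift_le[OF a Lambda_subset Lambda_add Lambda_minus v', of "rep c"] by (simp add: Zc_eq[OF c] ZL_def)
  show "ZL a \<le> exp (a * Sq (rep c)) * Zc c a"
    using coset_shift_le[OF a Lambda_subset Lambda_add Lambda_minus v, of 0] by (simp add: Zc_eq[OF c] ZL_def)
qed

lemma infsum_classes: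
  fixes f :: "'v \<Rightarrow> complex"
  assumes f: "f summable_on \<Gamma>"
  shows "infsum f \<Gamma> = (\<Sum>c\<in>C. infsum f (fib c))"
proof -
  have "\<Gamma> = (\<Union>c\<in>C. fib c)" unfolding R_image[symmetric] fib_def by blast
  moreover have "infsum f (\<Union>c\<in>C'. fib c) = (\<Sum>c\<in>C'. infsum f (fib c))" if "finite C'" for C'
    using that
  proof (induction C' rule: finite_induct)
    case (insert c C')
    have sub: "fib c \<subseteq> \<Gamma>" "(\<Union>c\<in>C'. fib c) \<subseteq> \<Gamma>" by (auto simp: fib_def)
    have "infsum f (fib c \<union> (\<Union>c\<in>C'. fib c)) = infsum f (fib c) + infsum f (\<Union>c\<in>C'. fib c)"
      using insert sub f by (intro infsum_Un_disjoint) (auto simp: fib_def intro: summable_on_subset_banach)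
    then show ?case using insert by simp
  qed simp
  ultimately show ?thesis using finite_C by metis
qed

lemma of_real_infsum_exp:
  assumes a: "a > 0" and X: "X \<subseteq> \<Gamma>"
  shows "(\<Sum>\<^sub>\<infinity>x\<in>X. complex_of_real (exp (- a * Sq x))) = of_real (\<Sum>\<^sub>\<infinity>x\<in>X. exp (- a * Sq x))"
  using summable_Z[OF a X] by (intro infsumI has_sum_of_real) (simp add: has_sum_infsum)

lemma sum_classes:
  assumes a: "a > 0"
  shows "(\<Sum>\<^sub>\<infinity>x\<in>\<Gamma>. of_real (exp (- a * Sq x)) * l (R x)) = (\<Sum>c\<in>C. l c * complex_of_real (Zc c a))"
proof -
  have sum: "(\<lambda>x. of_real (exp (- a * Sq x)) * l (R x)) summable_on \<Gamma>"
  proof -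
    define M where "M = (\<Sum>c\<in>C. cmod (l c))"
    have "(\<lambda>x. M * exp (- a * Sq x)) summable_on \<Gamma>"
      using a by (intro summable_on_cmult_right summable_Z) auto
    then have "(\<lambda>x. cmod (of_real (exp (- a * Sq x)) * l (R x))) summable_on \<Gamma>"
    proof (rule summable_on_comparison_test)
      fix x assume "x \<in> \<Gamma>"
      then have "cmod (l (R x)) \<le> M" unfolding M_def
        using finite_C by (intro member_le_sum) (auto simp: R_image[symmetric])
      then show "cmod (of_real (exp (- a * Sq x)) * l (R x)) \<le> M * exp (- a * Sq x)"
        by (simp add: norm_mult)
    qed auto
    then show ?thesis by (rule abs_summable_summable)
  qed
  have "infsum (\<lambda>x. of_real (exp (- a * Sq x)) * l (R x)) (fib c) = l c * complex_of_real (Zc c a)" if "c \<in> C" for c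
  proof -
    have "infsum (\<lambda>x. of_real (exp (- a * Sq x)) * l (R x)) (fib c) = infsum (\<lambda>x. l c * of_real (exp (- a * Sq x))) (fib c)"
      by (intro infsum_cong) (auto simp: fib_def)
    also have "\<dots> = l c * complex_of_real (Zc c a)"
      unfolding Zc_def infsum_cmult_right' by (subst of_real_infsum_exp[OF a]) (auto simp: fib_def)
    finally show ?thesis .
  qed
  then show ?thesis unfolding infsum_classes[OF sum] by (intro sum.cong) auto
qed

lemma C_nonempty: "C \<noteq> {}"
  unfolding R_image[symmetric] using Gamma_zero by blast

text \<open>All classes have the same asymptotic weight, since by \<open>coset_shift_le\<close> the ratio of the weight of a class
  to that of \<open>(1 + \<i>) \<Gamma>\<close> lies between two bounds that tend to 1.\<close>

lemma equidistribution:
  assumes a: "\<And>n. a n > 0" and lim: "a \<longlonglongrightarrow> 0"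
  shows "(\<lambda>n. (\<Sum>\<^sub>\<infinity>x\<in>\<Gamma>. of_real (exp (- a n * Sq x)) * l (R x)) / complex_of_real (Z (a n))) \<longlonglongrightarrow> (\<Sum>c\<in>C. l c) / of_nat (card C)"
proof -
  have ratio: "(\<lambda>n. Zc c (a n) / ZL (a n)) \<longlonglongrightarrow> 1" if c: "c \<in> C" for c
  proof (rule tendsto_sandwich)
    have "(\<lambda>n. exp (- (a n * Sq (rep c)))) \<longlonglongrightarrow> exp (- (0 * Sq (rep c)))" by (intro tendsto_intros lim)
    then show "(\<lambda>n. exp (- (a n * Sq (rep c)))) \<longlonglongrightarrow> 1" by simp
    have "(\<lambda>n. exp (a n * Sq (rep c))) \<longlonglongrightarrow> exp (0 * Sq (rep c))" by (intro tendsto_intros lim)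
    then show "(\<lambda>n. exp (a n * Sq (rep c))) \<longlonglongrightarrow> 1" by simp
    show "\<forall>\<^sub>F n in sequentially. exp (- (a n * Sq (rep c))) \<le> Zc c (a n) / ZL (a n)"
      using Zc_bounds(2)[OF c a] ZL_pos[OF a] by (intro always_eventually) (simp add: field_simps exp_minus)
    show "\<forall>\<^sub>F n in sequentially. Zc c (a n) / ZL (a n) \<le> exp (a n * Sq (rep c))"
      using Zc_bounds(1)[OF c a] ZL_pos[OF a] by (intro always_eventually) (simp add: field_simps)
  qed
  have rc: "(\<lambda>n. complex_of_real (Zc c (a n) / ZL (a n))) \<longlonglongrightarrow> 1" if "c \<in> C" for c
    using tendsto_of_real[OF ratio[OF that], where 'a = complex] by simp
  have Zs: "complex_of_real (Z (a n)) = (\<Sum>c\<in>C. complex_of_real (Zc c (a n)))" for n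
    using sum_classes[OF a, of n "\<lambda>_. 1"] of_real_infsum_exp[OF a, of \<Gamma> n] by (simp add: Z_def)
  have "(\<lambda>n. (\<Sum>c\<in>C. l c * complex_of_real (Zc c (a n) / ZL (a n))) / (\<Sum>c\<in>C. complex_of_real (Zc c (a n) / ZL (a n)))) \<longlonglongrightarrow> (\<Sum>c\<in>C. l c * 1) / (\<Sum>c\<in>C. 1)"
    using finite_C C_nonempty by (intro tendsto_divide tendsto_sum tendsto_mult tendsto_const rc) auto
  moreover have "(\<Sum>c\<in>C. l c * complex_of_real (Zc c (a n) / ZL (a n))) / (\<Sum>c\<in>C. complex_of_real (Zc c (a n) / ZL (a n)))
     = (\<Sum>\<^sub>\<infinity>x\<in>\<Gamma>. of_real (exp (- a n * Sq x)) * l (R x)) / complex_of_real (Z (a n))" for n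
    unfolding sum_classes[OF a] Zs using ZL_pos[OF a, of n]
    by (simp add: sum_divide_distrib[symmetric])
  ultimately show ?thesis by simp
qed

definition Kd :: real where "Kd = (\<Sum>c\<in>C. exp (Sq (inverse (1 + \<i>) *\<^sub>C rep c)))"

lemma one_plus_i_nonzero: "1 + \<i> \<noteq> 0" by (simp add: complex_eq_iff)

text \<open>Multiplication by \<open>1 + \<i>\<close> doubles \<open>Sq\<close>, so the weight of each class for \<open>a / 2\<close> is that of a shifted lattice
  for \<open>a\<close>.\<close>

lemma doubling:
  assumes a: "a > 0" "a \<le> 1"
  shows "Z (a / 2) \<le> Kd * Z a"
proof -
  have a2: "a / 2 > 0" using a by simp
  have "complex_of_real (Z (a / 2)) = (\<Sum>c\<in>C. complex_of_real (Zc c (a / 2)))"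
    using sum_classes[OF a2, of "\<lambda>_. 1"] of_real_infsum_exp[OF a2, of \<Gamma>] by (simp add: Z_def)
  then have "Z (a / 2) = (\<Sum>c\<in>C. Zc c (a / 2))" by (simp only: of_real_sum[symmetric] of_real_eq_iff)
  also have "\<dots> \<le> (\<Sum>c\<in>C. exp (Sq (inverse (1 + \<i>) *\<^sub>C rep c)) * Z a)"
  proof (rule sum_mono)
    fix c assume c: "c \<in> C"
    define v where "v = inverse (1 + \<i>) *\<^sub>C rep c"
    have rv: "rep c = (1 + \<i>) *\<^sub>C v" using one_plus_i_nonzero by (simp add: v_def scaleC_scaleC scaleC_one)
    have "2 *\<^sub>R (- v) = - ((1 - \<i>) *\<^sub>C rep c)"
    proof -
      have "(1 - \<i>) * (1 + \<i>) = complex_of_real 2" by (simp add: complex_eq_iff)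
      then show ?thesis unfolding rv scaleC_scaleC scaleR_minus_right by (simp only: scaleR_scaleC)
    qed
    also have "\<dots> \<in> \<Gamma>" using rep[OF c] by (intro Gamma_minus Gamma_scale) auto
    finally have v2: "2 *\<^sub>R (- v) \<in> \<Gamma>" .
    have inj: "inj_on (scaleC (1 + \<i>)) \<Gamma>" using one_plus_i_nonzero by (auto intro!: inj_onI)
    have "Zc c (a / 2) = (\<Sum>\<^sub>\<infinity>y\<in>\<Gamma>. exp (- (a / 2) * Sq ((1 + \<i>) *\<^sub>C v + (1 + \<i>) *\<^sub>C y)))"
      unfolding Zc_eq[OF c] infsum_reindex[OF inj] comp_def rv[symmetric] ..
    also have "\<dots> = (\<Sum>\<^sub>\<infinity>y\<in>\<Gamma>. exp (- a * Sq (v + y)))"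
      by (simp add: scaleC_add_right[symmetric] Sq_scale cmod_power2)
    also have "\<dots> \<le> exp (a * Sq (- v)) * (\<Sum>\<^sub>\<infinity>y\<in>\<Gamma>. exp (- a * Sq (v + - v + y)))"
      by (rule coset_shift_le[OF a(1) order_refl Gamma_add Gamma_minus v2])
    also have "\<dots> = exp (a * Sq v) * Z a" by (simp add: Z_def)
    also have "\<dots> \<le> exp (Sq v) * Z a"
      using a Z_pos[OF a(1)] mult_right_mono[of a 1 "Sq v"] by (intro mult_right_mono) auto
    finally show "Zc c (a / 2) \<le> exp (Sq (inverse (1 + \<i>) *\<^sub>C rep c)) * Z a" by (simp add: v_def)
  qed
  also have "\<dots> = Kd * Z a" by (simp add: Kd_def sum_distrib_right)
  finally show ?thesis .
qed

text \<open>The weight of lattice points with \<open>Sq x\<close> much larger than \<open>1 / a\<close> is negligible: there the factor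
  \<open>exp (- a / 4 * Sq x)\<close> is small, and by \<open>doubling\<close> the rest is bounded by the total weight. The threshold
  \<open>Sq x * (a * sqrt a) \<le> 1\<close> leaves room to show convergence of the summands along arbitrary sequences of
  points that satisfy it.\<close>

lemma concentration:
  fixes \<Psi> :: "nat \<Rightarrow> 'v \<Rightarrow> complex" and l :: "'v \<Rightarrow> complex"
  assumes a: "\<And>n. a n > 0" "\<And>n. a n \<le> 1" and lim: "a \<longlonglongrightarrow> 0"
    and Psi: "\<And>n x. x \<in> \<Gamma> \<Longrightarrow> cmod (\<Psi> n x) \<le> K * exp (a n / 4 * Sq x)"
    and l: "\<And>x. x \<in> \<Gamma> \<Longrightarrow> cmod (l x) \<le> K"
    and conv: "\<And>x. (\<And>n. x n \<in> \<Gamma> \<and> Sq (x n) * (a n * sqrt (a n)) \<le> 1) \<Longrightarrow> (\<lambda>n. \<Psi> n (x n) - l (x n)) \<longlonglongrightarrow> 0"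
  shows "(\<lambda>n. (\<Sum>\<^sub>\<infinity>x\<in>\<Gamma>. of_real (exp (- a n * Sq x)) * \<Psi> n x) / of_real (Z (a n))
            - (\<Sum>\<^sub>\<infinity>x\<in>\<Gamma>. of_real (exp (- a n * Sq x)) * l x) / of_real (Z (a n))) \<longlonglongrightarrow> 0"
proof (rule LIMSEQ_I)
  fix e :: real assume e: "e > 0"
  have K: "K \<ge> 0" using l[OF Gamma_zero] norm_ge_zero order_trans by blast
  have unif: "eventually (\<lambda>n. \<forall>x\<in>\<Gamma>. Sq x * (a n * sqrt (a n)) \<le> 1 \<longrightarrow> cmod (\<Psi> n x - l x) \<le> e / 2) sequentially"
  proof -
    define bad where "bad n x \<longleftrightarrow> x \<in> \<Gamma> \<and> Sq x * (a n * sqrt (a n)) \<le> 1 \<and> \<not> cmod (\<Psi> n x - l x) \<le> e / 2" for n x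
    (* Choosing a counterexample for each n, where there is one, reduces uniformity to sequences. *)
    define xs where "xs n = (if \<exists>x. bad n x then SOME x. bad n x else 0)" for n
    have bad: "bad n (xs n)" if "\<exists>x. bad n x" for n using that someI_ex[OF that] by (simp add: xs_def)
    have "xs n \<in> \<Gamma> \<and> Sq (xs n) * (a n * sqrt (a n)) \<le> 1" for n
    proof (cases "\<exists>x. bad n x")
      case True then show ?thesis using bad[OF True] by (simp add: bad_def)
    next
      case False then show ?thesis by (simp add: xs_def)
    qed
    then have "(\<lambda>n. \<Psi> n (xs n) - l (xs n)) \<longlonglongrightarrow> 0" by (rule conv)
    then have "eventually (\<lambda>n. dist (\<Psi> n (xs n) - l (xs n)) 0 < e / 2) sequentially"
      using e by (intro tendstoD) auto
    then show ?thesis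
    proof eventually_elim
      case (elim n)
      then have "\<not> bad n (xs n)" by (simp add: bad_def)
      then have "\<not> (\<exists>x. bad n x)" using bad by blast
      then show ?case by (auto simp: bad_def)
    qed
  qed
  have small: "eventually (\<lambda>n. 2 * K * exp (- 1 / (4 * sqrt (a n))) * Kd < e / 2) sequentially"
  proof -
    have "filterlim a (at_right 0) sequentially"
      using a(1) by (intro tendsto_imp_filterlim_at_right[OF lim] always_eventually) auto
    then have "((\<lambda>n. exp (- 1 / (4 * sqrt (a n)))) \<longlongrightarrow> 0) sequentially"
      by (rule filterlim_compose[rotated]) real_asymp
    then have "((\<lambda>n. 2 * K * exp (- 1 / (4 * sqrt (a n))) * Kd) \<longlongrightarrow> 2 * K * 0 * Kd) sequentially"
      by (intro tendsto_intros)
    then show ?thesis using e by (intro order_tendstoD(2)) auto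
  qed
  have "eventually (\<lambda>n. norm ((\<Sum>\<^sub>\<infinity>x\<in>\<Gamma>. of_real (exp (- a n * Sq x)) * \<Psi> n x) / of_real (Z (a n))
            - (\<Sum>\<^sub>\<infinity>x\<in>\<Gamma>. of_real (exp (- a n * Sq x)) * l x) / of_real (Z (a n))) < e) sequentially"
    using unif small
  proof eventually_elim
    case (elim n)
    define w where "w = 2 * K * exp (- 1 / (4 * sqrt (a n)))"
    have w: "w \<ge> 0" using K by (simp add: w_def)
    have sq: "sqrt (a n) > 0" using a by simp
    have pw: "cmod (of_real (exp (- a n * Sq x)) * \<Psi> n x - of_real (exp (- a n * Sq x)) * l x) \<le> e / 2 * exp (- a n * Sq x) + w * exp (- (a n / 2) * Sq x)"
      if x: "x \<in> \<Gamma>" for x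
    proof -
      have n: "cmod (of_real (exp (- a n * Sq x)) * \<Psi> n x - of_real (exp (- a n * Sq x)) * l x) = exp (- a n * Sq x) * cmod (\<Psi> n x - l x)"
        by (simp add: right_diff_distrib[symmetric] norm_mult)
      show ?thesis
      proof (cases "Sq x * (a n * sqrt (a n)) \<le> 1")
        case True
        then have "exp (- a n * Sq x) * cmod (\<Psi> n x - l x) \<le> exp (- a n * Sq x) * (e / 2)"
          using elim(1) x by (intro mult_left_mono) auto
        also have "\<dots> = e / 2 * exp (- a n * Sq x)" by (rule mult.commute)
        finally have "exp (- a n * Sq x) * cmod (\<Psi> n x - l x) \<le> e / 2 * exp (- a n * Sq x)" .
        moreover have "0 \<le> w * exp (- (a n / 2) * Sq x)" using w by simp
        ultimately show ?thesis unfolding n by linarith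
      next
        case False
        have "cmod (\<Psi> n x - l x) \<le> cmod (\<Psi> n x) + cmod (l x)" by (rule norm_triangle_ineq4)
        also have "\<dots> \<le> K * exp (a n / 4 * Sq x) + K * 1" using Psi[OF x, of n] l[OF x] by simp
        also have "\<dots> \<le> K * exp (a n / 4 * Sq x) + K * exp (a n / 4 * Sq x)"
          using K a(1)[of n] by (intro add_mono mult_left_mono) auto
        finally have "exp (- a n * Sq x) * cmod (\<Psi> n x - l x) \<le> exp (- a n * Sq x) * (2 * K * exp (a n / 4 * Sq x))"
          by (intro mult_left_mono) auto
        also have "\<dots> = 2 * K * (exp (- (a n / 4) * Sq x) * exp (- (a n / 2) * Sq x))"
          by (simp add: exp_add[symmetric])
        also have "\<dots> \<le> 2 * K * (exp (- 1 / (4 * sqrt (a n))) * exp (- (a n / 2) * Sq x))"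
        proof -
          have "1 / sqrt (a n) \<le> Sq x * a n" using False sq by (simp add: field_simps)
          then have "- (a n / 4) * Sq x \<le> - 1 / (4 * sqrt (a n))" by (simp add: field_simps)
          then show ?thesis using K by (intro mult_left_mono mult_right_mono) auto
        qed
        also have "\<dots> = w * exp (- (a n / 2) * Sq x)" by (simp add: w_def)
        finally have "exp (- a n * Sq x) * cmod (\<Psi> n x - l x) \<le> w * exp (- (a n / 2) * Sq x)" .
        moreover have "0 \<le> e / 2 * exp (- a n * Sq x)" using e by simp
        ultimately show ?thesis unfolding n by linarith
      qed
    qed
    have a2: "a n / 2 > 0" using a(1)[of n] by simp
    have s1: "(\<lambda>x. of_real (exp (- a n * Sq x)) * \<Psi> n x) summable_on \<Gamma>"
    proof (rule abs_summable_summable, rule summable_on_comparison_test)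
      show "(\<lambda>x. K * exp (- (3 * a n / 4) * Sq x)) summable_on \<Gamma>"
        using a(1)[of n] by (intro summable_on_cmult_right summable_Z) auto
      fix x assume x: "x \<in> \<Gamma>"
      have "exp (- a n * Sq x) * cmod (\<Psi> n x) \<le> exp (- a n * Sq x) * (K * exp (a n / 4 * Sq x))"
        by (intro mult_left_mono Psi x) auto
      also have "\<dots> = K * exp (- (3 * a n / 4) * Sq x)" by (simp add: exp_add[symmetric] algebra_simps)
      finally show "cmod (of_real (exp (- a n * Sq x)) * \<Psi> n x) \<le> K * exp (- (3 * a n / 4) * Sq x)" by (simp add: norm_mult)
    qed auto
    have s2: "(\<lambda>x. of_real (exp (- a n * Sq x)) * l x) summable_on \<Gamma>"
    proof (rule abs_summable_summable, rule summable_on_comparison_test)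
      show "(\<lambda>x. K * exp (- a n * Sq x)) summable_on \<Gamma>"
        using a(1)[of n] by (intro summable_on_cmult_right summable_Z) auto
      fix x assume x: "x \<in> \<Gamma>"
      show "cmod (of_real (exp (- a n * Sq x)) * l x) \<le> K * exp (- a n * Sq x)"
        using l[OF x] by (simp add: norm_mult)
    qed auto
    have sb: "(\<lambda>x. e / 2 * exp (- a n * Sq x) + w * exp (- (a n / 2) * Sq x)) summable_on \<Gamma>"
      using a(1)[of n] a2 by (intro summable_on_add summable_on_cmult_right summable_Z) auto
    let ?D = "\<lambda>x. of_real (exp (- a n * Sq x)) * \<Psi> n x - of_real (exp (- a n * Sq x)) * l x"
    have sD: "(\<lambda>x. cmod (?D x)) summable_on \<Gamma>"
      by (rule summable_on_comparison_test[OF sb]) (use pw in auto)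
    have "(\<Sum>\<^sub>\<infinity>x\<in>\<Gamma>. of_real (exp (- a n * Sq x)) * \<Psi> n x) - (\<Sum>\<^sub>\<infinity>x\<in>\<Gamma>. of_real (exp (- a n * Sq x)) * l x) = infsum ?D \<Gamma>"
    proof -
      have "infsum ?D \<Gamma> = infsum (\<lambda>x. of_real (exp (- a n * Sq x)) * \<Psi> n x + - (of_real (exp (- a n * Sq x)) * l x)) \<Gamma>" by simp
      also have "\<dots> = (\<Sum>\<^sub>\<infinity>x\<in>\<Gamma>. of_real (exp (- a n * Sq x)) * \<Psi> n x) + (\<Sum>\<^sub>\<infinity>x\<in>\<Gamma>. - (of_real (exp (- a n * Sq x)) * l x))"
        using s2 by (intro infsum_add s1) (simp add: summable_on_uminus)
      finally show ?thesis by (simp add: infsum_uminus)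
    qed
    also have "cmod (infsum ?D \<Gamma>) \<le> (\<Sum>\<^sub>\<infinity>x\<in>\<Gamma>. cmod (?D x))" by (rule norm_infsum_bound[OF sD])
    also have "\<dots> \<le> (\<Sum>\<^sub>\<infinity>x\<in>\<Gamma>. e / 2 * exp (- a n * Sq x) + w * exp (- (a n / 2) * Sq x))"
      by (intro infsum_mono sD sb pw)
    also have "\<dots> = (\<Sum>\<^sub>\<infinity>x\<in>\<Gamma>. e / 2 * exp (- a n * Sq x)) + (\<Sum>\<^sub>\<infinity>x\<in>\<Gamma>. w * exp (- (a n / 2) * Sq x))"
      using a(1)[of n] a2 by (intro infsum_add summable_on_cmult_right summable_Z) auto
    also have "\<dots> = e / 2 * Z (a n) + w * Z (a n / 2)"
      unfolding Z_def infsum_cmult_right' ..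
    also have "\<dots> \<le> e / 2 * Z (a n) + w * (Kd * Z (a n))"
      by (intro add_left_mono mult_left_mono doubling a w)
    also have "\<dots> = (e / 2 + w * Kd) * Z (a n)" by (simp add: algebra_simps)
    also have "\<dots> < e * Z (a n)"
      using elim(2) Z_pos[OF a(1), of n] by (intro mult_strict_right_mono) (auto simp: w_def)
    finally show ?case
      using Z_pos[OF a(1), of n] by (simp add: diff_divide_distrib[symmetric] norm_divide field_simps)
  qed
  then show "\<exists>no. \<forall>n\<ge>no. norm ((\<Sum>\<^sub>\<infinity>x\<in>\<Gamma>. of_real (exp (- a n * Sq x)) * \<Psi> n x) / of_real (Z (a n))
            - (\<Sum>\<^sub>\<infinity>x\<in>\<Gamma>. of_real (exp (- a n * Sq x)) * l x) / of_real (Z (a n)) - 0) < e"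
    by (simp add: eventually_sequentially)
qed

end

section \<open>Multiplication by the imaginary unit and the theta function\<close>

context gauss_lat
begin

text \<open>In finite dimension the norm is controlled by the hermitian form.\<close>

lemma tendsto_zero_Sq:
  assumes "(\<lambda>n. Sq (d n)) \<longlonglongrightarrow> 0"
  shows "d \<longlonglongrightarrow> 0"
proof -
  have "(\<lambda>n. H (Dv k) (d n)) \<longlonglongrightarrow> 0" for k
  proof (rule Lim_null_comparison)
    have "(\<lambda>n. sqrt (Sq (Dv k) * Sq (d n))) \<longlonglongrightarrow> sqrt (Sq (Dv k) * 0)" by (intro tendsto_intros assms)
    then show "(\<lambda>n. sqrt (Sq (Dv k) * Sq (d n))) \<longlonglongrightarrow> 0" by simp
    show "\<forall>\<^sub>F n in sequentially. norm (H (Dv k) (d n)) \<le> sqrt (Sq (Dv k) * Sq (d n))"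
      by (intro always_eventually allI real_le_rsqrt Cauchy_Schwarz)
  qed
  then have "(\<lambda>n. H (Dv k) (d n) *\<^sub>C bk k) \<longlonglongrightarrow> 0 *\<^sub>C bk k" for k
    by (rule bounded_linear.tendsto[OF bounded_linear_scaleC])
  then have "(\<lambda>n. lin (\<lambda>k. H (Dv k) (d n))) \<longlonglongrightarrow> (\<Sum>k<g. 0 *\<^sub>C bk k)"
    unfolding lin_def by (intro tendsto_sum)
  then show ?thesis unfolding lin_H_Dv by simp
qed

lemma Sq_scaled_tendsto:
  assumes a: "\<And>n. a n > 0" "a \<longlonglongrightarrow> 0" and x: "\<And>n. Sq (x n) * (a n * sqrt (a n)) \<le> 1"
  shows "(\<lambda>n. (a n)\<^sup>2 * Sq (x n)) \<longlonglongrightarrow> 0"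
proof (rule tendsto_sandwich[where f = "\<lambda>_. 0"])
  show "(\<lambda>n. sqrt (a n)) \<longlonglongrightarrow> 0" using tendsto_real_sqrt[OF a(2)] by simp
  have "(a n)\<^sup>2 * Sq (x n) \<le> sqrt (a n)" for n
  proof -
    have "(a n)\<^sup>2 * Sq (x n) = (Sq (x n) * (a n * sqrt (a n))) * sqrt (a n)"
      using a(1)[of n] by (simp add: power2_eq_square)
    also have "\<dots> \<le> 1 * sqrt (a n)" using a(1)[of n] x[of n] by (intro mult_right_mono) auto
    finally show ?thesis by simp
  qed
  then show "\<forall>\<^sub>F n in sequentially. (a n)\<^sup>2 * Sq (x n) \<le> sqrt (a n)" by simp
qed auto

end

lemma pi_le_4: "pi \<le> 4" using pi_less_4 by simp

text \<open>The multipliers times \<open>exp (- \<pi>\<i>/2 Sq x)\<close>, the phase that is left on the left-hand side of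
  \<open>theta_poisson\<close> at \<open>\<tau> = 0\<close>, depend on the class modulo \<open>(1 + \<i>) \<Gamma>\<close> only.\<close>

locale theta_classes = theta_lat \<Gamma> H bs g \<theta> ch + gauss_classes \<Gamma> H bs g R C
  for \<Gamma> :: "'v::complex_normed_vector set" and H bs g \<theta> ch and R :: "'v \<Rightarrow> 'c" and C +
  fixes lc :: "'c \<Rightarrow> complex"
  assumes lc: "x \<in> \<Gamma> \<Longrightarrow> ch x * exp (- (\<i> * of_real pi * of_real (Sq x) / 2)) = lc (R x)"
begin

text \<open>The bulk of the weight lies at points \<open>x\<close> with \<open>\<tau> x\<close> small, where the summand is close to \<open>\<theta> (\<i> z)\<close>.\<close>

lemma limit_E_side:
  assumes t: "\<And>n. 0 < \<tau> n" "\<And>n. \<tau> n \<le> 1 / 8" and lim: "\<tau> \<longlonglongrightarrow> 0"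
  shows "(\<lambda>n. (\<Sum>\<^sub>\<infinity>x\<in>\<Gamma>. E (\<tau> n) z x) / of_real (Z (pi * \<tau> n))) \<longlonglongrightarrow> \<theta> (\<i> *\<^sub>C z)"
proof -
  obtain K where K: "K > 0" "\<And>x. cmod (\<theta> x) \<le> K * exp (pi / 2 * Sq x)" using theta_growth by blast
  define a where "a n = pi * \<tau> n" for n
  have a0: "a n > 0" for n using t by (simp add: a_def)
  have a1: "a n \<le> 1" for n
    using mult_mono[of pi 4 "\<tau> n" "1/8"] pi_le_4 t[of n] by (simp add: a_def)
  have alim: "a \<longlonglongrightarrow> 0" unfolding a_def using tendsto_mult[OF tendsto_const lim, of pi] by simp
  define \<Psi> where "\<Psi> n x = exp (\<i> * of_real (pi * \<tau> n) * H x z) * \<theta> ((\<i> * of_real (1 - \<tau> n)) *\<^sub>C z + of_real (\<tau> n) *\<^sub>C x)" for n x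
  define K' where "K' = K * exp (2 * pi * Sq z) + cmod (\<theta> (\<i> *\<^sub>C z))"
  have "(\<lambda>n. (\<Sum>\<^sub>\<infinity>x\<in>\<Gamma>. of_real (exp (- a n * Sq x)) * \<Psi> n x) / of_real (Z (a n))
            - (\<Sum>\<^sub>\<infinity>x\<in>\<Gamma>. of_real (exp (- a n * Sq x)) * \<theta> (\<i> *\<^sub>C z)) / of_real (Z (a n))) \<longlonglongrightarrow> 0"
  proof (rule concentration[OF a0 a1 alim, where K = K'])
    show "cmod (\<Psi> n x) \<le> K' * exp (a n / 4 * Sq x)" if "x \<in> \<Gamma>" for n x
    proof -
      have "cmod (\<Psi> n x) \<le> (K * exp (2 * pi * Sq z)) * exp (pi * \<tau> n / 4 * Sq x)"
        unfolding \<Psi>_def norm_mult by (rule E_bound_aux[OF K(2,1) t])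
      also have "\<dots> \<le> K' * exp (a n / 4 * Sq x)"
        unfolding a_def K'_def by (intro mult_right_mono) auto
      finally show ?thesis .
    qed
    show "cmod (\<theta> (\<i> *\<^sub>C z)) \<le> K'" for x :: 'v using K by (simp add: K'_def)
    fix x assume x: "\<And>n. x n \<in> \<Gamma> \<and> Sq (x n) * (a n * sqrt (a n)) \<le> 1"
    then have sx: "(\<lambda>n. (a n)\<^sup>2 * Sq (x n)) \<longlonglongrightarrow> 0" by (intro Sq_scaled_tendsto a0 alim) auto
    have e1: "(\<lambda>n. of_real (a n) * H (x n) z) \<longlonglongrightarrow> 0"
    proof (rule Lim_null_comparison)
      have "(\<lambda>n. sqrt (((a n)\<^sup>2 * Sq (x n)) * Sq z)) \<longlonglongrightarrow> sqrt (0 * Sq z)" by (intro tendsto_intros sx)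
      then show "(\<lambda>n. sqrt (((a n)\<^sup>2 * Sq (x n)) * Sq z)) \<longlonglongrightarrow> 0" by simp
      show "\<forall>\<^sub>F n in sequentially. norm (of_real (a n) * H (x n) z) \<le> sqrt (((a n)\<^sup>2 * Sq (x n)) * Sq z)"
      proof (intro always_eventually allI real_le_rsqrt)
        fix n
        have "(a n)\<^sup>2 * (cmod (H (x n) z))\<^sup>2 \<le> (a n)\<^sup>2 * (Sq (x n) * Sq z)"
          by (intro mult_left_mono Cauchy_Schwarz) auto
        then show "(norm (of_real (a n) * H (x n) z))\<^sup>2 \<le> ((a n)\<^sup>2 * Sq (x n)) * Sq z"
          by (simp add: norm_mult power_mult_distrib mult.assoc)
      qed
    qed
    have "(\<lambda>n. exp (\<i> * (of_real (a n) * H (x n) z))) \<longlonglongrightarrow> exp (\<i> * 0)"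
      by (intro tendsto_intros e1)
    then have e2: "(\<lambda>n. exp (\<i> * of_real (pi * \<tau> n) * H (x n) z)) \<longlonglongrightarrow> 1"
      by (simp add: a_def mult.assoc)
    define d where "d n = of_real (\<tau> n) *\<^sub>C (x n - \<i> *\<^sub>C z)" for n
    have pt: "(\<i> * of_real (1 - \<tau> n)) *\<^sub>C z + of_real (\<tau> n) *\<^sub>C x n = \<i> *\<^sub>C z + d n" for n
    proof -
      have "\<i> * of_real (1 - \<tau> n) = \<i> - of_real (\<tau> n) * \<i>" by (simp add: algebra_simps)
      then show ?thesis
        by (simp add: d_def complex_vector.scale_right_diff_distrib complex_vector.scale_left_diff_distrib scaleC_scaleC)
    qed
    have dlim: "(\<lambda>n. Sq (d n)) \<longlonglongrightarrow> 0"
    proof (rule tendsto_sandwich[where f = "\<lambda>_. 0"])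
      have "(\<lambda>n. 2 * ((a n)\<^sup>2 * Sq (x n)) + 2 * ((a n)\<^sup>2 * Sq z)) \<longlonglongrightarrow> 2 * 0 + 2 * (0\<^sup>2 * Sq z)"
        by (intro tendsto_intros sx alim)
      then show "(\<lambda>n. 2 * ((a n)\<^sup>2 * Sq (x n)) + 2 * ((a n)\<^sup>2 * Sq z)) \<longlonglongrightarrow> 0" by simp
      show "\<forall>\<^sub>F n in sequentially. Sq (d n) \<le> 2 * ((a n)\<^sup>2 * Sq (x n)) + 2 * ((a n)\<^sup>2 * Sq z)"
      proof (intro always_eventually allI)
        fix n
        have "\<tau> n \<le> a n" unfolding a_def using t(1)[of n] pi_gt3 by simp
        then have "(\<tau> n)\<^sup>2 \<le> (a n)\<^sup>2" using t(1)[of n] by (intro power_mono) auto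
        moreover have "Sq (x n - \<i> *\<^sub>C z) \<le> 2 * Sq (x n) + 2 * Sq z"
          using Sq_add_le[of "x n" "- (\<i> *\<^sub>C z)"] by (simp add: Sq_scale)
        ultimately have "(\<tau> n)\<^sup>2 * Sq (x n - \<i> *\<^sub>C z) \<le> (a n)\<^sup>2 * (2 * Sq (x n) + 2 * Sq z)"
          by (intro mult_mono) auto
        then show "Sq (d n) \<le> 2 * ((a n)\<^sup>2 * Sq (x n)) + 2 * ((a n)\<^sup>2 * Sq z)"
          unfolding d_def Sq_scale norm_of_real power2_abs by (simp add: algebra_simps)
      qed
    qed auto
    have "(\<lambda>n. \<i> *\<^sub>C z + d n) \<longlonglongrightarrow> \<i> *\<^sub>C z + 0"
      by (intro tendsto_intros tendsto_zero_Sq dlim)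
    then have "(\<lambda>n. \<theta> (\<i> *\<^sub>C z + d n)) \<longlonglongrightarrow> \<theta> (\<i> *\<^sub>C z)"
      by (intro continuous_on_tendsto_compose[OF continuous_theta]) auto
    then have "(\<lambda>n. \<Psi> n (x n) - \<theta> (\<i> *\<^sub>C z)) \<longlonglongrightarrow> 1 * \<theta> (\<i> *\<^sub>C z) - \<theta> (\<i> *\<^sub>C z)"
      unfolding \<Psi>_def pt by (intro tendsto_intros e2)
    then show "(\<lambda>n. \<Psi> n (x n) - \<theta> (\<i> *\<^sub>C z)) \<longlonglongrightarrow> 0" by simp
  qed
  moreover have "(\<Sum>\<^sub>\<infinity>x\<in>\<Gamma>. of_real (exp (- a n * Sq x)) * \<theta> (\<i> *\<^sub>C z)) / of_real (Z (a n)) = \<theta> (\<i> *\<^sub>C z)" for n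
    unfolding infsum_cmult_left' of_real_infsum_exp[OF a0 order_refl] Z_def[symmetric]
    using Z_pos[OF a0, of n] by simp
  ultimately have "(\<lambda>n. (\<Sum>\<^sub>\<infinity>x\<in>\<Gamma>. of_real (exp (- a n * Sq x)) * \<Psi> n x) / of_real (Z (a n)) - \<theta> (\<i> *\<^sub>C z)) \<longlonglongrightarrow> 0"
    by simp
  then show ?thesis
    unfolding LIM_zero_iff E_split \<Psi>_def a_def .
qed

text \<open>First order expansion at \<open>\<tau> = 0\<close>, with exact remainder. The real part of the first order term is the
  source of the Gaussian decay on the left-hand side of \<open>theta_poisson\<close>.\<close>

lemma s_expand: "s \<tau> - 1 / 2 = \<i> / 2 + of_real (\<tau> / 2) + - (\<i> * of_real (\<tau>\<^sup>2) * s \<tau> / 2)"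
proof -
  have "r \<tau> * s \<tau> = 1" by (simp add: s_def)
  then have 1: "s \<tau> - \<i> * s \<tau> + \<i> * of_real \<tau> * s \<tau> = 1"
    by (simp add: r_def algebra_simps)
  have "2 * s \<tau> = 1 + \<i> + (of_real \<tau> * s \<tau> - \<i> * of_real \<tau> * s \<tau>)"
    using arg_cong[OF 1, of "\<lambda>w. (1 + \<i>) * w"] by (simp add: algebra_simps)
  moreover have "of_real \<tau> * s \<tau> - \<i> * of_real \<tau> * s \<tau> = of_real \<tau> - \<i> * of_real (\<tau>\<^sup>2) * s \<tau>"
    using arg_cong[OF 1, of "\<lambda>w. of_real \<tau> * w"] by (simp add: algebra_simps power2_eq_square)
  ultimately have "(2 * s \<tau> - (1 + \<i> + (of_real \<tau> - \<i> * of_real (\<tau>\<^sup>2) * s \<tau>))) / 2 = 0" by simp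
  moreover have "(2 * s \<tau> - (1 + \<i> + (of_real \<tau> - \<i> * of_real (\<tau>\<^sup>2) * s \<tau>))) / 2
      = (s \<tau> - 1 / 2) - (\<i> / 2 + of_real (\<tau> / 2) + - (\<i> * of_real (\<tau>\<^sup>2) * s \<tau> / 2))"
    by (simp add: field_simps)
  ultimately show ?thesis by simp
qed

lemma norm_s_le: "cmod (s \<tau>) \<le> 1"
proof -
  have "1 \<le> cmod (r \<tau>)" using complex_Re_le_cmod[of "r \<tau>"] by (simp add: r_def)
  then show ?thesis by (simp add: s_def norm_divide)
qed

text \<open>The Gaussian here has the exponent \<open>- \<pi> \<tau> / 2 * Sq x\<close>, half of that on the other side; the phase at \<open>\<tau> = 0\<close> is absorbed in \<open>lc\<close>
  and the remainder of \<open>s_expand\<close> is negligible where the weight is concentrated.\<close>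

lemma limit_F_side:
  assumes t: "\<And>n. 0 < \<tau> n" "\<And>n. \<tau> n \<le> 1 / 8" and lim: "\<tau> \<longlonglongrightarrow> 0"
  shows "(\<lambda>n. (\<Sum>\<^sub>\<infinity>x\<in>\<Gamma>. ch x * exp (- (of_real pi * (s (\<tau> n) - 1 / 2) * of_real (Sq x)))) / of_real (Z (pi * \<tau> n / 2)))
     \<longlonglongrightarrow> (\<Sum>c\<in>C. lc c) / of_nat (card C)"
proof -
  define a where "a n = pi * \<tau> n / 2" for n
  have a0: "a n > 0" for n using t by (simp add: a_def)
  have a1: "a n \<le> 1" for n
    using mult_mono[of pi 4 "\<tau> n" "1/8"] pi_le_4 t[of n] by (simp add: a_def)
  have alim: "a \<longlonglongrightarrow> 0" unfolding a_def using tendsto_mult[OF tendsto_const lim, of "pi / 2"] by simp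
  define \<eta> where "\<eta> n = - (\<i> * of_real ((\<tau> n)\<^sup>2) * s (\<tau> n) / 2)" for n
  have eta: "cmod (\<eta> n) \<le> (\<tau> n)\<^sup>2 / 2" for n
  proof -
    have "cmod (\<eta> n) = (\<tau> n)\<^sup>2 * cmod (s (\<tau> n)) / 2" unfolding \<eta>_def by (simp add: norm_mult norm_divide norm_power)
    also have "\<dots> \<le> (\<tau> n)\<^sup>2 * 1 / 2" by (intro divide_right_mono mult_left_mono norm_s_le) auto
    finally show ?thesis by simp
  qed
  define \<Psi> where "\<Psi> n x = lc (R x) * exp (- (of_real pi * \<eta> n * of_real (Sq x)))" for n x
  have summand: "ch x * exp (- (of_real pi * (s (\<tau> n) - 1 / 2) * of_real (Sq x))) = of_real (exp (- a n * Sq x)) * \<Psi> n x"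
    if x: "x \<in> \<Gamma>" for n x
  proof -
    have "- (of_real pi * (s (\<tau> n) - 1 / 2) * of_real (Sq x)) = of_real (- a n * Sq x) + (- (\<i> * of_real pi * of_real (Sq x) / 2) + - (of_real pi * \<eta> n * of_real (Sq x)))"
      unfolding s_expand \<eta>_def[symmetric] a_def by (simp add: algebra_simps)
    then show ?thesis unfolding \<Psi>_def lc[OF x, symmetric] by (simp only: exp_add exp_of_real mult_ac)
  qed
  have norm_lc: "cmod (lc (R x)) = 1" if x: "x \<in> \<Gamma>" for x
    unfolding lc[OF x, symmetric] by (simp add: norm_mult norm_chi[OF x])
  have "(\<lambda>n. (\<Sum>\<^sub>\<infinity>x\<in>\<Gamma>. of_real (exp (- a n * Sq x)) * \<Psi> n x) / of_real (Z (a n))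
            - (\<Sum>\<^sub>\<infinity>x\<in>\<Gamma>. of_real (exp (- a n * Sq x)) * lc (R x)) / of_real (Z (a n))) \<longlonglongrightarrow> 0"
  proof (rule concentration[OF a0 a1 alim, where K = 1])
    show "cmod (\<Psi> n x) \<le> 1 * exp (a n / 4 * Sq x)" if x: "x \<in> \<Gamma>" for n x
    proof -
      have "- Re (\<eta> n) \<le> (\<tau> n)\<^sup>2 / 2" using eta[of n] abs_Re_le_cmod[of "\<eta> n"] by simp
      also have "\<dots> \<le> \<tau> n / 8" using t(1)[of n] mult_left_mono[OF t(2)[of n], of "\<tau> n"] by (simp add: power2_eq_square)
      finally have "(pi * Sq x) * - Re (\<eta> n) \<le> (pi * Sq x) * (\<tau> n / 8)" by (intro mult_left_mono) auto
      then show ?thesis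
        unfolding \<Psi>_def norm_mult norm_lc[OF x] by (simp add: a_def algebra_simps)
    qed
    show "cmod (lc (R x)) \<le> 1" if "x \<in> \<Gamma>" for x using norm_lc[OF that] by simp
    fix x assume x: "\<And>n. x n \<in> \<Gamma> \<and> Sq (x n) * (a n * sqrt (a n)) \<le> 1"
    then have sx: "(\<lambda>n. (a n)\<^sup>2 * Sq (x n)) \<longlonglongrightarrow> 0" by (intro Sq_scaled_tendsto a0 alim) auto
    have e0: "(\<lambda>n. of_real pi * \<eta> n * of_real (Sq (x n))) \<longlonglongrightarrow> 0"
    proof (rule Lim_null_comparison)
      have "(\<lambda>n. 2 / pi * ((a n)\<^sup>2 * Sq (x n))) \<longlonglongrightarrow> 2 / pi * 0" by (intro tendsto_intros sx)
      then show "(\<lambda>n. 2 / pi * ((a n)\<^sup>2 * Sq (x n))) \<longlonglongrightarrow> 0" by simp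
      show "\<forall>\<^sub>F n in sequentially. norm (of_real pi * \<eta> n * of_real (Sq (x n))) \<le> 2 / pi * ((a n)\<^sup>2 * Sq (x n))"
      proof (intro always_eventually allI)
        fix n
        have "norm (of_real pi * \<eta> n * of_real (Sq (x n))) = pi * cmod (\<eta> n) * Sq (x n)" by (simp add: norm_mult)
        also have "\<dots> \<le> pi * ((\<tau> n)\<^sup>2 / 2) * Sq (x n)" by (intro mult_right_mono mult_left_mono eta) auto
        also have "\<dots> = 2 / pi * ((a n)\<^sup>2 * Sq (x n))" by (simp add: a_def power2_eq_square field_simps)
        finally show "norm (of_real pi * \<eta> n * of_real (Sq (x n))) \<le> 2 / pi * ((a n)\<^sup>2 * Sq (x n))" .
      qed
    qed
    have "(\<lambda>n. exp (- (of_real pi * \<eta> n * of_real (Sq (x n)))) - 1) \<longlonglongrightarrow> exp (- 0) - 1"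
      by (intro tendsto_intros e0)
    then have "(\<lambda>n. norm (exp (- (of_real pi * \<eta> n * of_real (Sq (x n)))) - 1)) \<longlonglongrightarrow> 0"
      by (intro tendsto_norm_zero) simp
    moreover have "norm (\<Psi> n (x n) - lc (R (x n))) = norm (exp (- (of_real pi * \<eta> n * of_real (Sq (x n)))) - 1)" for n
    proof -
      have "\<Psi> n (x n) - lc (R (x n)) = lc (R (x n)) * (exp (- (of_real pi * \<eta> n * of_real (Sq (x n)))) - 1)"
        by (simp add: \<Psi>_def right_diff_distrib)
      then show ?thesis using x[of n] by (simp only: norm_mult norm_lc mult_1)
    qed
    ultimately have "(\<lambda>n. norm (\<Psi> n (x n) - lc (R (x n)))) \<longlonglongrightarrow> 0" by presburger
    then show "(\<lambda>n. \<Psi> n (x n) - lc (R (x n))) \<longlonglongrightarrow> 0" by (rule tendsto_norm_zero_cancel)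
  qed
  from tendsto_add[OF this equidistribution[OF a0 alim, of lc]]
  have "(\<lambda>n. (\<Sum>\<^sub>\<infinity>x\<in>\<Gamma>. of_real (exp (- a n * Sq x)) * \<Psi> n x) / of_real (Z (a n))) \<longlonglongrightarrow> (\<Sum>c\<in>C. lc c) / of_nat (card C)"
    by simp
  moreover have "(\<Sum>\<^sub>\<infinity>x\<in>\<Gamma>. ch x * exp (- (of_real pi * (s (\<tau> n) - 1 / 2) * of_real (Sq x)))) = (\<Sum>\<^sub>\<infinity>x\<in>\<Gamma>. of_real (exp (- a n * Sq x)) * \<Psi> n x)" for n
    by (intro infsum_cong summand)
  ultimately show ?thesis by (simp only: a_def)
qed

text \<open>Dividing \<open>theta_poisson\<close> by the total weights and letting \<open>\<tau>\<close> tend to 0. The two sides are normalised by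
  the weights of different Gaussians; the ratio of these weights lies in \<open>[0, 1]\<close> and converges along a subsequence.\<close>

theorem theta_i_times:
  "\<exists>c\<ge>0. \<forall>z. (\<Sum>c\<in>C. lc c) * \<theta> z = of_real c * (1 - \<i>) ^ g * \<theta> (\<i> *\<^sub>C z)"
proof -
  define \<tau> where "\<tau> n = 1 / (8 * (real n + 1))" for n
  have t: "0 < \<tau> n" "\<tau> n \<le> 1 / 8" for n by (auto simp: \<tau>_def field_simps)
  have lim: "\<tau> \<longlonglongrightarrow> 0" unfolding \<tau>_def by real_asymp
  define \<rho> where "\<rho> n = Z (pi * \<tau> n) / Z (pi * \<tau> n / 2)" for n
  have Zp: "Z (pi * \<tau> n) > 0" "Z (pi * \<tau> n / 2) > 0" for n using t by (auto intro!: Z_pos)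
  have "\<rho> n \<in> {0..1}" for n
  proof -
    have sm: "(\<lambda>x. exp (- (pi * \<tau> n) * Sq x)) summable_on \<Gamma>" "(\<lambda>x. exp (- (pi * \<tau> n / 2) * Sq x)) summable_on \<Gamma>"
      using t[of n] by (intro summable_Z; simp)+
    have "Z (pi * \<tau> n) \<le> Z (pi * \<tau> n / 2)"
      unfolding Z_def
    proof (rule infsum_mono)
      fix x
      have "(pi * \<tau> n / 2) * Sq x \<le> (pi * \<tau> n) * Sq x" using t[of n] by (intro mult_right_mono) auto
      then show "exp (- (pi * \<tau> n) * Sq x) \<le> exp (- (pi * \<tau> n / 2) * Sq x)" by simp
    qed (rule sm)+
    then show ?thesis using Zp[of n] by (simp add: \<rho>_def)
  qed
  (* The subsequence is chosen before z is fixed, so that the constant does not depend on z. *)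
  then obtain l \<phi> where l: "l \<in> {0..1}" "strict_mono \<phi>" "(\<rho> \<circ> \<phi>) \<longlonglongrightarrow> l"
    using compact_Icc[of 0 "1::real"] unfolding compact_def by metis
  define u where "u n = \<tau> (\<phi> n)" for n
  have u: "0 < u n" "u n \<le> 1 / 8" for n using t by (auto simp: u_def)
  have ulim: "u \<longlonglongrightarrow> 0" unfolding u_def using LIMSEQ_subseq_LIMSEQ[OF lim l(2)] by (simp add: comp_def)
  obtain j where j: "j \<ge> 0" "J 1 = of_real j" using J_real_nonneg[of 1] by auto
  define GS where "GS = (\<Sum>c\<in>C. lc c)"
  have cardC: "card C > 0" using finite_C C_nonempty by (simp add: card_gt_0_iff)
  have "GS * \<theta> z = of_real (real (card C) * j * l) * (1 - \<i>) ^ g * \<theta> (\<i> *\<^sub>C z)" for z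
  proof -
    let ?F = "\<lambda>n. (\<Sum>\<^sub>\<infinity>x\<in>\<Gamma>. ch x * exp (- (of_real pi * (s (u n) - 1 / 2) * of_real (Sq x))))"
    let ?E = "\<lambda>n. (\<Sum>\<^sub>\<infinity>x\<in>\<Gamma>. E (u n) z x)"
    have F: "(\<lambda>n. \<theta> z * (?F n / of_real (Z (pi * u n / 2)))) \<longlonglongrightarrow> \<theta> z * (GS / of_nat (card C))"
      unfolding GS_def by (intro tendsto_intros limit_F_side u ulim)
    have rl: "(\<lambda>n. complex_of_real (Z (pi * u n) / Z (pi * u n / 2))) \<longlonglongrightarrow> of_real l"
      using tendsto_of_real[OF l(3), where 'a = complex] by (simp add: comp_def \<rho>_def u_def)
    have "(\<lambda>n. J 1 * r (u n) ^ g * (?E n / of_real (Z (pi * u n))) * complex_of_real (Z (pi * u n) / Z (pi * u n / 2)))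
        \<longlonglongrightarrow> J 1 * (1 - \<i> * of_real (1 - 0)) ^ g * \<theta> (\<i> *\<^sub>C z) * of_real l"
      unfolding r_def by (intro tendsto_intros limit_E_side u ulim rl)
    moreover have "J 1 * r (u n) ^ g * (?E n / of_real (Z (pi * u n))) * complex_of_real (Z (pi * u n) / Z (pi * u n / 2))
       = \<theta> z * (?F n / of_real (Z (pi * u n / 2)))" for n
    proof -
      have "\<theta> z * ?F n = J 1 * r (u n) ^ g * ?E n"
        using theta_poisson[OF u, of z n] by (simp add: s_def power_one_over field_simps)
      then show ?thesis using Zp[of "\<phi> n"] by (simp add: u_def)
    qed
    ultimately have "(\<lambda>n. \<theta> z * (?F n / of_real (Z (pi * u n / 2)))) \<longlonglongrightarrow> J 1 * (1 - \<i>) ^ g * \<theta> (\<i> *\<^sub>C z) * of_real l"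
      by (simp only: diff_zero of_real_1 mult_1_right)
    from LIMSEQ_unique[OF F this] have "\<theta> z * (GS / of_nat (card C)) = J 1 * (1 - \<i>) ^ g * \<theta> (\<i> *\<^sub>C z) * of_real l" .
    then show ?thesis using cardC by (simp add: j(2) field_simps)
  qed
  moreover have "real (card C) * j * l \<ge> 0" using j l by auto
  ultimately show ?thesis unfolding GS_def by blast
qed

end

section \<open>Order of vanishing\<close>

text \<open>In Leibniz's formula every term but one contains a derivative of \<open>f\<close> of order less than \<open>m\<close>.\<close>

lemma higher_deriv_mult_first:
  assumes "h holomorphic_on UNIV" "f holomorphic_on UNIV" "\<And>j. j < m \<Longrightarrow> (deriv ^^ j) f 0 = 0"
  shows "(deriv ^^ m) (\<lambda>t. h t * f t) 0 = h 0 * (deriv ^^ m) f (0 :: complex)"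
proof -
  have "(deriv ^^ m) (\<lambda>t. h t * f t) 0 = (\<Sum>i = 0..m. of_nat (m choose i) * (deriv ^^ i) h 0 * (deriv ^^ (m - i)) f 0)"
    by (rule higher_deriv_mult[OF assms(1,2)]) auto
  also have "\<dots> = (\<Sum>i\<in>{0}. of_nat (m choose i) * (deriv ^^ i) h 0 * (deriv ^^ (m - i)) f 0)"
    using assms(3) by (intro sum.mono_neutral_right) auto
  finally show ?thesis by simp
qed

text \<open>If all derivatives along all lines through \<open>p\<close> vanished, \<open>f\<close> would vanish on each such line, hence
  everywhere.\<close>

lemma vanishing_order_witness:
  fixes f :: "'v::complex_normed_vector \<Rightarrow> complex"
  assumes hol: "\<And>v. (\<lambda>t. f (p + t *\<^sub>C v)) holomorphic_on UNIV" and nz: "f z \<noteq> 0"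
  shows "\<exists>v. (deriv ^^ vanishing_order f p) (\<lambda>t. f (p + t *\<^sub>C v)) 0 \<noteq> 0"
    and "j < vanishing_order f p \<Longrightarrow> (deriv ^^ j) (\<lambda>t. f (p + t *\<^sub>C v)) 0 = 0"
proof -
  let ?\<phi> = "\<lambda>t. f (p + t *\<^sub>C (z - p))"
  have "\<exists>k v. (deriv ^^ k) (\<lambda>t. f (p + t *\<^sub>C v)) 0 \<noteq> 0"
  proof (rule ccontr)
    assume "\<not> ?thesis"
    then have "(deriv ^^ k) ?\<phi> 0 = 0" for k by blast
    moreover have "(\<lambda>n. (deriv ^^ n) ?\<phi> 0 / fact n * (1 - 0) ^ n) sums ?\<phi> 1"
      by (rule holomorphic_power_series[of _ _ 2]) (auto intro: holomorphic_on_subset[OF hol])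
    ultimately have "?\<phi> 1 = 0" using sums_unique2[OF sums_zero] by simp
    then show False using nz by (simp add: scaleC_one)
  qed
  then show "\<exists>v. (deriv ^^ vanishing_order f p) (\<lambda>t. f (p + t *\<^sub>C v)) 0 \<noteq> 0"
    unfolding vanishing_order_def by (rule LeastI_ex)
  assume "j < vanishing_order f p"
  then show "(deriv ^^ j) (\<lambda>t. f (p + t *\<^sub>C v)) 0 = 0"
    unfolding vanishing_order_def using not_less_Least by blast
qed

lemma vanishing_order_translate:
  fixes f :: "'v::complex_normed_vector \<Rightarrow> complex"
  assumes hol: "\<And>p v. (\<lambda>t. f (p + t *\<^sub>C v)) holomorphic_on UNIV" and nz: "f z \<noteq> 0"
    and tr: "\<And>v. f (p' + v) = c * exp (L v) * f (p + v)" and c: "c \<noteq> 0"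
    and lin: "\<And>t v. L (t *\<^sub>C v) = t * L v"
  shows "vanishing_order f p' = vanishing_order f p"
proof -
  let ?k = "vanishing_order f p"
  have D: "(deriv ^^ m) (\<lambda>t. f (p' + t *\<^sub>C v)) 0 = c * (deriv ^^ m) (\<lambda>t. f (p + t *\<^sub>C v)) 0" if "m \<le> ?k" for m v
  proof -
    have "(\<lambda>t. f (p' + t *\<^sub>C v)) = (\<lambda>t. (c * exp (t * L v)) * f (p + t *\<^sub>C v))"
      unfolding tr lin ..
    moreover have "(\<lambda>t. c * exp (t * L v)) holomorphic_on UNIV" by (intro holomorphic_intros)
    ultimately show ?thesis
      using higher_deriv_mult_first[OF _ hol, of "\<lambda>t. c * exp (t * L v)" m p v]
        vanishing_order_witness(2)[of f p z _ v, OF hol nz] that by simp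
  qed
  show ?thesis
    unfolding vanishing_order_def[of f p']
  proof (rule Least_equality)
    show "\<exists>v. (deriv ^^ ?k) (\<lambda>t. f (p' + t *\<^sub>C v)) 0 \<noteq> 0"
      using vanishing_order_witness(1)[of f p z, OF hol nz] c by (simp add: D)
    fix m assume "\<exists>v. (deriv ^^ m) (\<lambda>t. f (p' + t *\<^sub>C v)) 0 \<noteq> 0"
    then show "?k \<le> m"
      using vanishing_order_witness(2)[of f p z m, OF hol nz] by (intro leI notI) (auto simp: D)
  qed
qed

text \<open>The leading homogeneous part at \<open>p\<close> is multiplied by \<open>c\<close> and, on the other hand, by a power of \<open>u\<close>.\<close>

lemma vanishing_order_rotate:
  fixes f :: "'v::complex_normed_vector \<Rightarrow> complex"
  assumes hol: "\<And>p v. (\<lambda>t. f (p + t *\<^sub>C v)) holomorphic_on UNIV" and nz: "f z \<noteq> 0"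
    and rot: "\<And>v. f (p + u *\<^sub>C v) = c * exp (L v) * f (p + v)"
    and lin: "\<And>t v. L (t *\<^sub>C v) = t * L v"
  shows "u ^ vanishing_order f p = c"
proof -
  let ?k = "vanishing_order f p"
  obtain v where v: "(deriv ^^ ?k) (\<lambda>t. f (p + t *\<^sub>C v)) 0 \<noteq> 0"
    using vanishing_order_witness(1)[of f p z, OF hol nz] by blast
  have eq: "(\<lambda>t. f (p + (u * t) *\<^sub>C v)) = (\<lambda>t. (c * exp (t * L v)) * f (p + t *\<^sub>C v))"
  proof
    fix t show "f (p + (u * t) *\<^sub>C v) = (c * exp (t * L v)) * f (p + t *\<^sub>C v)"
      using rot[of "t *\<^sub>C v"] by (simp only: scaleC_scaleC lin)
  qed
  have "u ^ ?k * (deriv ^^ ?k) (\<lambda>t. f (p + t *\<^sub>C v)) (u * 0) = (deriv ^^ ?k) (\<lambda>t. f (p + (u * t) *\<^sub>C v)) 0"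
    by (rule higher_deriv_compose_linear[where S = UNIV and T = UNIV, symmetric]) (auto intro: hol)
  also have "\<dots> = c * (deriv ^^ ?k) (\<lambda>t. f (p + t *\<^sub>C v)) 0"
  proof -
    have "(\<lambda>t. c * exp (t * L v)) holomorphic_on UNIV" by (intro holomorphic_intros)
    then show ?thesis
      unfolding eq
      using higher_deriv_mult_first[OF _ hol, of "\<lambda>t. c * exp (t * L v)" ?k p v]
        vanishing_order_witness(2)[of f p z _ v, OF hol nz] by simp
  qed
  finally show ?thesis using v by simp
qed

context theta_classes
begin

lemma inverse_one_minus_i: "inverse (1 - \<i>) = of_real (1 / sqrt 2) * cis (pi / 4)"
  by (simp add: complex_eq_iff cos_45 sin_45 Re_divide Im_divide inverse_eq_divide real_div_sqrt field_simps)

text \<open>Only the phase of the constant in \<open>theta_i_times\<close> matters, because its fourth power is 1. The phase of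
  \<open>1 / (1 - \<i>)\<close> accounts for the summand \<open>g\<close>.\<close>

lemma theta_i_eigenvalue:
  assumes nz: "\<theta> z0 \<noteq> 0" and GS: "(\<Sum>c\<in>C. lc c) = of_real \<rho> * z8 \<sigma>" "\<rho> > 0"
  shows "\<theta> (\<i> *\<^sub>C z) = z8 (\<sigma> + of_nat g) * \<theta> z"
proof -
  obtain c where c: "c \<ge> 0" "\<And>z. (\<Sum>c\<in>C. lc c) * \<theta> z = of_real c * (1 - \<i>) ^ g * \<theta> (\<i> *\<^sub>C z)"
    using theta_i_times by blast
  have "c \<noteq> 0" using c(2)[of z0] nz GS by auto
  then have cp: "c > 0" using c(1) by simp
  have im: "1 - \<i> \<noteq> 0" by (simp add: complex_eq_iff)
  define t where "t = \<rho> / c * (1 / sqrt 2) ^ g"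
  have t: "t > 0" using GS(2) cp by (simp add: t_def)
  define \<mu> where "\<mu> = of_real t * z8 (\<sigma> + of_nat g)"
  have mu: "\<theta> (\<i> *\<^sub>C z) = \<mu> * \<theta> z" for z
  proof -
    have "\<theta> (\<i> *\<^sub>C z) = of_real \<rho> * z8 \<sigma> / (of_real c * (1 - \<i>) ^ g) * \<theta> z"
      using c(2)[of z] im cp GS(1) by (simp add: field_simps)
    also have "of_real \<rho> * z8 \<sigma> / (of_real c * (1 - \<i>) ^ g) = of_real (\<rho> / c) * z8 \<sigma> * inverse (1 - \<i>) ^ g"
      by (simp add: divide_inverse power_inverse)
    also have "\<dots> = \<mu>"
      unfolding inverse_one_minus_i \<mu>_def t_def z8_add z8_of_nat power_mult_distrib by simp
    finally show ?thesis .
  qed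
  have "\<theta> z0 = \<mu> ^ 4 * \<theta> z0"
  proof -
    have "\<theta> (\<i> *\<^sub>C \<i> *\<^sub>C \<i> *\<^sub>C \<i> *\<^sub>C z0) = \<mu> ^ 4 * \<theta> z0"
      unfolding mu by (simp add: power4_eq_xxxx)
    then show ?thesis by (simp add: scaleC_scaleC scaleC_one)
  qed
  then have "\<mu> ^ 4 = 1" using nz by simp
  then have "cmod \<mu> ^ 4 = 1" by (metis norm_one norm_power)
  then have "t ^ 4 = 1" using t by (simp add: \<mu>_def norm_mult)
  then have "t = 1" using t power_eq_imp_eq_base[of t 4 1] by simp
  then show ?thesis using mu by (simp add: \<mu>_def)
qed

text \<open>Hence the multiplicity does not depend on the representative of a point of the quotient.\<close>

lemma vanishing_order_Gamma:
  assumes nz: "\<theta> z0 \<noteq> 0" and x: "x \<in> \<Gamma>"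
  shows "vanishing_order \<theta> (p + x) = vanishing_order \<theta> p"
proof (rule vanishing_order_translate[OF theta_line nz])
  fix v
  have "\<theta> (p + x + v) = \<theta> ((p + v) + x)" by (simp add: add_ac)
  also have "\<dots> = ch x * exp (of_real pi * (H x p + of_real (Sq x) / 2) + of_real pi * H x v) * \<theta> (p + v)"
    unfolding quasi'[OF x] H_add_right by (simp add: algebra_simps)
  finally show "\<theta> (p + x + v) = (ch x * exp (of_real pi * (H x p + of_real (Sq x) / 2))) * exp (of_real pi * H x v) * \<theta> (p + v)"
    by (simp only: exp_add mult.assoc)
next
  show "ch x * exp (of_real pi * (H x p + of_real (Sq x) / 2)) \<noteq> 0"
    using norm_chi[OF x] by auto
qed (simp add: H_scale_right)

text \<open>The point \<open>p\<close> is fixed by multiplication by \<open>\<i>\<close> modulo \<open>\<Gamma>\<close>: \<open>\<i> p = p + \<delta>\<close>. The eigenvalue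
  equation and quasi-periodicity under \<open>\<delta>\<close> then supply the hypothesis of \<open>vanishing_order_rotate\<close>.\<close>

lemma power_i_vanishing_order:
  assumes nz: "\<theta> z0 \<noteq> 0" and \<lambda>: "\<And>z. \<theta> (\<i> *\<^sub>C z) = \<mu> * \<theta> z" and d: "\<delta> \<in> \<Gamma>"
    and p: "p = - ((1 + \<i>) / 2) *\<^sub>C \<delta>"
  shows "\<i> ^ vanishing_order \<theta> p * lc (R \<delta>) = \<mu>"
proof -
  have ch: "ch \<delta> \<noteq> 0" using norm_chi[OF d] by auto
  have ip: "\<i> *\<^sub>C p = p + \<delta>"
  proof -
    have "p + \<delta> = (- ((1 + \<i>) / 2) + 1) *\<^sub>C \<delta>" unfolding p by (simp only: scaleC_add_left scaleC_one)
    also have "- ((1 + \<i>) / 2) + 1 = \<i> * - ((1 + \<i>) / 2)" by (simp add: field_simps)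
    finally show ?thesis unfolding p scaleC_scaleC ..
  qed
  have Hp: "H \<delta> p = - ((1 + \<i>) / 2) * of_real (Sq \<delta>)" unfolding p H_scale_right H_self ..
  have "\<i> ^ vanishing_order \<theta> p = \<mu> / lc (R \<delta>)"
  proof (rule vanishing_order_rotate[OF theta_line nz])
    fix v
    let ?X = "of_real pi * (H \<delta> (p + \<i> *\<^sub>C v) + of_real (Sq \<delta>) / 2)"
    have "\<mu> * \<theta> (p + v) = \<theta> ((p + \<i> *\<^sub>C v) + \<delta>)"
      unfolding \<lambda>[symmetric] scaleC_add_right ip by (simp add: add_ac)
    also have "\<dots> = ch \<delta> * exp ?X * \<theta> (p + \<i> *\<^sub>C v)"
      by (rule quasi'[OF d])
    finally have 1: "\<theta> (p + \<i> *\<^sub>C v) = \<mu> / ch \<delta> * exp (- ?X) * \<theta> (p + v)"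
      using ch by (simp add: exp_minus field_simps)
    have "- ?X = \<i> * of_real pi * of_real (Sq \<delta>) / 2 + - (\<i> * of_real pi * H \<delta> v)"
      unfolding H_add_right Hp H_scale_right by (simp add: field_simps)
    then have 2: "exp (- ?X) = exp (\<i> * of_real pi * of_real (Sq \<delta>) / 2) * exp (- (\<i> * of_real pi * H \<delta> v))"
      by (simp only: exp_add)
    show "\<theta> (p + \<i> *\<^sub>C v) = \<mu> / lc (R \<delta>) * exp (- (\<i> * of_real pi * H \<delta> v)) * \<theta> (p + v)"
    proof -
      define A where "A = \<i> * of_real pi * of_real (Sq \<delta>) / 2"
      have "\<mu> / ch \<delta> * exp A = \<mu> / (ch \<delta> * exp (- A))"
        unfolding exp_minus using ch by (simp add: divide_inverse)
      then show ?thesis unfolding 1 2 lc[OF d, symmetric] A_def[symmetric] by (simp only: mult.assoc[symmetric])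
    qed
  qed (simp add: H_scale_right)
  moreover have "lc (R \<delta>) \<noteq> 0" unfolding lc[OF d, symmetric] using ch by simp
  ultimately show ?thesis by simp
qed

end

section \<open>The two-torsion points and their forms\<close>

lemma of_int_2_even: "even k \<Longrightarrow> (of_int k :: 2) = 0"
proof -
  assume "even k"
  then obtain m where k: "k = m + m" by (metis evenE mult_2)
  show "(of_int k :: 2) = 0" unfolding k of_int_add by (rule two_add_self)
qed

lemma of_int_2_iff: "(of_int k :: 2) = 0 \<longleftrightarrow> even k"
proof
  assume "(of_int k :: 2) = 0"
  show "even k"
  proof (rule ccontr)
    assume "odd k"
    then have "even (k - 1)" by simp
    then have "(of_int (k - 1) :: 2) = 0" by (rule of_int_2_even)
    then show False using \<open>of_int k = 0\<close> by simp
  qed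
qed (rule of_int_2_even)

lemma of_int_2_eq: "even (k - l) \<Longrightarrow> (of_int k :: 2) = of_int l"
  using of_int_2_even[of "k - l"] by simp

lemma of_int_4_eq: "4 dvd (k - l) \<Longrightarrow> (of_int k :: 4) = of_int l"
proof -
  assume "4 dvd (k - l)"
  then obtain m where "k - l = 4 * m" by blast
  moreover have "(4 :: 4) = 0" by simp
  ultimately have "(of_int (k - l) :: 4) = 0" by (simp only: of_int_mult of_int_numeral mult_zero_left)
  then show ?thesis by simp
qed

lemma double2_of_int: "double (of_int k :: 2) = (of_int (2 * k) :: 4)"
proof -
  define n where "n = nat (k mod 2)"
  have n: "int n = k mod 2" by (simp add: n_def)
  have k: "even (k - int n)" unfolding n by (simp add: minus_mod_eq_div_mult)
  then have "(of_int k :: 2) = of_nat n" using of_int_2_eq[of k "int n"] by simp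
  then have "double (of_int k :: 2) = (of_nat (2 * n) :: 4)" by (simp only: double2_of_nat)
  also have "\<dots> = of_int (2 * int n)" by simp
  also have "\<dots> = (of_int (2 * k) :: 4)"
  proof (rule of_int_4_eq)
    show "4 dvd 2 * int n - 2 * k" using k by presburger
  qed
  finally show ?thesis .
qed

lemma i4_of_int_nonneg:
  assumes "k \<ge> 0" shows "i4 (of_int k) = exp (\<i> * of_real pi * of_int k / 2)"
proof -
  obtain n where k: "k = int n" using assms nonneg_int_cases by blast
  have "exp (\<i> * of_real pi * of_int k / 2) = exp (of_nat n * (\<i> * of_real pi / 2))" by (simp add: k mult_ac)
  also have "\<dots> = exp (\<i> * of_real pi / 2) ^ n" by (rule exp_of_nat_mult)
  also have "exp (\<i> * of_real pi / 2) = \<i>" using cis_pi_half by (simp add: cis_conv_exp)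
  finally show ?thesis by (simp add: k i4_of_nat)
qed

text \<open>The residue field of the prime \<open>1 + \<i>\<close> has two elements.\<close>

lemma gint_mod_eps:
  assumes "n \<in> gauss_ints" shows "\<exists>d\<in>{0, 1}. \<exists>m\<in>gauss_ints. n = d + (1 + \<i>) * m"
proof -
  obtain a b where n: "Re n = of_int a" "Im n = of_int b" using assms by (auto simp: gauss_ints_def elim!: Ints_cases)
  show ?thesis
  proof (cases "even (a + b)")
    case True
    then obtain k where k: "a + b = 2 * k" by blast
    have "n = 0 + (1 + \<i>) * Complex (of_int k) (of_int (b - k))"
      using n k by ((simp add: complex_eq_iff; fail) | (simp add: complex_eq_iff, linarith))
    then show ?thesis by (intro bexI[of _ 0] bexI[of _ "Complex (of_int k) (of_int (b - k))"]) (auto simp: gauss_ints_def)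
  next
    case False
    then have "even (a - 1 + b)" by simp
    then obtain k where k: "a - 1 + b = 2 * k" by blast
    have "n = 1 + (1 + \<i>) * Complex (of_int k) (of_int (b - k))"
      using n k by ((simp add: complex_eq_iff; fail) | (simp add: complex_eq_iff, linarith))
    then show ?thesis by (intro bexI[of _ 1] bexI[of _ "Complex (of_int k) (of_int (b - k))"]) (auto simp: gauss_ints_def)
  qed
qed

context gauss_lat
begin

lemma class2_eq: "class2 \<Gamma> \<gamma> = (\<lambda>x. 2 *\<^sub>R x + \<gamma>) ` \<Gamma>"
  by (auto simp: class2_def r_coset_def lattice_group_def)

lemma carrier_A2: "carrier (A2 \<Gamma>) = class2 \<Gamma> ` \<Gamma>"
  by (auto simp: A2_def FactGroup_def RCOSETS_def class2_def lattice_group_def)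

lemma mult_A2:
  assumes "x \<in> \<Gamma>" "y \<in> \<Gamma>"
  shows "class2 \<Gamma> x \<otimes>\<^bsub>A2 \<Gamma>\<^esub> class2 \<Gamma> y = class2 \<Gamma> (x + y)"
proof -
  have "class2 \<Gamma> x \<otimes>\<^bsub>A2 \<Gamma>\<^esub> class2 \<Gamma> y = {a + b | a b. a \<in> class2 \<Gamma> x \<and> b \<in> class2 \<Gamma> y}"
    by (auto simp: A2_def FactGroup_def set_mult_def lattice_group_def)
  also have "\<dots> = class2 \<Gamma> (x + y)"
  proof
    show "{a + b | a b. a \<in> class2 \<Gamma> x \<and> b \<in> class2 \<Gamma> y} \<subseteq> class2 \<Gamma> (x + y)"
    proof
      fix w assume "w \<in> {a + b | a b. a \<in> class2 \<Gamma> x \<and> b \<in> class2 \<Gamma> y}"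
      then obtain u v where uv: "u \<in> \<Gamma>" "v \<in> \<Gamma>" "w = (2 *\<^sub>R u + x) + (2 *\<^sub>R v + y)" by (auto simp: class2_eq)
      then have "w = 2 *\<^sub>R (u + v) + (x + y)" by (simp add: scaleR_right_distrib)
      then show "w \<in> class2 \<Gamma> (x + y)" using uv Gamma_add unfolding class2_eq by blast
    qed
    show "class2 \<Gamma> (x + y) \<subseteq> {a + b | a b. a \<in> class2 \<Gamma> x \<and> b \<in> class2 \<Gamma> y}"
    proof
      fix w assume "w \<in> class2 \<Gamma> (x + y)"
      then obtain u where u: "u \<in> \<Gamma>" "w = 2 *\<^sub>R u + (x + y)" by (auto simp: class2_eq)
      have "w = (2 *\<^sub>R u + x) + (2 *\<^sub>R 0 + y)" unfolding u(2) by simp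
      moreover have "2 *\<^sub>R u + x \<in> class2 \<Gamma> x" "2 *\<^sub>R 0 + y \<in> class2 \<Gamma> y"
        unfolding class2_eq using u(1) Gamma_zero by (blast intro: imageI)+
      ultimately show "w \<in> {a + b | a b. a \<in> class2 \<Gamma> x \<and> b \<in> class2 \<Gamma> y}" by blast
    qed
  qed
  finally show ?thesis .
qed

lemma one_A2: "\<one>\<^bsub>A2 \<Gamma>\<^esub> = class2 \<Gamma> 0"
  by (simp add: A2_def FactGroup_def class2_eq)

lemma two_Gamma: "x \<in> \<Gamma> \<Longrightarrow> 2 *\<^sub>R x \<in> \<Gamma>"
  by (simp add: scaleR_2 Gamma_add)

lemma class2_self: "x \<in> class2 \<Gamma> x"
  unfolding class2_eq by (rule image_eqI[of _ _ 0]) auto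

lemma class2_cong: 
  assumes "u \<in> \<Gamma>" shows "class2 \<Gamma> (2 *\<^sub>R u + x) = class2 \<Gamma> x"
proof
  show "class2 \<Gamma> (2 *\<^sub>R u + x) \<subseteq> class2 \<Gamma> x"
  proof
    fix w assume "w \<in> class2 \<Gamma> (2 *\<^sub>R u + x)"
    then obtain v where v: "v \<in> \<Gamma>" "w = 2 *\<^sub>R v + (2 *\<^sub>R u + x)" unfolding class2_eq by blast
    then have "w = 2 *\<^sub>R (v + u) + x" by (simp add: scaleR_right_distrib)
    then show "w \<in> class2 \<Gamma> x" unfolding class2_eq using Gamma_add[OF v(1) assms] by blast
  qed
  show "class2 \<Gamma> x \<subseteq> class2 \<Gamma> (2 *\<^sub>R u + x)"
  proof
    fix w assume "w \<in> class2 \<Gamma> x"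
    then obtain v where v: "v \<in> \<Gamma>" "w = 2 *\<^sub>R v + x" unfolding class2_eq by blast
    then have "w = 2 *\<^sub>R (v - u) + (2 *\<^sub>R u + x)" by (simp add: scaleR_right_diff_distrib)
    then show "w \<in> class2 \<Gamma> (2 *\<^sub>R u + x)" unfolding class2_eq using Gamma_diff[OF v(1) assms] by blast
  qed
qed

lemma class2_eq_iff: "class2 \<Gamma> x = class2 \<Gamma> y \<longleftrightarrow> x \<in> class2 \<Gamma> y"
proof
  assume "x \<in> class2 \<Gamma> y"
  then obtain u where "u \<in> \<Gamma>" "x = 2 *\<^sub>R u + y" unfolding class2_eq by blast
  then show "class2 \<Gamma> x = class2 \<Gamma> y" using class2_cong by blast
qed (use class2_self in blast)

lemma i_act_class2: "i_act (class2 \<Gamma> x) = class2 \<Gamma> (\<i> *\<^sub>C x)"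
proof
  show "i_act (class2 \<Gamma> x) \<subseteq> class2 \<Gamma> (\<i> *\<^sub>C x)"
  proof
    fix w assume "w \<in> i_act (class2 \<Gamma> x)"
    then obtain u where u: "u \<in> \<Gamma>" "w = \<i> *\<^sub>C (2 *\<^sub>R u + x)" unfolding i_act_def class2_eq by blast
    then have "w = 2 *\<^sub>R (\<i> *\<^sub>C u) + \<i> *\<^sub>C x" by (simp add: scaleC_add_right scaleR_scaleC scaleC_scaleC mult.commute)
    then show "w \<in> class2 \<Gamma> (\<i> *\<^sub>C x)" unfolding class2_eq using Gamma_scale[OF gint_i u(1)] by blast
  qed
  show "class2 \<Gamma> (\<i> *\<^sub>C x) \<subseteq> i_act (class2 \<Gamma> x)"
  proof
    fix w assume "w \<in> class2 \<Gamma> (\<i> *\<^sub>C x)"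
    then obtain u where u: "u \<in> \<Gamma>" "w = 2 *\<^sub>R u + \<i> *\<^sub>C x" unfolding class2_eq by blast
    have "\<i> *\<^sub>C (2 *\<^sub>R ((- \<i>) *\<^sub>C u) + x) = w"
    proof -
      have "\<i> * (complex_of_real 2 * - \<i>) = complex_of_real 2" by (simp add: complex_eq_iff)
      then show ?thesis unfolding u(2) scaleC_add_right scaleR_scaleC scaleC_scaleC by (simp only:)
    qed
    moreover have "(- \<i>) *\<^sub>C u \<in> \<Gamma>" using u(1) by (intro Gamma_scale gint_uminus gint_i)
    ultimately show "w \<in> i_act (class2 \<Gamma> x)" unfolding i_act_def class2_eq by blast
  qed
qed

lemma Gamma_i: "x \<in> \<Gamma> \<Longrightarrow> \<i> *\<^sub>C x \<in> \<Gamma>"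
  by (rule Gamma_scale[OF gint_i])

definition epsv :: "'v \<Rightarrow> 'v" where "epsv x = x + \<i> *\<^sub>C x"

lemma epsv_eq: "epsv x = (1 + \<i>) *\<^sub>C x"
  by (simp only: epsv_def scaleC_add_left scaleC_one)

lemma epsv_Gamma: "x \<in> \<Gamma> \<Longrightarrow> epsv x \<in> \<Gamma>"
  by (simp add: epsv_def Gamma_add Gamma_i)

lemma epsv_add: "epsv (x + y) = epsv x + epsv y"
  by (simp add: epsv_eq scaleC_add_right)

lemma epsv_diff: "epsv (x - y) = epsv x - epsv y"
  by (simp add: epsv_eq complex_vector.scale_right_diff_distrib)

lemma epsv_minus: "epsv (- x) = - epsv x"
  by (simp add: epsv_eq complex_vector.scale_minus_right)

lemma epsv_epsv: "epsv (epsv x) = 2 *\<^sub>R (\<i> *\<^sub>C x)"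
proof -
  have "(1 + \<i>) * (1 + \<i>) = complex_of_real 2 * \<i>" by (simp add: complex_eq_iff)
  then show ?thesis by (simp only: epsv_eq scaleC_scaleC scaleR_scaleC)
qed

text \<open>The class of \<open>\<epsilon> x\<close>; as a function of \<open>x\<close> it identifies \<open>\<Gamma>/\<epsilon>\<Gamma>\<close> with \<open>A_i = \<epsilon> A\<^sub>2\<close>.\<close>

definition ceps :: "'v \<Rightarrow> 'v set" where "ceps x = class2 \<Gamma> (epsv x)"

lemma eps_class2: "x \<in> \<Gamma> \<Longrightarrow> eps \<Gamma> (class2 \<Gamma> x) = ceps x"
  by (simp add: eps_def i_act_class2 mult_A2 Gamma_i ceps_def epsv_def)

lemma epsv_two: "epsv w = 2 *\<^sub>R u \<longleftrightarrow> w = epsv (- (\<i> *\<^sub>C u))"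
proof -
  have inj: "epsv a = epsv b \<longleftrightarrow> a = b" for a b
    unfolding epsv_eq by (simp add: complex_eq_iff)
  have "epsv (epsv (- (\<i> *\<^sub>C u))) = 2 *\<^sub>R u"
    unfolding epsv_epsv complex_vector.scale_minus_right scaleC_scaleC by simp
  then show ?thesis using inj[of w "epsv (- (\<i> *\<^sub>C u))"] by simp
qed

lemma ceps_eq_iff: 
  assumes "x \<in> \<Gamma>" "y \<in> \<Gamma>"
  shows "ceps x = ceps y \<longleftrightarrow> (\<exists>u\<in>\<Gamma>. x = y + epsv u)"
proof
  assume "ceps x = ceps y"
  then obtain u where u: "u \<in> \<Gamma>" "epsv x = 2 *\<^sub>R u + epsv y"
    unfolding ceps_def class2_eq_iff unfolding class2_eq by blast
  then have "epsv (x - y) = 2 *\<^sub>R u" by (simp add: epsv_diff)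
  then have "x - y = epsv (- (\<i> *\<^sub>C u))" unfolding epsv_two .
  then have "x = y + epsv (- (\<i> *\<^sub>C u))" by (simp add: algebra_simps)
  then show "\<exists>u\<in>\<Gamma>. x = y + epsv u" using u(1) Gamma_minus Gamma_i by blast
next
  assume "\<exists>u\<in>\<Gamma>. x = y + epsv u"
  then obtain u where u: "u \<in> \<Gamma>" "x = y + epsv u" by blast
  have "epsv x = 2 *\<^sub>R (\<i> *\<^sub>C u) + epsv y" unfolding u(2) epsv_add epsv_epsv by simp
  then show "ceps x = ceps y" unfolding ceps_def using class2_cong[OF Gamma_i[OF u(1)]] by simp
qed

text \<open>If \<open>\<i> x = x + 2 u\<close>, then \<open>x = - \<epsilon> u\<close>, since \<open>(\<i> - 1) \<epsilon> = - 2\<close>.\<close>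

lemma carrier_A_i: "carrier (A_i \<Gamma>) = ceps ` \<Gamma>"
proof
  show "carrier (A_i \<Gamma>) \<subseteq> ceps ` \<Gamma>"
  proof
    fix \<alpha> assume "\<alpha> \<in> carrier (A_i \<Gamma>)"
    then obtain x where x: "x \<in> \<Gamma>" "\<alpha> = class2 \<Gamma> x" "class2 \<Gamma> (\<i> *\<^sub>C x) = class2 \<Gamma> x"
      by (auto simp: A_i_def carrier_A2 i_act_class2)
    then obtain u where u: "u \<in> \<Gamma>" "\<i> *\<^sub>C x = 2 *\<^sub>R u + x"
      unfolding class2_eq_iff unfolding class2_eq by blast
    have "epsv (\<i> *\<^sub>C x) = 2 *\<^sub>R (\<i> *\<^sub>C u) + 2 *\<^sub>R u + epsv x"
      unfolding u(2) epsv_add by (simp add: epsv_def scaleC_add_right scaleR_scaleC scaleC_scaleC mult.commute)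
    moreover have "epsv (\<i> *\<^sub>C x) = \<i> *\<^sub>C x - x"
      unfolding epsv_def scaleC_scaleC by simp
    moreover have "\<i> *\<^sub>C x - x = 2 *\<^sub>R u" using u(2) by simp
    ultimately have "epsv x = 2 *\<^sub>R (- (\<i> *\<^sub>C u))" by (simp add: eq_neg_iff_add_eq_0 add.commute)
    then have "x = epsv (- (\<i> *\<^sub>C - (\<i> *\<^sub>C u)))" unfolding epsv_two .
    then have "x = epsv (- u)"
      unfolding complex_vector.scale_minus_right scaleC_scaleC by simp
    then show "\<alpha> \<in> ceps ` \<Gamma>" using x u(1) Gamma_minus unfolding ceps_def by blast
  qed
  show "ceps ` \<Gamma> \<subseteq> carrier (A_i \<Gamma>)"
  proof
    fix \<alpha> assume "\<alpha> \<in> ceps ` \<Gamma>"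
    then obtain x where x: "x \<in> \<Gamma>" "\<alpha> = ceps x" by blast
    have "i_act \<alpha> = ceps (\<i> *\<^sub>C x)"
      unfolding x(2) ceps_def i_act_class2 by (simp only: epsv_def scaleC_add_right)
    also have "\<dots> = ceps x"
    proof -
      have "\<i> *\<^sub>C x = x + epsv (\<i> *\<^sub>C x)" unfolding epsv_def scaleC_scaleC by simp
      then show ?thesis using ceps_eq_iff[OF Gamma_i[OF x(1)] x(1)] Gamma_i[OF x(1)] by blast
    qed
    finally show "\<alpha> \<in> carrier (A_i \<Gamma>)"
      using x epsv_Gamma[OF x(1)] by (auto simp: A_i_def carrier_A2 ceps_def)
  qed
qed

lemma mult_A_i: "x \<in> \<Gamma> \<Longrightarrow> y \<in> \<Gamma> \<Longrightarrow> ceps x \<otimes>\<^bsub>A_i \<Gamma>\<^esub> ceps y = ceps (x + y)"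
  by (simp add: A_i_def ceps_def mult_A2 epsv_Gamma epsv_add)

lemma one_A_i: "\<one>\<^bsub>A_i \<Gamma>\<^esub> = ceps 0"
  by (simp add: A_i_def one_A2 ceps_def epsv_def)

lemma ceps_two: "x \<in> \<Gamma> \<Longrightarrow> ceps (x + x) = ceps 0"
proof -
  assume x: "x \<in> \<Gamma>"
  have "x + x = 0 + epsv (- (\<i> *\<^sub>C epsv x))"
  proof -
    have "epsv (2 *\<^sub>R x) = 2 *\<^sub>R epsv x"
      unfolding epsv_eq scaleR_scaleC scaleC_scaleC by (simp only: mult.commute)
    then have "2 *\<^sub>R x = epsv (- (\<i> *\<^sub>C epsv x))" unfolding epsv_two .
    then show ?thesis by (simp add: scaleR_2)
  qed
  then show ?thesis using ceps_eq_iff[of "x + x" 0] x by (meson Gamma_add Gamma_i Gamma_minus Gamma_zero epsv_Gamma)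
qed

lemma comm_group_A_i: "comm_group (A_i \<Gamma>)"
proof (rule comm_groupI)
  fix x y z
  show "\<one>\<^bsub>A_i \<Gamma>\<^esub> \<in> carrier (A_i \<Gamma>)" by (simp add: one_A_i carrier_A_i)
  assume x: "x \<in> carrier (A_i \<Gamma>)"
  then show "\<one>\<^bsub>A_i \<Gamma>\<^esub> \<otimes>\<^bsub>A_i \<Gamma>\<^esub> x = x" unfolding one_A_i carrier_A_i using mult_A_i[of 0] by auto
  show "\<exists>y\<in>carrier (A_i \<Gamma>). y \<otimes>\<^bsub>A_i \<Gamma>\<^esub> x = \<one>\<^bsub>A_i \<Gamma>\<^esub>"
  proof (rule bexI[OF _ x])
    show "x \<otimes>\<^bsub>A_i \<Gamma>\<^esub> x = \<one>\<^bsub>A_i \<Gamma>\<^esub>"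
      using x unfolding one_A_i carrier_A_i by (auto simp: mult_A_i ceps_two)
  qed
  assume y: "y \<in> carrier (A_i \<Gamma>)"
  show "x \<otimes>\<^bsub>A_i \<Gamma>\<^esub> y \<in> carrier (A_i \<Gamma>)"
    using x y unfolding carrier_A_i by (auto simp: mult_A_i Gamma_add)
  show "x \<otimes>\<^bsub>A_i \<Gamma>\<^esub> y = y \<otimes>\<^bsub>A_i \<Gamma>\<^esub> x"
    using x y unfolding carrier_A_i by (auto simp: mult_A_i add.commute)
  assume z: "z \<in> carrier (A_i \<Gamma>)"
  show "x \<otimes>\<^bsub>A_i \<Gamma>\<^esub> y \<otimes>\<^bsub>A_i \<Gamma>\<^esub> z = x \<otimes>\<^bsub>A_i \<Gamma>\<^esub> (y \<otimes>\<^bsub>A_i \<Gamma>\<^esub> z)"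
    using x y z unfolding carrier_A_i by (auto simp: mult_A_i Gamma_add add.assoc)
qed

lemma finite_A_i: "finite (carrier (A_i \<Gamma>))"
proof (rule finite_subset)
  show "finite ((\<lambda>c. ceps (lin c)) ` PiE {..<g} (\<lambda>_. {0, 1}))"
    by (intro finite_imageI finite_PiE) auto
  show "carrier (A_i \<Gamma>) \<subseteq> (\<lambda>c. ceps (lin c)) ` PiE {..<g} (\<lambda>_. {0, 1})"
  proof
    fix \<alpha> assume "\<alpha> \<in> carrier (A_i \<Gamma>)"
    then obtain x where x: "x \<in> \<Gamma>" "\<alpha> = ceps x" by (auto simp: carrier_A_i)
    obtain n where n: "x = lin n" "\<And>k. k < g \<Longrightarrow> n k \<in> gauss_ints" using Gamma_linE[OF x(1)] by blast
    have "\<exists>d m. k < g \<longrightarrow> d \<in> {0, 1} \<and> m \<in> gauss_ints \<and> n k = d + (1 + \<i>) * m" for k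
      using gint_mod_eps[OF n(2), of k] by blast
    then obtain d m where dm: "\<And>k. k < g \<Longrightarrow> d k \<in> {0, 1} \<and> m k \<in> gauss_ints \<and> n k = d k + (1 + \<i>) * m k" by metis
    have "lin n = lin (\<lambda>k. d k + (1 + \<i>) * m k)" using dm by (intro lin_cong) auto
    then have xd: "x = lin d + epsv (lin m)" by (simp add: n(1) lin_add lin_scale epsv_eq)
    have "lin d \<in> \<Gamma>" using dm by (intro lin_in_Gamma) force
    moreover have "lin m \<in> \<Gamma>" using dm by (intro lin_in_Gamma) auto
    ultimately have "ceps x = ceps (lin d)" using xd ceps_eq_iff[OF x(1)] by blast
    then have "\<alpha> = ceps (lin (restrict d {..<g}))" using x by simp
    moreover have "restrict d {..<g} \<in> PiE {..<g} (\<lambda>_. {0, 1})" using dm by auto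
    ultimately show "\<alpha> \<in> (\<lambda>c. ceps (lin c)) ` PiE {..<g} (\<lambda>_. {0, 1})" by blast
  qed
qed

abbreviation "EE \<equiv> E_form H"
abbreviation "SS \<equiv> S_form H"

lemma EE: "x \<in> \<Gamma> \<Longrightarrow> y \<in> \<Gamma> \<Longrightarrow> Im (H x y) = of_int (EE x y)"
  and SS: "x \<in> \<Gamma> \<Longrightarrow> y \<in> \<Gamma> \<Longrightarrow> Re (H x y) = of_int (SS x y)"
  using int_H[of x y] by (auto simp: E_form_def S_form_def gauss_ints_def floor_of_int elim!: Ints_cases)

lemma EE_I: "Im (H x y) = of_int k \<Longrightarrow> EE x y = k"
  and SS_I: "Re (H x y) = of_int k \<Longrightarrow> SS x y = k"
  by (simp_all add: E_form_def S_form_def)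

lemma Sq_SS: "x \<in> \<Gamma> \<Longrightarrow> Sq x = of_int (SS x x)"
  by (simp add: Sq_def SS)

lemma EE_add: "x \<in> \<Gamma> \<Longrightarrow> y \<in> \<Gamma> \<Longrightarrow> z \<in> \<Gamma> \<Longrightarrow> EE (x + y) z = EE x z + EE y z"
  "x \<in> \<Gamma> \<Longrightarrow> y \<in> \<Gamma> \<Longrightarrow> z \<in> \<Gamma> \<Longrightarrow> EE z (x + y) = EE z x + EE z y"
  by (auto intro!: EE_I simp: H_add_left H_add_right EE)

lemma SS_add: "x \<in> \<Gamma> \<Longrightarrow> y \<in> \<Gamma> \<Longrightarrow> SS (x + y) (x + y) = SS x x + 2 * SS x y + SS y y"
  using SS_I[of "x + y" "x + y"] Sq_add[of x y] by (simp add: SS Sq_SS flip: Sq_def)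

lemma EE_two: "x \<in> \<Gamma> \<Longrightarrow> y \<in> \<Gamma> \<Longrightarrow> EE (2 *\<^sub>R x) y = 2 * EE x y" "x \<in> \<Gamma> \<Longrightarrow> y \<in> \<Gamma> \<Longrightarrow> EE x (2 *\<^sub>R y) = 2 * EE x y"
  by (simp_all add: scaleR_2 EE_add)

lemma EE_swap: "x \<in> \<Gamma> \<Longrightarrow> y \<in> \<Gamma> \<Longrightarrow> EE y x = - EE x y"
  by (rule EE_I) (simp add: H_cnj[of y x] EE)

lemma SS_swap: "x \<in> \<Gamma> \<Longrightarrow> y \<in> \<Gamma> \<Longrightarrow> SS y x = SS x y"
  by (rule SS_I) (simp add: H_cnj[of y x] SS)

lemma EE_eps: "x \<in> \<Gamma> \<Longrightarrow> y \<in> \<Gamma> \<Longrightarrow> EE x (epsv y) = SS x y + EE x y"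
  by (rule EE_I) (simp add: epsv_eq H_scale_right EE SS)

lemma SS_eps: "x \<in> \<Gamma> \<Longrightarrow> y \<in> \<Gamma> \<Longrightarrow> SS x (epsv y) = SS x y - EE x y"
  by (rule SS_I) (simp add: epsv_eq H_scale_right EE SS)

lemma EE_i: "x \<in> \<Gamma> \<Longrightarrow> EE x (\<i> *\<^sub>C x) = SS x x"
  by (rule EE_I) (simp add: H_scale_right SS)

lemma EE_self: "x \<in> \<Gamma> \<Longrightarrow> EE x x = 0"
  using EE_swap[of x x] by simp

lemma SS_epsv_self: "x \<in> \<Gamma> \<Longrightarrow> SS (epsv x) (epsv x) = 2 * SS x x"
  by (rule SS_I) (simp add: Sq_def[symmetric] epsv_eq Sq_scale cmod_power2 Sq_SS)

lemma SS_nonneg: "x \<in> \<Gamma> \<Longrightarrow> SS x x \<ge> 0"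
  using Sq_nonneg[of x] by (simp add: Sq_SS)

lemma e_form_class2:
  assumes x: "x \<in> \<Gamma>" and y: "y \<in> \<Gamma>"
  shows "e_form H (class2 \<Gamma> x) (class2 \<Gamma> y) = of_int (EE x y)"
  unfolding e_form_def
proof (rule the_equality)
  show "\<exists>x'\<in>class2 \<Gamma> x. \<exists>y'\<in>class2 \<Gamma> y. of_int (EE x y) = (of_int (EE x' y') :: 2)"
    using class2_self by blast
  fix c :: 2 assume "\<exists>x'\<in>class2 \<Gamma> x. \<exists>y'\<in>class2 \<Gamma> y. c = of_int (EE x' y')"
  then obtain u v where uv: "u \<in> \<Gamma>" "v \<in> \<Gamma>" "c = of_int (EE (2 *\<^sub>R u + x) (2 *\<^sub>R v + y))"
    unfolding class2_eq by blast
  show "c = of_int (EE x y)"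
    unfolding uv(3)
  proof (rule of_int_2_eq)
    show "even (EE (2 *\<^sub>R u + x) (2 *\<^sub>R v + y) - EE x y)"
      using uv x y by (simp add: EE_add EE_two two_Gamma Gamma_add)
  qed
qed

lemma Q_form_class2:
  assumes x: "x \<in> \<Gamma>"
  shows "Q_form H (class2 \<Gamma> x) = of_int (SS x x)"
  unfolding Q_form_def
proof (rule the_equality)
  show "\<exists>x'\<in>class2 \<Gamma> x. of_int (SS x x) = (of_int (SS x' x') :: 4)"
    using class2_self by blast
  fix c :: 4 assume "\<exists>x'\<in>class2 \<Gamma> x. c = of_int (SS x' x')"
  then obtain u where u: "u \<in> \<Gamma>" "c = of_int (SS (2 *\<^sub>R u + x) (2 *\<^sub>R u + x))"
    unfolding class2_eq by blast
  have 1: "SS (2 *\<^sub>R u) (2 *\<^sub>R u) = 4 * SS u u" "SS (2 *\<^sub>R u) x = 2 * SS u x"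
    using u x by (auto intro!: SS_I simp: scaleR_2 H_add_left H_add_right SS)
  show "c = of_int (SS x x)"
    unfolding u(2)
  proof (rule of_int_4_eq)
    have "SS (2 *\<^sub>R u + x) (2 *\<^sub>R u + x) - SS x x = 4 * (SS u u + SS u x)"
      using u x by (simp add: SS_add two_Gamma 1)
    then show "4 dvd SS (2 *\<^sub>R u + x) (2 *\<^sub>R u + x) - SS x x" by simp
  qed
qed

text \<open>\<open>E(x, \<epsilon> y) = S(x, y) + E(x, y)\<close>. The value is independent of the representatives because
  \<open>E(\<epsilon> u, \<epsilon> y)\<close> is even.\<close>

lemma b_form_ceps:
  assumes x: "x \<in> \<Gamma>" and y: "y \<in> \<Gamma>"
  shows "b_form \<Gamma> H (ceps x) (ceps y) = of_int (SS x y + EE x y)"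
  unfolding b_form_def
proof (rule the_equality)
  show "\<exists>\<alpha>\<in>carrier (A2 \<Gamma>). \<exists>\<beta>\<in>carrier (A2 \<Gamma>). ceps x = eps \<Gamma> \<alpha> \<and> ceps y = eps \<Gamma> \<beta> \<and> of_int (SS x y + EE x y) = e_form H \<alpha> (eps \<Gamma> \<beta>)"
  proof (intro bexI conjI)
    show "ceps x = eps \<Gamma> (class2 \<Gamma> x)" "ceps y = eps \<Gamma> (class2 \<Gamma> y)" using x y by (simp_all add: eps_class2)
    show "of_int (SS x y + EE x y) = e_form H (class2 \<Gamma> x) (eps \<Gamma> (class2 \<Gamma> y))"
      unfolding eps_class2[OF y] ceps_def e_form_class2[OF x epsv_Gamma[OF y]] EE_eps[OF x y] ..
  qed (use x y in \<open>auto simp: carrier_A2\<close>)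
  fix c assume "\<exists>\<alpha>\<in>carrier (A2 \<Gamma>). \<exists>\<beta>\<in>carrier (A2 \<Gamma>). ceps x = eps \<Gamma> \<alpha> \<and> ceps y = eps \<Gamma> \<beta> \<and> c = e_form H \<alpha> (eps \<Gamma> \<beta>)"
  then obtain x' y' where xy: "x' \<in> \<Gamma>" "y' \<in> \<Gamma>" "ceps x' = ceps x" "ceps y = ceps y'" "c = e_form H (class2 \<Gamma> x') (ceps y)"
    by (auto simp: carrier_A2 eps_class2)
  obtain u where u: "u \<in> \<Gamma>" "x' = x + epsv u" using xy x by (auto simp: ceps_eq_iff)
  have "c = of_int (EE x' (epsv y))"
    unfolding xy(5) ceps_def by (rule e_form_class2[OF xy(1) epsv_Gamma[OF y]])
  also have "\<dots> = of_int (EE x (epsv y) + EE (epsv u) (epsv y))"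
    unfolding u(2) using x u(1) y by (simp add: EE_add epsv_Gamma)
  also have "EE (epsv u) (epsv y) = 2 * EE u y"
    using u y by (intro EE_I) (simp add: epsv_eq H_scale_left H_scale_right EE)
  also have "of_int (EE x (epsv y) + 2 * EE u y) = (of_int (EE x (epsv y)) :: 2)"
    by (rule of_int_2_eq) simp
  finally show "c = of_int (SS x y + EE x y)" by (simp only: EE_eps[OF x y])
qed

text \<open>Nondegeneracy comes from the dual vectors: if all products of \<open>x\<close> with lattice vectors are divisible by
  \<open>1 + \<i>\<close>, then so are the coordinates of \<open>x\<close>.\<close>

lemma f2_form_A_i: "f2_form (A_i \<Gamma>) (b_form \<Gamma> H)"
proof -
  interpret comm_group "A_i \<Gamma>" by (rule comm_group_A_i)
  show ?thesis
  proof
    show "finite (carrier (A_i \<Gamma>))" by (rule finite_A_i)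
    fix a assume a: "a \<in> carrier (A_i \<Gamma>)"
    then obtain x where x: "x \<in> \<Gamma>" "a = ceps x" by (auto simp: carrier_A_i)
    show "a \<otimes>\<^bsub>A_i \<Gamma>\<^esub> a = \<one>\<^bsub>A_i \<Gamma>\<^esub>" using x by (simp add: mult_A_i one_A_i ceps_two)
    {
      assume nd: "\<And>y. y \<in> carrier (A_i \<Gamma>) \<Longrightarrow> b_form \<Gamma> H a y = 0"
      have "\<exists>m\<in>gauss_ints. H y x = (1 + \<i>) * m" if y: "y \<in> \<Gamma>" for y
      proof -
        have "b_form \<Gamma> H a (ceps y) = 0" using y by (intro nd) (simp add: carrier_A_i)
        then have "even (SS x y + EE x y)"
          unfolding x(2) b_form_ceps[OF x(1) y] of_int_2_iff .
        then obtain k where "SS x y + EE x y = 2 * k" by blast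
        then have "SS y x - EE y x = 2 * k"
          using SS_swap[OF x(1) y] EE_swap[OF x(1) y] by simp
        then have k: "Re (H y x) - Im (H y x) = 2 * of_int k" using SS[OF y x(1)] EE[OF y x(1)] by linarith
        let ?m = "Complex (Re (H y x) - of_int k) (- of_int k)"
        have "H y x = (1 + \<i>) * ?m" using k by (simp add: complex_eq_iff)
        moreover have "?m \<in> gauss_ints" using int_H[OF y x(1)] by (simp add: gauss_ints_def)
        ultimately show ?thesis by blast
      qed
      then have "\<forall>k. \<exists>m\<in>gauss_ints. H (Dv k) x = (1 + \<i>) * m" using Dv(1) by blast
      then obtain m where m: "\<And>k. m k \<in> gauss_ints" "\<And>k. H (Dv k) x = (1 + \<i>) * m k" by metis
      have "x = lin (\<lambda>k. H (Dv k) x)" by (rule lin_H_Dv[symmetric])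
      also have "\<dots> = epsv (lin m)" unfolding m(2) lin_scale epsv_eq ..
      finally have "x = 0 + epsv (lin m)" by simp
      moreover have "lin m \<in> \<Gamma>" using m(1) by (rule lin_in_Gamma)
      ultimately have "ceps x = ceps 0" using ceps_eq_iff[OF x(1) Gamma_zero] by blast
      then show "a = \<one>\<^bsub>A_i \<Gamma>\<^esub>" by (simp add: x one_A_i)
    }
    fix b assume b: "b \<in> carrier (A_i \<Gamma>)"
    then obtain y where y: "y \<in> \<Gamma>" "b = ceps y" by (auto simp: carrier_A_i)
    show "b_form \<Gamma> H a b = b_form \<Gamma> H b a"
      unfolding x(2) y(2) b_form_ceps[OF x(1) y(1)] b_form_ceps[OF y(1) x(1)]
    proof (rule of_int_2_eq)
      show "even (SS x y + EE x y - (SS y x + EE y x))" using SS_swap[OF x(1) y(1)] EE_swap[OF x(1) y(1)] by simp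
    qed
    fix d assume d: "d \<in> carrier (A_i \<Gamma>)"
    then obtain z where z: "z \<in> \<Gamma>" "d = ceps z" by (auto simp: carrier_A_i)
    have SSa: "SS (x + y) z = SS x z + SS y z" using x y z by (intro SS_I) (simp add: H_add_left SS)
    show "b_form \<Gamma> H (a \<otimes>\<^bsub>A_i \<Gamma>\<^esub> b) d = b_form \<Gamma> H a d + b_form \<Gamma> H b d"
      unfolding x(2) y(2) z(2) mult_A_i[OF x(1) y(1)] b_form_ceps[OF x(1) z(1)] b_form_ceps[OF y(1) z(1)] b_form_ceps[OF Gamma_add[OF x(1) y(1)] z(1)]
      unfolding SSa EE_add(1)[OF x(1) y(1) z(1)] by (simp add: algebra_simps)
  qed
qed

end

locale gauss_quad = gauss_lat \<Gamma> H bs g for \<Gamma> :: "'v::complex_normed_vector set" and H bs g +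
  fixes q :: "'v set \<Rightarrow> 4"
  assumes q: "q \<in> i_invariant_forms \<Gamma> H"
begin

definition qv :: "'v \<Rightarrow> 4" where "qv x = q (class2 \<Gamma> x)"

lemma qv_add: "x \<in> \<Gamma> \<Longrightarrow> y \<in> \<Gamma> \<Longrightarrow> qv (x + y) = qv x + qv y + of_int (2 * EE x y)"
proof -
  assume xy: "x \<in> \<Gamma>" "y \<in> \<Gamma>"
  have "q (class2 \<Gamma> x \<otimes>\<^bsub>A2 \<Gamma>\<^esub> class2 \<Gamma> y) = q (class2 \<Gamma> x) + q (class2 \<Gamma> y) + double (e_form H (class2 \<Gamma> x) (class2 \<Gamma> y))"
    using q xy by (auto simp: i_invariant_forms_def quadratic_forms_def carrier_A2)
  then show ?thesis
    unfolding mult_A2[OF xy] e_form_class2[OF xy] double2_of_int qv_def .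
qed

lemma qv_i: "x \<in> \<Gamma> \<Longrightarrow> qv (\<i> *\<^sub>C x) = qv x"
proof -
  assume x: "x \<in> \<Gamma>"
  have "q (i_act (class2 \<Gamma> x)) = q (class2 \<Gamma> x)"
    using q x by (auto simp: i_invariant_forms_def carrier_A2)
  then show ?thesis by (simp only: i_act_class2 qv_def)
qed

lemma qv_zero: "qv 0 = 0"
  using qv_add[of 0 0] by (simp add: EE_self)

lemma qv_cong: "u \<in> \<Gamma> \<Longrightarrow> qv (2 *\<^sub>R u + x) = qv x"
  by (simp add: qv_def class2_cong)

text \<open>The form \<open>e\<close> is alternating, so \<open>2 q(x) = q(2 x) = 0\<close>.\<close>

lemma qv_even: "x \<in> \<Gamma> \<Longrightarrow> qv x + qv x = 0"
  using qv_add[of x x] qv_cong[of x 0] qv_zero by (simp add: EE_self scaleR_2)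

text \<open>Here invariance of \<open>q\<close> under \<open>\<i>\<close> enters: \<open>q(x + \<i> x) = 2 q(x) + 2 E(x, \<i> x)\<close>.\<close>

lemma qv_epsv: "x \<in> \<Gamma> \<Longrightarrow> qv (epsv x) = of_int (2 * SS x x)"
  unfolding epsv_def by (simp only: qv_add Gamma_i qv_i qv_even EE_i add_0)

lemma qv_minus_epsv: "x \<in> \<Gamma> \<Longrightarrow> qv (- epsv x) = of_int (2 * SS x x)"
  using qv_epsv[of "- x"] SS_I[of "- x" "- x" "SS x x"] 
  by (simp add: epsv_minus Gamma_minus H_minus_left H_minus_right SS)

abbreviation "Qq \<equiv> Qq_form \<Gamma> H q"

text \<open>Changing \<open>x\<close> by \<open>\<epsilon> u\<close> changes \<open>q(x)\<close> and \<open>S(x, x)\<close> by the same amount modulo 4.\<close>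

lemma Qq_ceps:
  assumes x: "x \<in> \<Gamma>"
  shows "Qq (ceps x) = qv x - of_int (SS x x)"
  unfolding Qq_form_def
proof (rule the_equality)
  show "\<exists>\<alpha>\<in>carrier (A2 \<Gamma>). ceps x = eps \<Gamma> \<alpha> \<and> qv x - of_int (SS x x) = q \<alpha> - Q_form H \<alpha>"
  proof (intro bexI conjI)
    show "ceps x = eps \<Gamma> (class2 \<Gamma> x)" using x by (simp add: eps_class2)
    show "qv x - of_int (SS x x) = q (class2 \<Gamma> x) - Q_form H (class2 \<Gamma> x)"
      using x by (simp add: Q_form_class2 qv_def)
  qed (use x in \<open>auto simp: carrier_A2\<close>)
  fix c assume "\<exists>\<alpha>\<in>carrier (A2 \<Gamma>). ceps x = eps \<Gamma> \<alpha> \<and> c = q \<alpha> - Q_form H \<alpha>"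
  then obtain x' where x': "x' \<in> \<Gamma>" "ceps x' = ceps x" "c = qv x' - of_int (SS x' x')"
    by (auto simp: carrier_A2 eps_class2 Q_form_class2 qv_def)
  obtain u where u: "u \<in> \<Gamma>" "x' = x + epsv u" using x' x by (auto simp: ceps_eq_iff)
  have eu: "epsv u \<in> \<Gamma>" by (rule epsv_Gamma[OF u(1)])
  have "c = qv x + of_int (2 * SS u u) + of_int (2 * (SS x u + EE x u)) - of_int (SS x x + 2 * (SS x u - EE x u) + 2 * SS u u)"
    unfolding x'(3) u(2) qv_add[OF x eu] SS_add[OF x eu] EE_eps[OF x u(1)] SS_eps[OF x u(1)] SS_epsv_self[OF u(1)] qv_epsv[OF u(1)] ..
  also have "\<dots> = qv x - of_int (SS x x) + of_int (4 * EE x u)"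
    by (simp add: algebra_simps)
  also have "of_int (4 * EE x u) = (0 :: 4)" using of_int_4_eq[of "4 * EE x u" 0] by simp
  finally show "c = qv x - of_int (SS x x)" by simp
qed

lemma Qq_quadratic: "Qq \<in> quadratic_forms (A_i \<Gamma>) (b_form \<Gamma> H)"
  unfolding quadratic_forms_def
proof (intro CollectI ballI)
  fix a b assume "a \<in> carrier (A_i \<Gamma>)" "b \<in> carrier (A_i \<Gamma>)"
  then obtain x y where x: "x \<in> \<Gamma>" "a = ceps x" and y: "y \<in> \<Gamma>" "b = ceps y" by (auto simp: carrier_A_i)
  have "Qq (ceps (x + y)) = (qv x - of_int (SS x x)) + (qv y - of_int (SS y y)) + of_int (2 * EE x y - 2 * SS x y)"
    unfolding Qq_ceps[OF Gamma_add[OF x(1) y(1)]] qv_add[OF x(1) y(1)] SS_add[OF x(1) y(1)] by simp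
  also have "of_int (2 * EE x y - 2 * SS x y) = (of_int (2 * (SS x y + EE x y)) :: 4)"
    by (rule of_int_4_eq) presburger
  finally show "Qq (a \<otimes>\<^bsub>A_i \<Gamma>\<^esub> b) = Qq a + Qq b + double (b_form \<Gamma> H a b)"
    unfolding x(2) y(2) mult_A_i[OF x(1) y(1)] b_form_ceps[OF x(1) y(1)] double2_of_int Qq_ceps[OF x(1)] Qq_ceps[OF y(1)] .
qed

lemma i4_qv_minus_epsv: "x \<in> \<Gamma> \<Longrightarrow> i4 (qv (- epsv x)) = exp (- (\<i> * of_real pi * of_real (Sq x)))"
proof -
  assume x: "x \<in> \<Gamma>"
  have "i4 (qv (- epsv x)) = exp (\<i> * of_real pi * of_int (2 * SS x x) / 2)"
    unfolding qv_minus_epsv[OF x] using SS_nonneg[OF x] by (intro i4_of_int_nonneg) simp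
  also have "\<dots> = exp (\<i> * of_real pi * of_real (Sq x))" by (simp add: Sq_SS[OF x] mult.assoc)
  also have "\<dots> = exp (- (\<i> * of_real pi * of_real (Sq x)))"
  proof -
    have "exp (\<i> * of_real pi * of_real (Sq x)) = exp (2 * of_int (SS x x) * of_real pi * \<i>) * exp (- (\<i> * of_real pi * of_real (Sq x)))"
      unfolding exp_add[symmetric] Sq_SS[OF x] by (simp add: algebra_simps)
    moreover have "exp (2 * of_int (SS x x) * of_real pi * \<i>) = 1"
      using exp_integer_2pi[of "of_int (SS x x)"] by simp
    ultimately show ?thesis by simp
  qed
  finally show ?thesis .
qed

text \<open>This identifies the limiting phase on the left-hand side of \<open>theta_poisson\<close> with the quadratic form
  \<open>Q\<^sub>q\<close>.\<close>

lemma i4_Qq: "x \<in> \<Gamma> \<Longrightarrow> i4 (qv x) * exp (- (\<i> * of_real pi * of_real (Sq x) / 2)) = i4 (Qq (ceps x))"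
proof -
  assume x: "x \<in> \<Gamma>"
  have "i4 (of_int (SS x x)) = exp (\<i> * of_real pi * of_real (Sq x) / 2)"
    using i4_of_int_nonneg[OF SS_nonneg[OF x]] by (simp only: Sq_SS[OF x] of_real_of_int_eq)
  then show ?thesis by (simp only: Qq_ceps[OF x] i4_diff exp_minus divide_inverse)
qed

end

section \<open>The congruence\<close>

text \<open>A basis of the lattice is a complex basis of the ambient space.\<close>

lemma gaussian_basis_length_unique:
  assumes "gaussian_basis \<Gamma> (bs :: 'v::complex_normed_vector list)" "gaussian_basis \<Gamma>' (bs' :: 'v list)"
  shows "length bs = length bs'"
proof -
  have "length as = complex_vector.dim (UNIV :: 'v set)" if "gaussian_basis \<Delta> as" for \<Delta> and as :: "'v list"
  proof -
    have as: "distinct as" "complex_vector.independent (set as)" "complex_vector.span (set as) = UNIV"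
      using that by (auto simp: gaussian_basis_def)
    have "complex_vector.dim (UNIV :: 'v set) = card (set as)"
      using complex_vector.dim_span_eq_card_independent[OF as(2)] as(3) by simp
    then show ?thesis using distinct_card[OF as(1)] by simp
  qed
  from this[OF assms(1)] this[OF assms(2)] show ?thesis by simp
qed

theorem proposition3:
  fixes \<Gamma> :: "'v::complex_normed_vector set"
    and H :: "'v \<Rightarrow> 'v \<Rightarrow> complex"
    and g :: nat
    and q :: "'v set \<Rightarrow> 4"
    and \<theta> :: "'v \<Rightarrow> complex"
    and \<alpha> :: "'v set"
  assumes "gaussian_lattice g \<Gamma> H"
    and "unimodular \<Gamma> H"
    and "q \<in> i_invariant_forms \<Gamma> H"
    and "\<theta> \<in> theta_sections \<Gamma> H q"
    and "\<exists>z. \<theta> z \<noteq> 0"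
    and "\<alpha> \<in> carrier (A_i \<Gamma>)"
  shows "(of_nat (2 * divisor_mult \<theta> (torsion_point \<alpha>)) :: 8) =
    brown (A_i \<Gamma>) (b_form \<Gamma> H) (Qq_form \<Gamma> H q) + of_nat g - double (Qq_form \<Gamma> H q \<alpha>)"
proof -
  obtain bs where bs: "gaussian_basis \<Gamma> bs" "(gram_det H bs)\<^sup>2 = 1"
    using assms(2) by (auto simp: unimodular_def)
  obtain bs0 where bs0: "gaussian_basis \<Gamma> bs0" "length bs0 = g"
    using assms(1) by (auto simp: gaussian_lattice_def)
  interpret gl: gauss_lat \<Gamma> H bs g
    using assms(1) bs gaussian_basis_length_unique[OF bs(1) bs0(1)] bs0(2)
    by unfold_locales (auto simp: gaussian_lattice_def)
  interpret gq: gauss_quad \<Gamma> H bs g q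
    by unfold_locales (rule assms(3))
  define ch where "ch x = i4 (gq.qv x)" for x
  have \<theta>: "entire \<theta>" "\<And>x z. x \<in> \<Gamma> \<Longrightarrow> \<theta> (z + x) = theta_factor \<Gamma> H q x z * \<theta> z"
    using assms(4) by (auto simp: theta_sections_def)
  define lc where "lc a = i4 (Qq_form \<Gamma> H q a)" for a
  interpret tc: theta_classes \<Gamma> H bs g \<theta> ch gl.ceps "carrier (A_i \<Gamma>)" lc
  proof unfold_locales
    show "entire \<theta>" by (rule \<theta>(1))
    show "\<theta> (z + x) = ch x * exp (of_real pi * H x (z + (1/2) *\<^sub>R x)) * \<theta> z" if "x \<in> \<Gamma>" for x z
      using \<theta>(2)[OF that] by (simp only: theta_factor_def ch_def gq.qv_def i4_def)
    show "cmod (ch x) = 1" if "x \<in> \<Gamma>" for x by (simp add: ch_def)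
    show "ch (- ((1 + \<i>) *\<^sub>C x)) = exp (- (\<i> * of_real pi * of_real (gl.Sq x)))" if "x \<in> \<Gamma>" for x
      using gq.i4_qv_minus_epsv[OF that] by (simp only: ch_def gl.epsv_eq)
    show "finite (carrier (A_i \<Gamma>))" by (rule gl.finite_A_i)
    show "gl.ceps ` \<Gamma> = carrier (A_i \<Gamma>)" by (rule gl.carrier_A_i[symmetric])
    show "gl.ceps x = gl.ceps y \<longleftrightarrow> x - y \<in> (\<lambda>w. (1 + \<i>) *\<^sub>C w) ` \<Gamma>" if "x \<in> \<Gamma>" "y \<in> \<Gamma>" for x y
      unfolding gl.ceps_eq_iff[OF that] gl.epsv_eq image_iff by (simp add: algebra_simps)
    show "ch x * exp (- (\<i> * of_real pi * of_real (gl.Sq x) / 2)) = lc (gl.ceps x)" if "x \<in> \<Gamma>" for x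
      using gq.i4_Qq[OF that] by (simp only: ch_def lc_def)
  qed
  interpret ff: f2_form "A_i \<Gamma>" "b_form \<Gamma> H" by (rule gl.f2_form_A_i)
  let ?Q = "Qq_form \<Gamma> H q"
  define \<sigma> where "\<sigma> = brown (A_i \<Gamma>) (b_form \<Gamma> H) ?Q"
  obtain \<rho> where \<rho>: "\<rho> > 0" "ff.gauss_sum ?Q = of_real \<rho> * z8 \<sigma>"
    using ff.gauss_sum_brown[OF gq.Qq_quadratic] unfolding \<sigma>_def by blast
  obtain z0 where z0: "\<theta> z0 \<noteq> 0" using assms(5) by blast
  have GS: "(\<Sum>a\<in>carrier (A_i \<Gamma>). lc a) = of_real \<rho> * z8 \<sigma>"
    using \<rho>(2) by (simp only: lc_def ff.gauss_sum_def)
  note eigen = tc.theta_i_eigenvalue[OF z0 GS \<rho>(1)]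
  obtain \<delta> where \<delta>: "\<delta> \<in> \<Gamma>" "\<alpha> = gl.ceps \<delta>"
    using assms(6) by (auto simp: gl.carrier_A_i)
  (* Twice p is - \<epsilon> \<delta>, which has the class \<alpha> modulo 2 \<Gamma>. *)
  define p where "p = - ((1 + \<i>) / 2) *\<^sub>C \<delta>"
  define m where "m = vanishing_order \<theta> p"
  have "divisor_mult \<theta> (torsion_point \<alpha>) = m"
    unfolding divisor_mult_def
  proof (rule the_equality)
    have half: "(1 / 2) *\<^sub>R (2 *\<^sub>R u + gl.epsv \<delta>) = p + (u + gl.epsv \<delta>)" for u
    proof -
      have "p = - ((1 / 2) *\<^sub>R gl.epsv \<delta>)"
        unfolding p_def gl.epsv_eq scaleR_scaleC scaleC_scaleC complex_vector.scale_minus_left[symmetric] by simp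
      moreover have "gl.epsv \<delta> = (1 / 2) *\<^sub>R gl.epsv \<delta> + (1 / 2) *\<^sub>R gl.epsv \<delta>"
        unfolding scaleR_left_distrib[symmetric] by simp
      ultimately show ?thesis by (simp add: scaleR_right_distrib algebra_simps)
    qed
    show all: "\<forall>z\<in>torsion_point \<alpha>. vanishing_order \<theta> z = m"
    proof
      fix z assume "z \<in> torsion_point \<alpha>"
      then obtain u where u: "u \<in> \<Gamma>" "z = p + (u + gl.epsv \<delta>)"
        unfolding torsion_point_def \<delta>(2) gl.ceps_def gl.class2_eq using half by auto
      show "vanishing_order \<theta> z = m"
        unfolding u(2) m_def by (rule tc.vanishing_order_Gamma[OF z0 gl.Gamma_add[OF u(1) gl.epsv_Gamma[OF \<delta>(1)]]])
    qed
    fix m' assume m': "\<forall>z\<in>torsion_point \<alpha>. vanishing_order \<theta> z = m'"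
    have "m' = m" if "z \<in> torsion_point \<alpha>" for z
      using bspec[OF all that] bspec[OF m' that] by simp
    moreover have "(1 / 2) *\<^sub>R gl.epsv \<delta> \<in> torsion_point \<alpha>"
      unfolding torsion_point_def \<delta>(2) gl.ceps_def by (intro imageI gl.class2_self)
    ultimately show "m' = m" .
  qed
  moreover have "\<i> ^ m * i4 (?Q \<alpha>) = z8 (\<sigma> + of_nat g)"
    using tc.power_i_vanishing_order[OF z0 eigen \<delta>(1) p_def] by (simp only: m_def lc_def \<delta>(2))
  then have "z8 (of_nat (2 * m)) * z8 (double (?Q \<alpha>)) = z8 (\<sigma> + of_nat g)"
    using z8_double[of "of_nat m"] by (simp only: z8_double i4_of_nat double4_of_nat)
  then have "of_nat (2 * m) + double (?Q \<alpha>) = \<sigma> + of_nat g"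
    by (simp only: z8_add[symmetric] z8_eq_iff)
  ultimately show ?thesis
    unfolding \<sigma>_def by (simp only: eq_diff_eq)
qed

end
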